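(* Let $G$ be a (real, finite-dimensional) Lie group with Lie algebra $\mathfrak g$, let $H\subset G$ be a dense subgroup, and put $\mathfrak h=\{Z\in\mathfrak g:\exp(tZ)\in H\text{ for all }t\in\mathbf R\}$. Endow $G/H$ with the quotient diffeology. Then $\mathfrak h$ is an ideal in $\mathfrak g$, and there is an isomorphism of cochain complexes $$(\Omega^\bullet(G/H),d)\;\cong\;\bigl(\textstyle\bigwedge^\bullet(\mathfrak g/\mathfrak h)^*,\mathrm d\bigr)$$ from the diffeological de Rham complex of $G/H$ to the Chevalley--Eilenberg complex of the Lie algebra $\mathfrak g/\mathfrak h$. Hence $$H_{\mathrm{dR}}^\bullet(G/H)\cong H^\bullet(\mathfrak g/\mathfrak h),$$ where the left side is diffeological de Rham cohomology and the right side is Lie algebra cohomology with trivial real coefficients.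
   Context: A diffeology on a set $X$ is a set $\mathscr P$ of maps $P:U\to X$ (called plots), with $U$ ranging over open subsets of the spaces $\mathbf R^m$, $m\in\mathbf N$, such that: (D1) all constant maps $\mathbf R^m\to X$ are plots; (D2) a map $P:U\to X$ is a plot if every point of $U$ has an open neighborhood $V$ such that $P|_V$ is a plot; (D3) if $Q:V\to X$ is a plot and $\Phi:U\to V$ is $C^\infty$ between Euclidean open sets, then $Q\circ\Phi$ is a plot. A map between diffeological spaces is smooth if its composition with every plot is a plot. A manifold $X$ carries its manifold diffeology, whose plots are all $C^\infty$ maps $U\to X$. If $X$ is a diffeological space and $s:X\to Y$ a surjection, the quotient diffeology on $Y$ has as plots the maps $Q:V\to Y$ such that each $v\in V$ has an open neighborhood $U\subset V$ and a plot $P:U\to X$ with $s\circ P=Q|_U$. $G/H$ is the set of cosets $qH$, with the quotient diffeology for $q\mapsto qH$. A (diffeological) $k$-form $\beta$ on a diffeological space $Y$ assigns to each plot $Q:V\to Y$ an ordinary smooth $k$-form $Q^*\beta$ on $V$, such that $(Q\circ\Phi)^*\beta=\Phi^*(Q^*\beta)$ for every $C^\infty$ map $\Phi:U\to V$ from a Euclidean open set. The exterior derivative $d\beta$ is defined by $Q^*(d\beta)=d(Q^*\beta)$ for every plot $Q$. $\Omega^k(Y)$ is the space of $k$-forms, $(\Omega^\bullet(Y),d)$ the de Rham complex, and $H^\bullet_{\mathrm{dR}}(Y)$ its cohomology. The Chevalley--Eilenberg complex of a real Lie algebra $\mathfrak a$ is $\bigwedge^\bullet\mathfrak a^*$ (alternating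 multilinear forms on $\mathfrak a$) with coboundary $\mathrm d\omega(Z_0,\dots,Z_k)=\sum_{0\le i<j\le k}(-1)^{i+j}\omega([Z_i,Z_j],Z_0,\dots,\widehat{Z_i},\dots,\widehat{Z_j},\dots,Z_k)$ (hats mean omission); its cohomology is $H^\bullet(\mathfrak a)$. *)

theory Defs
  imports "HOL-Analysis.Analysis" "HOL-Algebra.Left_Coset"
begin

section \<open>Smooth maps between open subsets of Euclidean spaces\<close>

text \<open>
  As in the library's \<^const>\<open>Euclidean_space\<close>, R^m consists of the functions
  \<^typ>\<open>nat \<Rightarrow> real\<close> vanishing at all indices from m on, so that m may vary within a formula.
  C^\<open>k\<close> functions are defined by iterated partial derivatives; for an open subset U of R^m and
  an index below m, the point \<open>x(i := t)\<close> stays in U for t near \<open>x i\<close>, hence only the values on U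
  matter.
\<close>

type_synonym vec = "nat \<Rightarrow> real"

definition partial :: "nat \<Rightarrow> (vec \<Rightarrow> real) \<Rightarrow> vec \<Rightarrow> real" where
  "partial i f x = deriv (\<lambda>t. f (x(i := t))) (x i)"

fun Ck_on :: "nat \<Rightarrow> nat \<Rightarrow> vec set \<Rightarrow> (vec \<Rightarrow> real) \<Rightarrow> bool" where
  "Ck_on 0 m U f \<longleftrightarrow> continuous_on U f"
| "Ck_on (Suc k) m U f \<longleftrightarrow> continuous_on U f \<and>
     (\<forall>i<m. (\<forall>x\<in>U. (\<lambda>t. f (x(i := t))) differentiable (at (x i))) \<and> Ck_on k m U (partial i f))"

definition smooth_fun_on :: "nat \<Rightarrow> vec set \<Rightarrow> (vec \<Rightarrow> real) \<Rightarrow> bool" where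
  "smooth_fun_on m U f \<longleftrightarrow> (\<forall>k. Ck_on k m U f)"

definition smooth_vec_on :: "nat \<Rightarrow> vec set \<Rightarrow> nat \<Rightarrow> (vec \<Rightarrow> vec) \<Rightarrow> bool" where
  "smooth_vec_on m U n f \<longleftrightarrow>
     f ` U \<subseteq> topspace (Euclidean_space n) \<and> (\<forall>j<n. smooth_fun_on m U (\<lambda>x. f x j))"

definition dir_deriv :: "nat \<Rightarrow> (vec \<Rightarrow> real) \<Rightarrow> vec \<Rightarrow> vec \<Rightarrow> real" where
  "dir_deriv m f x v = (\<Sum>j<m. v j * partial j f x)"

definition jacobian :: "nat \<Rightarrow> nat \<Rightarrow> (vec \<Rightarrow> vec) \<Rightarrow> vec \<Rightarrow> vec \<Rightarrow> vec" where
  "jacobian m n f x v = (\<lambda>i. if i < n then dir_deriv m (\<lambda>y. f y i) x v else 0)"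


section \<open>Real vector spaces and Lie algebras with explicit carrier\<close>

record 'v real_space =
  vcarrier :: "'v set"
  vzero :: 'v
  vadd :: "'v \<Rightarrow> 'v \<Rightarrow> 'v"
  vscale :: "real \<Rightarrow> 'v \<Rightarrow> 'v"

record 'v lie_algebra = "'v real_space" +
  lie_bracket :: "'v \<Rightarrow> 'v \<Rightarrow> 'v"

definition euclid_vs :: "nat \<Rightarrow> vec real_space" where
  "euclid_vs m = \<lparr>vcarrier = topspace (Euclidean_space m), vzero = (\<lambda>i. 0),
     vadd = (\<lambda>x y i. x i + y i), vscale = (\<lambda>c x i. c * x i)\<rparr>"

definition vs_subspace :: "('v, 'z) real_space_scheme \<Rightarrow> 'v set \<Rightarrow> bool" where
  "vs_subspace V W \<longleftrightarrow> W \<subseteq> vcarrier V \<and> vzero V \<in> W \<and>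
     (\<forall>x\<in>W. \<forall>y\<in>W. vadd V x y \<in> W) \<and> (\<forall>c. \<forall>x\<in>W. vscale V c x \<in> W)"

definition lie_ideal :: "'v lie_algebra \<Rightarrow> 'v set \<Rightarrow> bool" where
  "lie_ideal L I \<longleftrightarrow> vs_subspace L I \<and> (\<forall>x\<in>vcarrier L. \<forall>z\<in>I. lie_bracket L x z \<in> I)"

definition vs_coset :: "('v, 'z) real_space_scheme \<Rightarrow> 'v \<Rightarrow> 'v set \<Rightarrow> 'v set" where
  "vs_coset V x W = vadd V x ` W"

definition quot_vs :: "('v, 'z) real_space_scheme \<Rightarrow> 'v set \<Rightarrow> 'v set real_space" where
  "quot_vs V W = \<lparr>vcarrier = (\<lambda>x. vs_coset V x W) ` vcarrier V, vzero = W,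
     vadd = (\<lambda>A B. \<Union>x\<in>A. \<Union>y\<in>B. vs_coset V (vadd V x y) W),
     vscale = (\<lambda>c A. \<Union>x\<in>A. vs_coset V (vscale V c x) W)\<rparr>"

definition quot_lie_algebra :: "'v lie_algebra \<Rightarrow> 'v set \<Rightarrow> 'v set lie_algebra" where
  "quot_lie_algebra L I = \<lparr>vcarrier = vcarrier (quot_vs L I), vzero = vzero (quot_vs L I),
     vadd = vadd (quot_vs L I), vscale = vscale (quot_vs L I),
     lie_bracket = (\<lambda>A B. \<Union>x\<in>A. \<Union>y\<in>B. vs_coset L (lie_bracket L x y) I)\<rparr>"

definition vs_linear ::
  "('v, 'y) real_space_scheme \<Rightarrow> ('w, 'z) real_space_scheme \<Rightarrow> ('v \<Rightarrow> 'w) \<Rightarrow> bool" where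
  "vs_linear V W f \<longleftrightarrow> f ` vcarrier V \<subseteq> vcarrier W \<and>
     (\<forall>x\<in>vcarrier V. \<forall>y\<in>vcarrier V. f (vadd V x y) = vadd W (f x) (f y)) \<and>
     (\<forall>c. \<forall>x\<in>vcarrier V. f (vscale V c x) = vscale W c (f x))"

definition vs_isomorphism ::
  "('v, 'y) real_space_scheme \<Rightarrow> ('w, 'z) real_space_scheme \<Rightarrow> ('v \<Rightarrow> 'w) \<Rightarrow> bool" where
  "vs_isomorphism V W f \<longleftrightarrow> vs_linear V W f \<and> bij_betw f (vcarrier V) (vcarrier W)"

definition vs_isomorphic ::
  "('v, 'y) real_space_scheme \<Rightarrow> ('w, 'z) real_space_scheme \<Rightarrow> bool" where
  "vs_isomorphic V W \<longleftrightarrow> (\<exists>f. vs_isomorphism V W f)"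


section \<open>Cochain complexes\<close>

definition cochain_complex :: "(nat \<Rightarrow> 'v real_space) \<Rightarrow> (nat \<Rightarrow> 'v \<Rightarrow> 'v) \<Rightarrow> bool" where
  "cochain_complex C d \<longleftrightarrow> (\<forall>k. vs_linear (C k) (C (Suc k)) (d k) \<and>
     (\<forall>x\<in>vcarrier (C k). d (Suc k) (d k x) = vzero (C (Suc (Suc k)))))"

definition cochain_isomorphic ::
  "(nat \<Rightarrow> 'v real_space) \<Rightarrow> (nat \<Rightarrow> 'v \<Rightarrow> 'v) \<Rightarrow>
   (nat \<Rightarrow> 'w real_space) \<Rightarrow> (nat \<Rightarrow> 'w \<Rightarrow> 'w) \<Rightarrow> bool" where
  "cochain_isomorphic C d C' d' \<longleftrightarrow> cochain_complex C d \<and> cochain_complex C' d' \<and>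
     (\<exists>\<Phi>. \<forall>k. vs_isomorphism (C k) (C' k) (\<Phi> k) \<and>
        (\<forall>x\<in>vcarrier (C k). \<Phi> (Suc k) (d k x) = d' k (\<Phi> k x)))"

definition cocycles :: "(nat \<Rightarrow> 'v real_space) \<Rightarrow> (nat \<Rightarrow> 'v \<Rightarrow> 'v) \<Rightarrow> nat \<Rightarrow> 'v set" where
  "cocycles C d k = {x \<in> vcarrier (C k). d k x = vzero (C (Suc k))}"

fun coboundaries :: "(nat \<Rightarrow> 'v real_space) \<Rightarrow> (nat \<Rightarrow> 'v \<Rightarrow> 'v) \<Rightarrow> nat \<Rightarrow> 'v set" where
  "coboundaries C d 0 = {vzero (C 0)}"
| "coboundaries C d (Suc k) = d k ` vcarrier (C k)"

definition cohomology ::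
  "(nat \<Rightarrow> 'v real_space) \<Rightarrow> (nat \<Rightarrow> 'v \<Rightarrow> 'v) \<Rightarrow> nat \<Rightarrow> 'v set real_space" where
  "cohomology C d k =
     quot_vs ((C k)\<lparr>vcarrier := cocycles C d k\<rparr>) (coboundaries C d k)"


section \<open>Alternating forms and the Chevalley--Eilenberg complex\<close>

text \<open>
  A k-form takes its arguments as a list. Forms are extended by 0 to all lists that are not
  k-tuples of elements of the carrier, so that equality of forms is equality of functions.
\<close>

type_synonym 'v form = "'v list \<Rightarrow> real"

definition alternating_form :: "('v, 'z) real_space_scheme \<Rightarrow> nat \<Rightarrow> 'v form \<Rightarrow> bool" where
  "alternating_form V k \<omega> \<longleftrightarrow>
     (\<forall>vs. \<not> (length vs = k \<and> set vs \<subseteq> vcarrier V) \<longrightarrow> \<omega> vs = 0) \<and>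
     (\<forall>us ws x y a b.
        length us + length ws + 1 = k \<and> set us \<union> set ws \<union> {x, y} \<subseteq> vcarrier V \<longrightarrow>
        \<omega> (us @ vadd V (vscale V a x) (vscale V b y) # ws) =
          a * \<omega> (us @ x # ws) + b * \<omega> (us @ y # ws)) \<and>
     (\<forall>vs. set vs \<subseteq> vcarrier V \<and> \<not> distinct vs \<longrightarrow> \<omega> vs = 0)"

definition exterior_dual :: "('v, 'z) real_space_scheme \<Rightarrow> nat \<Rightarrow> 'v form real_space" where
  "exterior_dual V k = \<lparr>vcarrier = {\<omega>. alternating_form V k \<omega>}, vzero = (\<lambda>vs. 0),
     vadd = (\<lambda>\<omega> \<eta> vs. \<omega> vs + \<eta> vs), vscale = (\<lambda>c \<omega> vs. c * \<omega> vs)\<rparr>"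

definition CE_d :: "'v lie_algebra \<Rightarrow> 'v form \<Rightarrow> 'v form" where
  "CE_d L \<omega> = (\<lambda>Zs. if set Zs \<subseteq> vcarrier L
     then \<Sum>(i, j)\<in>{(i, j). i < j \<and> j < length Zs}.
            (- 1) ^ (i + j) * \<omega> (lie_bracket L (Zs ! i) (Zs ! j) # nths Zs (- {i, j}))
     else 0)"


section \<open>Diffeologies\<close>

text \<open>
  A plot is a triple of a dimension m, an open subset U of R^m and a map on U, which takes the
  value \<^const>\<open>undefined\<close> outside U.
\<close>

type_synonym 'x plot = "nat \<times> vec set \<times> (vec \<Rightarrow> 'x)"

definition diffeology :: "'x set \<Rightarrow> 'x plot set \<Rightarrow> bool" where
  "diffeology X D \<longleftrightarrow>
     (\<forall>(m, U, P)\<in>D. openin (Euclidean_space m) U \<and> P \<in> U \<rightarrow>\<^sub>E X) \<and>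
     (\<forall>m. \<forall>x\<in>X. (m, topspace (Euclidean_space m), \<lambda>u\<in>topspace (Euclidean_space m). x) \<in> D) \<and>
     (\<forall>m U P. openin (Euclidean_space m) U \<and> P \<in> U \<rightarrow>\<^sub>E X \<and>
        (\<forall>u\<in>U. \<exists>V. u \<in> V \<and> V \<subseteq> U \<and> openin (Euclidean_space m) V \<and> (m, V, restrict P V) \<in> D)
        \<longrightarrow> (m, U, P) \<in> D) \<and>
     (\<forall>(n, V, Q)\<in>D. \<forall>m U \<Phi>. openin (Euclidean_space m) U \<and> smooth_vec_on m U n \<Phi> \<and> \<Phi> ` U \<subseteq> V
        \<longrightarrow> (m, U, restrict (Q \<circ> \<Phi>) U) \<in> D)"

definition quotient_diffeology :: "'x plot set \<Rightarrow> ('x \<Rightarrow> 'y) \<Rightarrow> 'y set \<Rightarrow> 'y plot set" where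
  "quotient_diffeology D s Y = {(m, V, Q). openin (Euclidean_space m) V \<and> Q \<in> V \<rightarrow>\<^sub>E Y \<and>
     (\<forall>v\<in>V. \<exists>U P. v \<in> U \<and> U \<subseteq> V \<and> (m, U, P) \<in> D \<and> (\<forall>u\<in>U. s (P u) = Q u))}"


lemma Ck_on_subset: "Ck_on k m U f \<Longrightarrow> W \<subseteq> U \<Longrightarrow> Ck_on k m W f"
proof (induction k arbitrary: f)
  case 0
  then show ?case by (auto intro: continuous_on_subset)
next
  case (Suc k)
  show ?case
    using Suc.prems Suc.IH[OF _ Suc.prems(2)]
    by (auto intro: continuous_on_subset simp: subset_iff)
qed

lemma smooth_vec_on_subset: "W \<subseteq> U \<Longrightarrow> smooth_vec_on m U n f \<Longrightarrow> smooth_vec_on m W n f"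
  by (auto simp: smooth_vec_on_def smooth_fun_on_def intro: Ck_on_subset[of _ m U])

lemma continuous_map_smooth_vec_on:
  assumes "openin (Euclidean_space m) U" "smooth_vec_on m U n f"
  shows "continuous_map (subtopology (Euclidean_space m) U) (Euclidean_space n) f"
proof -
  have sub: "U \<subseteq> {x. \<forall>i\<ge>m. x i = 0}"
    using openin_subset[OF assms(1)] by (simp add: topspace_Euclidean_space)
  have zero: "f x j = 0" if "x \<in> U" "j \<ge> n" for x j
    using assms(2) that by (auto simp: smooth_vec_on_def topspace_Euclidean_space)
  have "continuous_on U (\<lambda>x. f x j)" for j
  proof (cases "j < n")
    case True
    then have "Ck_on 0 m U (\<lambda>x. f x j)"
      using assms(2) by (simp only: smooth_vec_on_def smooth_fun_on_def)
    then show ?thesis by simp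
  next
    case False
    then show ?thesis
      by (simp add: zero cong: continuous_on_cong)
  qed
  then have "continuous_on U f"
    by (rule continuous_on_coordinatewise_then_product)
  then have "continuous_map (top_of_set U) euclidean f"
    by simp
  moreover have "subtopology (Euclidean_space m) U = top_of_set U"
    using sub by (simp add: Euclidean_space_def subtopology_subtopology inf.absorb2
        euclidean_product_topology)
  moreover have "f ` U \<subseteq> {x. \<forall>i\<ge>n. x i = 0}"
    using zero by auto
  ultimately show ?thesis
    by (auto simp: Euclidean_space_def continuous_map_in_subtopology euclidean_product_topology)
qed

lemma diffeology_quotient_diffeology:
  assumes D: "diffeology X D" and s: "s ` X = Y"
  shows "diffeology Y (quotient_diffeology D s Y)"
proof -
  have mem: "(m, V, Q) \<in> quotient_diffeology D s Y \<longleftrightarrow>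
      openin (Euclidean_space m) V \<and> Q \<in> V \<rightarrow>\<^sub>E Y \<and>
      (\<forall>v\<in>V. \<exists>U P. v \<in> U \<and> U \<subseteq> V \<and> (m, U, P) \<in> D \<and> (\<forall>u\<in>U. s (P u) = Q u))" for m V Q
    by (simp add: quotient_diffeology_def)
  note D' = D[unfolded diffeology_def]
  have plot: "\<And>m U P. (m, U, P) \<in> D \<Longrightarrow> openin (Euclidean_space m) U \<and> P \<in> U \<rightarrow>\<^sub>E X"
    using D'[THEN conjunct1] by fast
  have const: "\<And>m x. x \<in> X \<Longrightarrow>
      (m, topspace (Euclidean_space m), \<lambda>u\<in>topspace (Euclidean_space m). x) \<in> D"
    using D'[THEN conjunct2, THEN conjunct1] by blast
  have comp: "(m, U, restrict (Q \<circ> \<Phi>) U) \<in> D"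
    if Q: "(n, V, Q) \<in> D" and U: "openin (Euclidean_space m) U"
      and \<Phi>: "smooth_vec_on m U n \<Phi>" "\<Phi> ` U \<subseteq> V" for n V Q m U \<Phi>
    using bspec[OF D'[THEN conjunct2, THEN conjunct2, THEN conjunct2] Q, simplified prod.case,
      rule_format, of m U \<Phi>] U \<Phi> by simp
  have 2: "(m, topspace (Euclidean_space m), \<lambda>u\<in>topspace (Euclidean_space m). y)
      \<in> quotient_diffeology D s Y" if y: "y \<in> Y" for m y
  proof -
    obtain x where "x \<in> X" "s x = y" using s y by blast
    then show ?thesis
      using const[of x m] y unfolding mem by (intro conjI ballI exI) auto
  qed
  have 3: "(m, U, Q) \<in> quotient_diffeology D s Y"
    if U: "openin (Euclidean_space m) U" and Q: "Q \<in> U \<rightarrow>\<^sub>E Y"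
      and loc: "\<forall>u\<in>U. \<exists>V. u \<in> V \<and> V \<subseteq> U \<and> openin (Euclidean_space m) V \<and>
        (m, V, restrict Q V) \<in> quotient_diffeology D s Y" for m U Q
    unfolding mem
  proof (intro conjI U Q ballI)
    fix u assume "u \<in> U"
    with loc obtain V where V: "u \<in> V" "V \<subseteq> U"
      and RV: "(m, V, restrict Q V) \<in> quotient_diffeology D s Y"
      by (elim ballE exE conjE) auto
    obtain W P where P: "u \<in> W" "W \<subseteq> V" "(m, W, P) \<in> D"
      "\<forall>w\<in>W. s (P w) = restrict Q V w"
      using bspec[OF RV[unfolded mem, THEN conjunct2, THEN conjunct2] V(1)] by (elim exE conjE)
    then show "\<exists>W P. u \<in> W \<and> W \<subseteq> U \<and> (m, W, P) \<in> D \<and> (\<forall>w\<in>W. s (P w) = Q w)"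
      using V by (intro exI[of _ W] exI[of _ P] conjI) (auto simp: subset_iff)
  qed
  have 4: "(m, U, restrict (Q \<circ> \<Phi>) U) \<in> quotient_diffeology D s Y"
    if Q: "(n, V, Q) \<in> quotient_diffeology D s Y" and U: "openin (Euclidean_space m) U"
      and \<Phi>: "smooth_vec_on m U n \<Phi>" "\<Phi> ` U \<subseteq> V" for n V Q m U \<Phi>
    unfolding mem
  proof (intro conjI U ballI)
    show "restrict (Q \<circ> \<Phi>) U \<in> U \<rightarrow>\<^sub>E Y"
      using Q[unfolded mem] \<Phi>(2) by (auto simp: PiE_iff)
  next
    fix u assume u: "u \<in> U"
    then have "\<Phi> u \<in> V" using \<Phi>(2) by auto
    from bspec[OF Q[unfolded mem, THEN conjunct2, THEN conjunct2] this]
    obtain V' P where P: "\<Phi> u \<in> V'" "(n, V', P) \<in> D" "\<forall>v\<in>V'. s (P v) = Q v"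
      by (elim exE conjE)
    define W where "W = {w \<in> U. \<Phi> w \<in> V'}"
    have top: "topspace (subtopology (Euclidean_space m) U) = U"
      using openin_subset[OF U] by auto
    have "openin (subtopology (Euclidean_space m) U) W"
      using openin_continuous_map_preimage[OF continuous_map_smooth_vec_on[OF U \<Phi>(1)],
          OF plot[OF P(2), THEN conjunct1]]
      unfolding W_def top .
    then have W: "openin (Euclidean_space m) W"
      using U by (simp add: openin_open_subtopology)
    have sub: "W \<subseteq> U" "\<Phi> ` W \<subseteq> V'" "u \<in> W"
      using u P(1) by (auto simp: W_def)
    have "(m, W, restrict (P \<circ> \<Phi>) W) \<in> D"
      by (rule comp[OF P(2) W smooth_vec_on_subset[OF sub(1) \<Phi>(1)] sub(2)])
    then show "\<exists>W P. u \<in> W \<and> W \<subseteq> U \<and> (m, W, P) \<in> D \<and>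
        (\<forall>w\<in>W. s (P w) = restrict (Q \<circ> \<Phi>) U w)"
      using sub P(3)
      by (intro exI[of _ W] exI[of _ "restrict (P \<circ> \<Phi>) W"] conjI) auto
  qed
  show ?thesis
    unfolding diffeology_def
  proof (intro conjI)
    show "\<forall>(m, U, P)\<in>quotient_diffeology D s Y. openin (Euclidean_space m) U \<and> P \<in> U \<rightarrow>\<^sub>E Y"
      by (auto simp: mem)
    show "\<forall>m. \<forall>y\<in>Y. (m, topspace (Euclidean_space m),
        \<lambda>u\<in>topspace (Euclidean_space m). y) \<in> quotient_diffeology D s Y"
      using 2 by blast
    show "\<forall>m U P. openin (Euclidean_space m) U \<and> P \<in> U \<rightarrow>\<^sub>E Y \<and>
        (\<forall>u\<in>U. \<exists>V. u \<in> V \<and> V \<subseteq> U \<and> openin (Euclidean_space m) V \<and>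
          (m, V, restrict P V) \<in> quotient_diffeology D s Y)
        \<longrightarrow> (m, U, P) \<in> quotient_diffeology D s Y"
      by (intro allI impI) (elim conjE, rule 3)
    show "\<forall>(n, V, Q)\<in>quotient_diffeology D s Y. \<forall>m U \<Phi>. openin (Euclidean_space m) U \<and>
        smooth_vec_on m U n \<Phi> \<and> \<Phi> ` U \<subseteq> V
        \<longrightarrow> (m, U, restrict (Q \<circ> \<Phi>) U) \<in> quotient_diffeology D s Y"
      by clarify (rule 4)
  qed
qed


section \<open>Differential forms on diffeological spaces\<close>

text \<open>
  A smooth k-form on an open subset V of R^m maps each point to an alternating k-form on R^m; it is
  extended by 0 outside V.
\<close>

type_synonym dform = "vec \<Rightarrow> vec form"

definition smooth_form :: "nat \<Rightarrow> vec set \<Rightarrow> nat \<Rightarrow> dform \<Rightarrow> bool" where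
  "smooth_form m V k \<omega> \<longleftrightarrow>
     (\<forall>x\<in>V. alternating_form (euclid_vs m) k (\<omega> x)) \<and>
     (\<forall>x. x \<notin> V \<longrightarrow> \<omega> x = (\<lambda>vs. 0)) \<and>
     (\<forall>vs. length vs = k \<and> set vs \<subseteq> topspace (Euclidean_space m) \<longrightarrow>
        smooth_fun_on m V (\<lambda>x. \<omega> x vs))"

definition pullback_form :: "nat \<Rightarrow> vec set \<Rightarrow> nat \<Rightarrow> (vec \<Rightarrow> vec) \<Rightarrow> dform \<Rightarrow> dform" where
  "pullback_form m U n \<Phi> \<omega> = (\<lambda>x vs. if x \<in> U \<and> set vs \<subseteq> topspace (Euclidean_space m)
     then \<omega> (\<Phi> x) (map (jacobian m n \<Phi> x) vs) else 0)"

text \<open>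
  The usual invariant formula for the exterior derivative, applied to constant vector fields
  (whose brackets vanish).
\<close>

definition ext_deriv :: "nat \<Rightarrow> vec set \<Rightarrow> dform \<Rightarrow> dform" where
  "ext_deriv m V \<omega> = (\<lambda>x vs. if x \<in> V \<and> set vs \<subseteq> topspace (Euclidean_space m)
     then \<Sum>i<length vs. (- 1) ^ i * dir_deriv m (\<lambda>y. \<omega> y (nths vs (- {i}))) x (vs ! i)
     else 0)"

text \<open>Forms on a diffeological space with set of plots D are extended by 0 to all non-plots.\<close>

definition diffeological_form :: "'x plot set \<Rightarrow> nat \<Rightarrow> ('x plot \<Rightarrow> dform) \<Rightarrow> bool" where
  "diffeological_form D k \<beta> \<longleftrightarrow>
     (\<forall>p. p \<notin> D \<longrightarrow> \<beta> p = (\<lambda>x vs. 0)) \<and>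
     (\<forall>(n, V, Q)\<in>D. smooth_form n V k (\<beta> (n, V, Q))) \<and>
     (\<forall>(n, V, Q)\<in>D. \<forall>m U \<Phi>. openin (Euclidean_space m) U \<and> smooth_vec_on m U n \<Phi> \<and> \<Phi> ` U \<subseteq> V
        \<longrightarrow> \<beta> (m, U, restrict (Q \<circ> \<Phi>) U) = pullback_form m U n \<Phi> (\<beta> (n, V, Q)))"

definition diffeo_forms :: "'x plot set \<Rightarrow> nat \<Rightarrow> ('x plot \<Rightarrow> dform) real_space" where
  "diffeo_forms D k = \<lparr>vcarrier = {\<beta>. diffeological_form D k \<beta>}, vzero = (\<lambda>p x vs. 0),
     vadd = (\<lambda>\<alpha> \<beta> p x vs. \<alpha> p x vs + \<beta> p x vs), vscale = (\<lambda>c \<beta> p x vs. c * \<beta> p x vs)\<rparr>"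

definition diffeo_d :: "'x plot set \<Rightarrow> ('x plot \<Rightarrow> dform) \<Rightarrow> 'x plot \<Rightarrow> dform" where
  "diffeo_d D \<beta> = (\<lambda>(m, V, Q). if (m, V, Q) \<in> D then ext_deriv m V (\<beta> (m, V, Q)) else (\<lambda>x vs. 0))"


section \<open>Manifolds\<close>

text \<open>
  A chart is a pair of an open set W and a map on W. The atlas need not be maximal. Manifolds are
  Hausdorff, but not required to be second countable.
\<close>

record 'a manifold =
  mdim :: nat
  mtop :: "'a topology"
  charts :: "('a set \<times> ('a \<Rightarrow> vec)) set"

definition smooth_manifold :: "'a manifold \<Rightarrow> bool" where
  "smooth_manifold M \<longleftrightarrow>
     Hausdorff_space (mtop M) \<and>
     (\<Union>(W, \<phi>)\<in>charts M. W) = topspace (mtop M) \<and>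
     (\<forall>(W, \<phi>)\<in>charts M. openin (mtop M) W \<and> openin (Euclidean_space (mdim M)) (\<phi> ` W) \<and>
        homeomorphic_map (subtopology (mtop M) W)
          (subtopology (Euclidean_space (mdim M)) (\<phi> ` W)) \<phi>) \<and>
     (\<forall>(W, \<phi>)\<in>charts M. \<forall>(W', \<psi>)\<in>charts M.
        smooth_vec_on (mdim M) (\<phi> ` (W \<inter> W')) (mdim M) (\<psi> \<circ> inv_into W \<phi>))"

definition smooth_map :: "'a manifold \<Rightarrow> 'b manifold \<Rightarrow> ('a \<Rightarrow> 'b) \<Rightarrow> bool" where
  "smooth_map M N f \<longleftrightarrow> continuous_map (mtop M) (mtop N) f \<and>
     (\<forall>(W, \<phi>)\<in>charts M. \<forall>(W', \<psi>)\<in>charts N.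
        smooth_vec_on (mdim M) (\<phi> ` {p \<in> W. f p \<in> W'}) (mdim N) (\<psi> \<circ> f \<circ> inv_into W \<phi>))"

definition open_submanifold :: "nat \<Rightarrow> vec set \<Rightarrow> vec manifold" where
  "open_submanifold m U =
     \<lparr>mdim = m, mtop = subtopology (Euclidean_space m) U, charts = {(U, \<lambda>x. x)}\<rparr>"

definition vec_append :: "nat \<Rightarrow> vec \<Rightarrow> vec \<Rightarrow> vec" where
  "vec_append m x y = (\<lambda>i. if i < m then x i else y (i - m))"

definition prod_manifold :: "'a manifold \<Rightarrow> 'b manifold \<Rightarrow> ('a \<times> 'b) manifold" where
  "prod_manifold M N =
     \<lparr>mdim = mdim M + mdim N, mtop = prod_topology (mtop M) (mtop N),
      charts = {(W \<times> W', \<lambda>(p, q). vec_append (mdim M) (\<phi> p) (\<psi> q)) | W \<phi> W' \<psi>.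
                  (W, \<phi>) \<in> charts M \<and> (W', \<psi>) \<in> charts N}\<rparr>"

definition manifold_diffeology :: "'a manifold \<Rightarrow> 'a plot set" where
  "manifold_diffeology M = {(m, U, P). openin (Euclidean_space m) U \<and> P \<in> extensional U \<and>
     smooth_map (open_submanifold m U) M P}"

text \<open>Smooth real functions, extended by 0 to the points of the type outside the manifold.\<close>

definition smooth_functions :: "'a manifold \<Rightarrow> ('a \<Rightarrow> real) set" where
  "smooth_functions M = {f. (\<forall>p. p \<notin> topspace (mtop M) \<longrightarrow> f p = 0) \<and>
     (\<forall>(W, \<phi>)\<in>charts M. smooth_fun_on (mdim M) (\<phi> ` W) (f \<circ> inv_into W \<phi>))}"

text \<open>Vector fields are derivations of the algebra of smooth functions, extended by 0.\<close>

type_synonym 'a vfield = "('a \<Rightarrow> real) \<Rightarrow> 'a \<Rightarrow> real"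

definition vector_field :: "'a manifold \<Rightarrow> 'a vfield \<Rightarrow> bool" where
  "vector_field M X \<longleftrightarrow>
     (\<forall>f. f \<notin> smooth_functions M \<longrightarrow> X f = (\<lambda>p. 0)) \<and>
     (\<forall>f\<in>smooth_functions M. X f \<in> smooth_functions M) \<and>
     (\<forall>f\<in>smooth_functions M. \<forall>g\<in>smooth_functions M.
        (\<forall>a b. X (\<lambda>p. a * f p + b * g p) = (\<lambda>p. a * X f p + b * X g p)) \<and>
        X (\<lambda>p. f p * g p) = (\<lambda>p. X f p * g p + f p * X g p))"


section \<open>Lie groups\<close>

definition lie_group :: "('a, 'z) monoid_scheme \<Rightarrow> 'a manifold \<Rightarrow> bool" where
  "lie_group G M \<longleftrightarrow> group G \<and> smooth_manifold M \<and> topspace (mtop M) = carrier G \<and>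
     smooth_map (prod_manifold M M) M (\<lambda>(p, q). p \<otimes>\<^bsub>G\<^esub> q) \<and>
     smooth_map M M (\<lambda>p. inv\<^bsub>G\<^esub> p)"

definition left_translate ::
  "('a, 'z) monoid_scheme \<Rightarrow> 'a \<Rightarrow> ('a \<Rightarrow> real) \<Rightarrow> 'a \<Rightarrow> real" where
  "left_translate G g f = (\<lambda>p. if p \<in> carrier G then f (g \<otimes>\<^bsub>G\<^esub> p) else 0)"

definition left_invariant :: "('a, 'z) monoid_scheme \<Rightarrow> 'a manifold \<Rightarrow> 'a vfield \<Rightarrow> bool" where
  "left_invariant G M X \<longleftrightarrow> (\<forall>g\<in>carrier G. \<forall>f\<in>smooth_functions M.
     X (left_translate G g f) = left_translate G g (X f))"

definition lie_algebra_of ::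
  "('a, 'z) monoid_scheme \<Rightarrow> 'a manifold \<Rightarrow> 'a vfield lie_algebra" where
  "lie_algebra_of G M = \<lparr>vcarrier = {X. vector_field M X \<and> left_invariant G M X},
     vzero = (\<lambda>f p. 0), vadd = (\<lambda>X Y f p. X f p + Y f p), vscale = (\<lambda>c X f p. c * X f p),
     lie_bracket = (\<lambda>X Y f p. X (Y f) p - Y (X f) p)\<rparr>"

definition integral_curve :: "'a manifold \<Rightarrow> 'a vfield \<Rightarrow> (real \<Rightarrow> 'a) \<Rightarrow> bool" where
  "integral_curve M X \<gamma> \<longleftrightarrow> range \<gamma> \<subseteq> topspace (mtop M) \<and>
     (\<forall>f\<in>smooth_functions M. \<forall>t. ((\<lambda>t. f (\<gamma> t)) has_real_derivative X f (\<gamma> t)) (at t))"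

text \<open>
  The flow of a left-invariant vector field is complete and unique, and the integral curve through
  the unit is the one-parameter subgroup generated by the field.
\<close>

definition lie_exp :: "('a, 'z) monoid_scheme \<Rightarrow> 'a manifold \<Rightarrow> 'a vfield \<Rightarrow> 'a" where
  "lie_exp G M Z = (THE \<gamma>. integral_curve M Z \<gamma> \<and> \<gamma> 0 = \<one>\<^bsub>G\<^esub>) 1"

definition lie_subalgebra_of ::
  "('a, 'z) monoid_scheme \<Rightarrow> 'a manifold \<Rightarrow> 'a set \<Rightarrow> 'a vfield set" where
  "lie_subalgebra_of G M H = {Z \<in> vcarrier (lie_algebra_of G M).
     \<forall>t. lie_exp G M (vscale (lie_algebra_of G M) t Z) \<in> H}"

definition coset_diffeology ::
  "('a, 'z) monoid_scheme \<Rightarrow> 'a manifold \<Rightarrow> 'a set \<Rightarrow> 'a set plot set" where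
  "coset_diffeology G M H =
     quotient_diffeology (manifold_diffeology M) (\<lambda>q. q <#\<^bsub>G\<^esub> H) (lcosets\<^bsub>G\<^esub> H)"

end

theory Submission
  imports Defs "HOL-Algebra.Generated_Groups"
begin

text \<open>
  Two local lifts of a plot of G/H differ by a plot of G with values in H. The velocities of such plots, moved to
  the unit, form the Lie algebra of H: they form a subspace stable under Ad(H), hence under Ad(G) by density, and a
  curve tangent to the corresponding left-invariant distribution is locally obtained by solving a differential
  equation in the parameter space of a product of curves in H, so it stays in H. In particular this subspace is an
  ideal. The Maurer--Cartan form of a lift is therefore well defined modulo the ideal, and composing it with an
  alternating form on the quotient Lie algebra gives a form on G/H. Conversely, the value of a form on G/H at a plot
  of G is unchanged by left translations of the plot by H, hence, by continuity and density, by G; so it depends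
  only on the Maurer--Cartan form of the plot. By the Maurer--Cartan equation the exterior derivative becomes the
  Chevalley--Eilenberg coboundary.
\<close>

section \<open>Calculus with iterated partial derivatives\<close>

text \<open>The obstacle is that \<open>H\<close> is dense and in general not closed: a limit of
  elements of \<open>H\<close>, such as that of gamma(t/n)^n, need not lie in \<open>H\<close>, and
  no submanifold structure on \<open>H\<close> is at hand. Everything has to happen with smooth maps
  that take values in \<open>H\<close> itself. This is why \<open>h0\<close> collects the velocities
  of arbitrary smooth curves in \<open>H\<close>: sums of velocities then come from products of
  curves. The price is paid in the comparison with the exponential map, where a one-parameter group
  must be shown to lie in \<open>H\<close> exactly and not merely in its closure. Limits are taken
  only in closed conditions: membership in a subspace of R^n in \<open>h0_Adi_dense\<close>, an
  equation between real numbers in \<open>form_translate\<close>. A second obstacle is that Lie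
  algebra elements are derivations of global functions, whereas the calculus needs coordinates: bump
  functions and Hadamard's lemma identify the Lie algebra with R^n through \<open>E\<close>, and
  \<open>mc\<close> is the Maurer--Cartan form in these coordinates.\<close>

abbreviation Rn :: "nat \<Rightarrow> vec set" where "Rn m \<equiv> topspace (Euclidean_space m)"

abbreviation eopen :: "nat \<Rightarrow> vec set \<Rightarrow> bool" where "eopen m U \<equiv> openin (Euclidean_space m) U"

section \<open>Cubes as a neighbourhood basis of R^m\<close>

definition cube :: "nat \<Rightarrow> vec \<Rightarrow> real \<Rightarrow> vec set" where
  "cube m x \<epsilon> = {y \<in> Rn m. \<forall>i<m. \<bar>y i - x i\<bar> < \<epsilon>}"

lemma Rn_iff: "x \<in> Rn m \<longleftrightarrow> (\<forall>i\<ge>m. x i = 0)"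
  by (simp add: topspace_Euclidean_space)

lemma eopen_subset: "eopen m U \<Longrightarrow> U \<subseteq> Rn m"
  by (rule openin_subset)

lemma eopen_eq: "eopen m U \<longleftrightarrow> (\<exists>T. open T \<and> U = T \<inter> Rn m)"
  unfolding Euclidean_space_def by (simp add: openin_subtopology euclidean_product_topology)

lemma eopen_cube: "eopen m (cube m x \<epsilon>)"
proof -
  have "open {y::vec. \<forall>i\<in>{..<m}. y (id i) \<in> ball (x i) \<epsilon>}"
    by (rule product_topology_basis') auto
  moreover have "cube m x \<epsilon> = {y. \<forall>i\<in>{..<m}. y (id i) \<in> ball (x i) \<epsilon>} \<inter> Rn m"
    by (auto simp: cube_def dist_real_def abs_minus_commute)
  ultimately show ?thesis unfolding eopen_eq by blast
qed

lemma mem_cube_self: "x \<in> Rn m \<Longrightarrow> \<epsilon> > 0 \<Longrightarrow> x \<in> cube m x \<epsilon>"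
  by (auto simp: cube_def)

lemma open_contains_cube:
  assumes "open T" "x \<in> T" "x \<in> Rn m"
  shows "\<exists>\<epsilon>>0. cube m x \<epsilon> \<subseteq> T"
proof -
  have "openin (product_topology (\<lambda>i. euclidean) UNIV) T"
    using assms(1) by (simp add: open_fun_def)
  from product_topology_open_contains_basis[OF this assms(2)]
  obtain X where X: "x \<in> (\<Pi>\<^sub>E i\<in>UNIV. X i)" "\<forall>i. open (X i)" "(\<Pi>\<^sub>E i\<in>UNIV. X i) \<subseteq> T"
    by auto
  have "\<exists>e>0. \<forall>s. \<bar>s - x i\<bar> < e \<longrightarrow> s \<in> X i" for i
    using X(1,2) open_contains_ball[of "X i"]
    by (metis PiE_mem UNIV_I dist_real_def mem_ball dist_commute subset_iff)
  then obtain e where e: "\<And>i. e i > 0" "\<And>i s. \<bar>s - x i\<bar> < e i \<Longrightarrow> s \<in> X i" by metis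
  \<comment> \<open>Only the radii of the first \<open>m\<close> factors matter, as the other
    coordinates of points of the cube agree with those of \<open>x\<close>; the 1 keeps the minimum
    defined when \<open>m\<close> is 0.\<close>
  define \<epsilon> where "\<epsilon> = Min (insert 1 (e ` {..<m}))"
  have "\<epsilon> > 0" using e(1) by (auto simp: \<epsilon>_def)
  moreover have "\<epsilon> \<le> e i" if "i < m" for i using that by (auto simp: \<epsilon>_def)
  ultimately have "y \<in> (\<Pi>\<^sub>E i\<in>UNIV. X i)" if "y \<in> cube m x \<epsilon>" for y
  proof -
    have "y i \<in> X i" for i
    proof (cases "i < m")
      case True
      then have "\<bar>y i - x i\<bar> < e i" using that \<open>i < m \<Longrightarrow> \<epsilon> \<le> e i\<close> by (force simp: cube_def)
      then show ?thesis by (rule e(2))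
    next
      case False
      then have "y i = x i" using that assms(3) by (simp add: cube_def Rn_iff)
      then show ?thesis using e by simp
    qed
    then show ?thesis by (simp add: PiE_iff)
  qed
  then show ?thesis using X(3) \<open>\<epsilon> > 0\<close> by blast
qed

lemma eopen_contains_cube:
  assumes "eopen m U" "x \<in> U"
  obtains \<epsilon> where "\<epsilon> > 0" "cube m x \<epsilon> \<subseteq> U"
proof -
  obtain T where T: "open T" "U = T \<inter> Rn m" using assms(1) eopen_eq by blast
  then obtain \<epsilon> where "\<epsilon> > 0" "cube m x \<epsilon> \<subseteq> T" using open_contains_cube[of T x m] assms by blast
  then show ?thesis using T that by (auto simp: cube_def)
qed

lemma eopen_Int: "eopen m U \<Longrightarrow> eopen m V \<Longrightarrow> eopen m (U \<inter> V)"
  by (rule openin_Int)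

lemma eopen_Rn: "eopen m (Rn m)"
  by (rule openin_topspace)

lemma subtopology_Rn: "U \<subseteq> Rn m \<Longrightarrow> subtopology (Euclidean_space m) U = top_of_set U"
  by (simp add: Euclidean_space_def subtopology_subtopology inf.absorb2
        euclidean_product_topology)

lemma tendsto_vecI:
  assumes x: "x \<in> Rn m" and ev: "\<forall>\<^sub>F t in F. y t \<in> Rn m"
    and lim: "\<And>i. i < m \<Longrightarrow> ((\<lambda>t. y t i) \<longlongrightarrow> x i) F"
  shows "(y \<longlongrightarrow> x) F"
proof (rule topological_tendstoI)
  fix T assume "open T" "x \<in> T"
  then obtain \<epsilon> where \<epsilon>: "\<epsilon> > 0" "cube m x \<epsilon> \<subseteq> T" using open_contains_cube x by blast
  have "\<forall>\<^sub>F t in F. \<forall>i\<in>{..<m}. \<bar>y t i - x i\<bar> < \<epsilon>"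
    unfolding eventually_ball_finite_distrib[OF finite_lessThan]
    using lim \<epsilon>(1) by (auto simp: tendsto_iff dist_real_def)
  with ev show "\<forall>\<^sub>F t in F. y t \<in> T"
    by eventually_elim (use \<epsilon>(2) in \<open>auto simp: cube_def\<close>)
qed

lemma continuous_on_locally:
  assumes "\<And>x. x \<in> U \<Longrightarrow> \<exists>V. x \<in> V \<and> V \<subseteq> U \<and> eopen m V \<and> continuous_on V f"
    and U: "eopen m U"
  shows "continuous_on U f"
  unfolding continuous_on_eq_continuous_within
proof
  fix x assume x: "x \<in> U"
  then obtain V where V: "x \<in> V" "V \<subseteq> U" "eopen m V" "continuous_on V f" using assms by blast
  obtain T where T: "open T" "V = T \<inter> Rn m" using V(3) eopen_eq by blast
  have "at x within U = at x within V"
    using T V U[THEN eopen_subset] by (intro at_within_nhd[of x T]) auto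
  then show "continuous (at x within U) f"
    using V by (simp add: continuous_on_eq_continuous_within)
qed

section \<open>Partial derivatives and C^k functions on open sets\<close>

lemma upd_eventually:
  assumes "eopen m U" "x \<in> U" "i < m"
  shows "\<forall>\<^sub>F t in nhds (x i). x(i := t) \<in> U"
proof -
  obtain \<epsilon> where \<epsilon>: "\<epsilon> > 0" "cube m x \<epsilon> \<subseteq> U" using eopen_contains_cube assms by blast
  have "x(i := t) \<in> U" if "dist t (x i) < \<epsilon>" for t
  proof -
    have "x(i := t) \<in> cube m x \<epsilon>"
      using that assms \<epsilon>(1) eopen_subset[OF assms(1)]
      by (auto simp: cube_def Rn_iff dist_real_def)
    then show ?thesis using \<epsilon> by blast
  qed
  then show ?thesis using \<epsilon>(1) unfolding eventually_nhds_metric by blast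
qed

text \<open>\<open>partial\<close> is built on \<open>deriv\<close> and has some value even without
  differentiability; this predicate records existence together with the value, as the calculus rules
  require.\<close>

definition hasp :: "nat \<Rightarrow> (vec \<Rightarrow> real) \<Rightarrow> vec \<Rightarrow> real \<Rightarrow> bool" where
  "hasp i f x D \<longleftrightarrow> ((\<lambda>t. f (x(i := t))) has_real_derivative D) (at (x i))"

lemma hasp_partial: "hasp i f x D \<Longrightarrow> partial i f x = D"
  unfolding hasp_def partial_def by (rule DERIV_imp_deriv)

lemma hasp_cong:
  assumes "eopen m U" "x \<in> U" "i < m" "\<And>y. y \<in> U \<Longrightarrow> f y = g y"
  shows "hasp i f x D \<longleftrightarrow> hasp i g x D"
  unfolding hasp_def
  by (rule DERIV_cong_ev[OF refl _ refl], rule eventually_mono[OF upd_eventually[OF assms(1-3)]])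
    (use assms(4) in auto)

lemma partial_cong:
  assumes "eopen m U" "x \<in> U" "i < m" "\<And>y. y \<in> U \<Longrightarrow> f y = g y"
  shows "partial i f x = partial i g x"
  unfolding partial_def
  by (rule deriv_cong_ev, rule eventually_mono[OF upd_eventually[OF assms(1-3)]])
    (use assms(4) in auto)

lemma hasp_ex: "(\<lambda>t. f (x(i := t))) differentiable (at (x i)) \<longleftrightarrow> hasp i f x (partial i f x)"
  unfolding hasp_def partial_def real_differentiable_def
  using DERIV_deriv_iff_real_differentiable real_differentiable_def by metis

lemma Ck_SucD:
  assumes "Ck_on (Suc k) m U f"
  shows "continuous_on U f" "\<And>x i. x \<in> U \<Longrightarrow> i < m \<Longrightarrow> hasp i f x (partial i f x)"
    "\<And>i. i < m \<Longrightarrow> Ck_on k m U (partial i f)"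
  using assms by (auto simp: hasp_ex)

lemma Ck_cong:
  assumes "eopen m U" "\<And>x. x \<in> U \<Longrightarrow> f x = g x"
  shows "Ck_on k m U f = Ck_on k m U g"
  using assms(2)
proof (induction k arbitrary: f g)
  case 0
  then show ?case by (simp cong: continuous_on_cong)
next
  case (Suc k)
  have 1: "Ck_on k m U (partial i f) = Ck_on k m U (partial i g)" if "i < m" for i
    by (rule Suc.IH) (rule partial_cong[OF assms(1) _ that Suc.prems])
  have 2: "hasp i f x (partial i f x) = hasp i g x (partial i g x)" if "i < m" "x \<in> U" for i x
    using hasp_cong[OF assms(1) that(2,1) Suc.prems] partial_cong[OF assms(1) that(2,1) Suc.prems]
    by simp
  show ?case
    using 1 2 Suc.prems by (auto simp: hasp_ex cong: continuous_on_cong)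
qed

text \<open>The induction step of most closure properties: a formula for the partial derivative is
  supplied, and \<open>Ck_cong\<close> transfers its regularity to
  \<open>partial i f\<close>.\<close>

lemma Ck_SucI:
  assumes "eopen m U" "continuous_on U f"
    and "\<And>i. i < m \<Longrightarrow> \<exists>g. Ck_on k m U g \<and> (\<forall>x\<in>U. hasp i f x (g x))"
  shows "Ck_on (Suc k) m U f"
proof -
  have "(\<forall>x\<in>U. hasp i f x (partial i f x)) \<and> Ck_on k m U (partial i f)" if i: "i < m" for i
  proof -
    obtain g where g: "Ck_on k m U g" "\<forall>x\<in>U. hasp i f x (g x)" using assms(3)[OF i] by blast
    then have eq: "partial i f x = g x" if "x \<in> U" for x using that hasp_partial by blast
    then show ?thesis using g Ck_cong[OF assms(1) eq] by auto
  qed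
  then show ?thesis using assms(2) by (simp add: hasp_ex)
qed

lemma Ck_continuous: "Ck_on k m U f \<Longrightarrow> continuous_on U f"
  by (cases k) auto

lemma Ck_SucD': "Ck_on (Suc k) m U f \<Longrightarrow> Ck_on k m U f"
proof (induction k arbitrary: f)
  case (Suc k)
  then have "Ck_on k m U (partial i f)" if "i < m" for i using that Ck_SucD(3) by blast
  then show ?case using Suc.prems by auto
qed auto

lemma Ck_mono: "Ck_on k m U f \<Longrightarrow> l \<le> k \<Longrightarrow> Ck_on l m U f"
  by (induction k) (auto simp: le_Suc_eq simp del: Ck_on.simps dest: Ck_SucD')

lemma Ck_const: "eopen m U \<Longrightarrow> Ck_on k m U (\<lambda>x. c)"
proof (induction k arbitrary: c)
  case (Suc k)
  show ?case
    by (rule Ck_SucI[OF Suc.prems]) (auto simp: hasp_def intro!: exI[of _ "\<lambda>x. 0"] Suc)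
qed auto

lemma continuous_on_coord: "continuous_on U (\<lambda>x::vec. x j)"
  by (rule continuous_on_subset[OF _ subset_UNIV]) simp

lemma Ck_coord: "eopen m U \<Longrightarrow> Ck_on k m U (\<lambda>x. x j)"
proof (cases k)
  case 0
  then show ?thesis using continuous_on_coord by simp
next
  case (Suc k')
  assume U: "eopen m U"
  show ?thesis unfolding Suc
  proof (intro Ck_SucI[OF U] continuous_on_coord)
    show "\<exists>g. Ck_on k' m U g \<and> (\<forall>x\<in>U. hasp i (\<lambda>x. x j) x (g x))" for i
      by (intro exI[of _ "\<lambda>x. if i = j then 1 else 0"]) (auto simp: hasp_def Ck_const[OF U])
  qed
qed

lemma Ck_add:
  "eopen m U \<Longrightarrow> Ck_on k m U f \<Longrightarrow> Ck_on k m U g \<Longrightarrow> Ck_on k m U (\<lambda>x. f x + g x)"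
proof (induction k arbitrary: f g)
  case (Suc k)
  note D = Ck_SucD[OF Suc.prems(2)] Ck_SucD[OF Suc.prems(3)]
  show ?case
  proof (rule Ck_SucI[OF Suc.prems(1)])
    show "continuous_on U (\<lambda>x. f x + g x)" using D by (intro continuous_intros)
    show "\<exists>h. Ck_on k m U h \<and> (\<forall>x\<in>U. hasp i (\<lambda>x. f x + g x) x (h x))" if "i < m" for i
      using that D Suc.IH[OF Suc.prems(1), of "partial i f" "partial i g"]
      by (intro exI[of _ "\<lambda>x. partial i f x + partial i g x"])
         (auto simp: hasp_def intro!: DERIV_add)
  qed
qed (auto intro: continuous_intros)

lemma hasp_mult:
  "hasp i f x D \<Longrightarrow> hasp i g x E \<Longrightarrow> hasp i (\<lambda>x. f x * g x) x (D * g x + E * f x)"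
  unfolding hasp_def by (drule (1) DERIV_mult) simp

lemma Ck_mult:
  "eopen m U \<Longrightarrow> Ck_on k m U f \<Longrightarrow> Ck_on k m U g \<Longrightarrow> Ck_on k m U (\<lambda>x. f x * g x)"
proof (induction k arbitrary: f g)
  case (Suc k)
  note D = Ck_SucD[OF Suc.prems(2)] Ck_SucD[OF Suc.prems(3)]
  note E = Suc.prems(2,3)[THEN Ck_SucD']
  show ?case
  proof (rule Ck_SucI[OF Suc.prems(1)])
    show "continuous_on U (\<lambda>x. f x * g x)" using D by (intro continuous_intros)
    show "\<exists>h. Ck_on k m U h \<and> (\<forall>x\<in>U. hasp i (\<lambda>x. f x * g x) x (h x))" if "i < m" for i
      using that D E Suc.prems(1)
      by (intro exI[of _ "\<lambda>x. partial i f x * g x + partial i g x * f x"] conjI ballI hasp_mult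
          Ck_add Suc.IH) auto
  qed
qed (auto intro: continuous_intros)

lemma Ck_sum:
  "eopen m U \<Longrightarrow> (\<And>j. j \<in> A \<Longrightarrow> Ck_on k m U (f j)) \<Longrightarrow> Ck_on k m U (\<lambda>x. \<Sum>j\<in>A. f j x)"
  by (induction A rule: infinite_finite_induct) (auto intro: Ck_const Ck_add)

lemma Ck_inverse:
  "eopen m U \<Longrightarrow> Ck_on k m U f \<Longrightarrow> (\<And>x. x \<in> U \<Longrightarrow> f x \<noteq> 0) \<Longrightarrow> Ck_on k m U (\<lambda>x. inverse (f x))"
proof (induction k arbitrary: f)
  case (Suc k)
  note D = Ck_SucD[OF Suc.prems(2)]
  note E = Suc.prems(2)[THEN Ck_SucD']
  show ?case
  proof (rule Ck_SucI[OF Suc.prems(1)])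
    show "continuous_on U (\<lambda>x. inverse (f x))" using D Suc.prems(3) by (intro continuous_intros) auto
    show "\<exists>h. Ck_on k m U h \<and> (\<forall>x\<in>U. hasp i (\<lambda>x. inverse (f x)) x (h x))" if i: "i < m" for i
    proof (intro exI[of _ "\<lambda>x. -1 * (inverse (f x) * partial i f x * inverse (f x))"] conjI ballI)
      show "Ck_on k m U (\<lambda>x. -1 * (inverse (f x) * partial i f x * inverse (f x)))"
        using Suc.prems E D(3)[OF i] by (intro Ck_mult Ck_const Suc.IH) auto
      show "hasp i (\<lambda>x. inverse (f x)) x (-1 * (inverse (f x) * partial i f x * inverse (f x)))"
        if x: "x \<in> U" for x
        using DERIV_inverse'[OF D(2)[OF x i, unfolded hasp_def]] Suc.prems(3)[OF x]
        by (simp add: hasp_def)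
    qed
  qed
qed (auto intro: continuous_intros)

lemma Ck_local:
  assumes "eopen m U" "\<And>x. x \<in> U \<Longrightarrow> \<exists>V. x \<in> V \<and> eopen m V \<and> Ck_on k m V f"
  shows "Ck_on k m U f"
  using assms(2)
proof (induction k arbitrary: f)
  case 0
  have "\<exists>V. x \<in> V \<and> V \<subseteq> U \<and> eopen m V \<and> continuous_on V f" if x: "x \<in> U" for x
    using 0[OF x] x assms(1) continuous_on_subset[of _ f] eopen_Int[OF assms(1)]
    by (metis Ck_on.simps(1) IntI Int_lower1 Int_lower2)
  then show ?case by (simp add: continuous_on_locally[OF _ assms(1)])
next
  case (Suc k)
  show ?case
  proof (rule Ck_SucI[OF assms(1)])
    have "\<exists>V. x \<in> V \<and> V \<subseteq> U \<and> eopen m V \<and> continuous_on V f" if x: "x \<in> U" for x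
      using Suc.prems[OF x] x assms(1) continuous_on_subset[of _ f] eopen_Int[OF assms(1)]
      by (metis Ck_continuous IntI Int_lower1 Int_lower2)
    then show "continuous_on U f" by (simp add: continuous_on_locally[OF _ assms(1)])
    show "\<exists>g. Ck_on k m U g \<and> (\<forall>x\<in>U. hasp i f x (g x))" if i: "i < m" for i
    proof (intro exI[of _ "partial i f"] conjI ballI)
      show "Ck_on k m U (partial i f)"
      proof (rule Suc.IH)
        fix x assume "x \<in> U"
        from Suc.prems[OF this] obtain V where "x \<in> V" "eopen m V" "Ck_on (Suc k) m V f"
          by blast
        then show "\<exists>V. x \<in> V \<and> eopen m V \<and> Ck_on k m V (partial i f)"
          using Ck_SucD(3)[OF _ i] by blast
      qed
      show "hasp i f x (partial i f x)" if x: "x \<in> U" for x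
      proof -
        from Suc.prems[OF x] obtain V where V: "x \<in> V" "Ck_on (Suc k) m V f" by blast
        show ?thesis by (rule Ck_SucD(2)[OF V(2,1) i])
      qed
    qed
  qed
qed

section \<open>The chain rule\<close>

lemma mvt_sym:
  fixes g :: "real \<Rightarrow> real"
  assumes "\<And>s. \<bar>s - a\<bar> \<le> \<bar>b - a\<bar> \<Longrightarrow> (g has_real_derivative g' s) (at s)"
  shows "\<exists>\<xi>. \<bar>\<xi> - a\<bar> \<le> \<bar>b - a\<bar> \<and> g b - g a = g' \<xi> * (b - a)"
proof (cases a b rule: linorder_cases)
  case less
  have "\<exists>z. a < z \<and> z < b \<and> g b - g a = (b - a) * g' z"
    by (rule MVT2[OF less]) (use assms less in auto)
  then obtain z where "a < z" "z < b" "g b - g a = (b - a) * g' z" by blast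
  then show ?thesis using less by (intro exI[of _ z]) auto
next
  case equal
  then show ?thesis by auto
next
  case greater
  have "\<exists>z. b < z \<and> z < a \<and> g a - g b = (a - b) * g' z"
    by (rule MVT2[OF greater]) (use assms greater in auto)
  then obtain z where "b < z" "z < a" "g a - g b = (a - b) * g' z" by blast
  then show ?thesis using greater by (intro exI[of _ z]) (auto simp: algebra_simps)
qed

text \<open>Only one-variable derivatives are used: the increment of \<open>f\<close> along
  \<open>c\<close> is telescoped. \<open>hyb k t\<close> has its first \<open>k\<close> coordinates
  from \<open>c t\<close> and the others from \<open>c t0\<close>, so each step changes one
  coordinate, where the mean value theorem and the continuity of the partial derivative
  apply.\<close>

lemma chain_curve:
  assumes V: "eopen n V" and f: "Ck_on (Suc 0) n V f"
    and c0: "c t0 \<in> V" and ev: "\<forall>\<^sub>F t in nhds t0. c t \<in> V"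
    and dc: "\<And>j. j < n \<Longrightarrow> ((\<lambda>t. c t j) has_real_derivative c' j) (at t0)"
  shows "((\<lambda>t. f (c t)) has_real_derivative (\<Sum>j<n. partial j f (c t0) * c' j)) (at t0)"
proof -
  define x where "x = c t0"
  define hyb where "hyb k t = (\<lambda>i. if i < k then c t i else x i)" for k t
  obtain \<epsilon> where \<epsilon>: "\<epsilon> > 0" "cube n x \<epsilon> \<subseteq> V"
    using eopen_contains_cube V c0 x_def by metis
  have VR: "V \<subseteq> Rn n" using eopen_subset V .
  have xR: "x \<in> Rn n" using VR c0 x_def by blast
  have lim: "((\<lambda>t. c t j) \<longlongrightarrow> x j) (at t0)" if "j < n" for j
    using DERIV_isCont[OF dc[OF that]] by (simp add: isCont_def x_def)
  have near: "\<forall>\<^sub>F t in at t0. c t \<in> Rn n \<and> (\<forall>j\<in>{..<n}. \<bar>c t j - x j\<bar> < \<epsilon>)"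
  proof (rule eventually_conj)
    show "\<forall>\<^sub>F t in at t0. c t \<in> Rn n"
      using ev VR unfolding eventually_at_filter by (auto elim: eventually_mono)
    show "\<forall>\<^sub>F t in at t0. \<forall>j\<in>{..<n}. \<bar>c t j - x j\<bar> < \<epsilon>"
      unfolding eventually_ball_finite_distrib[OF finite_lessThan]
      using lim \<epsilon>(1) by (auto simp: tendsto_iff dist_real_def)
  qed
  have term_deriv: "((\<lambda>t. f (hyb (Suc j) t) - f (hyb j t)) has_real_derivative partial j f x * c' j) (at t0)"
    if j: "j < n" for j
  proof -
    define P where "P t \<xi> \<longleftrightarrow> \<bar>\<xi> - x j\<bar> \<le> \<bar>c t j - x j\<bar> \<and>
      f (hyb (Suc j) t) - f (hyb j t) = partial j f ((hyb j t)(j := \<xi>)) * (c t j - x j)" for t \<xi>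
    have in_cube: "(hyb j t)(j := s) \<in> cube n x \<epsilon>"
      if "c t \<in> Rn n" "\<forall>j\<in>{..<n}. \<bar>c t j - x j\<bar> < \<epsilon>" "\<bar>s - x j\<bar> \<le> \<bar>c t j - x j\<bar>" for t s
      using that xR \<epsilon>(1) j le_less_trans[OF that(3), of \<epsilon>] by (auto simp: cube_def hyb_def Rn_iff)
    have ex: "\<exists>\<xi>. P t \<xi>" if t: "c t \<in> Rn n" "\<forall>j\<in>{..<n}. \<bar>c t j - x j\<bar> < \<epsilon>" for t
    proof -
      have "((\<lambda>s. f ((hyb j t)(j := s))) has_real_derivative partial j f ((hyb j t)(j := s))) (at s)"
        if "\<bar>s - x j\<bar> \<le> \<bar>c t j - x j\<bar>" for s
        using Ck_SucD(2)[OF f, of "(hyb j t)(j := s)" j] in_cube[OF t that] \<epsilon>(2) j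
        by (auto simp: hasp_def)
      from mvt_sym[of "x j" "c t j" "\<lambda>s. f ((hyb j t)(j := s))", OF this]
      obtain \<xi> where "\<bar>\<xi> - x j\<bar> \<le> \<bar>c t j - x j\<bar>"
        "f ((hyb j t)(j := c t j)) - f ((hyb j t)(j := x j)) = partial j f ((hyb j t)(j := \<xi>)) * (c t j - x j)"
        by blast
      moreover have "(hyb j t)(j := c t j) = hyb (Suc j) t" "(hyb j t)(j := x j) = hyb j t"
        by (auto simp: hyb_def fun_eq_iff)
      ultimately show ?thesis by (auto simp: P_def)
    qed
    define \<xi> where "\<xi> t = (SOME s. P t s)" for t
    have P: "\<forall>\<^sub>F t in at t0. P t (\<xi> t)"
      unfolding \<xi>_def using near by eventually_elim (rule someI_ex, rule ex, auto)
    define y where "y t = (hyb j t)(j := \<xi> t)" for t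
    have yV: "\<forall>\<^sub>F t in at t0. y t \<in> V"
      using near P by eventually_elim (use in_cube \<epsilon>(2) in \<open>auto simp: y_def P_def\<close>)
    have lim0: "((\<lambda>t. c t i - x i) \<longlongrightarrow> 0) (at t0)" if "i < n" for i
      using tendsto_diff[OF lim[OF that] tendsto_const[of "x i"]] by simp
    have "((\<lambda>t. \<xi> t - x j) \<longlongrightarrow> 0) (at t0)"
      by (rule Lim_null_comparison[OF _ tendsto_rabs_zero[OF lim0[OF j]]])
         (use P in eventually_elim, auto simp: P_def)
    then have l\<xi>: "(\<xi> \<longlongrightarrow> x j) (at t0)" by (simp add: LIM_zero_iff)
    \<comment> \<open>The intermediate point differs from \<open>x\<close> by no more than
      \<open>c t\<close> does in each coordinate.\<close>
    have "(y \<longlongrightarrow> x) (at t0)"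
    proof (rule tendsto_vecI[OF xR])
      show "\<forall>\<^sub>F t in at t0. y t \<in> Rn n" using yV VR by (auto elim: eventually_mono)
      show "((\<lambda>t. y t i) \<longlongrightarrow> x i) (at t0)" if "i < n" for i
        using l\<xi> lim[OF that] by (cases "i = j"; cases "i < j") (auto simp: y_def hyb_def)
    qed
    then have q: "((\<lambda>t. partial j f (y t)) \<longlongrightarrow> partial j f x) (at t0)"
      using Ck_continuous[OF Ck_SucD(3)[OF f j]] yV c0 x_def
      by (intro continuous_on_tendsto_compose[of V "partial j f"]) auto
    have "((\<lambda>t. partial j f (y t) * ((c t j - c t0 j) / (t - t0))) \<longlongrightarrow> partial j f x * c' j) (at t0)"
      using q dc[OF j] by (intro tendsto_mult) (auto simp: has_field_derivative_iff)
    then show ?thesis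
      unfolding has_field_derivative_iff
    proof (rule Lim_transform_eventually)
      have 0: "f (hyb (Suc j) t0) - f (hyb j t0) = 0"
        by (rule eq_iff_diff_eq_0[THEN iffD1], rule arg_cong[of _ _ f])
           (auto simp: hyb_def x_def fun_eq_iff)
      show "\<forall>\<^sub>F t in at t0. partial j f (y t) * ((c t j - c t0 j) / (t - t0)) =
         (f (hyb (Suc j) t) - f (hyb j t) - (f (hyb (Suc j) t0) - f (hyb j t0))) / (t - t0)"
        using P by eventually_elim (simp only: 0, auto simp: P_def y_def x_def)
    qed
  qed
  have "((\<lambda>t. \<Sum>j<n. f (hyb (Suc j) t) - f (hyb j t)) has_real_derivative (\<Sum>j<n. partial j f x * c' j)) (at t0)"
    by (rule DERIV_sum) (use term_deriv in auto)
  then have "((\<lambda>t. f (hyb n t) - f (hyb 0 t)) has_real_derivative (\<Sum>j<n. partial j f x * c' j)) (at t0)"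
    by (simp add: sum_lessThan_telescope[of "\<lambda>k. f (hyb k _)"])
  then have "((\<lambda>t. (f (hyb n t) - f (hyb 0 t)) + f x) has_real_derivative (\<Sum>j<n. partial j f x * c' j)) (at t0)"
    using DERIV_add[OF _ DERIV_const] by fastforce
  moreover have "f (hyb n t) - f (hyb 0 t) + f x = f (c t)" if "c t \<in> V" for t
  proof -
    have "hyb n t = c t" "hyb 0 t = x"
      using that VR xR by (auto simp: hyb_def fun_eq_iff Rn_iff subset_iff)
    then show ?thesis by simp
  qed
  ultimately show ?thesis
    using DERIV_cong_ev[OF refl eventually_mono[OF ev], of "\<lambda>t. (f (hyb n t) - f (hyb 0 t)) + f x" "\<lambda>t. f (c t)"]
    by (simp add: x_def)
qed

lemma hasp_compose:
  assumes U: "eopen m U" and V: "eopen n V" and x: "x \<in> U" and i: "i < m"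
    and \<Phi>: "\<Phi> ` U \<subseteq> V" "\<And>j. j < n \<Longrightarrow> hasp i (\<lambda>y. \<Phi> y j) x (D j)" and f: "Ck_on (Suc 0) n V f"
  shows "hasp i (\<lambda>y. f (\<Phi> y)) x (\<Sum>j<n. partial j f (\<Phi> x) * D j)"
proof -
  have "((\<lambda>t. f (\<Phi> (x(i := t)))) has_real_derivative (\<Sum>j<n. partial j f (\<Phi> (x(i := x i))) * D j)) (at (x i))"
    using upd_eventually[OF U x i] \<Phi> x
    by (intro chain_curve[OF V f]) (auto simp: hasp_def elim!: eventually_mono)
  then show ?thesis by (simp add: hasp_def)
qed

lemma continuous_on_vec_compose:
  assumes V: "eopen n V" and \<Phi>: "\<Phi> ` U \<subseteq> V"
    and c: "\<And>j. j < n \<Longrightarrow> continuous_on U (\<lambda>x. \<Phi> x j)" "continuous_on V f"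
  shows "continuous_on U (\<lambda>x. f (\<Phi> x))"
proof (rule continuous_on_compose2[OF c(2) _ \<Phi>], rule continuous_on_coordinatewise_then_product)
  fix j show "continuous_on U (\<lambda>x. \<Phi> x j)"
  proof (cases "j < n")
    case False
    then have "\<Phi> x j = 0" if "x \<in> U" for x
      using that \<Phi> eopen_subset[OF V] by (auto simp: Rn_iff subset_iff)
    then show ?thesis by (simp cong: continuous_on_cong)
  qed (rule c)
qed

lemma Ck_compose:
  assumes U: "eopen m U" and V: "eopen n V" and \<Phi>: "\<Phi> ` U \<subseteq> V"
  shows "(\<And>j. j < n \<Longrightarrow> Ck_on k m U (\<lambda>x. \<Phi> x j)) \<Longrightarrow> Ck_on k n V f \<Longrightarrow> Ck_on k m U (\<lambda>x. f (\<Phi> x))"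
proof (induction k arbitrary: f)
  case 0
  then show ?case using continuous_on_vec_compose[OF V \<Phi>] by simp
next
  case (Suc k)
  show ?case
  proof (rule Ck_SucI[OF U])
    show "continuous_on U (\<lambda>x. f (\<Phi> x))" using Suc.prems[THEN Ck_continuous] by (rule continuous_on_vec_compose[OF V \<Phi>])
    show "\<exists>g. Ck_on k m U g \<and> (\<forall>x\<in>U. hasp i (\<lambda>x. f (\<Phi> x)) x (g x))" if i: "i < m" for i
    proof (intro exI[of _ "\<lambda>x. \<Sum>j<n. partial j f (\<Phi> x) * partial i (\<lambda>y. \<Phi> y j) x"] conjI ballI)
      show "Ck_on k m U (\<lambda>x. \<Sum>j<n. partial j f (\<Phi> x) * partial i (\<lambda>y. \<Phi> y j) x)"
      proof (rule Ck_sum[OF U], rule Ck_mult[OF U])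
        fix j assume "j \<in> {..<n}"
        then have j: "j < n" by simp
        show "Ck_on k m U (\<lambda>x. partial j f (\<Phi> x))"
          by (rule Suc.IH) (use Ck_SucD'[OF Suc.prems(1)] Ck_SucD(3)[OF Suc.prems(2) j] in auto)
        show "Ck_on k m U (\<lambda>x. partial i (\<lambda>y. \<Phi> y j) x)"
          using Ck_SucD(3)[OF Suc.prems(1)[OF j] i] by simp
      qed
      show "hasp i (\<lambda>x. f (\<Phi> x)) x (\<Sum>j<n. partial j f (\<Phi> x) * partial i (\<lambda>y. \<Phi> y j) x)" if x: "x \<in> U" for x
        using Ck_SucD(2)[OF Suc.prems(1) x i] Ck_mono[OF Suc.prems(2), of "Suc 0"]
        by (intro hasp_compose[OF U V x i \<Phi>]) auto
    qed
  qed
qed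

text \<open>Schwarz's argument: the second difference over the square of side \<open>h\<close> is
  symmetric in \<open>i\<close> and \<open>j\<close>. The mean value theorem in direction
  \<open>i\<close> and then in direction \<open>j\<close> turns it into \<open>h * h\<close> times a
  mixed derivative at some point of the cube.\<close>

lemma mvt_2d:
  assumes cube: "cube m x \<epsilon> \<subseteq> U" and f: "Ck_on (Suc (Suc 0)) m U f" and x: "x \<in> Rn m"
    and ij: "i < m" "j < m" "i \<noteq> j" and h: "0 < h" "h < \<epsilon>"
  shows "\<exists>p\<in>cube m x \<epsilon>. f (x(i := x i + h, j := x j + h)) - f (x(i := x i + h)) - f (x(j := x j + h)) + f x
     = h * (h * partial j (partial i f) p)"
proof -
  have inb: "x(i := s, j := t) \<in> cube m x \<epsilon>"
    if "x i \<le> s" "s \<le> x i + h" "x j \<le> t" "t \<le> x j + h" for s t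
    using that x ij h by (auto simp: cube_def Rn_iff)
  define G where "G s = f (x(i := s, j := x j + h)) - f (x(i := s, j := x j))" for s
  have "(G has_real_derivative (partial i f (x(i := s, j := x j + h)) - partial i f (x(i := s, j := x j)))) (at s)"
    if "x i \<le> s" "s \<le> x i + h" for s
  proof -
    have "((\<lambda>s. f (x(i := s, j := t))) has_real_derivative partial i f (x(i := s, j := t))) (at s)"
      if "x j \<le> t" "t \<le> x j + h" for t
    proof -
      have "x(i := s, j := t) \<in> U" using inb that \<open>x i \<le> s\<close> \<open>s \<le> x i + h\<close> cube by blast
      from Ck_SucD(2)[OF f this ij(1)] show ?thesis
        using ij(3) by (simp add: hasp_def fun_upd_twist)
    qed
    then show ?thesis unfolding G_def using h by (intro DERIV_diff) auto
  qed
  then obtain s where s: "x i < s" "s < x i + h"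
    "G (x i + h) - G (x i) = (x i + h - x i) * (partial i f (x(i := s, j := x j + h)) - partial i f (x(i := s, j := x j)))"
    using MVT2[of "x i" "x i + h" G "\<lambda>s. partial i f (x(i := s, j := x j + h)) - partial i f (x(i := s, j := x j))"] h
    by auto
  have "((\<lambda>t. partial i f (x(i := s, j := t))) has_real_derivative partial j (partial i f) (x(i := s, j := t))) (at t)"
    if "x j \<le> t" "t \<le> x j + h" for t
  proof -
    have "x(i := s, j := t) \<in> U" using inb that s cube by (meson less_imp_le subsetD)
    from Ck_SucD(2)[OF Ck_SucD(3)[OF f ij(1)] this ij(2)] show ?thesis
      by (simp add: hasp_def)
  qed
  then obtain t where t: "x j < t" "t < x j + h"
    "partial i f (x(i := s, j := x j + h)) - partial i f (x(i := s, j := x j))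
      = (x j + h - x j) * partial j (partial i f) (x(i := s, j := t))"
    using MVT2[of "x j" "x j + h" "\<lambda>t. partial i f (x(i := s, j := t))" "\<lambda>t. partial j (partial i f) (x(i := s, j := t))"] h
    by auto
  show ?thesis
    using inb[of s t] s t ij(3) unfolding G_def
    by (intro bexI[of _ "x(i := s, j := t)"]) (auto simp: fun_upd_twist fun_upd_triv fun_upd_idem)
qed

lemma continuous_near_cube:
  fixes g :: "vec \<Rightarrow> real"
  assumes "continuous_on U g" and U: "eopen m U" and x: "x \<in> U" and "\<eta> > 0"
  shows "\<exists>\<epsilon>>0. cube m x \<epsilon> \<subseteq> U \<and> (\<forall>p\<in>cube m x \<epsilon>. \<bar>g p - g x\<bar> < \<eta>)"
proof -
  obtain T where T: "open T" "T \<inter> U = g -` ball (g x) \<eta> \<inter> U"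
    using assms(1) open_ball[of "g x" \<eta>] unfolding continuous_on_open_invariant by blast
  obtain T' where T': "open T'" "U = T' \<inter> Rn m" using U eopen_eq by blast
  have "x \<in> T" using x assms(4) T(2) by auto
  then obtain \<epsilon> where e: "\<epsilon> > 0" "cube m x \<epsilon> \<subseteq> T \<inter> T'"
    using open_contains_cube[of "T \<inter> T'" x m] T T' x by auto
  have sub: "cube m x \<epsilon> \<subseteq> U" using e T' by (auto simp: cube_def)
  have "\<bar>g p - g x\<bar> < \<eta>" if "p \<in> cube m x \<epsilon>" for p
  proof -
    have "p \<in> g -` ball (g x) \<eta> \<inter> U" using that sub e T(2) by blast
    then show ?thesis by (simp add: dist_real_def abs_minus_commute)
  qed
  then show ?thesis using e(1) sub by blast
qed

lemma partial_commute:
  assumes U: "eopen m U" and f: "Ck_on (Suc (Suc 0)) m U f" and x: "x \<in> U" and ij: "i < m" "j < m"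
  shows "partial i (partial j f) x = partial j (partial i f) x"
proof (cases "i = j")
  case False
  have xR: "x \<in> Rn m" using x eopen_subset[OF U] by blast
  have c1: "continuous_on U (partial j (partial i f))" and c2: "continuous_on U (partial i (partial j f))"
    using Ck_continuous[OF Ck_SucD(3)[OF Ck_SucD(3)[OF f]]] ij by blast+
  show ?thesis
  proof (rule ccontr)
    assume ne: "\<not> ?thesis"
    \<comment> \<open>Half the gap, so that values within \<eta> of the two mixed derivatives cannot
      coincide.\<close>
    define \<eta> where "\<eta> = \<bar>partial i (partial j f) x - partial j (partial i f) x\<bar> / 2"
    have "\<eta> > 0" using ne by (simp add: \<eta>_def)
    from continuous_near_cube[OF c1 U x this] continuous_near_cube[OF c2 U x this] obtain \<epsilon>1 \<epsilon>2 where
      e1: "\<epsilon>1 > 0" "cube m x \<epsilon>1 \<subseteq> U" "\<forall>p\<in>cube m x \<epsilon>1. \<bar>partial j (partial i f) p - partial j (partial i f) x\<bar> < \<eta>"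
      and e2: "\<epsilon>2 > 0" "cube m x \<epsilon>2 \<subseteq> U" "\<forall>p\<in>cube m x \<epsilon>2. \<bar>partial i (partial j f) p - partial i (partial j f) x\<bar> < \<eta>"
      by blast
    define h where "h = min \<epsilon>1 \<epsilon>2 / 2"
    have h: "0 < h" "h < \<epsilon>1" "h < \<epsilon>2" using e1 e2 by (auto simp: h_def)
    obtain p where p: "p \<in> cube m x \<epsilon>1" "f (x(i := x i + h, j := x j + h)) - f (x(i := x i + h)) - f (x(j := x j + h)) + f x
     = h * (h * partial j (partial i f) p)"
      using mvt_2d[OF e1(2) f xR ij False h(1,2)] by blast
    obtain q where q: "q \<in> cube m x \<epsilon>2" "f (x(j := x j + h, i := x i + h)) - f (x(j := x j + h)) - f (x(i := x i + h)) + f x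
     = h * (h * partial i (partial j f) q)"
      using mvt_2d[OF e2(2) f xR ij(2,1) _ h(1,3)] False by blast
    have "h * (h * partial j (partial i f) p) = h * (h * partial i (partial j f) q)"
      using p(2) q(2) fun_upd_twist[OF False, of x] by (simp add: algebra_simps)
    then have "partial j (partial i f) p = partial i (partial j f) q" using h by auto
    moreover have "\<bar>partial j (partial i f) p - partial j (partial i f) x\<bar> < \<eta>" using e1(3) p(1) by blast
    moreover have "\<bar>partial i (partial j f) q - partial i (partial j f) x\<bar> < \<eta>" using e2(3) q(1) by blast
    ultimately show False unfolding \<eta>_def by (smt (verit) field_sum_of_halves)
  qed
qed simp

declare Ck_on.simps(2) [simp del]

section \<open>C^infinity functions and maps\<close>

lemma smooth_cong:
  "eopen m U \<Longrightarrow> (\<And>x. x \<in> U \<Longrightarrow> f x = g x) \<Longrightarrow> smooth_fun_on m U f = smooth_fun_on m U g"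
  unfolding smooth_fun_on_def using Ck_cong by blast

lemma smooth_local:
  "eopen m U \<Longrightarrow> (\<And>x. x \<in> U \<Longrightarrow> \<exists>V. x \<in> V \<and> eopen m V \<and> smooth_fun_on m V f) \<Longrightarrow> smooth_fun_on m U f"
  unfolding smooth_fun_on_def
proof
  fix k assume U: "eopen m U" and ex: "\<And>x. x \<in> U \<Longrightarrow> \<exists>V. x \<in> V \<and> eopen m V \<and> (\<forall>k. Ck_on k m V f)"
  show "Ck_on k m U f" by (rule Ck_local[OF U]) (use ex in meson)
qed

lemma smooth_subset: "smooth_fun_on m U f \<Longrightarrow> W \<subseteq> U \<Longrightarrow> smooth_fun_on m W f"
  unfolding smooth_fun_on_def using Ck_on_subset by blast

lemma smooth_const: "eopen m U \<Longrightarrow> smooth_fun_on m U (\<lambda>x. c)"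
  unfolding smooth_fun_on_def by (intro allI Ck_const) auto

lemma smooth_coord: "eopen m U \<Longrightarrow> smooth_fun_on m U (\<lambda>x. x j)"
  unfolding smooth_fun_on_def by (intro allI Ck_coord) auto

lemma smooth_add:
  "eopen m U \<Longrightarrow> smooth_fun_on m U f \<Longrightarrow> smooth_fun_on m U g \<Longrightarrow> smooth_fun_on m U (\<lambda>x. f x + g x)"
  unfolding smooth_fun_on_def by (intro allI Ck_add) auto

lemma smooth_mult:
  "eopen m U \<Longrightarrow> smooth_fun_on m U f \<Longrightarrow> smooth_fun_on m U g \<Longrightarrow> smooth_fun_on m U (\<lambda>x. f x * g x)"
  unfolding smooth_fun_on_def by (intro allI Ck_mult) auto

lemma smooth_cmult:
  "eopen m U \<Longrightarrow> smooth_fun_on m U f \<Longrightarrow> smooth_fun_on m U (\<lambda>x. c * f x)"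
  by (intro smooth_mult smooth_const)

lemma smooth_diff:
  assumes "eopen m U" "smooth_fun_on m U f" "smooth_fun_on m U g"
  shows "smooth_fun_on m U (\<lambda>x. f x - g x)"
  using smooth_add[OF assms(1,2) smooth_cmult[OF assms(1,3), of "-1"]] by simp

lemma smooth_sum:
  "eopen m U \<Longrightarrow> (\<And>j. j \<in> A \<Longrightarrow> smooth_fun_on m U (f j)) \<Longrightarrow> smooth_fun_on m U (\<lambda>x. \<Sum>j\<in>A. f j x)"
  unfolding smooth_fun_on_def by (intro allI Ck_sum) auto

lemma smooth_prod:
  "eopen m U \<Longrightarrow> (\<And>j. j \<in> A \<Longrightarrow> smooth_fun_on m U (f j)) \<Longrightarrow> smooth_fun_on m U (\<lambda>x. \<Prod>j\<in>A. f j x)"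
  by (induction A rule: infinite_finite_induct) (auto intro: smooth_const smooth_mult)

lemma smooth_inverse:
  "eopen m U \<Longrightarrow> smooth_fun_on m U f \<Longrightarrow> (\<And>x. x \<in> U \<Longrightarrow> f x \<noteq> 0) \<Longrightarrow> smooth_fun_on m U (\<lambda>x. inverse (f x))"
  unfolding smooth_fun_on_def by (intro allI Ck_inverse) auto

lemma smooth_divide:
  "eopen m U \<Longrightarrow> smooth_fun_on m U f \<Longrightarrow> smooth_fun_on m U g \<Longrightarrow> (\<And>x. x \<in> U \<Longrightarrow> g x \<noteq> 0) \<Longrightarrow>
    smooth_fun_on m U (\<lambda>x. f x / g x)"
  unfolding divide_inverse by (intro smooth_mult smooth_inverse)

lemma smooth_Ck: "smooth_fun_on m U f \<Longrightarrow> Ck_on k m U f"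
  by (simp add: smooth_fun_on_def)

lemma smooth_continuous: "smooth_fun_on m U f \<Longrightarrow> continuous_on U f"
  using smooth_Ck[of m U f 0] by simp

lemma smooth_partial: "smooth_fun_on m U f \<Longrightarrow> i < m \<Longrightarrow> smooth_fun_on m U (partial i f)"
  unfolding smooth_fun_on_def using Ck_SucD(3) by blast

lemma smooth_hasp: "smooth_fun_on m U f \<Longrightarrow> x \<in> U \<Longrightarrow> i < m \<Longrightarrow> hasp i f x (partial i f x)"
  unfolding smooth_fun_on_def using Ck_SucD(2) by blast

text \<open>A coinductive principle for families closed under partial derivatives. It applies when
  the derivatives are known only as members of the same family, as for \<open>hexp\<close> and for
  smooth functions along an integral curve.\<close>

lemma smooth_funI:
  assumes "eopen m U" "f \<in> S"
    and "\<And>f. f \<in> S \<Longrightarrow> continuous_on U f"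
    and "\<And>f i. f \<in> S \<Longrightarrow> i < m \<Longrightarrow> \<exists>g\<in>S. \<forall>x\<in>U. hasp i f x (g x)"
  shows "smooth_fun_on m U f"
proof -
  have "Ck_on k m U f" if "f \<in> S" for k f
    using that
  proof (induction k arbitrary: f)
    case (Suc k)
    show ?case
      by (rule Ck_SucI[OF assms(1) assms(3)[OF Suc.prems]])
        (use assms(4)[OF Suc.prems] Suc.IH in blast)
  qed (simp add: assms(3))
  then show ?thesis using assms(2) by (simp add: smooth_fun_on_def)
qed

lemma smooth_vecD:
  assumes "smooth_vec_on m U n \<Phi>"
  shows "\<Phi> ` U \<subseteq> Rn n" "\<And>j. j < n \<Longrightarrow> smooth_fun_on m U (\<lambda>x. \<Phi> x j)"
  using assms by (auto simp: smooth_vec_on_def)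

lemma smooth_vecI:
  "\<Phi> ` U \<subseteq> Rn n \<Longrightarrow> (\<And>j. j < n \<Longrightarrow> smooth_fun_on m U (\<lambda>x. \<Phi> x j)) \<Longrightarrow> smooth_vec_on m U n \<Phi>"
  by (auto simp: smooth_vec_on_def)

lemma smooth_compose:
  assumes "eopen m U" "eopen n V" "smooth_vec_on m U n \<Phi>" "\<Phi> ` U \<subseteq> V" "smooth_fun_on n V f"
  shows "smooth_fun_on m U (\<lambda>x. f (\<Phi> x))"
  unfolding smooth_fun_on_def
proof
  fix k show "Ck_on k m U (\<lambda>x. f (\<Phi> x))"
    by (rule Ck_compose[OF assms(1,2,4)])
      (use assms(3,5) in \<open>auto simp: smooth_vec_on_def smooth_fun_on_def\<close>)
qed

lemma smooth_vec_compose: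
  assumes "eopen m U" "eopen n V" "smooth_vec_on m U n \<Phi>" "\<Phi> ` U \<subseteq> V" "smooth_vec_on n V l \<Psi>"
  shows "smooth_vec_on m U l (\<lambda>x. \<Psi> (\<Phi> x))"
proof (rule smooth_vecI)
  show "(\<lambda>x. \<Psi> (\<Phi> x)) ` U \<subseteq> Rn l" using smooth_vecD(1)[OF assms(5)] assms(4) by blast
  show "smooth_fun_on m U (\<lambda>x. \<Psi> (\<Phi> x) j)" if "j < l" for j
    by (rule smooth_compose[OF assms(1-4) smooth_vecD(2)[OF assms(5) that]])
qed

lemma smooth_vec_cong:
  "eopen m U \<Longrightarrow> (\<And>x. x \<in> U \<Longrightarrow> f x = g x) \<Longrightarrow> smooth_vec_on m U n f = smooth_vec_on m U n g"
  unfolding smooth_vec_on_def using smooth_cong[of m U "\<lambda>x. f x _" "\<lambda>x. g x _"]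
  by (metis (no_types, lifting) image_cong)

lemma smooth_vec_local:
  assumes "eopen m U" "\<And>x. x \<in> U \<Longrightarrow> \<exists>V. x \<in> V \<and> eopen m V \<and> smooth_vec_on m V n f"
  shows "smooth_vec_on m U n f"
proof (rule smooth_vecI)
  show "f ` U \<subseteq> Rn n" using assms(2) smooth_vecD(1) by blast
  show "smooth_fun_on m U (\<lambda>x. f x j)" if "j < n" for j
  proof (rule smooth_local[OF assms(1)])
    fix x assume "x \<in> U"
    from assms(2)[OF this] obtain V where "x \<in> V" "eopen m V" "smooth_vec_on m V n f" by blast
    then show "\<exists>V. x \<in> V \<and> eopen m V \<and> smooth_fun_on m V (\<lambda>x. f x j)"
      using smooth_vecD(2)[OF _ that] by blast
  qed
qed

lemma eopen_vimage:
  assumes "eopen m U" "eopen n V" "smooth_vec_on m U n \<Phi>"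
  shows "eopen m {x \<in> U. \<Phi> x \<in> V}"
proof -
  have "topspace (subtopology (Euclidean_space m) U) = U" using eopen_subset[OF assms(1)] by auto
  then have "openin (subtopology (Euclidean_space m) U) {x \<in> U. \<Phi> x \<in> V}"
    using openin_continuous_map_preimage[OF continuous_map_smooth_vec_on[OF assms(1,3)] assms(2)]
    by simp
  then show ?thesis using assms(1) openin_open_subtopology by blast
qed

subsection \<open>Directional derivatives\<close>

lemma dir_deriv_cong:
  assumes "eopen m U" "x \<in> U" "\<And>y. y \<in> U \<Longrightarrow> f y = g y"
  shows "dir_deriv m f x v = dir_deriv m g x v"
  unfolding dir_deriv_def by (rule sum.cong) (use partial_cong[OF assms(1,2) _ assms(3)] in auto)

lemma partial_add:
  assumes "smooth_fun_on m U f" "smooth_fun_on m U g" "x \<in> U" "i < m"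
  shows "partial i (\<lambda>y. f y + g y) x = partial i f x + partial i g x"
  by (rule hasp_partial) (use assms smooth_hasp in \<open>auto simp: hasp_def intro!: DERIV_add\<close>)

lemma partial_cmult:
  assumes "smooth_fun_on m U f" "x \<in> U" "i < m"
  shows "partial i (\<lambda>y. c * f y) x = c * partial i f x"
  by (rule hasp_partial) (use assms smooth_hasp in \<open>auto simp: hasp_def intro!: DERIV_cmult\<close>)

lemma dir_deriv_add:
  assumes "smooth_fun_on m U f" "smooth_fun_on m U g" "x \<in> U"
  shows "dir_deriv m (\<lambda>y. f y + g y) x v = dir_deriv m f x v + dir_deriv m g x v"
  unfolding dir_deriv_def using partial_add[OF assms]
  by (simp add: sum.distrib[symmetric] distrib_left)

lemma dir_deriv_cmult:
  assumes "smooth_fun_on m U f" "x \<in> U"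
  shows "dir_deriv m (\<lambda>y. c * f y) x v = c * dir_deriv m f x v"
  unfolding dir_deriv_def using partial_cmult[OF assms]
  by (simp add: sum_distrib_left mult.left_commute)

lemma dir_deriv_const: "dir_deriv m (\<lambda>y. c) x v = 0"
  by (simp add: dir_deriv_def partial_def)

lemma dir_deriv_mult:
  assumes "smooth_fun_on m U f" "smooth_fun_on m U g" "x \<in> U"
  shows "dir_deriv m (\<lambda>y. f y * g y) x v = dir_deriv m f x v * g x + f x * dir_deriv m g x v"
proof -
  have "partial i (\<lambda>y. f y * g y) x = partial i f x * g x + partial i g x * f x" if "i < m" for i
    by (rule hasp_partial, rule hasp_mult) (use assms smooth_hasp that in auto)
  then show ?thesis
    unfolding dir_deriv_def sum_distrib_left sum_distrib_right sum.distrib[symmetric]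
    by (intro sum.cong) (auto simp: algebra_simps)
qed

lemma dir_deriv_sum:
  assumes "eopen m U" "\<And>j. j \<in> A \<Longrightarrow> smooth_fun_on m U (f j)" "x \<in> U"
  shows "dir_deriv m (\<lambda>y. \<Sum>j\<in>A. f j y) x v = (\<Sum>j\<in>A. dir_deriv m (f j) x v)"
  using assms(2)
proof (induction A rule: infinite_finite_induct)
  case (insert a A)
  then show ?case
    using dir_deriv_add[OF insert.prems[of a] smooth_sum[OF assms(1), of A f] assms(3)] by simp
qed (auto simp: dir_deriv_const)

lemma smooth_dir_deriv:
  "eopen m U \<Longrightarrow> smooth_fun_on m U f \<Longrightarrow> smooth_fun_on m U (\<lambda>x. dir_deriv m f x v)"
  unfolding dir_deriv_def by (intro smooth_sum smooth_cmult smooth_partial) auto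

lemma dir_deriv_commute:
  assumes U: "eopen m U" and f: "smooth_fun_on m U f" and x: "x \<in> U"
  shows "dir_deriv m (\<lambda>y. dir_deriv m f y v) x w = dir_deriv m (\<lambda>y. dir_deriv m f y w) x v"
proof -
  have *: "dir_deriv m (\<lambda>y. dir_deriv m f y v) x w = (\<Sum>j<m. \<Sum>i<m. v j * (w i * partial i (partial j f) x))" for v w
  proof -
    have "dir_deriv m (\<lambda>y. dir_deriv m f y v) x w = (\<Sum>j<m. dir_deriv m (\<lambda>y. v j * partial j f y) x w)"
      unfolding dir_deriv_def[of m f]
      by (rule dir_deriv_sum[OF U _ x]) (auto intro!: smooth_cmult[OF U] smooth_partial[OF f])
    also have "\<dots> = (\<Sum>j<m. v j * dir_deriv m (partial j f) x w)"
      using dir_deriv_cmult[OF smooth_partial[OF f] x] by (intro sum.cong) auto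
    finally show ?thesis unfolding dir_deriv_def[of m "partial _ f"] by (simp add: sum_distrib_left)
  qed
  have "partial i (partial j f) x = partial j (partial i f) x" if "i < m" "j < m" for i j
    by (rule partial_commute[OF U _ x that]) (rule smooth_Ck[OF f])
  then show ?thesis unfolding * by (subst sum.swap) (auto intro!: sum.cong)
qed

lemma dir_deriv_lin:
  "dir_deriv m f x (\<lambda>i. a * v i + b * w i) = a * dir_deriv m f x v + b * dir_deriv m f x w"
  by (simp add: dir_deriv_def sum.distrib sum_distrib_left distrib_right mult.assoc)

lemma dir_deriv_compose:
  assumes U: "eopen m U" and V: "eopen n V" and \<Phi>: "smooth_vec_on m U n \<Phi>" "\<Phi> ` U \<subseteq> V"
    and f: "smooth_fun_on n V f" and x: "x \<in> U"
  shows "dir_deriv m (\<lambda>y. f (\<Phi> y)) x v = dir_deriv n f (\<Phi> x) (jacobian m n \<Phi> x v)"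
proof -
  have "partial i (\<lambda>y. f (\<Phi> y)) x = (\<Sum>j<n. partial j f (\<Phi> x) * partial i (\<lambda>y. \<Phi> y j) x)" if i: "i < m" for i
  proof (rule hasp_partial, rule hasp_compose[OF U V x i \<Phi>(2) _ smooth_Ck[OF f]])
    show "hasp i (\<lambda>y. \<Phi> y j) x (partial i (\<lambda>y. \<Phi> y j) x)" if "j < n" for j
      by (rule smooth_hasp[OF smooth_vecD(2)[OF \<Phi>(1) that] x i])
  qed
  then have "dir_deriv m (\<lambda>y. f (\<Phi> y)) x v = (\<Sum>i<m. \<Sum>j<n. v i * (partial j f (\<Phi> x) * partial i (\<lambda>y. \<Phi> y j) x))"
    unfolding dir_deriv_def by (simp add: sum_distrib_left)
  also have "\<dots> = (\<Sum>j<n. \<Sum>i<m. v i * (partial j f (\<Phi> x) * partial i (\<lambda>y. \<Phi> y j) x))"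
    by (rule sum.swap)
  also have "\<dots> = dir_deriv n f (\<Phi> x) (jacobian m n \<Phi> x v)"
    by (simp add: dir_deriv_def jacobian_def sum_distrib_left sum_distrib_right mult_ac)
  finally show ?thesis .
qed

lemma jacobian_Rn: "jacobian m n \<Phi> x v \<in> Rn n"
  by (auto simp: Rn_iff jacobian_def)

definition unitv :: "nat \<Rightarrow> vec" where "unitv i = (\<lambda>j. if j = i then 1 else 0)"

lemma unitv_Rn: "i < m \<Longrightarrow> unitv i \<in> Rn m"
  by (auto simp: unitv_def Rn_iff)

lemma dir_deriv_unitv: "i < m \<Longrightarrow> dir_deriv m f x (unitv i) = partial i f x"
  by (simp add: dir_deriv_def unitv_def if_distrib[of "\<lambda>a. a * _"] cong: if_cong)

lemma partial_coord: "partial i (\<lambda>y. y j) x = (if i = j then 1 else 0)"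
  by (auto simp: partial_def)

lemma dir_deriv_coord: "j < m \<Longrightarrow> dir_deriv m (\<lambda>y. y j) x v = v j"
  by (simp add: dir_deriv_def partial_coord if_distrib[of "\<lambda>a. _ * a"] cong: if_cong)

lemma curve_eventually:
  fixes t :: real
  assumes V: "eopen n V" and c: "c t \<in> V" "\<And>s. c s \<in> Rn n"
    and cont: "\<And>j. j < n \<Longrightarrow> isCont (\<lambda>s. c s j) t"
  shows "\<forall>\<^sub>F s in nhds t. c s \<in> V"
proof -
  obtain \<epsilon> where \<epsilon>: "\<epsilon> > 0" "cube n (c t) \<epsilon> \<subseteq> V" using eopen_contains_cube V c by blast
  have "\<forall>\<^sub>F s in nhds t. \<forall>j\<in>{..<n}. \<bar>c s j - c t j\<bar> < \<epsilon>"
    unfolding eventually_ball_finite_distrib[OF finite_lessThan]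
  proof
    fix j assume "j \<in> {..<n}"
    then have "((\<lambda>s. c s j) \<longlongrightarrow> c t j) (nhds t)"
      using cont by (intro tendsto_at_iff_tendsto_nhds[THEN iffD1] isContD) auto
    then show "\<forall>\<^sub>F s in nhds t. \<bar>c s j - c t j\<bar> < \<epsilon>"
      using \<epsilon>(1) by (auto simp: tendsto_iff dist_real_def)
  qed
  then show ?thesis
    by eventually_elim (use \<epsilon>(2) c(2) in \<open>auto simp: cube_def\<close>)
qed

subsection \<open>Hadamard's lemma\<close>

definition seg :: "vec \<Rightarrow> real \<Rightarrow> vec \<Rightarrow> vec" where
  "seg e t x = (\<lambda>i. e i + t * (x i - e i))"

lemma seg_Rn: "e \<in> Rn n \<Longrightarrow> x \<in> Rn n \<Longrightarrow> seg e t x \<in> Rn n"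
  by (auto simp: seg_def Rn_iff)

lemma seg_cube: "e \<in> Rn n \<Longrightarrow> x \<in> cube n e r \<Longrightarrow> 0 \<le> t \<Longrightarrow> t \<le> 1 \<Longrightarrow> seg e t x \<in> cube n e r"
  using seg_Rn[of e n x t] unfolding cube_def
proof safe
  fix i assume "e \<in> Rn n" "0 \<le> t" "t \<le> 1" "\<forall>i<n. \<bar>x i - e i\<bar> < r" "i < n"
  then have "\<bar>t * (x i - e i)\<bar> \<le> 1 * \<bar>x i - e i\<bar>" "\<bar>x i - e i\<bar> < r"
    by (auto simp: abs_mult intro: mult_left_le_one_le)
  then show "\<bar>seg e t x i - e i\<bar> < r" by (simp add: seg_def)
qed

lemma continuous_seg:
  fixes u :: "vec \<Rightarrow> real" and w :: "real \<Rightarrow> real"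
  assumes e: "e \<in> Rn n" and u: "continuous_on (cube n e r) u" and w: "continuous_on {0..1} w"
  shows "continuous_on (cube n e r \<times> cbox 0 1) (\<lambda>(x, t). w t * u (seg e t x))"
proof -
  let ?S = "cube n e r \<times> cbox (0::real) 1"
  have co: "continuous_on ?S (\<lambda>z. fst z j)" for j
    by (rule continuous_on_compose2[OF continuous_on_coord[of UNIV j]]) (auto intro: continuous_intros)
  have 1: "continuous_on ?S (\<lambda>z. u (seg e (snd z) (fst z)))"
  proof (rule continuous_on_vec_compose[OF eopen_cube _ _ u])
    show "(\<lambda>z. seg e (snd z) (fst z)) ` ?S \<subseteq> cube n e r" using seg_cube[OF e] by auto
    show "continuous_on ?S (\<lambda>z. seg e (snd z) (fst z) j)" for j
      unfolding seg_def by (intro continuous_intros co)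
  qed
  have 2: "continuous_on ?S (\<lambda>z. w (snd z))"
    by (rule continuous_on_compose2[OF w]) (auto intro: continuous_intros)
  show ?thesis unfolding case_prod_unfold using 1 2 by (intro continuous_intros)
qed

text \<open>The weight \<open>w\<close> makes the induction work: differentiating
  \<open>u (seg e t x)\<close> in \<open>x i\<close> brings out a factor \<open>t\<close>, so the
  derivative is an integral of the same shape with weight \<open>w t * t\<close>.\<close>

lemma Ck_integral_seg:
  assumes e: "e \<in> Rn n"
  shows "Ck_on k n (cube n e r) u \<Longrightarrow> continuous_on {0..1} w \<Longrightarrow>
    Ck_on k n (cube n e r) (\<lambda>x. integral (cbox 0 1) (\<lambda>t. w t * u (seg e t x)))"
proof (induction k arbitrary: u w)
  case 0
  then show ?case using integral_continuous_on_param[OF continuous_seg[OF e, of r u w]] by simp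
next
  case (Suc k)
  note uD = Ck_SucD[OF Suc.prems(1)]
  show ?case
  proof (rule Ck_SucI[OF eopen_cube])
    show "continuous_on (cube n e r) (\<lambda>x. integral (cbox 0 1) (\<lambda>t. w t * u (seg e t x)))"
      by (rule integral_continuous_on_param[OF continuous_seg[OF e uD(1) Suc.prems(2)]])
    fix i assume i: "i < n"
    let ?g = "\<lambda>x. integral (cbox 0 1) (\<lambda>t. (w t * t) * partial i u (seg e t x))"
    have w': "continuous_on {0..1} (\<lambda>t. w t * t)" using Suc.prems(2) by (intro continuous_intros)
    have "hasp i (\<lambda>x. integral (cbox 0 1) (\<lambda>t. w t * u (seg e t x))) x (?g x)"
      if x: "x \<in> cube n e r" for x
    proof -
      \<comment> \<open>The range of the \<open>i\<close>-th coordinate in the cube. It is convex,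
        as differentiation under the integral sign demands, and open, so that the derivative within
        it is the full derivative.\<close>
      define S where "S = ball (e i) r"
      have S: "open S" "convex S" by (simp_all add: S_def)
      have memS: "s \<in> S \<longleftrightarrow> \<bar>s - e i\<bar> < r" for s
        unfolding S_def mem_ball dist_real_def by (subst abs_minus_commute) (rule refl)
      have up: "x(i := s) \<in> cube n e r" if "s \<in> S" for s
        using that x i by (auto simp: cube_def memS Rn_iff)
      have xi: "x i \<in> S" using x i by (auto simp: memS cube_def)
      have upd: "seg e t (x(i := s)) = (seg e t x)(i := e i + t * (s - e i))" for s t
        by (auto simp: seg_def)
      have d: "((\<lambda>s. w t * u (seg e t (x(i := s)))) has_real_derivative
          (w t * t) * partial i u (seg e t (x(i := s)))) (at s within S)"
        if s: "s \<in> S" and t: "t \<in> cbox 0 1" for s t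
      proof -
        have mem: "seg e t (x(i := s)) \<in> cube n e r" using seg_cube[OF e up[OF s]] t by auto
        have "((\<lambda>a. u ((seg e t x)(i := a))) has_real_derivative partial i u (seg e t (x(i := s))))
           (at (e i + t * (s - e i)))"
          using uD(2)[OF mem i] unfolding hasp_def upd by simp
        moreover have "((\<lambda>s. e i + t * (s - e i)) has_real_derivative t) (at s)"
          by (auto intro!: derivative_eq_intros)
        ultimately have "((\<lambda>s. u ((seg e t x)(i := e i + t * (s - e i)))) has_real_derivative
           partial i u (seg e t (x(i := s))) * t) (at s)"
          by (rule DERIV_chain2)
        from DERIV_cmult[OF this, of "w t"] show ?thesis
          unfolding upd by (simp add: mult_ac has_field_derivative_at_within)
      qed
      have cc: "continuous_on (S \<times> cbox 0 1) (\<lambda>(s, t). v t * f (seg e t (x(i := s))))"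
        if "continuous_on (cube n e r) f" "continuous_on {0..1} v" for v :: "real \<Rightarrow> real" and f :: "vec \<Rightarrow> real"
      proof -
        have "continuous_on UNIV (\<lambda>s. x(i := s))"
        proof (rule continuous_on_coordinatewise_then_product)
          show "continuous_on UNIV (\<lambda>s. (x(i := s)) j)" for j by (cases "j = i") auto
        qed
        then have "continuous_on (S \<times> cbox (0::real) 1) (\<lambda>z. (x(i := fst z), snd z))"
          by (intro continuous_on_Pair continuous_on_compose2[of UNIV "\<lambda>s. x(i := s)" _ fst] continuous_on_fst continuous_on_snd continuous_on_id subset_UNIV)
        moreover have "(\<lambda>z. (x(i := fst z), snd z)) ` (S \<times> cbox (0::real) 1) \<subseteq> cube n e r \<times> cbox 0 1"
          using up by auto
        ultimately show ?thesis
          using continuous_on_compose2[OF continuous_seg[OF e that]] by (fastforce simp: case_prod_unfold)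
      qed
      have "((\<lambda>s. integral (cbox 0 1) (\<lambda>t. w t * u (seg e t (x(i := s))))) has_real_derivative
         integral (cbox 0 1) (\<lambda>t. (w t * t) * partial i u (seg e t (x(i := x i))))) (at (x i) within S)"
      proof (rule leibniz_rule_field_derivative[OF d _ _ xi S(2)])
        show "(\<lambda>t. w t * u (seg e t (x(i := s)))) integrable_on cbox 0 1" if s: "s \<in> S" for s
        proof (rule integrable_continuous)
          have "continuous_on (cbox (0::real) 1) (\<lambda>t. (\<lambda>(s, t). w t * u (seg e t (x(i := s)))) (s, t))"
            by (rule continuous_on_compose2[OF cc[OF uD(1) Suc.prems(2)]])
              (use s in \<open>auto intro: continuous_intros\<close>)
          then show "continuous_on (cbox 0 1) (\<lambda>t. w t * u (seg e t (x(i := s))))" by simp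
        qed
        show "continuous_on (S \<times> cbox 0 1) (\<lambda>(s, t). w t * t * partial i u (seg e t (x(i := s))))"
          by (rule cc[OF Ck_continuous[OF uD(3)[OF i]] w'])
      qed auto
      then show ?thesis unfolding hasp_def at_within_open[OF xi S(1)] by simp
    qed
    then show "\<exists>g. Ck_on k n (cube n e r) g \<and>
        (\<forall>x\<in>cube n e r. hasp i (\<lambda>x. integral (cbox 0 1) (\<lambda>t. w t * u (seg e t x))) x (g x))"
      using Suc.IH[OF uD(3)[OF i] w'] by blast
  qed
qed

text \<open>The coefficient \<open>g i x\<close> is the integral over \<open>t\<close> of the
  \<open>i\<close>-th partial derivative at \<open>seg e t x\<close>. The expansion is the
  fundamental theorem of calculus along the segment from \<open>e\<close> to \<open>x\<close>; at
  \<open>e\<close> the integrand is constant.\<close>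

lemma hadamard:
  assumes e: "e \<in> Rn n" and r: "r > 0" and u: "smooth_fun_on n (cube n e r) u"
  shows "\<exists>g. (\<forall>i<n. smooth_fun_on n (cube n e r) (g i)) \<and>
    (\<forall>x\<in>cube n e r. u x = u e + (\<Sum>i<n. (x i - e i) * g i x)) \<and> (\<forall>i<n. g i e = partial i u e)"
proof -
  define g where "g i x = integral (cbox 0 1) (\<lambda>t. 1 * partial i u (seg e t x))" for i x
  have 1: "smooth_fun_on n (cube n e r) (g i)" if "i < n" for i
    using Ck_integral_seg[OF e smooth_Ck[OF smooth_partial[OF u that]], where w="\<lambda>t. 1"]
    unfolding smooth_fun_on_def g_def by simp
  have 2: "u x = u e + (\<Sum>i<n. (x i - e i) * g i x)" if x: "x \<in> cube n e r" for x
  proof -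
    have xR: "x \<in> Rn n" using x by (simp add: cube_def)
    have d: "((\<lambda>t. u (seg e t x)) has_real_derivative (\<Sum>j<n. partial j u (seg e t x) * (x j - e j))) (at t)"
      if t: "t \<in> {0..1}" for t
    proof (rule chain_curve[OF eopen_cube smooth_Ck[OF u]])
      show m: "seg e t x \<in> cube n e r" using seg_cube[OF e x] t by auto
      show dd: "((\<lambda>t. seg e t x j) has_real_derivative x j - e j) (at t)" for j
        unfolding seg_def by (auto intro!: derivative_eq_intros)
      show "\<forall>\<^sub>F t in nhds t. seg e t x \<in> cube n e r"
        by (rule curve_eventually[where c="\<lambda>t. seg e t x", OF eopen_cube m seg_Rn[OF e xR]])
          (rule DERIV_isCont[OF dd])
    qed
    have "((\<lambda>t. \<Sum>j<n. partial j u (seg e t x) * (x j - e j)) has_integral u (seg e 1 x) - u (seg e 0 x)) {0..1}"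
      by (rule fundamental_theorem_of_calculus)
        (use d in \<open>auto simp: has_real_derivative_iff_has_vector_derivative[symmetric] has_field_derivative_at_within\<close>)
    then have "u x - u e = integral (cbox 0 1) (\<lambda>t. \<Sum>j<n. partial j u (seg e t x) * (x j - e j))"
      by (simp add: seg_def integral_unique)
    also have "\<dots> = (\<Sum>j<n. integral (cbox 0 1) (\<lambda>t. partial j u (seg e t x) * (x j - e j)))"
    proof (rule integral_sum)
      fix j assume "j \<in> {..<n}"
      then have c: "continuous_on (cube n e r) (partial j u)"
        using smooth_continuous[OF smooth_partial[OF u]] by auto
      have "continuous_on (cbox (0::real) 1) (\<lambda>t. partial j u (seg e t x))"
        by (rule continuous_on_vec_compose[OF eopen_cube _ _ c])
          (use seg_cube[OF e x] in \<open>auto simp: seg_def intro!: continuous_intros\<close>)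
      then show "(\<lambda>t. partial j u (seg e t x) * (x j - e j)) integrable_on cbox 0 1"
        by (intro integrable_continuous continuous_intros)
    qed simp
    also have "\<dots> = (\<Sum>i<n. (x i - e i) * g i x)"
      by (simp add: g_def mult.commute)
    finally show ?thesis by simp
  qed
  have 3: "g i e = partial i u e" for i
    by (simp add: g_def seg_def)
  show ?thesis by (intro exI[of _ g] conjI ballI allI impI 1 2 3)
qed

subsection \<open>Bump functions\<close>

text \<open>The flat function exp(-1/t), with polynomials in 1/t as factors so that the family is
  closed under differentiation.\<close>

definition hexp :: "real poly \<Rightarrow> real \<Rightarrow> real" where
  "hexp p t = (if t > 0 then poly p (1 / t) * exp (- (1 / t)) else 0)"

lemma poly_exp_tendsto_0: "((\<lambda>y. poly p y * exp (- y)) \<longlongrightarrow> 0) at_top" for p :: "real poly"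
proof -
  have "((\<lambda>y. \<Sum>i\<le>degree p. coeff p i * (y ^ i / exp y)) \<longlongrightarrow> (\<Sum>i\<le>degree p. coeff p i * 0)) at_top"
    by (intro tendsto_intros tendsto_power_div_exp_0)
  then show ?thesis
    by (simp add: poly_altdef sum_distrib_right exp_minus field_simps sum_divide_distrib)
qed

text \<open>For t > 0 the derivative of p(1/t) exp(-1/t) is (1/t)^2 (p - p')(1/t) exp(-1/t), and
  \<open>[:0, 0, 1:]\<close> is X^2. At 0 the difference quotient from the right is X p evaluated at
  1/t, times exp(-1/t), and tends to 0.\<close>

lemma hexp_deriv: "(hexp p has_real_derivative hexp ([:0, 0, 1:] * (p - pderiv p)) t) (at t)"
proof (cases t "0::real" rule: linorder_cases)
  case less
  have "((\<lambda>t. 0) has_real_derivative 0) (at t)" by simp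
  moreover have "\<forall>\<^sub>F s in nhds t. 0 = hexp p s"
    by (rule eventually_mono[OF eventually_nhds_in_open[of "{..<0}" t]])
      (use less in \<open>auto simp: hexp_def\<close>)
  ultimately have "(hexp p has_real_derivative 0) (at t)"
    using DERIV_cong_ev[OF refl _ refl, of "\<lambda>t. 0" "hexp p" t] by blast
  moreover have "hexp q t = 0" for q using less by (simp add: hexp_def)
  ultimately show ?thesis by simp
next
  case greater
  have "((\<lambda>t. poly p (1 / t) * exp (- (1 / t))) has_real_derivative
     hexp ([:0, 0, 1:] * (p - pderiv p)) t) (at t)"
  proof -
    have 1: "((\<lambda>t. 1 / t) has_real_derivative - (1 / t\<^sup>2)) (at t)"
      using greater by (auto intro!: derivative_eq_intros simp: power2_eq_square)
    have 2: "((\<lambda>t. poly p (1 / t)) has_real_derivative poly (pderiv p) (1 / t) * - (1 / t\<^sup>2)) (at t)"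
      by (rule DERIV_chain2[OF poly_DERIV 1])
    have 3: "((\<lambda>t. exp (- (1 / t))) has_real_derivative exp (- (1 / t)) * (1 / t\<^sup>2)) (at t)"
      by (rule DERIV_chain2[OF DERIV_exp]) (use DERIV_minus[OF 1] in simp)
    have "poly (pderiv p) (1 / t) * - (1 / t\<^sup>2) * exp (- (1 / t)) + exp (- (1 / t)) * (1 / t\<^sup>2) * poly p (1 / t)
       = hexp ([:0, 0, 1:] * (p - pderiv p)) t"
      using greater by (simp add: hexp_def power2_eq_square left_diff_distrib right_diff_distrib)
    then show ?thesis using DERIV_mult[OF 2 3] by simp
  qed
  moreover have "\<forall>\<^sub>F s in nhds t. poly p (1 / s) * exp (- (1 / s)) = hexp p s"
    by (rule eventually_mono[OF eventually_nhds_in_open[of "{0<..}" t]])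
      (use greater in \<open>auto simp: hexp_def\<close>)
  ultimately show ?thesis
    using DERIV_cong_ev[OF refl _ refl, of "\<lambda>t. poly p (1 / t) * exp (- (1 / t))" "hexp p" t]
    by auto
next
  case equal
  have "((\<lambda>y. (hexp p y - hexp p 0) / (y - 0)) \<longlongrightarrow> 0) (at 0)"
  proof (rule filterlim_split_at_real)
    have "\<forall>\<^sub>F y in at_left 0. (0::real) = (hexp p y - hexp p 0) / (y - 0)"
      by (auto simp: eventually_at_filter hexp_def)
    then show "((\<lambda>y. (hexp p y - hexp p 0) / (y - 0)) \<longlongrightarrow> 0) (at_left 0)"
      by (rule Lim_transform_eventually[OF tendsto_const])
    have "((\<lambda>y. poly ([:0,1:] * p) (inverse y) * exp (- inverse y)) \<longlongrightarrow> 0) (at_right 0)"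
      by (rule filterlim_compose[OF poly_exp_tendsto_0 filterlim_inverse_at_top_right])
    moreover have "\<forall>\<^sub>F y in at_right 0. poly ([:0,1:] * p) (inverse y) * exp (- inverse y)
        = (hexp p y - hexp p 0) / (y - 0)"
      by (auto simp: eventually_at_filter hexp_def field_simps)
    ultimately show "((\<lambda>y. (hexp p y - hexp p 0) / (y - 0)) \<longlongrightarrow> 0) (at_right 0)"
      by (rule Lim_transform_eventually)
  qed
  then show ?thesis using equal by (simp add: has_field_derivative_iff hexp_def)
qed

lemma smooth_hexp: "smooth_fun_on 1 (Rn 1) (\<lambda>x. hexp p (x 0))"
proof (rule smooth_funI[OF eopen_Rn, of _ "range (\<lambda>p x. hexp p (x 0))"])
  fix f :: "vec \<Rightarrow> real" assume "f \<in> range (\<lambda>p x. hexp p (x 0))"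
  then obtain p where p: "f = (\<lambda>x. hexp p (x 0))" by blast
  have "continuous_on UNIV (hexp p)"
    using hexp_deriv by (intro continuous_at_imp_continuous_on ballI DERIV_isCont)
  then show "continuous_on (Rn 1) f" unfolding p
    by (rule continuous_on_compose2[OF _ continuous_on_coord]) auto
  show "\<exists>g\<in>range (\<lambda>p x. hexp p (x 0)). \<forall>x\<in>Rn 1. hasp i f x (g x)" if "i < 1" for i
    using hexp_deriv[of p] that unfolding p
    by (intro bexI[of _ "\<lambda>x. hexp ([:0, 0, 1:] * (p - pderiv p)) (x 0)"]) (auto simp: hasp_def)
qed auto

lemma bump_exists:
  assumes e: "e \<in> Rn n" and r: "r > 0"
  obtains b where "smooth_fun_on n (Rn n) b" "b e = 1"
    "\<And>x. x \<in> Rn n \<Longrightarrow> b x \<noteq> 0 \<Longrightarrow> x \<in> cube n e r"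
proof
  \<comment> \<open>The \<open>i\<close>-th factor vanishes as soon as the distance in coordinate
    \<open>i\<close> is at least \<open>r\<close>; dividing by the value at the centre normalises
    \<open>b e\<close> to 1.\<close>
  define b where "b x = (\<Prod>i<n. hexp 1 (r\<^sup>2 - (x i - e i)\<^sup>2) * inverse (hexp 1 (r\<^sup>2)))" for x
  have "smooth_fun_on n (Rn n) (\<lambda>x. hexp 1 ((\<lambda>j. if j = 0 then r\<^sup>2 - (x i - e i)\<^sup>2 else 0) (0::nat)))" for i
    by (rule smooth_compose[OF eopen_Rn eopen_Rn _ _ smooth_hexp, of n "\<lambda>x j. if j = 0 then r\<^sup>2 - (x i - e i)\<^sup>2 else 0"])
      (auto intro!: smooth_vecI smooth_diff smooth_mult smooth_const smooth_coord eopen_Rn simp: Rn_iff power2_eq_square)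
  then show "smooth_fun_on n (Rn n) b"
    unfolding b_def by (intro smooth_prod smooth_mult smooth_const eopen_Rn) simp
  have "hexp 1 (r\<^sup>2) > 0" using r by (simp add: hexp_def)
  then show "b e = 1" by (simp add: b_def)
  fix x assume "x \<in> Rn n" "b x \<noteq> 0"
  then have "(x i - e i)\<^sup>2 < r\<^sup>2" if "i < n" for i
    using that by (auto simp: b_def hexp_def split: if_splits)
  then have "\<bar>x i - e i\<bar> < r" if "i < n" for i
    using that r by (metis power2_abs power2_less_imp_less less_imp_le)
  then show "x \<in> cube n e r" using \<open>x \<in> Rn n\<close> by (simp add: cube_def)
qed

section \<open>Compact cubes and bounds on them\<close>

definition ccube :: "nat \<Rightarrow> vec \<Rightarrow> real \<Rightarrow> vec set" where
  "ccube m x r = {y \<in> Rn m. \<forall>i<m. \<bar>y i - x i\<bar> \<le> r}"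

lemma compact_ccube: "compact (ccube m x r)"
proof -
  \<comment> \<open>A product of compact intervals and, at the indices from \<open>m\<close> on, of
    single points: compact by Tychonoff's theorem.\<close>
  have "compactin (product_topology (\<lambda>i. euclideanreal) UNIV)
     (PiE UNIV (\<lambda>i. if i < m then {x i - r..x i + r} else {0}))"
    unfolding compactin_PiE by auto
  moreover have "PiE UNIV (\<lambda>i. if i < m then {x i - r..x i + r} else {0}) = ccube m x r"
  proof (rule Set.set_eqI)
    fix y :: vec
    have "y \<in> PiE UNIV (\<lambda>i. if i < m then {x i - r..x i + r} else {0}) \<longleftrightarrow>
        (\<forall>i. y i \<in> (if i < m then {x i - r..x i + r} else {0}))"
      by (simp add: PiE_iff)
    also have "\<dots> \<longleftrightarrow> (\<forall>i. (i < m \<longrightarrow> \<bar>y i - x i\<bar> \<le> r) \<and> (i \<ge> m \<longrightarrow> y i = 0))"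
      by (intro iff_allI) (auto simp: abs_le_iff)
    also have "\<dots> \<longleftrightarrow> y \<in> ccube m x r" by (auto simp: ccube_def Rn_iff)
    finally show "y \<in> PiE UNIV (\<lambda>i. if i < m then {x i - r..x i + r} else {0}) \<longleftrightarrow> y \<in> ccube m x r" .
  qed
  ultimately show ?thesis by (simp add: euclidean_product_topology)
qed

lemma Ck_bounded:
  assumes "Ck_on k n V f" "ccube n x r \<subseteq> V"
  shows "\<exists>B\<ge>0. \<forall>y\<in>ccube n x r. \<bar>f y\<bar> \<le> B"
proof -
  have "compact (f ` ccube n x r)"
    by (rule compact_continuous_image[OF continuous_on_subset[OF Ck_continuous[OF assms(1)] assms(2)] compact_ccube])
  then obtain B where "\<forall>y\<in>ccube n x r. \<bar>f y\<bar> \<le> B"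
    unfolding bounded_iff[THEN iffD1, OF compact_imp_bounded] using compact_imp_bounded bounded_iff
    by (metis imageI real_norm_def)
  then show ?thesis by (intro exI[of _ "\<bar>B\<bar>"]) fastforce
qed

lemma uniform_bound:
  fixes B :: "nat \<Rightarrow> real"
  assumes "\<And>j. j < n \<Longrightarrow> B j \<ge> 0"
  shows "j < n \<Longrightarrow> B j \<le> (\<Sum>j<n. B j)"
  using assms by (intro member_le_sum) auto

subsection \<open>Local solutions of ordinary differential equations\<close>

text \<open>Closed cubes are convex, so the mean value theorem along a segment bounds the difference
  by the partial derivatives, which are bounded by compactness.\<close>

lemma Ck_lipschitz:
  assumes V: "eopen n V" and f: "Ck_on (Suc 0) n V f" and K: "ccube n x0 r \<subseteq> V" and x0: "x0 \<in> Rn n"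
  shows "\<exists>L\<ge>0. \<forall>x\<in>ccube n x0 r. \<forall>y\<in>ccube n x0 r. \<bar>f x - f y\<bar> \<le> L * (\<Sum>i<n. \<bar>x i - y i\<bar>)"
proof -
  have "\<exists>B\<ge>0. \<forall>y\<in>ccube n x0 r. \<bar>partial i f y\<bar> \<le> B" if "i < n" for i
    by (rule Ck_bounded[OF Ck_SucD(3)[OF f that] K])
  then obtain B where B: "\<And>i. i < n \<Longrightarrow> B i \<ge> 0"
    "\<And>i y. i < n \<Longrightarrow> y \<in> ccube n x0 r \<Longrightarrow> \<bar>partial i f y\<bar> \<le> B i" by metis
  define L where "L = (\<Sum>i<n. B i)"
  have BL: "B i \<le> L" if "i < n" for i unfolding L_def by (rule uniform_bound[where n=n and B=B, OF B(1) that])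
  have "\<bar>f x - f y\<bar> \<le> L * (\<Sum>i<n. \<bar>x i - y i\<bar>)" if x: "x \<in> ccube n x0 r" and y: "y \<in> ccube n x0 r" for x y
  proof -
    have R: "x \<in> Rn n" "y \<in> Rn n" using x y by (auto simp: ccube_def)
    have mem: "seg y t x \<in> ccube n x0 r" if t: "0 \<le> t" "t \<le> 1" for t
    proof -
      have "\<bar>seg y t x i - x0 i\<bar> \<le> r" if i: "i < n" for i
      proof -
        have "seg y t x i - x0 i = (1 - t) * (y i - x0 i) + t * (x i - x0 i)"
          by (simp add: seg_def algebra_simps)
        also have "\<bar>\<dots>\<bar> \<le> (1 - t) * \<bar>y i - x0 i\<bar> + t * \<bar>x i - x0 i\<bar>"
          using abs_triangle_ineq[of "(1 - t) * (y i - x0 i)" "t * (x i - x0 i)"] t by (simp add: abs_mult)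
        also have "\<dots> \<le> (1 - t) * r + t * r"
          using x y i t by (intro add_mono mult_left_mono) (auto simp: ccube_def)
        finally show ?thesis by (simp add: algebra_simps)
      qed
      then show ?thesis using seg_Rn[OF R(2,1)] by (simp add: ccube_def)
    qed
    have d: "((\<lambda>t. f (seg y t x)) has_real_derivative (\<Sum>j<n. partial j f (seg y t x) * (x j - y j))) (at t)"
      if t: "0 \<le> t" "t \<le> 1" for t
    proof (rule chain_curve[OF V f])
      show m: "seg y t x \<in> V" using mem[OF t] K by blast
      show dd: "((\<lambda>t. seg y t x j) has_real_derivative x j - y j) (at t)" for j
        unfolding seg_def by (auto intro!: derivative_eq_intros)
      show "\<forall>\<^sub>F t in nhds t. seg y t x \<in> V"
        by (rule curve_eventually[where c="\<lambda>t. seg y t x", OF V m seg_Rn[OF R(2,1)]])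
          (rule DERIV_isCont[OF dd])
    qed
    obtain t where t: "0 < t" "t < 1"
      "f (seg y 1 x) - f (seg y 0 x) = (1 - 0) * (\<Sum>j<n. partial j f (seg y t x) * (x j - y j))"
      using MVT2[of 0 1 "\<lambda>t. f (seg y t x)" "\<lambda>t. \<Sum>j<n. partial j f (seg y t x) * (x j - y j)"] d
      by auto
    have "\<bar>f x - f y\<bar> = \<bar>\<Sum>j<n. partial j f (seg y t x) * (x j - y j)\<bar>"
      using t(3) by (simp add: seg_def)
    also have "\<dots> \<le> (\<Sum>j<n. \<bar>partial j f (seg y t x)\<bar> * \<bar>x j - y j\<bar>)"
      by (rule order_trans[OF sum_abs]) (simp add: abs_mult)
    also have "\<dots> \<le> (\<Sum>j<n. L * \<bar>x j - y j\<bar>)"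
    proof (intro sum_mono mult_right_mono)
      fix j assume "j \<in> {..<n}"
      then show "\<bar>partial j f (seg y t x)\<bar> \<le> L"
        using B(2)[of j "seg y t x"] BL[of j] mem[of t] t by fastforce
    qed auto
    finally show ?thesis by (simp add: sum_distrib_left)
  qed
  moreover have "L \<ge> 0" unfolding L_def using B(1) by (intro sum_nonneg) auto
  ultimately show ?thesis by blast
qed

text \<open>Picard iteration as a contraction. The candidate curves are stored as bounded continuous
  real functions on the plane, which form a complete metric space: the value at
  \<open>(real i, s)\<close> is the \<open>i\<close>-th coordinate at time \<open>s\<close>.\<close>

lemma ode_exists:
  fixes \<xi> :: "nat \<Rightarrow> vec \<Rightarrow> real"
  assumes V: "eopen k V" and \<xi>: "\<And>j. j < k \<Longrightarrow> Ck_on (Suc 0) k V (\<xi> j)" and x0: "x0 \<in> V"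
  shows "\<exists>\<epsilon>>0. \<exists>\<tau>. \<tau> 0 = x0 \<and> (\<forall>t. \<tau> t \<in> Rn k) \<and> (\<forall>t. \<bar>t\<bar> < \<epsilon> \<longrightarrow> \<tau> t \<in> V \<and>
     (\<forall>j<k. ((\<lambda>s. \<tau> s j) has_real_derivative \<xi> j (\<tau> t)) (at t)))"
proof -
  have x0R: "x0 \<in> Rn k" using x0 eopen_subset[OF V] by blast
  obtain R where R: "R > 0" "cube k x0 R \<subseteq> V" using eopen_contains_cube[OF V x0] by blast
  define r where "r = R / 2"
  have r: "r > 0" using R by (simp add: r_def)
  define K where "K = ccube k x0 r"
  have KV: "K \<subseteq> V" using R by (force simp: K_def ccube_def cube_def r_def)
  have "\<exists>B\<ge>0. \<forall>y\<in>K. \<bar>\<xi> j y\<bar> \<le> B" if "j < k" for j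
    using Ck_bounded[OF \<xi>[OF that]] KV unfolding K_def by blast
  then obtain B where B: "\<And>j. j < k \<Longrightarrow> B j \<ge> 0" "\<And>j y. j < k \<Longrightarrow> y \<in> K \<Longrightarrow> \<bar>\<xi> j y\<bar> \<le> B j" by metis
  define N where "N = (\<Sum>j<k. B j)"
  have N: "\<bar>\<xi> j y\<bar> \<le> N" if "j < k" "y \<in> K" for j y
    using B(2)[OF that] uniform_bound[where n=k and B=B and j=j, OF B(1)] that(1) by (simp add: N_def)
  have N0: "N \<ge> 0" unfolding N_def using B(1) by (intro sum_nonneg) auto
  have "\<exists>L\<ge>0. \<forall>x\<in>K. \<forall>y\<in>K. \<bar>\<xi> j x - \<xi> j y\<bar> \<le> L * (\<Sum>i<k. \<bar>x i - y i\<bar>)" if "j < k" for j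
    using Ck_lipschitz[OF V \<xi>[OF that] _ x0R] KV unfolding K_def by blast
  then obtain C where C: "\<And>j. j < k \<Longrightarrow> C j \<ge> 0"
    "\<And>j x y. j < k \<Longrightarrow> x \<in> K \<Longrightarrow> y \<in> K \<Longrightarrow> \<bar>\<xi> j x - \<xi> j y\<bar> \<le> C j * (\<Sum>i<k. \<bar>x i - y i\<bar>)" by metis
  define L where "L = (\<Sum>j<k. C j)"
  have L0: "L \<ge> 0" unfolding L_def using C(1) by (intro sum_nonneg) auto
  have L: "\<bar>\<xi> j x - \<xi> j y\<bar> \<le> L * (\<Sum>i<k. \<bar>x i - y i\<bar>)" if "j < k" "x \<in> K" "y \<in> K" for j x y
    by (rule order_trans[OF C(2)[OF that]])
      (use uniform_bound[where n=k and B=C and j=j, OF C(1)] that(1) in \<open>auto simp: L_def intro!: mult_right_mono sum_nonneg\<close>)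
  \<comment> \<open>Coordinatewise projection onto the closed cube \<open>K\<close>. Composing with
    it extends the vector field to all candidates without enlarging its bound or its Lipschitz
    constant.\<close>
  define cl where "cl y = (\<lambda>i. if i < k then max (x0 i - r) (min (x0 i + r) (y i)) else 0)" for y :: vec
  have clK: "cl y \<in> K" for y using r by (auto simp: cl_def K_def ccube_def Rn_iff)
  have cl_id: "cl y = y" if "y \<in> K" for y
    using that by (auto simp: cl_def K_def ccube_def Rn_iff abs_le_iff fun_eq_iff)
  have cl1: "\<bar>cl y i - cl z i\<bar> \<le> \<bar>y i - z i\<bar>" for y z i
    by (auto simp: cl_def)
  define F where "F j y = \<xi> j (cl y)" for j y
  have FL: "\<bar>F j y - F j z\<bar> \<le> L * (\<Sum>i<k. \<bar>y i - z i\<bar>)" if "j < k" for j y z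
    using order_trans[OF L[OF that clK clK, of y z]] L0 cl1 unfolding F_def
    by (meson mult_left_mono sum_mono)
  have FN: "\<bar>F j y\<bar> \<le> N" if "j < k" for j y using N[OF that clK] by (simp add: F_def)
  \<comment> \<open>The contraction rate allowed per coordinate: the \<open>k\<close> coordinates
    add up to at most 1/2.\<close>
  define c where "c = 1 / (2 * (real k + 1))"
  have c: "c > 0" "k * c \<le> 1 / 2" by (auto simp: c_def field_simps)
  \<comment> \<open>The first bound keeps the curve in the cube of radius \<open>r\<close>, the
    second makes the operator contract. The 3 stems from the two integrals in \<open>I\<close>, over
    intervals of lengths at most 2 \<epsilon> and \<epsilon>.\<close>
  define \<epsilon> where "\<epsilon> = min (r / (3 * (N + 1))) (c / (3 * (L * k + 1)))"
  have Lk0: "L * real k \<ge> 0" using L0 by simp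
  have e0: "\<epsilon> > 0" using r N0 Lk0 c by (simp add: \<epsilon>_def)
  have eN: "3 * \<epsilon> * N \<le> r"
  proof -
    have "\<epsilon> * (3 * (N + 1)) \<le> r" using N0 by (subst pos_le_divide_eq[symmetric]) (auto simp: \<epsilon>_def)
    then show ?thesis using e0 by (simp add: algebra_simps)
  qed
  have eL: "3 * \<epsilon> * (L * k) \<le> c"
  proof -
    have "\<epsilon> * (3 * (L * k + 1)) \<le> c" using Lk0 by (subst pos_le_divide_eq[symmetric]) (auto simp: \<epsilon>_def)
    then show ?thesis using e0 by (simp add: algebra_simps)
  qed
  define vc where "vc u s = (\<lambda>i. if i < k then apply_bcontfun u (real i, s) else 0)"
    for u :: "(real \<times> real) \<Rightarrow>\<^sub>C real" and s
  \<comment> \<open>Time is clamped to the interval from -\<epsilon> to \<epsilon>, so that the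
    candidates are bounded and defined for all times.\<close>
  define ct where "ct t = max (- \<epsilon>) (min \<epsilon> t)" for t :: real
  have ct: "- \<epsilon> \<le> ct t" "ct t \<le> \<epsilon>" for t using e0 by (auto simp: ct_def)
  have uc: "continuous_on S (\<lambda>s. apply_bcontfun u (a, s))" for u :: "(real \<times> real) \<Rightarrow>\<^sub>C real" and a S
    by (rule continuous_on_compose2[OF continuous_on_apply_bcontfun[of UNIV u]]) (auto intro!: continuous_intros)
  have Fc: "continuous_on S (\<lambda>s. F j (vc u s))" if j: "j < k" for j u S
    unfolding F_def
  proof (rule continuous_on_vec_compose[OF V _ _ Ck_continuous[OF \<xi>[OF j]]])
    show "(\<lambda>s. cl (vc u s)) ` S \<subseteq> V" using clK KV by blast
    show "continuous_on S (\<lambda>s. cl (vc u s) i)" if "i < k" for i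
      using that by (simp add: cl_def vc_def) (intro continuous_intros uc)
  qed
  \<comment> \<open>The oriented integral from 0 to the clamped time, written with the common
    starting point -\<epsilon> so that negative times are covered.\<close>
  define I where "I u j t = integral {-\<epsilon>..ct t} (\<lambda>s. F j (vc u s)) - integral {-\<epsilon>..0} (\<lambda>s. F j (vc u s))" for u j t
  have IN: "\<bar>I u j t\<bar> \<le> r" if j: "j < k" for u j t
  proof -
    have "norm (integral {-\<epsilon>..ct t} (\<lambda>s. F j (vc u s))) \<le> N * (ct t - - \<epsilon>)"
      by (rule integral_bound[OF ct(1) Fc[OF j]]) (use FN[OF j] in auto)
    moreover have "norm (integral {-\<epsilon>..0} (\<lambda>s. F j (vc u s))) \<le> N * (0 - - \<epsilon>)"
      by (rule integral_bound[OF _ Fc[OF j]]) (use FN[OF j] e0 in auto)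
    moreover have "N * (ct t - - \<epsilon>) \<le> N * (2 * \<epsilon>)" using ct[of t] N0 by (intro mult_left_mono) auto
    ultimately have "\<bar>I u j t\<bar> \<le> N * (2 * \<epsilon>) + N * \<epsilon>" unfolding I_def by simp
    then show ?thesis using eN by (simp add: algebra_simps)
  qed
  have ID: "\<bar>I u j t - I v j t\<bar> \<le> c * dist u v" if j: "j < k" for u v j t
  proof -
    let ?d = "dist u v"
    have b: "\<bar>F j (vc u s) - F j (vc v s)\<bar> \<le> L * k * ?d" for s
    proof -
      have "\<bar>vc u s i - vc v s i\<bar> \<le> ?d" for i
        using dist_bounded[of u "(real i, s)" v] by (auto simp: vc_def dist_real_def)
      then have "(\<Sum>i<k. \<bar>vc u s i - vc v s i\<bar>) \<le> (\<Sum>i<k. ?d)" by (intro sum_mono) auto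
      then have "L * (\<Sum>i<k. \<bar>vc u s i - vc v s i\<bar>) \<le> L * (k * ?d)"
        using L0 by (intro mult_left_mono) auto
      then show ?thesis using FL[OF j, of "vc u s" "vc v s"] by (simp add: mult.assoc)
    qed
    have cF: "continuous_on S (\<lambda>s. F j (vc u s) - F j (vc v s))" for S
      by (intro continuous_intros Fc j)
    have "norm (integral {-\<epsilon>..ct t} (\<lambda>s. F j (vc u s) - F j (vc v s))) \<le> L * k * ?d * (ct t - - \<epsilon>)"
      by (rule integral_bound[OF ct(1) cF]) (use b in auto)
    moreover have "norm (integral {-\<epsilon>..0} (\<lambda>s. F j (vc u s) - F j (vc v s))) \<le> L * k * ?d * (0 - - \<epsilon>)"
      by (rule integral_bound[OF _ cF]) (use b e0 in auto)
    moreover have "L * k * ?d * (ct t - - \<epsilon>) \<le> L * k * ?d * (2 * \<epsilon>)"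
      using ct[of t] L0 by (intro mult_left_mono mult_nonneg_nonneg) auto
    moreover have "I u j t - I v j t = integral {-\<epsilon>..ct t} (\<lambda>s. F j (vc u s) - F j (vc v s))
        - integral {-\<epsilon>..0} (\<lambda>s. F j (vc u s) - F j (vc v s))"
      unfolding I_def by (simp add: integral_diff integrable_continuous_interval Fc j)
    ultimately have "\<bar>I u j t - I v j t\<bar> \<le> L * k * ?d * (2 * \<epsilon>) + L * k * ?d * \<epsilon>"
      unfolding real_norm_def by (smt (verit) diff_minus_eq_add add_0)
    also have "\<dots> = 3 * \<epsilon> * (L * k) * ?d" by (simp add: algebra_simps)
    also have "\<dots> \<le> c * ?d" by (rule mult_right_mono[OF eL]) simp
    finally show ?thesis .
  qed
  \<comment> \<open>Tent functions, equal to 1 at \<open>j\<close> and to 0 at the other natural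
    numbers: they interpolate the \<open>k\<close> coordinates continuously in the first argument of
    the stored function.\<close>
  define hat where "hat j a = max 0 (1 - \<bar>a - real j\<bar>)" for j :: nat and a :: real
  have hat: "0 \<le> hat j a" "hat j a \<le> 1" "hat j (real i) = (if i = j then 1 else 0)" for j i a
    by (auto simp: hat_def)
  define Tf where "Tf u = (\<lambda>z. \<Sum>j<k. hat j (fst z) * (x0 j + I u j (snd z)))" for u
  have Tb: "Tf u \<in> bcontfun" for u
  proof (rule bcontfun_normI)
    have hc: "continuous_on UNIV (\<lambda>z::real \<times> real. hat j (fst z))" for j
      unfolding hat_def by (intro continuous_intros)
    have Ic: "continuous_on UNIV (\<lambda>z::real \<times> real. I u j (snd z))" if j: "j < k" for j
    proof -
      have "continuous_on {-\<epsilon>..\<epsilon>} (\<lambda>t. integral {-\<epsilon>..t} (\<lambda>s. F j (vc u s)))"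
        by (rule indefinite_integral_continuous_1) (rule integrable_continuous_interval[OF Fc[OF j]])
      then have "continuous_on UNIV (\<lambda>z::real \<times> real. integral {-\<epsilon>..ct (snd z)} (\<lambda>s. F j (vc u s)))"
        by (rule continuous_on_compose2) (use ct in \<open>auto simp: ct_def intro!: continuous_intros\<close>)
      then show ?thesis unfolding I_def by (intro continuous_intros)
    qed
    show "continuous_on UNIV (Tf u)"
      unfolding Tf_def by (intro continuous_on_sum continuous_on_mult continuous_on_add hc Ic continuous_on_const) auto
    fix z :: "real \<times> real"
    have "\<bar>hat j (fst z) * (x0 j + I u j (snd z))\<bar> \<le> 1 * (\<bar>x0 j\<bar> + r)" if "j < k" for j
      unfolding abs_mult using hat(1,2)[of j "fst z"] IN[OF that, of u "snd z"] by (intro mult_mono) auto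
    then show "norm (Tf u z) \<le> (\<Sum>j<k. \<bar>x0 j\<bar> + r)"
      unfolding Tf_def real_norm_def by (intro order_trans[OF sum_abs] sum_mono) auto
  qed
  define T where "T u = Bcontfun (Tf u)" for u
  have Tap: "apply_bcontfun (T u) = Tf u" for u
    unfolding T_def by (rule Bcontfun_inverse[OF Tb])
  have "dist (T u) (T v) \<le> 1 / 2 * dist u v" for u v
  proof (rule dist_bound)
    fix z :: "real \<times> real"
    have "\<bar>hat j (fst z) * (I u j (snd z) - I v j (snd z))\<bar> \<le> 1 * (c * dist u v)" if "j < k" for j
      unfolding abs_mult using hat(1,2)[of j "fst z"] ID[OF that, of u "snd z" v] by (intro mult_mono) auto
    then have "\<bar>\<Sum>j<k. hat j (fst z) * (I u j (snd z) - I v j (snd z))\<bar> \<le> (\<Sum>j<k. 1 * (c * dist u v))"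
      by (intro order_trans[OF sum_abs] sum_mono) auto
    also have "\<dots> \<le> 1 / 2 * dist u v"
      using mult_right_mono[OF c(2), of "dist u v"] by simp
    finally have bd: "\<bar>\<Sum>j<k. hat j (fst z) * (I u j (snd z) - I v j (snd z))\<bar> \<le> 1 / 2 * dist u v" .
    show "dist (apply_bcontfun (T u) z) (apply_bcontfun (T v) z) \<le> 1 / 2 * dist u v"
    proof -
      have "Tf u z - Tf v z = (\<Sum>j<k. hat j (fst z) * (I u j (snd z) - I v j (snd z)))"
        unfolding Tf_def sum_subtractf[symmetric] by (rule sum.cong) (auto simp: right_diff_distrib distrib_left)
      then show ?thesis using bd unfolding Tap dist_real_def by simp
    qed
  qed
  then have "\<forall>u v. dist (T u) (T v) \<le> 1 / 2 * dist u v" by blast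
  then have "\<exists>!u. T u = u" by (rule banach_fix_type[where f=T and c="1/2", rotated 2]) auto
  then obtain u where u: "T u = u" by blast
  define \<tau> where "\<tau> = vc u"
  have \<tau>: "\<tau> t j = x0 j + I u j t" if "j < k" for t j
  proof -
    have "\<tau> t j = Tf u (real j, t)" using that u Tap[of u] by (simp add: \<tau>_def vc_def)
    also have "\<dots> = (\<Sum>i<k. if j = i then x0 i + I u i t else 0)"
      unfolding Tf_def by (intro sum.cong) (auto simp: hat)
    finally show ?thesis using that by simp
  qed
  have \<tau>R: "\<tau> t \<in> Rn k" for t by (simp add: \<tau>_def vc_def Rn_iff)
  have \<tau>K: "\<tau> t \<in> K" for t
    using \<tau>R \<tau> IN by (simp add: K_def ccube_def)
  have ct0: "ct 0 = 0" using e0 by (simp add: ct_def)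
  have "\<tau> 0 = x0"
  proof
    fix j show "\<tau> 0 j = x0 j"
      using \<tau>[of j 0] \<tau>R[of 0] x0R by (cases "j < k") (auto simp: I_def ct0 Rn_iff)
  qed
  moreover have "((\<lambda>s. \<tau> s j) has_real_derivative \<xi> j (\<tau> t)) (at t)" if t: "\<bar>t\<bar> < \<epsilon>" and j: "j < k" for t j
  proof -
    have tt: "t \<in> {-\<epsilon><..<\<epsilon>}" using t by auto
    have "((\<lambda>s. integral {-\<epsilon>..s} (\<lambda>s. F j (vc u s))) has_real_derivative F j (vc u t)) (at t within {-\<epsilon>..\<epsilon>})"
      by (rule integral_has_real_derivative[OF Fc[OF j]]) (use tt in auto)
    then have "((\<lambda>s. integral {-\<epsilon>..s} (\<lambda>s. F j (vc u s))) has_real_derivative F j (vc u t)) (at t)"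
      using tt at_within_interior[of t "{-\<epsilon>..\<epsilon>}"] by (simp add: interior_atLeastAtMost_real)
    then have "((\<lambda>s. x0 j + (integral {-\<epsilon>..s} (\<lambda>s. F j (vc u s)) - integral {-\<epsilon>..0} (\<lambda>s. F j (vc u s)))) has_real_derivative 0 + (F j (vc u t) - 0)) (at t)"
      by (intro DERIV_add DERIV_diff DERIV_const)
    moreover have "F j (vc u t) = \<xi> j (\<tau> t)" using cl_id[OF \<tau>K] by (simp add: F_def \<tau>_def)
    moreover have "\<forall>\<^sub>F s in nhds t. x0 j + (integral {-\<epsilon>..s} (\<lambda>s. F j (vc u s)) - integral {-\<epsilon>..0} (\<lambda>s. F j (vc u s))) = \<tau> s j"
    proof (rule eventually_mono[OF eventually_nhds_in_open[of "{-\<epsilon><..<\<epsilon>}" t]])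
      fix s assume "s \<in> {-\<epsilon><..<\<epsilon>}"
      then have "ct s = s" by (simp add: ct_def)
      then show "x0 j + (integral {-\<epsilon>..s} (\<lambda>s. F j (vc u s)) - integral {-\<epsilon>..0} (\<lambda>s. F j (vc u s))) = \<tau> s j"
        using \<tau>[OF j] by (simp add: I_def)
    qed (use tt in auto)
    ultimately show ?thesis using DERIV_cong_ev[OF refl _ refl] by fastforce
  qed
  ultimately show ?thesis using e0 \<tau>K KV \<tau>R by (intro exI[of _ \<epsilon>] conjI exI[of _ \<tau>]) auto
qed

subsection \<open>Splitting coordinates\<close>

abbreviation "va \<equiv> vec_append"

definition pr1 :: "nat \<Rightarrow> vec \<Rightarrow> vec" where "pr1 m z = (\<lambda>i. if i < m then z i else 0)"

definition pr2 :: "nat \<Rightarrow> vec \<Rightarrow> vec" where "pr2 m z = (\<lambda>i. z (i + m))"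

definition prodset :: "nat \<Rightarrow> nat \<Rightarrow> vec set \<Rightarrow> vec set \<Rightarrow> vec set" where
  "prodset m l U V = {z \<in> Rn (m + l). pr1 m z \<in> U \<and> pr2 m z \<in> V}"

lemma va_lt: "i < m \<Longrightarrow> va m x y i = x i"
  by (simp add: vec_append_def)

lemma pr1_va: "x \<in> Rn m \<Longrightarrow> pr1 m (va m x y) = x"
  by (auto simp: pr1_def vec_append_def Rn_iff)

lemma pr2_va: "pr2 m (va m x y) = y"
  by (auto simp: pr2_def vec_append_def)

lemma va_Rn: "y \<in> Rn l \<Longrightarrow> va m x y \<in> Rn (m + l)"
  by (auto simp: Rn_iff vec_append_def)

lemma va_inj: "x \<in> Rn m \<Longrightarrow> x' \<in> Rn m \<Longrightarrow> va m x y = va m x' y' \<Longrightarrow> x = x' \<and> y = y'"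
  using pr1_va pr2_va by metis

lemma va_prodset: "U \<subseteq> Rn m \<Longrightarrow> V \<subseteq> Rn l \<Longrightarrow> x \<in> U \<Longrightarrow> y \<in> V \<Longrightarrow> va m x y \<in> prodset m l U V"
  by (auto simp: prodset_def pr2_va va_Rn pr1_va subset_iff)

lemma va_pr: "z \<in> Rn (m + l) \<Longrightarrow> va m (pr1 m z) (pr2 m z) = z"
  by (auto simp: pr1_def pr2_def vec_append_def fun_eq_iff)

lemma smooth_pr1: "eopen (m + l) U \<Longrightarrow> smooth_vec_on (m + l) U m (pr1 m)"
  by (rule smooth_vecI) (auto simp: pr1_def Rn_iff intro: smooth_coord)

lemma smooth_pr2: "eopen (m + l) U \<Longrightarrow> smooth_vec_on (m + l) U l (pr2 m)"
  by (rule smooth_vecI) (use eopen_subset in \<open>fastforce simp: pr2_def Rn_iff\<close>,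
      auto simp: pr2_def intro: smooth_coord)

lemma smooth_va:
  assumes "smooth_vec_on k U m \<Phi>" "smooth_vec_on k U l \<Psi>"
  shows "smooth_vec_on k U (m + l) (\<lambda>x. va m (\<Phi> x) (\<Psi> x))"
proof (rule smooth_vecI)
  show "(\<lambda>x. va m (\<Phi> x) (\<Psi> x)) ` U \<subseteq> Rn (m + l)"
    using smooth_vecD(1)[OF assms(2)] va_Rn by blast
  show "smooth_fun_on k U (\<lambda>x. va m (\<Phi> x) (\<Psi> x) j)" if "j < m + l" for j
    using that smooth_vecD(2)[OF assms(1), of j] smooth_vecD(2)[OF assms(2), of "j - m"]
    by (cases "j < m") (auto simp: vec_append_def)
qed

lemma smooth_vec_const: "eopen m U \<Longrightarrow> c \<in> Rn l \<Longrightarrow> smooth_vec_on m U l (\<lambda>x. c)"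
  by (rule smooth_vecI) (auto intro: smooth_const)

lemma smooth_vec_id: "eopen m U \<Longrightarrow> smooth_vec_on m U m (\<lambda>x. x)"
  by (rule smooth_vecI) (use eopen_subset in \<open>auto intro: smooth_coord\<close>)

lemma eopen_prodset:
  assumes "eopen m U" "eopen l V"
  shows "eopen (m + l) (prodset m l U V)"
proof -
  have "prodset m l U V = {z \<in> {z \<in> Rn (m + l). pr1 m z \<in> U}. pr2 m z \<in> V}"
    by (auto simp: prodset_def)
  moreover have 1: "eopen (m + l) {z \<in> Rn (m + l). pr1 m z \<in> U}"
    by (rule eopen_vimage[OF eopen_Rn assms(1) smooth_pr1[OF eopen_Rn]])
  ultimately show ?thesis using eopen_vimage[OF 1 assms(2) smooth_pr2[OF 1]] by simp
qed

lemma sum_lessThan_add: "(\<Sum>j<m + l. f j) = (\<Sum>j<m. f j) + (\<Sum>j<l. f (m + j))" for f :: "nat \<Rightarrow> real"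
  by (induction l) (auto simp: algebra_simps)

text \<open>The one-variable functions behind the two sides coincide literally. The right-hand side
  depends smoothly on both groups of variables, which is how smooth dependence of derivatives on a
  base point is obtained later.\<close>

lemma slice2_dir_deriv:
  "dir_deriv l (\<lambda>b. K (va m x b)) b0 z = dir_deriv (m + l) K (va m x b0) (va m (\<lambda>i. 0) z)"
proof -
  have p: "partial (m + j) K (va m x b0) = partial j (\<lambda>b. K (va m x b)) b0" for j
  proof -
    have "(va m x b0)(m + j := t) = va m x (b0(j := t))" "va m x b0 (m + j) = b0 j" for t
      by (auto simp: vec_append_def fun_eq_iff)
    then show ?thesis by (simp add: partial_def)
  qed
  have "dir_deriv (m + l) K (va m x b0) (va m (\<lambda>i. 0) z) =
      (\<Sum>j<m. va m (\<lambda>i. 0) z j * partial j K (va m x b0)) +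
      (\<Sum>j<l. va m (\<lambda>i. 0) z (m + j) * partial (m + j) K (va m x b0))"
    unfolding dir_deriv_def by (rule sum_lessThan_add)
  also have "\<dots> = (\<Sum>j<l. z j * partial j (\<lambda>b. K (va m x b)) b0)"
    unfolding p by (simp add: vec_append_def)
  finally show ?thesis by (simp add: dir_deriv_def)
qed

lemma slice1_dir_deriv:
  "dir_deriv m (\<lambda>a. K (va m a b)) a0 v = dir_deriv (m + l) K (va m a0 b) (va m v (\<lambda>i. 0))"
proof -
  have p: "partial j K (va m a0 b) = partial j (\<lambda>a. K (va m a b)) a0" if "j < m" for j
  proof -
    have "(va m a0 b)(j := t) = va m (a0(j := t)) b" "va m a0 b j = a0 j" for t
      using that by (auto simp: vec_append_def fun_eq_iff)
    then show ?thesis by (simp add: partial_def)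
  qed
  have "dir_deriv (m + l) K (va m a0 b) (va m v (\<lambda>i. 0)) =
      (\<Sum>j<m. va m v (\<lambda>i. 0) j * partial j K (va m a0 b))"
    unfolding dir_deriv_def by (rule sum.mono_neutral_right) (auto simp: vec_append_def)
  also have "\<dots> = (\<Sum>j<m. v j * partial j (\<lambda>a. K (va m a b)) a0)"
    by (rule sum.cong[OF refl]) (simp add: p va_lt)
  finally show ?thesis by (simp add: dir_deriv_def)
qed

lemma jacobian_cong:
  assumes "eopen m U" "x \<in> U" "\<And>y. y \<in> U \<Longrightarrow> f y = g y"
  shows "jacobian m n f x v = jacobian m n g x v"
  unfolding jacobian_def using dir_deriv_cong[OF assms(1,2), of "\<lambda>y. f y _" "\<lambda>y. g y _"] assms(3)
  by (metis (no_types, lifting))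

lemma jacobian_lin:
  "jacobian m n \<Phi> x (\<lambda>i. a * v i + b * w i) = (\<lambda>i. a * jacobian m n \<Phi> x v i + b * jacobian m n \<Phi> x w i)"
  by (auto simp: jacobian_def dir_deriv_lin)

lemma jacobian_id: "v \<in> Rn m \<Longrightarrow> jacobian m m (\<lambda>y. y) x v = v"
  by (auto simp: jacobian_def dir_deriv_coord Rn_iff fun_eq_iff)

lemma jacobian_va:
  "jacobian k (m + l) (\<lambda>x. va m (\<Phi> x) (\<Psi> x)) x v = va m (jacobian k m \<Phi> x v) (jacobian k l \<Psi> x v)"
  by (auto simp: jacobian_def vec_append_def fun_eq_iff)

lemma jacobian_const: "jacobian m n (\<lambda>x. c) x v = (\<lambda>i. 0)"
  by (auto simp: jacobian_def dir_deriv_const)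

lemma eopen_vimage_real:
  assumes "eopen m U" "continuous_on U (f :: vec \<Rightarrow> real)" "open T"
  shows "eopen m {x \<in> U. f x \<in> T}"
proof -
  obtain A where "open A" "A \<inter> U = f -` T \<inter> U"
    using assms(2,3) unfolding continuous_on_open_invariant by blast
  moreover obtain B where "open B" "U = B \<inter> Rn m" using assms(1) eopen_eq by blast
  ultimately have "open (A \<inter> B)" "{x \<in> U. f x \<in> T} = (A \<inter> B) \<inter> Rn m" by auto
  then show ?thesis unfolding eopen_eq by blast
qed

section \<open>Smooth maps into a manifold\<close>

locale mfd =
  fixes M :: "'a manifold"
  assumes mfd: "smooth_manifold M"
begin

abbreviation "dm \<equiv> mdim M"

text \<open>The plots of the manifold diffeology without the demand that they be
  \<open>undefined\<close> off \<open>U\<close>, so that pointwise expressions such as products of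
  maps qualify.\<close>

definition sm :: "nat \<Rightarrow> vec set \<Rightarrow> (vec \<Rightarrow> 'a) \<Rightarrow> bool" where
  "sm m U p \<longleftrightarrow> eopen m U \<and> smooth_map (open_submanifold m U) M p"

lemma hausdorff: "Hausdorff_space (mtop M)"
  using mfd by (simp add: smooth_manifold_def)

lemma chart_at:
  assumes "g \<in> topspace (mtop M)"
  obtains W \<psi> where "(W, \<psi>) \<in> charts M" "g \<in> W"
proof -
  have "g \<in> (\<Union>(W, \<psi>)\<in>charts M. W)" using mfd assms by (simp add: smooth_manifold_def)
  then show ?thesis using that by auto
qed

lemma chart:
  assumes "(W, \<psi>) \<in> charts M"
  shows "openin (mtop M) W" "eopen dm (\<psi> ` W)" "inj_on \<psi> W"
    "\<And>T. openin (mtop M) T \<Longrightarrow> eopen dm (\<psi> ` (W \<inter> T))"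
    "W \<subseteq> topspace (mtop M)" "\<And>g. g \<in> W \<Longrightarrow> inv_into W \<psi> (\<psi> g) = g"
    "\<And>g. g \<in> W \<Longrightarrow> \<psi> g \<in> Rn dm"
proof -
  have c: "openin (mtop M) W \<and> eopen dm (\<psi> ` W) \<and>
        homeomorphic_map (subtopology (mtop M) W) (subtopology (Euclidean_space dm) (\<psi> ` W)) \<psi>"
    using mfd assms unfolding smooth_manifold_def by fast
  show 1: "openin (mtop M) W" and 2: "eopen dm (\<psi> ` W)" using c by auto
  show sub: "W \<subseteq> topspace (mtop M)" using openin_subset[OF 1] .
  then have ts: "topspace (subtopology (mtop M) W) = W" by auto
  show inj: "inj_on \<psi> W" using homeomorphic_imp_injective_map[OF conjunct2[OF conjunct2[OF c]]] ts by simp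
  show "eopen dm (\<psi> ` (W \<inter> T))" if "openin (mtop M) T" for T
  proof -
    have "openin (subtopology (mtop M) W) (W \<inter> T)"
      using that by (simp add: openin_subtopology_Int2)
    then have "openin (subtopology (Euclidean_space dm) (\<psi> ` W)) (\<psi> ` (W \<inter> T))"
      using homeomorphic_imp_open_map[OF conjunct2[OF conjunct2[OF c]]] unfolding open_map_def by blast
    then show ?thesis using openin_open_subtopology[OF 2] by blast
  qed
  show "inv_into W \<psi> (\<psi> g) = g" if "g \<in> W" for g using inj that by simp
  show "\<psi> g \<in> Rn dm" if "g \<in> W" for g using eopen_subset[OF 2] that by blast
qed

lemma transition:
  assumes "(W, \<psi>) \<in> charts M" "(W', \<kappa>) \<in> charts M"
  shows "smooth_vec_on dm (\<psi> ` (W \<inter> W')) dm (\<lambda>y. \<kappa> (inv_into W \<psi> y))"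
  using mfd assms unfolding smooth_manifold_def comp_def by fast

lemma sm_eopen: "sm m U p \<Longrightarrow> eopen m U"
  by (simp add: sm_def)

lemma sm_continuous: "sm m U p \<Longrightarrow> continuous_map (top_of_set U) (mtop M) p"
  using subtopology_Rn[of U m] eopen_subset[of m U]
  by (simp add: sm_def smooth_map_def open_submanifold_def)

lemma sm_into: "sm m U p \<Longrightarrow> x \<in> U \<Longrightarrow> p x \<in> topspace (mtop M)"
  using sm_continuous[of m U p] unfolding continuous_map_def by auto

lemma eopen_preimage:
  assumes "eopen m U" "continuous_map (top_of_set U) (mtop M) p" "openin (mtop M) T"
  shows "eopen m {x \<in> U. p x \<in> T}"
proof -
  have "openin (top_of_set U) {x \<in> U. p x \<in> T}"
    using openin_continuous_map_preimage[OF assms(2,3)] by simp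
  then show ?thesis using assms(1) subtopology_Rn[OF eopen_subset[OF assms(1)]] openin_open_subtopology[OF assms(1)]
    by simp
qed

lemma sm_open: "sm m U p \<Longrightarrow> openin (mtop M) T \<Longrightarrow> eopen m {x \<in> U. p x \<in> T}"
  by (rule eopen_preimage[OF sm_eopen sm_continuous])

lemma sm_iff:
  "sm m U p \<longleftrightarrow> eopen m U \<and> continuous_map (top_of_set U) (mtop M) p \<and>
    (\<forall>(W, \<psi>)\<in>charts M. smooth_vec_on m {x \<in> U. p x \<in> W} dm (\<lambda>x. \<psi> (p x)))"
proof (cases "eopen m U \<and> continuous_map (top_of_set U) (mtop M) p")
  case True
  have "smooth_vec_on m {x \<in> U. p x \<in> W} dm (\<psi> \<circ> p \<circ> inv_into U (\<lambda>x. x)) \<longleftrightarrow>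
      smooth_vec_on m {x \<in> U. p x \<in> W} dm (\<lambda>x. \<psi> (p x))" if "(W, \<psi>) \<in> charts M" for W \<psi>
    by (rule smooth_vec_cong[OF eopen_preimage[OF _ _ chart(1)[OF that]]])
      (use True in auto)
  then show ?thesis
    using True subtopology_Rn[of U m] eopen_subset[of m U]
    by (fastforce simp: sm_def smooth_map_def open_submanifold_def)
next
  case False
  then show ?thesis using sm_eopen sm_continuous by blast
qed

lemma sm_chart: "sm m U p \<Longrightarrow> (W, \<psi>) \<in> charts M \<Longrightarrow> smooth_vec_on m {x \<in> U. p x \<in> W} dm (\<lambda>x. \<psi> (p x))"
  unfolding sm_iff by blast

text \<open>One chart near each point suffices for smoothness in all charts, because the transition
  maps are smooth; continuity into \<open>M\<close> follows as well, since charts are open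
  maps.\<close>

lemma smI:
  assumes U: "eopen m U"
    and loc: "\<And>x. x \<in> U \<Longrightarrow> \<exists>V W \<psi>. x \<in> V \<and> V \<subseteq> U \<and> eopen m V \<and> (W, \<psi>) \<in> charts M \<and> p ` V \<subseteq> W \<and>
      smooth_vec_on m V dm (\<lambda>x. \<psi> (p x))"
  shows "sm m U p"
proof -
  have pre: "eopen m {y \<in> V. p y \<in> T}"
    if V: "eopen m V" "(W, \<psi>) \<in> charts M" "p ` V \<subseteq> W" "smooth_vec_on m V dm (\<lambda>x. \<psi> (p x))"
      and T: "openin (mtop M) T" for V W \<psi> T
  proof -
    have "{y \<in> V. p y \<in> T} = {y \<in> V. \<psi> (p y) \<in> \<psi> ` (W \<inter> T)}"
    proof (intro Collect_cong conj_cong refl)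
      fix y assume "y \<in> V"
      then have "p y \<in> W" using V by blast
      then show "p y \<in> T \<longleftrightarrow> \<psi> (p y) \<in> \<psi> ` (W \<inter> T)"
        using chart(3)[OF V(2)] by (auto simp: inj_on_def)
    qed
    then show ?thesis using eopen_vimage[OF V(1) chart(4)[OF V(2) T] V(4)] by simp
  qed
  have cont: "continuous_map (top_of_set U) (mtop M) p"
    unfolding continuous_map_def
  proof (intro conjI allI impI)
    show "p \<in> topspace (top_of_set U) \<rightarrow> topspace (mtop M)"
      using loc chart(5) by (auto simp: Pi_iff) (meson imageI subsetD)
    fix T assume T: "openin (mtop M) T"
    have "eopen m {x \<in> U. p x \<in> T}"
    proof (subst openin_subopen, safe)
      fix x assume x: "x \<in> U" "p x \<in> T"
      from loc[OF x(1)] obtain V W \<psi> where V: "x \<in> V" "V \<subseteq> U" "eopen m V" "(W, \<psi>) \<in> charts M" "p ` V \<subseteq> W"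
        "smooth_vec_on m V dm (\<lambda>x. \<psi> (p x))" by blast
      show "\<exists>A. eopen m A \<and> x \<in> A \<and> A \<subseteq> {x \<in> U. p x \<in> T}"
        using pre[OF V(3-6) T] V x by (intro exI[of _ "{y \<in> V. p y \<in> T}"]) auto
    qed
    then show "openin (top_of_set U) {x \<in> topspace (top_of_set U). p x \<in> T}"
      using openin_open_subtopology[OF U] subtopology_Rn[OF eopen_subset[OF U]] by auto
  qed
  show ?thesis
    unfolding sm_iff
  proof (intro conjI U cont ballI, clarify)
    fix W' \<kappa> assume c': "(W', \<kappa>) \<in> charts M"
    have o: "eopen m {x \<in> U. p x \<in> W'}" by (rule eopen_preimage[OF U cont chart(1)[OF c']])
    show "smooth_vec_on m {x \<in> U. p x \<in> W'} dm (\<lambda>x. \<kappa> (p x))"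
    proof (rule smooth_vec_local[OF o])
      fix x assume x: "x \<in> {x \<in> U. p x \<in> W'}"
      then have "x \<in> U" by simp
      from loc[OF this] obtain V W \<psi> where V: "x \<in> V" "V \<subseteq> U" "eopen m V" "(W, \<psi>) \<in> charts M" "p ` V \<subseteq> W"
        "smooth_vec_on m V dm (\<lambda>x. \<psi> (p x))" by blast
      let ?V = "{y \<in> V. p y \<in> W'}"
      have o': "eopen m ?V" by (rule pre[OF V(3-6) chart(1)[OF c']])
      have "smooth_vec_on m ?V dm (\<lambda>x. \<kappa> (inv_into W \<psi> (\<psi> (p x))))"
        by (rule smooth_vec_compose[OF o' chart(4)[OF V(4) chart(1)[OF c']] _ _ transition[OF V(4) c'], of "\<lambda>x. \<psi> (p x)"])
          (use smooth_vec_on_subset[OF _ V(6), of ?V] V(5) in auto)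
      then have "smooth_vec_on m ?V dm (\<lambda>x. \<kappa> (p x))"
        by (rule smooth_vec_cong[OF o', THEN iffD1, rotated]) (use V(5) chart(6)[OF V(4)] in force)
      then show "\<exists>V. x \<in> V \<and> eopen m V \<and> smooth_vec_on m V dm (\<lambda>x. \<kappa> (p x))"
        using o' x V(1) by (intro exI[of _ ?V]) auto
    qed
  qed
qed

lemma sm_chart_inv:
  assumes c: "(W, \<psi>) \<in> charts M"
  shows "sm dm (\<psi> ` W) (inv_into W \<psi>)"
proof (rule smI[OF chart(2)[OF c]])
  fix x assume x: "x \<in> \<psi> ` W"
  have "smooth_vec_on dm (\<psi> ` W) dm (\<lambda>x. \<psi> (inv_into W \<psi> x))"
    by (rule smooth_vec_cong[OF chart(2)[OF c], THEN iffD1, OF _ smooth_vec_id[OF chart(2)[OF c]]])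
      (auto simp: chart(6)[OF c])
  moreover have "inv_into W \<psi> ` (\<psi> ` W) \<subseteq> W" by (auto simp: chart(6)[OF c])
  ultimately show "\<exists>V W' \<psi>'. x \<in> V \<and> V \<subseteq> \<psi> ` W \<and> eopen dm V \<and> (W', \<psi>') \<in> charts M \<and> inv_into W \<psi> ` V \<subseteq> W' \<and>
      smooth_vec_on dm V dm (\<lambda>x. \<psi>' (inv_into W \<psi> x))"
    using c x chart(2)[OF c] by blast
qed

lemma sm_compose:
  assumes p: "sm n V p" and U: "eopen m U" and \<Phi>: "smooth_vec_on m U n \<Phi>" "\<Phi> ` U \<subseteq> V"
  shows "sm m U (\<lambda>x. p (\<Phi> x))"
proof (rule smI[OF U])
  fix x assume x: "x \<in> U"
  then have "p (\<Phi> x) \<in> topspace (mtop M)" using sm_into[OF p] \<Phi>(2) by blast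
  then obtain W \<psi> where c: "(W, \<psi>) \<in> charts M" "p (\<Phi> x) \<in> W" by (rule chart_at)
  let ?A = "{z \<in> V. p z \<in> W}" and ?V = "{y \<in> U. \<Phi> y \<in> {z \<in> V. p z \<in> W}}"
  have A: "eopen n ?A" by (rule sm_open[OF p chart(1)[OF c(1)]])
  have V: "eopen m ?V" by (rule eopen_vimage[OF U A \<Phi>(1)])
  have "smooth_vec_on m ?V dm (\<lambda>x. \<psi> (p (\<Phi> x)))"
    by (rule smooth_vec_compose[OF V A _ _ sm_chart[OF p c(1)]])
      (use smooth_vec_on_subset[OF _ \<Phi>(1), of ?V] in auto)
  then show "\<exists>V W \<psi>. x \<in> V \<and> V \<subseteq> U \<and> eopen m V \<and> (W, \<psi>) \<in> charts M \<and> (\<lambda>x. p (\<Phi> x)) ` V \<subseteq> W \<and>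
      smooth_vec_on m V dm (\<lambda>x. \<psi> (p (\<Phi> x)))"
    using c V x \<Phi>(2) by (intro exI[of _ ?V] exI[of _ W] exI[of _ \<psi>]) auto
qed

lemma sm_subset: "sm m U p \<Longrightarrow> eopen m V \<Longrightarrow> V \<subseteq> U \<Longrightarrow> sm m V p"
  using sm_compose[of m U p m V "\<lambda>x. x"] smooth_vec_id[of m V] by simp

lemma sm_cong:
  assumes p: "sm m U p" and eq: "\<And>x. x \<in> U \<Longrightarrow> p x = q x"
  shows "sm m U q"
proof (rule smI[OF sm_eopen[OF p]])
  fix x assume x: "x \<in> U"
  obtain W \<psi> where c: "(W, \<psi>) \<in> charts M" "p x \<in> W" using sm_into[OF p x] by (rule chart_at)
  have o: "eopen m {y \<in> U. p y \<in> W}" by (rule sm_open[OF p chart(1)[OF c(1)]])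
  have "smooth_vec_on m {y \<in> U. p y \<in> W} dm (\<lambda>x. \<psi> (q x))"
    by (rule smooth_vec_cong[OF o, THEN iffD1, OF _ sm_chart[OF p c(1)]]) (use eq in auto)
  then show "\<exists>V W \<psi>. x \<in> V \<and> V \<subseteq> U \<and> eopen m V \<and> (W, \<psi>) \<in> charts M \<and> q ` V \<subseteq> W \<and>
      smooth_vec_on m V dm (\<lambda>x. \<psi> (q x))"
    using c o x eq by (intro exI[of _ "{y \<in> U. p y \<in> W}"] exI[of _ W] exI[of _ \<psi>]) auto
qed

lemma sm_const:
  assumes "g \<in> topspace (mtop M)" "eopen m U"
  shows "sm m U (\<lambda>x. g)"
proof (rule smI[OF assms(2)])
  fix x assume "x \<in> U"
  obtain W \<psi> where c: "(W, \<psi>) \<in> charts M" "g \<in> W" using assms(1) by (rule chart_at)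
  then show "\<exists>V W \<psi>. x \<in> V \<and> V \<subseteq> U \<and> eopen m V \<and> (W, \<psi>) \<in> charts M \<and> (\<lambda>x. g) ` V \<subseteq> W \<and>
      smooth_vec_on m V dm (\<lambda>x. \<psi> g)"
    using \<open>x \<in> U\<close> assms(2) smooth_vec_const[OF assms(2) chart(7)[OF c]]
    by (intro exI[of _ U] exI[of _ W] exI[of _ \<psi>]) auto
qed

subsection \<open>Smooth functions\<close>

abbreviation "SF \<equiv> smooth_functions M"

lemma sf_zero: "f \<in> SF \<Longrightarrow> p \<notin> topspace (mtop M) \<Longrightarrow> f p = 0"
  by (simp add: smooth_functions_def)

lemma sf_sm:
  assumes f: "f \<in> SF" and p: "sm m U p"
  shows "smooth_fun_on m U (\<lambda>x. f (p x))"
proof (rule smooth_local[OF sm_eopen[OF p]])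
  fix x assume x: "x \<in> U"
  obtain W \<psi> where c: "(W, \<psi>) \<in> charts M" "p x \<in> W" using sm_into[OF p x] by (rule chart_at)
  have o: "eopen m {y \<in> U. p y \<in> W}" by (rule sm_open[OF p chart(1)[OF c(1)]])
  have f': "smooth_fun_on dm (\<psi> ` W) (\<lambda>y. f (inv_into W \<psi> y))"
    using f c(1) unfolding smooth_functions_def comp_def by fast
  have "smooth_fun_on m {y \<in> U. p y \<in> W} (\<lambda>x. f (inv_into W \<psi> (\<psi> (p x))))"
    by (rule smooth_compose[OF o chart(2)[OF c(1)] sm_chart[OF p c(1)] _ f']) auto
  then have "smooth_fun_on m {y \<in> U. p y \<in> W} (\<lambda>x. f (p x))"
    by (rule smooth_cong[OF o, THEN iffD1, rotated]) (auto simp: chart(6)[OF c(1)])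
  then show "\<exists>V. x \<in> V \<and> eopen m V \<and> smooth_fun_on m V (\<lambda>x. f (p x))"
    using x c o by (intro exI[of _ "{y \<in> U. p y \<in> W}"]) auto
qed

lemma sfI:
  assumes "\<And>p. p \<notin> topspace (mtop M) \<Longrightarrow> f p = 0"
    and "\<And>m U p. sm m U p \<Longrightarrow> smooth_fun_on m U (\<lambda>x. f (p x))"
  shows "f \<in> SF"
  using assms(1) assms(2)[OF sm_chart_inv] by (auto simp: smooth_functions_def comp_def)

lemma sf_add: "f \<in> SF \<Longrightarrow> g \<in> SF \<Longrightarrow> (\<lambda>p. f p + g p) \<in> SF"
  by (rule sfI) (auto simp: sf_zero intro: smooth_add[OF sm_eopen sf_sm sf_sm])

lemma sf_mult: "f \<in> SF \<Longrightarrow> g \<in> SF \<Longrightarrow> (\<lambda>p. f p * g p) \<in> SF"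
  by (rule sfI) (auto simp: sf_zero intro: smooth_mult[OF sm_eopen sf_sm sf_sm])

lemma sf_0: "(\<lambda>p. 0) \<in> SF"
  by (rule sfI) (auto intro!: smooth_const dest: sm_eopen)

lemma sf_cmult: "f \<in> SF \<Longrightarrow> (\<lambda>p. c * f p) \<in> SF"
  by (rule sfI) (auto simp: sf_zero intro: smooth_cmult[OF sm_eopen sf_sm])

lemma sf_lin: "f \<in> SF \<Longrightarrow> g \<in> SF \<Longrightarrow> (\<lambda>p. a * f p + b * g p) \<in> SF"
  by (intro sf_add sf_cmult)

lemma sf_sum: "(\<And>i. i \<in> A \<Longrightarrow> f i \<in> SF) \<Longrightarrow> (\<lambda>p. \<Sum>i\<in>A. f i p) \<in> SF"
  by (induction A rule: infinite_finite_induct) (auto intro: sf_0 sf_add)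

text \<open>The function \<open>b\<close> is concentrated in a coordinate cube around
  \<open>g\<close> inside \<open>W\<close> and \<open>T\<close>. The last clause is the point: a
  function \<open>u\<close> that is smooth on this cube only becomes a global smooth function after
  multiplication by \<open>b\<close>.\<close>

definition is_bump :: "'a set \<Rightarrow> ('a \<Rightarrow> vec) \<Rightarrow> 'a \<Rightarrow> 'a set \<Rightarrow> real \<Rightarrow> ('a \<Rightarrow> real) \<Rightarrow> bool" where
  "is_bump W \<psi> g T r b \<longleftrightarrow> r > 0 \<and> b \<in> SF \<and> b g = 1 \<and> cube dm (\<psi> g) r \<subseteq> \<psi> ` (W \<inter> T) \<and>
    (\<forall>p. b p \<noteq> 0 \<longrightarrow> p \<in> W \<and> p \<in> T \<and> \<psi> p \<in> cube dm (\<psi> g) r) \<and>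
    (\<forall>u. smooth_fun_on dm (cube dm (\<psi> g) r) u \<longrightarrow> (\<lambda>p. b p * u (\<psi> p)) \<in> SF)"

lemma is_bumpD:
  assumes "is_bump W \<psi> g T r b"
  shows "r > 0" "b \<in> SF" "b g = 1" "cube dm (\<psi> g) r \<subseteq> \<psi> ` (W \<inter> T)"
    "\<And>p. b p \<noteq> 0 \<Longrightarrow> p \<in> W \<and> p \<in> T \<and> \<psi> p \<in> cube dm (\<psi> g) r"
    "\<And>u. smooth_fun_on dm (cube dm (\<psi> g) r) u \<Longrightarrow> (\<lambda>p. b p * u (\<psi> p)) \<in> SF"
  using assms by (auto simp: is_bump_def)

text \<open>The extension by 0 out of the chart is smooth because the support lies in a compact set
  \<open>Q\<close>, and compact sets are closed in a Hausdorff space.\<close>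

lemma bump_mfd:
  assumes c: "(W, \<psi>) \<in> charts M" and g: "g \<in> W" and T: "openin (mtop M) T" "g \<in> T"
  shows "\<exists>r b. is_bump W \<psi> g T r b"
proof -
  have gR: "\<psi> g \<in> Rn dm" by (rule chart(7)[OF c g])
  obtain r where r: "r > 0" "cube dm (\<psi> g) r \<subseteq> \<psi> ` (W \<inter> T)"
    using eopen_contains_cube[OF chart(4)[OF c T(1)], of "\<psi> g"] g T(2) by blast
  \<comment> \<open>Half the radius: the closed cube \<open>K\<close> then separates the support of
    \<open>b0\<close> from the boundary of the cube of radius \<open>r\<close>.\<close>
  obtain b0 where b0: "smooth_fun_on dm (Rn dm) b0" "b0 (\<psi> g) = 1"
    "\<And>x. x \<in> Rn dm \<Longrightarrow> b0 x \<noteq> 0 \<Longrightarrow> x \<in> cube dm (\<psi> g) (r / 2)"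
    using bump_exists[OF gR, of "r / 2"] r(1) by auto
  define K where "K = ccube dm (\<psi> g) (r / 2)"
  have K1: "cube dm (\<psi> g) (r / 2) \<subseteq> K" by (auto simp: K_def ccube_def cube_def less_imp_le)
  have K2: "K \<subseteq> cube dm (\<psi> g) r" using r(1) by (force simp: K_def ccube_def cube_def)
  define Q where "Q = inv_into W \<psi> ` K"
  have "compactin (top_of_set (\<psi> ` W)) K"
    using K2 r(2) compact_ccube unfolding K_def by (auto simp: compactin_subtopology)
  then have "compactin (mtop M) Q"
    unfolding Q_def by (rule image_compactin[OF _ sm_continuous[OF sm_chart_inv[OF c]]])
  then have Qc: "closedin (mtop M) Q" by (rule compactin_imp_closedin[OF hausdorff])
  have Q: "p \<in> Q" if "p \<in> W" "\<psi> p \<in> K" for p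
    unfolding Q_def using that chart(6)[OF c that(1)] by (metis imageI)
  define b where "b p = (if p \<in> W \<and> \<psi> p \<in> cube dm (\<psi> g) r then b0 (\<psi> p) else 0)" for p
  have main: "(\<lambda>p. b p * u (\<psi> p)) \<in> SF" if u: "smooth_fun_on dm (cube dm (\<psi> g) r) u" for u
  proof (rule sfI)
    show "b p * u (\<psi> p) = 0" if "p \<notin> topspace (mtop M)" for p
      using that chart(5)[OF c] by (auto simp: b_def)
    fix m U p assume p: "sm m U p"
    note U = sm_eopen[OF p]
    show "smooth_fun_on m U (\<lambda>x. b (p x) * u (\<psi> (p x)))"
    proof (rule smooth_local[OF U])
      fix x assume x: "x \<in> U"
      let ?V = "{y \<in> {y \<in> U. p y \<in> W}. \<psi> (p y) \<in> cube dm (\<psi> g) r}"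
      show "\<exists>V. x \<in> V \<and> eopen m V \<and> smooth_fun_on m V (\<lambda>x. b (p x) * u (\<psi> (p x)))"
      proof (cases "x \<in> ?V")
        case True
        have V: "eopen m ?V" by (rule eopen_vimage[OF sm_open[OF p chart(1)[OF c]] eopen_cube sm_chart[OF p c]])
        have bu: "smooth_fun_on dm (cube dm (\<psi> g) r) (\<lambda>y. b0 y * u y)"
          by (intro smooth_mult eopen_cube u smooth_subset[OF b0(1)]) (auto simp: cube_def)
        have "smooth_fun_on m ?V (\<lambda>x. b0 (\<psi> (p x)) * u (\<psi> (p x)))"
          by (rule smooth_compose[OF V eopen_cube smooth_vec_on_subset[OF _ sm_chart[OF p c]] _ bu]) auto
        then have "smooth_fun_on m ?V (\<lambda>x. b (p x) * u (\<psi> (p x)))"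
          by (rule smooth_cong[OF V, THEN iffD1, rotated]) (auto simp: b_def)
        then show ?thesis using True V by (intro exI[of _ ?V]) auto
      next
        case False
        have "\<psi> (inv_into W \<psi> y) = y" if "y \<in> K" for y
          by (rule f_inv_into_f) (use that K2 r(2) in blast)
        moreover have "inv_into W \<psi> y \<in> W" if "y \<in> K" for y
          by (rule inv_into_into) (use that K2 r(2) in blast)
        ultimately have "p x \<notin> Q" using False x K2 by (auto simp: Q_def)
        let ?N = "{y \<in> U. p y \<in> topspace (mtop M) - Q}"
        have N: "eopen m ?N" by (rule sm_open[OF p]) (use Qc in blast)
        have z: "b (p y) * u (\<psi> (p y)) = 0" if "y \<in> ?N" for y
          using that Q[of "p y"] K1 b0(3)[of "\<psi> (p y)"] chart(7)[OF c] by (auto simp: b_def)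
        have "smooth_fun_on m ?N (\<lambda>x. b (p x) * u (\<psi> (p x)))"
          by (rule smooth_cong[OF N, THEN iffD1, OF _ smooth_const[OF N, of 0]]) (use z in auto)
        then show ?thesis using x \<open>p x \<notin> Q\<close> sm_into[OF p x] N by (intro exI[of _ ?N]) auto
      qed
    qed
  qed
  have "b \<in> SF" using main[OF smooth_const[OF eopen_cube, where c=1]] by simp
  moreover have "b g = 1" using g b0(2) mem_cube_self[OF gR r(1)] by (simp add: b_def)
  moreover have "p \<in> W \<and> p \<in> T \<and> \<psi> p \<in> cube dm (\<psi> g) r" if "b p \<noteq> 0" for p
  proof -
    have p: "p \<in> W" "\<psi> p \<in> cube dm (\<psi> g) r" using that by (auto simp: b_def split: if_splits)
    then obtain q where "q \<in> W \<inter> T" "\<psi> p = \<psi> q" using r(2) by blast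
    then show ?thesis using p chart(3)[OF c] by (metis IntD1 IntD2 inj_onD)
  qed
  ultimately show ?thesis unfolding is_bump_def using r main by (intro exI[of _ r] exI[of _ b] conjI allI impI) auto
qed

text \<open>Turns an equality tested on all smooth functions into one of points, as in the
  uniqueness of integral curves. A bump at one point supported off the other tells them
  apart.\<close>

lemma sf_separates:
  assumes "p \<in> topspace (mtop M)" "q \<in> topspace (mtop M)" "\<And>f. f \<in> SF \<Longrightarrow> f p = f q"
  shows "p = q"
proof (rule ccontr)
  assume "p \<noteq> q"
  then obtain T where T: "openin (mtop M) T" "p \<in> T" "q \<notin> T"
    using hausdorff assms(1,2) unfolding Hausdorff_space_def disjnt_iff by meson
  obtain W \<psi> where c: "(W, \<psi>) \<in> charts M" "p \<in> W" using assms(1) by (rule chart_at)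
  obtain r b where "is_bump W \<psi> p T r b" using bump_mfd[OF c T(1,2)] by blast
  note b = is_bumpD[OF this]
  show False using b(5)[of q] assms(3)[OF b(2)] b(3) T(3) by simp
qed

text \<open>Where a bump at \<open>p x\<close> is positive, a chart coordinate is the quotient of
  two global functions, the bump times this coordinate and the bump itself. That set is open in
  \<open>U\<close>, as the bump composed with \<open>p\<close> is continuous.\<close>

lemma sm_via_functions:
  assumes U: "eopen m U" and into: "\<And>x. x \<in> U \<Longrightarrow> p x \<in> topspace (mtop M)"
    and fp: "\<And>f. f \<in> SF \<Longrightarrow> smooth_fun_on m U (\<lambda>x. f (p x))"
  shows "sm m U p"
proof (rule smI[OF U])
  fix x assume x: "x \<in> U"
  obtain W \<psi> where c: "(W, \<psi>) \<in> charts M" "p x \<in> W" using into[OF x] by (rule chart_at)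
  obtain r b where "is_bump W \<psi> (p x) W r b" using bump_mfd[OF c chart(1)[OF c(1)] c(2)] by blast
  note b' = is_bumpD[OF this]
  note b = b'(2,3,5,6)
  let ?V = "{y \<in> U. b (p y) \<in> {0<..}}"
  have V: "eopen m ?V" by (rule eopen_vimage_real[OF U smooth_continuous[OF fp[OF b(1)]]]) simp
  have W: "p ` ?V \<subseteq> W" using b(3) by fastforce
  have "smooth_vec_on m ?V dm (\<lambda>x. \<psi> (p x))"
  proof (rule smooth_vecI)
    show "(\<lambda>x. \<psi> (p x)) ` ?V \<subseteq> Rn dm" using W chart(7)[OF c(1)] by blast
    fix j
    have "smooth_fun_on m U (\<lambda>x. b (p x) * (\<psi> (p x)) j)"
      by (rule fp[OF b(4)[OF smooth_coord[OF eopen_cube]]])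
    then have "smooth_fun_on m ?V (\<lambda>x. (b (p x) * (\<psi> (p x)) j) / b (p x))"
      by (intro smooth_divide[OF V smooth_subset smooth_subset[OF fp[OF b(1)]]]) auto
    then show "smooth_fun_on m ?V (\<lambda>x. \<psi> (p x) j)"
      by (rule smooth_cong[OF V, THEN iffD1, rotated]) auto
  qed
  then show "\<exists>V W \<psi>. x \<in> V \<and> V \<subseteq> U \<and> eopen m V \<and> (W, \<psi>) \<in> charts M \<and> p ` V \<subseteq> W \<and>
      smooth_vec_on m V dm (\<lambda>x. \<psi> (p x))"
    using x b(2) V W c(1) by (intro exI[of _ ?V] exI[of _ W] exI[of _ \<psi>]) auto
qed

end

section \<open>Left-invariant vector fields and the Maurer--Cartan form\<close>

text \<open>One chart around the unit is fixed throughout. It identifies the tangent space there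
  with \<open>Rn dm\<close>; the unit has coordinates \<open>e0\<close>, which may differ from
  0.\<close>

locale lie_grp = mfd M for M :: "'a manifold" +
  fixes G :: "('a, 'z) monoid_scheme" (structure) and W0 :: "'a set" and \<phi>0 :: "'a \<Rightarrow> vec"
  assumes LG: "lie_group G M" and c0: "(W0, \<phi>0) \<in> charts M" and one_W0: "\<one> \<in> W0"
begin

abbreviation "e0 \<equiv> \<phi>0 \<one>"
abbreviation "\<psi>0 \<equiv> inv_into W0 \<phi>0"
abbreviation "V0 \<equiv> \<phi>0 ` W0"
abbreviation iG ("\<iota> _" [81] 80) where "iG g \<equiv> inv\<^bsub>G\<^esub> g"

sublocale group G using LG by (simp add: lie_group_def)

lemma top_carrier: "topspace (mtop M) = carrier G"
  using LG by (simp add: lie_group_def)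

lemma V0: "eopen dm V0" "e0 \<in> V0" "e0 \<in> Rn dm"
  using chart(2)[OF c0] one_W0 chart(7)[OF c0] by auto

lemma \<psi>0: "sm dm V0 \<psi>0" "\<psi>0 e0 = \<one>" "\<And>b. b \<in> V0 \<Longrightarrow> \<psi>0 b \<in> carrier G"
  using sm_chart_inv[OF c0] chart(6)[OF c0 one_W0] sm_into[OF sm_chart_inv[OF c0]] top_carrier by auto

lemma \<phi>0_\<psi>0: "b \<in> V0 \<Longrightarrow> \<phi>0 (\<psi>0 b) = b"
  by (rule f_inv_into_f)

lemma sm_carrier: "sm m U p \<Longrightarrow> x \<in> U \<Longrightarrow> p x \<in> carrier G"
  using sm_into top_carrier by blast

section \<open>Products, inverses and translations of smooth maps\<close>

lemma sm_mult:
  assumes p: "sm m U p" and q: "sm m U q"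
  shows "sm m U (\<lambda>x. p x \<otimes> q x)"
proof (rule smI[OF sm_eopen[OF p]])
  fix x assume x: "x \<in> U"
  let ?\<mu> = "\<lambda>(p, q). p \<otimes> q"
  have pq: "p x \<in> carrier G" "q x \<in> carrier G" using sm_carrier p q x by auto
  obtain W1 \<phi>1 where c1: "(W1, \<phi>1) \<in> charts M" "p x \<in> W1" using sm_into[OF p x] by (rule chart_at)
  obtain W2 \<phi>2 where c2: "(W2, \<phi>2) \<in> charts M" "q x \<in> W2" using sm_into[OF q x] by (rule chart_at)
  obtain W \<psi> where c: "(W, \<psi>) \<in> charts M" "p x \<otimes> q x \<in> W"
    by (rule chart_at[of "p x \<otimes> q x"]) (use pq top_carrier in auto)
  have sm\<mu>: "smooth_map (prod_manifold M M) M ?\<mu>" using LG by (simp add: lie_group_def)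
  then have "continuous_map (prod_topology (mtop M) (mtop M)) (mtop M) ?\<mu>"
    by (simp add: smooth_map_def prod_manifold_def)
  from openin_continuous_map_preimage[OF this chart(1)[OF c(1)]]
  have "openin (prod_topology (mtop M) (mtop M))
      {z \<in> topspace (prod_topology (mtop M) (mtop M)). ?\<mu> z \<in> W}" .
  moreover have "(p x, q x) \<in> {z \<in> topspace (prod_topology (mtop M) (mtop M)). ?\<mu> z \<in> W}"
    using pq c(2) top_carrier by simp
  ultimately obtain T1 T2 where T: "openin (mtop M) T1" "openin (mtop M) T2" "p x \<in> T1" "q x \<in> T2"
    "T1 \<times> T2 \<subseteq> {z \<in> topspace (prod_topology (mtop M) (mtop M)). ?\<mu> z \<in> W}"
    unfolding openin_prod_topology_alt by meson
  define O1 where "O1 = W1 \<inter> T1"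
  define O2 where "O2 = W2 \<inter> T2"
  have O: "openin (mtop M) O1" "openin (mtop M) O2"
    unfolding O1_def O2_def using T chart(1) c1 c2 by blast+
  let ?\<Phi> = "\<lambda>(p, q). va dm (\<phi>1 p) (\<phi>2 q)"
  let ?S = "?\<Phi> ` {z \<in> W1 \<times> W2. ?\<mu> z \<in> W}"
  \<comment> \<open>\<open>?S\<close> is the domain in the definition of \<open>smooth_map\<close>.
    The calculus wants an open set, which the box \<open>?B\<close> is by construction.\<close>
  let ?B = "prodset dm dm (\<phi>1 ` O1) (\<phi>2 ` O2)"
  have B: "eopen (dm + dm) ?B"
    unfolding O1_def O2_def by (intro eopen_prodset chart(4) c1 c2 T)
  have inj: "inj_on ?\<Phi> (W1 \<times> W2)"
  proof (rule inj_onI, clarify)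
    fix a b a' b' assume h: "a \<in> W1" "b \<in> W2" "a' \<in> W1" "b' \<in> W2"
      "va dm (\<phi>1 a) (\<phi>2 b) = va dm (\<phi>1 a') (\<phi>2 b')"
    then have "\<phi>1 a = \<phi>1 a' \<and> \<phi>2 b = \<phi>2 b'"
      by (intro va_inj[of _ dm]) (auto intro: chart(7)[OF c1(1)])
    then show "a = a' \<and> b = b'" using h chart(3)[OF c1(1)] chart(3)[OF c2(1)] by (meson inj_onD)
  qed
  have BS: "?B \<subseteq> ?S"
  proof
    fix z assume z: "z \<in> ?B"
    then obtain a b where ab: "a \<in> O1" "b \<in> O2" "pr1 dm z = \<phi>1 a" "pr2 dm z = \<phi>2 b"
      by (auto simp: prodset_def)
    have "z = ?\<Phi> (a, b)" using va_pr[of z dm dm] z ab by (simp add: prodset_def)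
    moreover have "(a, b) \<in> {z \<in> W1 \<times> W2. ?\<mu> z \<in> W}"
      using ab T(5) by (auto simp: O1_def O2_def)
    ultimately show "z \<in> ?S" by blast
  qed
  have "(W1 \<times> W2, ?\<Phi>) \<in> charts (prod_manifold M M)"
    using c1 c2 by (auto simp: prod_manifold_def)
  then have "smooth_vec_on (dm + dm) ?S dm (\<psi> \<circ> ?\<mu> \<circ> inv_into (W1 \<times> W2) ?\<Phi>)"
    using sm\<mu> c(1) unfolding smooth_map_def prod_manifold_def by fastforce
  then have sB: "smooth_vec_on (dm + dm) ?B dm (\<lambda>z. (\<psi> \<circ> ?\<mu> \<circ> inv_into (W1 \<times> W2) ?\<Phi>) z)"
    using smooth_vec_on_subset[OF BS] by blast
  let ?V = "{y \<in> U. p y \<in> O1} \<inter> {y \<in> U. q y \<in> O2}"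
  have V: "eopen m ?V" by (intro eopen_Int sm_open[OF p] sm_open[OF q] O)
  have VW: "p y \<in> W1" "q y \<in> W2" "p y \<in> O1" "q y \<in> O2" "p y \<otimes> q y \<in> W" if "y \<in> ?V" for y
    using that T(5) by (auto simp: O1_def O2_def)
  have s1: "smooth_vec_on m ?V dm (\<lambda>y. \<phi>1 (p y))"
    by (rule smooth_vec_on_subset[OF _ sm_chart[OF p c1(1)]]) (use VW(1) in blast)
  have s2: "smooth_vec_on m ?V dm (\<lambda>y. \<phi>2 (q y))"
    by (rule smooth_vec_on_subset[OF _ sm_chart[OF q c2(1)]]) (use VW(2) in blast)
  have into: "(\<lambda>y. va dm (\<phi>1 (p y)) (\<phi>2 (q y))) ` ?V \<subseteq> ?B"
  proof (rule image_subsetI, rule va_prodset)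
    show "\<phi>1 ` O1 \<subseteq> Rn dm" "\<phi>2 ` O2 \<subseteq> Rn dm"
      using chart(7)[OF c1(1)] chart(7)[OF c2(1)] by (auto simp: O1_def O2_def)
    fix y assume "y \<in> ?V"
    from VW(3,4)[OF this] show "\<phi>1 (p y) \<in> \<phi>1 ` O1" "\<phi>2 (q y) \<in> \<phi>2 ` O2" by auto
  qed
  have "smooth_vec_on m ?V dm (\<lambda>y. (\<psi> \<circ> ?\<mu> \<circ> inv_into (W1 \<times> W2) ?\<Phi>) (va dm (\<phi>1 (p y)) (\<phi>2 (q y))))"
    by (rule smooth_vec_compose[OF V B smooth_va[OF s1 s2] into sB])
  then have "smooth_vec_on m ?V dm (\<lambda>y. \<psi> (p y \<otimes> q y))"
  proof (rule smooth_vec_cong[OF V, THEN iffD1, rotated])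
    fix y assume y: "y \<in> ?V"
    have "inv_into (W1 \<times> W2) ?\<Phi> (?\<Phi> (p y, q y)) = (p y, q y)"
      by (rule inv_into_f_f[OF inj]) (use VW[OF y] in auto)
    then show "(\<psi> \<circ> ?\<mu> \<circ> inv_into (W1 \<times> W2) ?\<Phi>) (va dm (\<phi>1 (p y)) (\<phi>2 (q y))) = \<psi> (p y \<otimes> q y)"
      by simp
  qed
  moreover have "x \<in> ?V" using x c1 c2 T by (auto simp: O1_def O2_def)
  ultimately show "\<exists>V W \<psi>. x \<in> V \<and> V \<subseteq> U \<and> eopen m V \<and> (W, \<psi>) \<in> charts M \<and> (\<lambda>x. p x \<otimes> q x) ` V \<subseteq> W \<and>
      smooth_vec_on m V dm (\<lambda>x. \<psi> (p x \<otimes> q x))"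
    using V VW(5) c(1) by (intro exI[of _ ?V] exI[of _ W] exI[of _ \<psi>]) auto
qed

lemma sm_inv:
  assumes p: "sm m U p"
  shows "sm m U (\<lambda>x. \<iota> (p x))"
proof (rule smI[OF sm_eopen[OF p]])
  fix x assume x: "x \<in> U"
  obtain W \<phi> where c: "(W, \<phi>) \<in> charts M" "p x \<in> W" using sm_into[OF p x] by (rule chart_at)
  obtain W' \<psi> where c': "(W', \<psi>) \<in> charts M" "\<iota> (p x) \<in> W'"
    by (rule chart_at[of "\<iota> (p x)"]) (use sm_carrier[OF p x] top_carrier in auto)
  have i: "smooth_map M M (\<lambda>p. \<iota> p)" using LG by (simp add: lie_group_def)
  then have "continuous_map (mtop M) (mtop M) (\<lambda>p. \<iota> p)" by (simp add: smooth_map_def)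
  from openin_continuous_map_preimage[OF this chart(1)[OF c'(1)]]
  have O: "openin (mtop M) {z \<in> topspace (mtop M). \<iota> z \<in> W'}" .
  let ?T = "W \<inter> {z \<in> topspace (mtop M). \<iota> z \<in> W'}"
  have T: "?T = {z \<in> W. \<iota> z \<in> W'}" using chart(5)[OF c(1)] by blast
  have s: "smooth_vec_on dm (\<phi> ` ?T) dm (\<lambda>y. (\<psi> \<circ> (\<lambda>p. \<iota> p) \<circ> inv_into W \<phi>) y)"
    unfolding T using i c(1) c'(1) unfolding smooth_map_def by fastforce
  have To: "openin (mtop M) ?T" by (intro openin_Int chart(1)[OF c(1)] O)
  let ?V = "{y \<in> U. p y \<in> ?T}"
  have V: "eopen m ?V" by (rule sm_open[OF p To])
  have sv: "smooth_vec_on m ?V dm (\<lambda>y. \<phi> (p y))"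
    by (rule smooth_vec_on_subset[OF _ sm_chart[OF p c(1)]]) blast
  have "smooth_vec_on m ?V dm (\<lambda>y. (\<psi> \<circ> (\<lambda>p. \<iota> p) \<circ> inv_into W \<phi>) (\<phi> (p y)))"
    by (rule smooth_vec_compose[OF V chart(4)[OF c(1) O] sv _ s]) auto
  then have "smooth_vec_on m ?V dm (\<lambda>y. \<psi> (\<iota> (p y)))"
    by (rule smooth_vec_cong[OF V, THEN iffD1, rotated]) (auto simp: chart(6)[OF c(1)])
  moreover have "x \<in> ?V" using x c c' sm_into[OF p x] by auto
  ultimately show "\<exists>V W \<psi>. x \<in> V \<and> V \<subseteq> U \<and> eopen m V \<and> (W, \<psi>) \<in> charts M \<and> (\<lambda>x. \<iota> (p x)) ` V \<subseteq> W \<and>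
      smooth_vec_on m V dm (\<lambda>x. \<psi> (\<iota> (p x)))"
    using V c'(1) by (intro exI[of _ ?V] exI[of _ W'] exI[of _ \<psi>]) auto
qed

lemma sm_constG: "g \<in> carrier G \<Longrightarrow> eopen m U \<Longrightarrow> sm m U (\<lambda>x. g)"
  using sm_const top_carrier by simp

lemma sm_lmult: "sm m U p \<Longrightarrow> g \<in> carrier G \<Longrightarrow> sm m U (\<lambda>x. g \<otimes> p x)"
  by (rule sm_mult[OF sm_constG[OF _ sm_eopen]])

lemma sm_rmult: "sm m U p \<Longrightarrow> g \<in> carrier G \<Longrightarrow> sm m U (\<lambda>x. p x \<otimes> g)"
  by (rule sm_mult[OF _ sm_constG[OF _ sm_eopen]])

lemma sf_ltrans: "f \<in> SF \<Longrightarrow> g \<in> carrier G \<Longrightarrow> left_translate G g f \<in> SF"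
proof (rule sfI)
  fix m U p assume f: "f \<in> SF" and g: "g \<in> carrier G" and p: "sm m U p"
  show "smooth_fun_on m U (\<lambda>x. left_translate G g f (p x))"
    by (rule smooth_cong[OF sm_eopen[OF p], THEN iffD1, OF _ sf_sm[OF f sm_lmult[OF p g]]])
      (simp add: left_translate_def sm_carrier[OF p])
qed (simp add: left_translate_def top_carrier)

definition rtrans :: "'a \<Rightarrow> ('a \<Rightarrow> real) \<Rightarrow> 'a \<Rightarrow> real" where
  "rtrans g f = (\<lambda>p. if p \<in> carrier G then f (p \<otimes> g) else 0)"

lemma sf_rtrans: "f \<in> SF \<Longrightarrow> g \<in> carrier G \<Longrightarrow> rtrans g f \<in> SF"
proof (rule sfI)
  fix m U p assume f: "f \<in> SF" and g: "g \<in> carrier G" and p: "sm m U p"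
  show "smooth_fun_on m U (\<lambda>x. rtrans g f (p x))"
    by (rule smooth_cong[OF sm_eopen[OF p], THEN iffD1, OF _ sf_sm[OF f sm_rmult[OF p g]]])
      (simp add: rtrans_def sm_carrier[OF p])
qed (simp add: rtrans_def top_carrier)

lemma sm_prod:
  assumes "sm m U p" "sm l V q"
  shows "sm (m + l) (prodset m l U V) (\<lambda>z. p (pr1 m z) \<otimes> q (pr2 m z))"
proof -
  have o: "eopen (m + l) (prodset m l U V)" by (rule eopen_prodset[OF sm_eopen[OF assms(1)] sm_eopen[OF assms(2)]])
  show ?thesis
    by (rule sm_mult[OF sm_compose[OF assms(1) o smooth_pr1[OF o]] sm_compose[OF assms(2) o smooth_pr2[OF o]]])
      (auto simp: prodset_def)
qed

text \<open>The left-invariant field with value \<open>z\<close> at the unit: differentiation along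
  right multiplication by points near the unit commutes with left translations.\<close>

definition E :: "vec \<Rightarrow> 'a vfield" where
  "E z f g = (if f \<in> SF \<and> g \<in> carrier G then dir_deriv dm (\<lambda>b. f (g \<otimes> \<psi>0 b)) e0 z else 0)"

lemma E_eq: "f \<in> SF \<Longrightarrow> g \<in> carrier G \<Longrightarrow> E z f g = dir_deriv dm (\<lambda>b. f (g \<otimes> \<psi>0 b)) e0 z"
  by (simp add: E_def)

lemma E_lin: "E (\<lambda>i. a * z i + b * w i) f g = a * E z f g + b * E w f g"
  by (simp add: E_def dir_deriv_lin)

lemma smooth_local_rep: "f \<in> SF \<Longrightarrow> g \<in> carrier G \<Longrightarrow> smooth_fun_on dm V0 (\<lambda>b. f (g \<otimes> \<psi>0 b))"
  by (rule sf_sm[OF _ sm_lmult[OF \<psi>0(1)]])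

text \<open>Along a smooth map \<open>p\<close>, the value of \<open>f\<close> at the product of
  p(x) and \<psi>0(b) is jointly smooth in x and b; hence its derivative in b at \<open>e0\<close>
  is smooth in x.\<close>

lemma E_sf: assumes f: "f \<in> SF" shows "E z f \<in> SF"
proof (rule sfI)
  fix m U p assume p: "sm m U p"
  note U = sm_eopen[OF p]
  let ?B = "prodset m dm U V0"
  define K where "K w = f (p (pr1 m w) \<otimes> \<psi>0 (pr2 m w))" for w
  have B: "eopen (m + dm) ?B" by (intro eopen_prodset U V0)
  have K: "smooth_fun_on (m + dm) ?B K"
    unfolding K_def by (rule sf_sm[OF f sm_prod[OF p \<psi>0(1)]])
  have s: "smooth_fun_on m U (\<lambda>x. dir_deriv (m + dm) K (va m x e0) (va m (\<lambda>i. 0) z))"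
    by (rule smooth_compose[OF U B smooth_va[OF smooth_vec_id[OF U] smooth_vec_const[OF U V0(3)]]
        _ smooth_dir_deriv[OF B K]])
      (use va_prodset[OF eopen_subset[OF U] eopen_subset[OF V0(1)] _ V0(2)] in auto)
  show "smooth_fun_on m U (\<lambda>x. E z f (p x))"
  proof (rule smooth_cong[OF U, THEN iffD1, OF _ s])
    fix x assume x: "x \<in> U"
    have "x \<in> Rn m" using x eopen_subset[OF U] by blast
    then have "(\<lambda>b. K (va m x b)) = (\<lambda>b. f (p x \<otimes> \<psi>0 b))" by (simp add: K_def pr1_va pr2_va)
    then show "dir_deriv (m + dm) K (va m x e0) (va m (\<lambda>i. 0) z) = E z f (p x)"
      using slice2_dir_deriv[of dm K m x e0 z] E_eq[OF f sm_carrier[OF p x], of z] by simp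
  qed
qed (simp add: E_def top_carrier)

lemma E_field_lin:
  assumes "f \<in> SF" "h \<in> SF"
  shows "E z (\<lambda>p. a * f p + b * h p) g = a * E z f g + b * E z h g"
proof (cases "g \<in> carrier G")
  case True
  note s = smooth_local_rep[OF assms(1) True] smooth_local_rep[OF assms(2) True]
  show ?thesis
    using dir_deriv_add[OF smooth_cmult[OF V0(1) s(1)] smooth_cmult[OF V0(1) s(2)] V0(2), of a b z]
      dir_deriv_cmult[OF s(1) V0(2)] dir_deriv_cmult[OF s(2) V0(2)]
    by (simp add: E_eq True assms sf_lin)
qed (simp add: E_def)

lemma E_field_mult:
  assumes "f \<in> SF" "h \<in> SF"
  shows "E z (\<lambda>p. f p * h p) g = E z f g * h g + f g * E z h g"
proof (cases "g \<in> carrier G")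
  case True
  note s = smooth_local_rep[OF assms(1) True] smooth_local_rep[OF assms(2) True]
  show ?thesis
    using dir_deriv_mult[OF s V0(2), of z] True
    by (simp add: E_eq assms sf_mult \<psi>0(2))
qed (simp add: E_def)

lemma E_ltrans:
  assumes f: "f \<in> SF" and h: "h \<in> carrier G"
  shows "E z (left_translate G h f) = left_translate G h (E z f)"
proof
  fix g
  show "E z (left_translate G h f) g = left_translate G h (E z f) g"
  proof (cases "g \<in> carrier G")
    case True
    have "dir_deriv dm (\<lambda>b. left_translate G h f (g \<otimes> \<psi>0 b)) e0 z = dir_deriv dm (\<lambda>b. f (h \<otimes> g \<otimes> \<psi>0 b)) e0 z"
      by (rule dir_deriv_cong[OF V0(1,2)]) (simp add: left_translate_def True h \<psi>0(3) m_assoc)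
    then show ?thesis
      unfolding E_eq[OF sf_ltrans[OF f h] True] using True h by (simp add: E_eq f left_translate_def)
  qed (simp add: E_def left_translate_def)
qed

lemma E_in: "E z \<in> vcarrier (lie_algebra_of G M)"
proof -
  have "E z f = (\<lambda>p. 0)" if "f \<notin> SF" for f using that by (auto simp: E_def)
  then have "vector_field M (E z)"
    unfolding vector_field_def
    by (intro conjI allI impI ballI ext E_sf) (auto simp: E_field_lin E_field_mult)
  moreover have "left_invariant G M (E z)" using E_ltrans by (simp add: left_invariant_def)
  ultimately show ?thesis by (simp add: lie_algebra_of_def)
qed

text \<open>The functions \<open>h j\<close> are the chart coordinates, shifted to vanish at the
  unit and made global by the bump \<open>b\<close>. They act as a dual basis: \<open>h j\<close>
  reads off the \<open>j\<close>-th component of a tangent vector at the unit.\<close>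

definition is_test :: "real \<Rightarrow> ('a \<Rightarrow> real) \<Rightarrow> (nat \<Rightarrow> 'a \<Rightarrow> real) \<Rightarrow> bool" where
  "is_test r b h \<longleftrightarrow> is_bump W0 \<phi>0 \<one> W0 r b \<and> (\<forall>j p. h j p = b p * (\<phi>0 p j - e0 j)) \<and>
    (\<forall>j. h j \<in> SF) \<and> (\<forall>j z. j < dm \<longrightarrow> E z (h j) \<one> = z j)"

lemma is_testD:
  assumes "is_test r b h"
  shows "r > 0" "cube dm e0 r \<subseteq> V0" "b \<in> SF" "b \<one> = 1" "\<And>p. b p \<noteq> 0 \<Longrightarrow> p \<in> W0 \<and> \<phi>0 p \<in> cube dm e0 r"
    "\<And>u. smooth_fun_on dm (cube dm e0 r) u \<Longrightarrow> (\<lambda>p. b p * u (\<phi>0 p)) \<in> SF"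
    "\<And>j p. h j p = b p * (\<phi>0 p j - e0 j)" "\<And>j. h j \<in> SF" "\<And>j z. j < dm \<Longrightarrow> E z (h j) \<one> = z j"
  using assms is_bumpD[of W0 \<phi>0 \<one> W0 r b] by (auto simp: is_test_def)

lemma test_functions: "\<exists>r b h. is_test r b h"
proof -
  obtain r b where bump: "is_bump W0 \<phi>0 \<one> W0 r b"
    using bump_mfd[OF c0 one_W0 chart(1)[OF c0] one_W0] by blast
  note b' = is_bumpD[OF bump]
  have "cube dm e0 r \<subseteq> V0" "\<And>p. b p \<noteq> 0 \<Longrightarrow> p \<in> W0 \<and> \<phi>0 p \<in> cube dm e0 r"
    using b'(4,5) by auto
  note b = b'(1) this(1) b'(2,3) this(2) b'(6)
  define h where "h j p = b p * (\<phi>0 p j - e0 j)" for j p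
  have h: "h j \<in> SF" for j
    unfolding h_def[abs_def] by (rule b(6)[of "\<lambda>y. y j - e0 j"]) (intro smooth_diff smooth_coord smooth_const eopen_cube)
  have "E z (h j) \<one> = z j" if j: "j < dm" for j z
  proof -
    have s1: "smooth_fun_on dm V0 (\<lambda>y. b (\<psi>0 y))" by (rule sf_sm[OF b(3) \<psi>0(1)])
    have s2: "smooth_fun_on dm V0 (\<lambda>y. y j - e0 j)" by (intro smooth_diff smooth_coord smooth_const V0(1))
    have "E z (h j) \<one> = dir_deriv dm (\<lambda>y. b (\<psi>0 y) * (y j - e0 j)) e0 z"
      unfolding E_eq[OF h one_closed]
      by (rule dir_deriv_cong[OF V0(1,2)]) (simp add: h_def \<psi>0(3) \<phi>0_\<psi>0)
    also have "\<dots> = dir_deriv dm (\<lambda>y. y j - e0 j) e0 z"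
      using dir_deriv_mult[OF s1 s2 V0(2)] by (simp add: \<psi>0(2) b(4))
    also have "\<dots> = dir_deriv dm (\<lambda>y. y j + (-1) * e0 j) e0 z" by simp
    also have "\<dots> = z j"
      using dir_deriv_add[OF smooth_coord[OF V0(1)] smooth_const[OF V0(1)] V0(2), of j "(-1) * e0 j" z]
      by (simp add: dir_deriv_coord[OF j] dir_deriv_const)
    finally show ?thesis .
  qed
  then show ?thesis using bump h h_def unfolding is_test_def by blast
qed

text \<open>Left translates of the test functions read off \<open>z\<close> at the point
  \<open>g\<close>, so a left-invariant field is determined by its value at any one point.\<close>

lemma E_cancel:
  assumes z: "z \<in> Rn dm" and w: "w \<in> Rn dm" and g: "g \<in> carrier G"
    and eq: "\<And>f. f \<in> SF \<Longrightarrow> E z f g = E w f g"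
  shows "z = w"
proof
  fix j
  obtain r b h where "is_test r b h" using test_functions by blast
  note h = is_testD(8,9)[OF this]
  show "z j = w j"
  proof (cases "j < dm")
    case True
    have "E v (left_translate G (\<iota> g) (h j)) g = v j" for v
      using E_ltrans[OF h(1), of "\<iota> g"] g h(2)[OF True] by (simp add: left_translate_def)
    then show ?thesis using eq[OF sf_ltrans[OF h(1), of "\<iota> g"]] g by (metis inv_closed)
  qed (use z w in \<open>simp add: Rn_iff\<close>)
qed

lemma E_inj: "z \<in> Rn dm \<Longrightarrow> w \<in> Rn dm \<Longrightarrow> E z = E w \<Longrightarrow> z = w"
  using E_cancel one_closed by metis

lemma vf_lin:
  assumes "vector_field M Z" "f \<in> SF" "g \<in> SF"
  shows "Z (\<lambda>p. a * f p + b * g p) = (\<lambda>p. a * Z f p + b * Z g p)"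
  using assms by (auto simp: vector_field_def)

lemma vf_mult:
  assumes "vector_field M Z" "f \<in> SF" "g \<in> SF"
  shows "Z (\<lambda>p. f p * g p) = (\<lambda>p. Z f p * g p + f p * Z g p)"
  using assms by (auto simp: vector_field_def)

lemma vf_sf: "vector_field M Z \<Longrightarrow> f \<in> SF \<Longrightarrow> Z f \<in> SF"
  by (simp add: vector_field_def)

lemma vf_0: "vector_field M Z \<Longrightarrow> Z (\<lambda>p. 0) = (\<lambda>p. 0)"
  using vf_lin[OF _ sf_0 sf_0, of Z 0 0] by simp

lemma vf_sum:
  assumes Z: "vector_field M Z"
  shows "(\<And>i. i \<in> A \<Longrightarrow> f i \<in> SF) \<Longrightarrow> Z (\<lambda>p. \<Sum>i\<in>A. f i p) = (\<lambda>p. \<Sum>i\<in>A. Z (f i) p)"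
proof (induction A rule: infinite_finite_induct)
  case (insert x F)
  then show ?case using vf_lin[OF Z, of "f x" "\<lambda>p. \<Sum>i\<in>F. f i p" 1 1] sf_sum[of F f] by simp
qed (auto simp: vf_0[OF Z])

text \<open>By Hadamard's lemma a derivation at the unit is determined by its values on the test functions.\<close>

lemma E_surj:
  assumes "Z \<in> vcarrier (lie_algebra_of G M)"
  shows "\<exists>z\<in>Rn dm. Z = E z"
proof -
  have Z: "vector_field M Z" and LI: "left_invariant G M Z" using assms by (auto simp: lie_algebra_of_def)
  obtain r b h where "is_test r b h" using test_functions by blast
  note t = is_testD[OF this]
  define z where "z = (\<lambda>j. if j < dm then Z (h j) \<one> else 0)"
  have at1: "Z f \<one> = E z f \<one>" if f: "f \<in> SF" for f
  proof -
    have s0: "smooth_fun_on dm V0 (\<lambda>y. f (\<psi>0 y))" by (rule sf_sm[OF f \<psi>0(1)])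
    obtain g where g': "(\<forall>i<dm. smooth_fun_on dm (cube dm e0 r) (g i)) \<and>
      (\<forall>x\<in>cube dm e0 r. f (\<psi>0 x) = f (\<psi>0 e0) + (\<Sum>i<dm. (x i - e0 i) * g i x)) \<and>
      (\<forall>i<dm. g i e0 = partial i (\<lambda>y. f (\<psi>0 y)) e0)"
      using hadamard[OF V0(3) t(1) smooth_subset[OF s0 t(2)]] by (elim exE)
    note g = g'[THEN conjunct1, rule_format] g'[THEN conjunct2, THEN conjunct1, rule_format]
      g'[THEN conjunct2, THEN conjunct2, rule_format]
    define k where "k i p = b p * g i (\<phi>0 p)" for i p
    have k: "k i \<in> SF" if "i < dm" for i unfolding k_def[abs_def] by (rule t(6)[OF g(1)[OF that]])
    have bb: "(\<lambda>p. b p * b p) \<in> SF" by (rule sf_mult[OF t(3) t(3)])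
    \<comment> \<open>Two factors \<open>b\<close> occur, one to globalise the coordinate and one
      for the Hadamard coefficient. When \<open>Z\<close> is applied at the unit, where
      \<open>b\<close> is 1, the derivatives of \<open>b * b\<close> cancel on the left and
      \<open>Z f\<close> remains.\<close>
    have eq: "(\<lambda>p. 1 * (f p * (b p * b p)) + (- f \<one>) * (b p * b p)) = (\<lambda>p. \<Sum>i<dm. h i p * k i p)"
    proof
      fix p
      show "1 * (f p * (b p * b p)) + (- f \<one>) * (b p * b p) = (\<Sum>i<dm. h i p * k i p)"
      proof (cases "b p = 0")
        case False
        then have p: "p \<in> W0" "\<phi>0 p \<in> cube dm e0 r" using t(5) by auto
        have "f p = f \<one> + (\<Sum>i<dm. (\<phi>0 p i - e0 i) * g i (\<phi>0 p))"
          using g(2)[OF p(2)] by (simp add: chart(6)[OF c0 p(1)] \<psi>0(2))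
        then have "1 * (f p * (b p * b p)) + (- f \<one>) * (b p * b p) =
            b p * b p * (\<Sum>i<dm. (\<phi>0 p i - e0 i) * g i (\<phi>0 p))" by (simp add: algebra_simps)
        also have "\<dots> = (\<Sum>i<dm. h i p * k i p)"
          unfolding sum_distrib_left t(7) k_def by (rule sum.cong) (auto simp: mult_ac)
        finally show ?thesis .
      qed (simp add: t(7))
    qed
    have "Z (\<lambda>p. 1 * (f p * (b p * b p)) + (- f \<one>) * (b p * b p)) \<one> = Z f \<one>"
      unfolding vf_lin[OF Z sf_mult[OF f bb] bb] vf_mult[OF Z f bb] by (simp add: t(4))
    moreover have "Z (\<lambda>p. \<Sum>i<dm. h i p * k i p) \<one> = (\<Sum>i<dm. Z (h i) \<one> * k i \<one> + h i \<one> * Z (k i) \<one>)"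
    proof -
      have "Z (\<lambda>p. \<Sum>i<dm. h i p * k i p) = (\<lambda>p. \<Sum>i<dm. Z (\<lambda>p. h i p * k i p) p)"
        by (rule vf_sum[OF Z]) (use sf_mult[OF t(8) k] in auto)
      then show ?thesis using vf_mult[OF Z t(8) k] by simp
    qed
    moreover have "h i \<one> = 0" for i by (simp add: t(7))
    moreover have "k i \<one> = partial i (\<lambda>y. f (\<psi>0 y)) e0" if "i < dm" for i
      using g(3)[OF that] by (simp add: k_def t(4))
    ultimately have "Z f \<one> = (\<Sum>i<dm. z i * partial i (\<lambda>y. f (\<psi>0 y)) e0)"
      unfolding eq by (simp add: z_def)
    also have "\<dots> = E z f \<one>"
      unfolding E_eq[OF f one_closed]
      by (subst dir_deriv_cong[OF V0(1,2), of _ "\<lambda>y. f (\<psi>0 y)"]) (auto simp: \<psi>0(3) dir_deriv_def)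
    finally show ?thesis .
  qed
  \<comment> \<open>Left invariance carries the equality from the unit to \<open>g\<close>; off the
    smooth functions and off the group both sides are 0 by convention.\<close>
  have "Z f g = E z f g" for f g
  proof (cases "f \<in> SF \<and> g \<in> carrier G")
    case True
    have "Z f g = left_translate G g (Z f) \<one>" using True by (simp add: left_translate_def)
    also have "\<dots> = Z (left_translate G g f) \<one>" using LI True by (simp add: left_invariant_def)
    also have "\<dots> = E z (left_translate G g f) \<one>" by (rule at1) (use True sf_ltrans in blast)
    also have "\<dots> = E z f g" using True E_ltrans[of f g z] by (simp add: left_translate_def)
    finally show ?thesis .
  next
    case False
    have "Z f g = 0"
    proof (cases "f \<in> SF")
      case True
      then show ?thesis using False sf_zero[OF vf_sf[OF Z True]] top_carrier by simp
    next
      case False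
      then show ?thesis using Z by (simp add: vector_field_def)
    qed
    then show ?thesis using False by (auto simp: E_def)
  qed
  then have "Z = E z" by (intro ext)
  moreover have "z \<in> Rn dm" by (auto simp: z_def Rn_iff)
  ultimately show ?thesis by blast
qed

subsection \<open>The Maurer--Cartan form of a smooth map\<close>

text \<open>The left Maurer--Cartan form p^{-1} dp in coordinates: the map
  \<open>\<lambda>y. \<iota> (p x) \<otimes> p y\<close> passes through the unit at
  \<open>x\<close>, and its derivative there is read in the chart.\<close>

definition mc :: "nat \<Rightarrow> (vec \<Rightarrow> 'a) \<Rightarrow> vec \<Rightarrow> vec \<Rightarrow> vec" where
  "mc m p x v = jacobian m dm (\<lambda>y. \<phi>0 (\<iota> (p x) \<otimes> p y)) x v"

lemma mc_Rn: "mc m p x v \<in> Rn dm"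
  by (simp add: mc_def jacobian_Rn)

lemma mc_lin: "mc m p x (\<lambda>i. a * v i + b * w i) = (\<lambda>i. a * mc m p x v i + b * mc m p x w i)"
  by (simp add: mc_def jacobian_lin)

text \<open>Near \<open>x\<close>, the map \<open>p\<close> is \<open>p x\<close> times a map into
  the chart at the unit, so the chain rule applies. Together with \<open>mcI\<close> this
  characterises the form by its effect on functions and replaces chart computations in the rules
  below.\<close>

lemma mc_deriv:
  assumes p: "sm m U p" and x: "x \<in> U" and f: "f \<in> SF"
  shows "dir_deriv m (\<lambda>y. f (p y)) x v = E (mc m p x v) f (p x)"
proof -
  have px: "p x \<in> carrier G" by (rule sm_carrier[OF p x])
  have q: "sm m U (\<lambda>y. \<iota> (p x) \<otimes> p y)" by (rule sm_lmult[OF p]) (simp add: px)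
  let ?V = "{y \<in> U. \<iota> (p x) \<otimes> p y \<in> W0}"
  have V: "eopen m ?V" by (rule sm_open[OF q chart(1)[OF c0]])
  have xV: "x \<in> ?V" using x px one_W0 by simp
  have "dir_deriv m (\<lambda>y. f (p y)) x v = dir_deriv m (\<lambda>y. f (p x \<otimes> \<psi>0 (\<phi>0 (\<iota> (p x) \<otimes> p y)))) x v"
  proof (rule dir_deriv_cong[OF V xV])
    fix y assume y: "y \<in> ?V"
    then have "p x \<otimes> (\<iota> (p x) \<otimes> p y) = p y" using px sm_carrier[OF p, of y] by (simp add: m_assoc[symmetric])
    then show "f (p y) = f (p x \<otimes> \<psi>0 (\<phi>0 (\<iota> (p x) \<otimes> p y)))" using y chart(6)[OF c0] by simp
  qed
  also have "\<dots> = dir_deriv dm (\<lambda>b. f (p x \<otimes> \<psi>0 b)) (\<phi>0 (\<iota> (p x) \<otimes> p x)) (mc m p x v)"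
    unfolding mc_def by (rule dir_deriv_compose[OF V V0(1) sm_chart[OF q c0] _ smooth_local_rep[OF f px] xV]) auto
  also have "\<dots> = E (mc m p x v) f (p x)" using px by (simp add: E_eq f)
  finally show ?thesis .
qed

lemma mcI:
  assumes p: "sm m U p" and x: "x \<in> U" and z: "z \<in> Rn dm"
    and eq: "\<And>f. f \<in> SF \<Longrightarrow> dir_deriv m (\<lambda>y. f (p y)) x v = E z f (p x)"
  shows "mc m p x v = z"
  by (rule E_cancel[OF mc_Rn z sm_carrier[OF p x]]) (use mc_deriv[OF p x] eq in auto)

text \<open>The base point enters twice, in the factor \<open>\<iota> (p x)\<close> and as the point
  of differentiation. A function of two independent points is differentiated in the second one, and
  the result is restricted to the diagonal.\<close>

lemma smooth_mc:
  assumes p: "sm m U p"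
  shows "smooth_fun_on m U (\<lambda>x. mc m p x v i)"
proof (cases "i < dm")
  case True
  note U = sm_eopen[OF p]
  let ?B = "prodset m m U U"
  have q: "sm (m + m) ?B (\<lambda>w. \<iota> (p (pr1 m w)) \<otimes> p (pr2 m w))" by (rule sm_prod[OF sm_inv[OF p] p])
  define K where "K w = \<phi>0 (\<iota> (p (pr1 m w)) \<otimes> p (pr2 m w)) i" for w
  let ?O = "{w \<in> ?B. \<iota> (p (pr1 m w)) \<otimes> p (pr2 m w) \<in> W0}"
  have O: "eopen (m + m) ?O" by (rule sm_open[OF q chart(1)[OF c0]])
  have K: "smooth_fun_on (m + m) ?O K" unfolding K_def by (rule smooth_vecD(2)[OF sm_chart[OF q c0] True])
  have R: "x \<in> Rn m" if "x \<in> U" for x using that eopen_subset[OF U] by blast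
  have s: "smooth_fun_on m U (\<lambda>x. dir_deriv (m + m) K (va m x x) (va m (\<lambda>i. 0) v))"
  proof (rule smooth_compose[OF U O smooth_va[OF smooth_vec_id[OF U] smooth_vec_id[OF U]] _ smooth_dir_deriv[OF O K]])
    show "(\<lambda>x. va m x x) ` U \<subseteq> ?O"
      using va_prodset[OF eopen_subset[OF U] eopen_subset[OF U]] sm_carrier[OF p] one_W0 R
      by (auto simp: pr1_va pr2_va)
  qed
  show ?thesis
  proof (rule smooth_cong[OF U, THEN iffD1, OF _ s])
    fix x assume x: "x \<in> U"
    have "(\<lambda>b. K (va m x b)) = (\<lambda>y. \<phi>0 (\<iota> (p x) \<otimes> p y) i)" by (simp add: K_def pr1_va[OF R[OF x]] pr2_va)
    then show "dir_deriv (m + m) K (va m x x) (va m (\<lambda>i. 0) v) = mc m p x v i"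
      using slice2_dir_deriv[of m K m x x v] True by (simp add: mc_def jacobian_def)
  qed
next
  case False
  then have "(\<lambda>x. mc m p x v i) = (\<lambda>x. 0)" using mc_Rn by (auto simp: Rn_iff)
  then show ?thesis using smooth_const[OF sm_eopen[OF p], of 0] by simp
qed

lemma mc_compose:
  assumes p: "sm n V p" and U: "eopen m U" and \<Phi>: "smooth_vec_on m U n \<Phi>" "\<Phi> ` U \<subseteq> V" and x: "x \<in> U"
  shows "mc m (\<lambda>y. p (\<Phi> y)) x v = mc n p (\<Phi> x) (jacobian m n \<Phi> x v)"
proof (rule mcI[OF sm_compose[OF p U \<Phi>] x mc_Rn])
  fix f assume f: "f \<in> SF"
  show "dir_deriv m (\<lambda>y. f (p (\<Phi> y))) x v = E (mc n p (\<Phi> x) (jacobian m n \<Phi> x v)) f (p (\<Phi> x))"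
    using dir_deriv_compose[OF U sm_eopen[OF p] \<Phi> sf_sm[OF f p] x] mc_deriv[OF p _ f, of "\<Phi> x"] \<Phi>(2) x
    by auto
qed

lemma mc_cong:
  assumes p: "sm m U p" and x: "x \<in> U" and eq: "\<And>y. y \<in> U \<Longrightarrow> p y = q y"
  shows "mc m p x v = mc m q x v"
proof (rule mcI[OF p x mc_Rn])
  fix f assume f: "f \<in> SF"
  show "dir_deriv m (\<lambda>y. f (p y)) x v = E (mc m q x v) f (p x)"
    using dir_deriv_cong[OF sm_eopen[OF p] x, of "\<lambda>y. f (p y)" "\<lambda>y. f (q y)"] eq
      mc_deriv[OF sm_cong[OF p eq] x f] x by auto
qed

lemma mc_const: "g \<in> carrier G \<Longrightarrow> mc m (\<lambda>x. g) x v = (\<lambda>i. 0)"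
  by (simp add: mc_def jacobian_const)

lemma mc_\<psi>0: "v \<in> Rn dm \<Longrightarrow> mc dm \<psi>0 e0 v = v"
proof -
  assume v: "v \<in> Rn dm"
  have "mc dm \<psi>0 e0 v = jacobian dm dm (\<lambda>y. y) e0 v"
    unfolding mc_def by (rule jacobian_cong[OF V0(1,2)]) (simp add: \<psi>0 \<phi>0_\<psi>0)
  then show ?thesis using jacobian_id[OF v] by simp
qed

lemma mc_lmult:
  assumes p: "sm m U p" and x: "x \<in> U" and g: "g \<in> carrier G"
  shows "mc m (\<lambda>y. g \<otimes> p y) x v = mc m p x v"
proof (rule mcI[OF sm_lmult[OF p g] x mc_Rn])
  fix f assume f: "f \<in> SF"
  have "dir_deriv m (\<lambda>y. f (g \<otimes> p y)) x v = dir_deriv m (\<lambda>y. left_translate G g f (p y)) x v"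
    by (rule dir_deriv_cong[OF sm_eopen[OF p] x]) (simp add: left_translate_def sm_carrier[OF p])
  then show "dir_deriv m (\<lambda>y. f (g \<otimes> p y)) x v = E (mc m p x v) f (g \<otimes> p x)"
    using mc_deriv[OF p x sf_ltrans[OF f g]] E_ltrans[OF f g] sm_carrier[OF p x]
    by (simp add: left_translate_def)
qed

text \<open>This is the adjoint action of the inverse of g.\<close>

definition Adi :: "'a \<Rightarrow> vec \<Rightarrow> vec" where
  "Adi g z = mc dm (\<lambda>b. \<iota> g \<otimes> \<psi>0 b \<otimes> g) e0 z"

lemma Adi_Rn: "Adi g z \<in> Rn dm"
  by (simp add: Adi_def mc_Rn)

text \<open>Since a g (g^{-1} b g) = a b g, conjugation moves the direction of differentiation
  across the right translation by \<open>g\<close>.\<close>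

lemma E_Adi:
  assumes f: "f \<in> SF" and g: "g \<in> carrier G" and a: "a \<in> carrier G"
  shows "E (Adi g z) f (a \<otimes> g) = E z (rtrans g f) a"
proof -
  have c: "sm dm V0 (\<lambda>b. \<iota> g \<otimes> \<psi>0 b \<otimes> g)" by (intro sm_rmult sm_lmult \<psi>0(1) inv_closed g)
  have e: "\<iota> g \<otimes> \<psi>0 e0 \<otimes> g = \<one>" using g by (simp add: \<psi>0(2))
  have "E (Adi g z) f (a \<otimes> g) = E (Adi g z) (left_translate G (a \<otimes> g) f) \<one>"
    using E_ltrans[OF f, of "a \<otimes> g" "Adi g z"] a g by (simp add: left_translate_def)
  also have "\<dots> = dir_deriv dm (\<lambda>b. left_translate G (a \<otimes> g) f (\<iota> g \<otimes> \<psi>0 b \<otimes> g)) e0 z"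
    using mc_deriv[OF c V0(2) sf_ltrans[OF f], of "a \<otimes> g" z] a g e by (simp add: Adi_def)
  also have "\<dots> = dir_deriv dm (\<lambda>b. rtrans g f (a \<otimes> \<psi>0 b)) e0 z"
  proof (rule dir_deriv_cong[OF V0(1,2)])
    fix b assume b: "b \<in> V0"
    have "a \<otimes> g \<otimes> (\<iota> g \<otimes> \<psi>0 b \<otimes> g) = a \<otimes> (g \<otimes> \<iota> g) \<otimes> \<psi>0 b \<otimes> g"
      using a g \<psi>0(3)[OF b] by (simp only: m_assoc inv_closed m_closed)
    then have "a \<otimes> g \<otimes> (\<iota> g \<otimes> \<psi>0 b \<otimes> g) = a \<otimes> \<psi>0 b \<otimes> g" using a g by simp
    then show "left_translate G (a \<otimes> g) f (\<iota> g \<otimes> \<psi>0 b \<otimes> g) = rtrans g f (a \<otimes> \<psi>0 b)"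
      using a g \<psi>0(3)[OF b] by (simp add: left_translate_def rtrans_def)
  qed
  also have "\<dots> = E z (rtrans g f) a" by (simp add: E_eq sf_rtrans f g a)
  finally show ?thesis .
qed

text \<open>Freeze one factor at a time: the diagonal direction (v, v) on the product of the two
  domains splits into (v, 0) and (0, v). In usual notation this is (h p)^{-1} d(h p) = Ad(p^{-1})
  (h^{-1} dh) + p^{-1} dp.\<close>

lemma mc_mult:
  assumes h: "sm m U h" and p: "sm m U p" and x: "x \<in> U"
  shows "mc m (\<lambda>y. h y \<otimes> p y) x v = (\<lambda>i. Adi (p x) (mc m h x v) i + mc m p x v i)"
proof (rule mcI[OF sm_mult[OF h p] x])
  have hx: "h x \<in> carrier G" and px: "p x \<in> carrier G" using sm_carrier h p x by auto
  show "(\<lambda>i. Adi (p x) (mc m h x v) i + mc m p x v i) \<in> Rn dm"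
    using Adi_Rn mc_Rn by (simp add: Rn_iff)
  note U = sm_eopen[OF h]
  have R: "x \<in> Rn m" using x eopen_subset[OF U] by blast
  fix f assume f: "f \<in> SF"
  let ?B = "prodset m m U U"
  have B: "eopen (m + m) ?B" by (intro eopen_prodset U)
  define K where "K w = f (h (pr1 m w) \<otimes> p (pr2 m w))" for w
  have K: "smooth_fun_on (m + m) ?B K" unfolding K_def by (rule sf_sm[OF f sm_prod[OF h p]])
  have "dir_deriv m (\<lambda>y. f (h y \<otimes> p y)) x v = dir_deriv m (\<lambda>y. K (va m y y)) x v"
    by (rule dir_deriv_cong[OF U x]) (use eopen_subset[OF U] in \<open>auto simp: K_def pr1_va pr2_va subset_iff\<close>)
  also have "\<dots> = dir_deriv (m + m) K (va m x x) (jacobian m (m + m) (\<lambda>y. va m y y) x v)"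
    by (rule dir_deriv_compose[OF U B smooth_va[OF smooth_vec_id[OF U] smooth_vec_id[OF U]] _ K x])
      (use va_prodset[OF eopen_subset[OF U] eopen_subset[OF U]] in auto)
  also have "\<dots> = dir_deriv (m + m) K (va m x x) (\<lambda>i. 1 * va m v (\<lambda>i. 0) i + 1 * va m (\<lambda>i. 0) v i)"
    unfolding dir_deriv_def[of "m + m"] 
    by (rule sum.cong) (auto simp: jacobian_def vec_append_def dir_deriv_coord)
  also have "\<dots> = dir_deriv m (\<lambda>a. K (va m a x)) x v + dir_deriv m (\<lambda>b. K (va m x b)) x v"
    unfolding dir_deriv_lin slice1_dir_deriv[of m K x x v m] slice2_dir_deriv[of m K m x x v] by simp
  also have "dir_deriv m (\<lambda>a. K (va m a x)) x v = dir_deriv m (\<lambda>y. rtrans (p x) f (h y)) x v"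
    by (rule dir_deriv_cong[OF U x])
      (use eopen_subset[OF U] sm_carrier[OF h] in \<open>auto simp: K_def pr1_va pr2_va subset_iff rtrans_def\<close>)
  also have "\<dots> = E (Adi (p x) (mc m h x v)) f (h x \<otimes> p x)"
    by (simp add: mc_deriv[OF h x sf_rtrans[OF f px]] E_Adi[OF f px hx])
  also have "dir_deriv m (\<lambda>b. K (va m x b)) x v = dir_deriv m (\<lambda>y. f (h x \<otimes> p y)) x v"
    by (simp add: K_def pr1_va[OF R] pr2_va)
  also have "\<dots> = E (mc m p x v) f (h x \<otimes> p x)"
    using mc_deriv[OF sm_lmult[OF p hx] x f] mc_lmult[OF p x hx] by simp
  finally show "dir_deriv m (\<lambda>y. f (h y \<otimes> p y)) x v = E (\<lambda>i. Adi (p x) (mc m h x v) i + mc m p x v i) f (h x \<otimes> p x)"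
    using E_lin[of 1 "Adi (p x) (mc m h x v)" 1 "mc m p x v"] by simp
qed

lemma mc_rmult:
  assumes p: "sm m U p" and x: "x \<in> U" and g: "g \<in> carrier G"
  shows "mc m (\<lambda>y. p y \<otimes> g) x v = Adi g (mc m p x v)"
  using mc_mult[OF p sm_constG[OF g sm_eopen[OF p]] x] by (simp add: mc_const g)

lemma Adi_one: "z \<in> Rn dm \<Longrightarrow> Adi \<one> z = z"
proof -
  assume z: "z \<in> Rn dm"
  have "mc dm (\<lambda>b. \<psi>0 b) e0 z = mc dm (\<lambda>b. \<iota> \<one> \<otimes> \<psi>0 b \<otimes> \<one>) e0 z"
    by (rule mc_cong[OF \<psi>0(1) V0(2)]) (simp add: \<psi>0(3))
  then show ?thesis using mc_\<psi>0[OF z] by (simp add: Adi_def)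
qed

text \<open>Right translation by the inverse of \<open>g\<close> undoes the effect of
  \<open>Adi g\<close> on functions.\<close>

lemma Adi_inj:
  assumes z: "z \<in> Rn dm" and g: "g \<in> carrier G" and 0: "Adi g z = (\<lambda>i. 0)"
  shows "z = (\<lambda>i. 0)"
proof (rule E_cancel[OF z _ one_closed])
  fix f assume f: "f \<in> SF"
  have "rtrans g (rtrans (\<iota> g) f) = f"
  proof
    fix a show "rtrans g (rtrans (\<iota> g) f) a = f a"
      using g sf_zero[OF f] top_carrier by (cases "a \<in> carrier G") (auto simp: rtrans_def m_assoc)
  qed
  then have "E z f \<one> = E (Adi g z) (rtrans (\<iota> g) f) (\<one> \<otimes> g)"
    using E_Adi[OF sf_rtrans[OF f inv_closed[OF g]] g one_closed] by simp
  also have "\<dots> = 0" using E_lin[of 0 "\<lambda>i. 0" 0 "\<lambda>i. 0"] by (simp add: 0)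
  also have "\<dots> = E (\<lambda>i. 0) f \<one>" using E_lin[of 0 "\<lambda>i. 0" 0 "\<lambda>i. 0"] by simp
  finally show "E z f \<one> = E (\<lambda>i. 0) f \<one>" .
qed (simp add: Rn_iff)

section \<open>The bracket in coordinates and the Maurer--Cartan equation\<close>

abbreviation "LA \<equiv> lie_algebra_of G M"

lemma bracket_in:
  assumes X: "X \<in> vcarrier LA" and Y: "Y \<in> vcarrier LA"
  shows "lie_bracket LA X Y \<in> vcarrier LA"
proof -
  have X': "vector_field M X" "left_invariant G M X" and Y': "vector_field M Y" "left_invariant G M Y"
    using X Y by (auto simp: lie_algebra_of_def)
  note vs = vf_sf[OF X'(1)] vf_sf[OF Y'(1)]
  have "vector_field M (\<lambda>f p. X (Y f) p - Y (X f) p)"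
    unfolding vector_field_def
  proof (intro conjI allI impI ballI)
    show "(\<lambda>p. X (Y f) p - Y (X f) p) = (\<lambda>p. 0)" if "f \<notin> SF" for f
      using that X'(1) Y'(1) vf_0[OF X'(1)] vf_0[OF Y'(1)] by (auto simp: vector_field_def)
    show "(\<lambda>p. X (Y f) p - Y (X f) p) \<in> SF" if "f \<in> SF" for f
      using sf_lin[of "X (Y f)" "Y (X f)" 1 "-1"] vs that by simp
    fix f g assume f: "f \<in> SF" and g: "g \<in> SF"
    show "(\<lambda>p. X (Y (\<lambda>p. a * f p + b * g p)) p - Y (X (\<lambda>p. a * f p + b * g p)) p) =
       (\<lambda>p. a * (X (Y f) p - Y (X f) p) + b * (X (Y g) p - Y (X g) p))" for a b
      by (simp add: vf_lin[OF X'(1)] vf_lin[OF Y'(1)] f g vs algebra_simps)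
    have XY: "X (Y (\<lambda>p. f p * g p)) = (\<lambda>p. (X (Y f) p * g p + Y f p * X g p) + (X f p * Y g p + f p * X (Y g) p))"
      if "vector_field M X" "vector_field M Y" for X Y
      using vf_lin[OF that(1) sf_mult[OF vf_sf[OF that(2) f] g] sf_mult[OF f vf_sf[OF that(2) g]], of 1 1]
      by (simp add: vf_mult that f g vf_sf)
    show "(\<lambda>p. X (Y (\<lambda>p. f p * g p)) p - Y (X (\<lambda>p. f p * g p)) p) =
       (\<lambda>p. (X (Y f) p - Y (X f) p) * g p + f p * (X (Y g) p - Y (X g) p))"
      unfolding XY[OF X'(1) Y'(1)] XY[OF Y'(1) X'(1)] by (auto simp: algebra_simps)
  qed
  moreover have "left_invariant G M (\<lambda>f p. X (Y f) p - Y (X f) p)"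
    unfolding left_invariant_def
  proof (intro ballI)
    fix g f assume "g \<in> carrier G" "f \<in> SF"
    then have "X (Y (left_translate G g f)) = left_translate G g (X (Y f))"
      "Y (X (left_translate G g f)) = left_translate G g (Y (X f))"
      using X'(2) Y'(2) vs by (auto simp: left_invariant_def)
    then show "(\<lambda>p. X (Y (left_translate G g f)) p - Y (X (left_translate G g f)) p) =
        left_translate G g (\<lambda>p. X (Y f) p - Y (X f) p)"
      by (auto simp: left_translate_def)
  qed
  ultimately show ?thesis by (simp add: lie_algebra_of_def)
qed

text \<open>The bracket of left-invariant fields carried to coordinates; \<open>E_surj\<close>
  provides such a vector, and it is unique by \<open>E_inj\<close>.\<close>

definition br :: "vec \<Rightarrow> vec \<Rightarrow> vec" where
  "br z w = (SOME b. b \<in> Rn dm \<and> E b = lie_bracket LA (E z) (E w))"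

lemma lie_br: "br z w \<in> Rn dm" "E (br z w) = lie_bracket LA (E z) (E w)"
proof -
  have "\<exists>b. b \<in> Rn dm \<and> E b = lie_bracket LA (E z) (E w)"
    using E_surj[OF bracket_in[OF E_in E_in]] by metis
  from someI_ex[OF this] show "br z w \<in> Rn dm" "E (br z w) = lie_bracket LA (E z) (E w)"
    by (auto simp: br_def)
qed

lemma E_sum: "E z f g = (\<Sum>l<dm. z l * E (unitv l) f g)"
proof (cases "f \<in> SF \<and> g \<in> carrier G")
  case True
  then show ?thesis by (simp add: E_eq dir_deriv_unitv) (simp add: dir_deriv_def)
next
  case False
  then have "E w f g = 0" for w by (auto simp: E_def)
  then show ?thesis by simp
qed

lemma E_field_sum:
  assumes "\<And>l. l \<in> A \<Longrightarrow> f l \<in> SF"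
  shows "E z (\<lambda>p. \<Sum>l\<in>A. c l * f l p) g = (\<Sum>l\<in>A. c l * E z (f l) g)"
  using assms
proof (induction A rule: infinite_finite_induct)
  case (insert x F)
  then show ?case
    using E_field_lin[of "f x" "\<lambda>p. \<Sum>l\<in>F. c l * f l p" z "c x" 1 g] sf_sum[of F "\<lambda>l p. c l * f l p"] sf_cmult
    by simp
qed (use E_field_lin[OF sf_0 sf_0, of z 0 0] in auto)

text \<open>A second derivative of \<open>\<lambda>y. f (p y)\<close> is a derivative of the form,
  applied to \<open>f\<close>, plus an iterated application of two left-invariant fields. The order
  of differentiation does not matter, so the difference of the first parts is minus the commutator
  of the fields.\<close>

lemma maurer_cartan:
  assumes p: "sm m U p" and x: "x \<in> U"
  shows "dir_deriv m (\<lambda>y. mc m p y v i) x u - dir_deriv m (\<lambda>y. mc m p y u i) x v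
    = - br (mc m p x u) (mc m p x v) i"
proof -
  note U = sm_eopen[OF p]
  define d where "d v u = (\<lambda>i. dir_deriv m (\<lambda>y. mc m p y v i) x u)" for v u
  have dR: "d v u \<in> Rn dm" for v u
  proof -
    have "(\<lambda>y. mc m p y v i) = (\<lambda>y. 0)" if "i \<ge> dm" for i using that mc_Rn by (auto simp: Rn_iff)
    then show ?thesis by (auto simp: Rn_iff d_def dir_deriv_const)
  qed
  have second: "dir_deriv m (\<lambda>y. dir_deriv m (\<lambda>y. f (p y)) y v) x u =
      E (d v u) f (p x) + E (mc m p x u) (E (mc m p x v) f) (p x)" if f: "f \<in> SF" for f v u
  proof -
    have El: "E (unitv l) f \<in> SF" for l by (rule E_sf[OF f])
    have "dir_deriv m (\<lambda>y. dir_deriv m (\<lambda>y. f (p y)) y v) x u =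
        dir_deriv m (\<lambda>y. \<Sum>l<dm. mc m p y v l * E (unitv l) f (p y)) x u"
      by (rule dir_deriv_cong[OF U x]) (simp add: mc_deriv[OF p _ f] E_sum[of "mc _ _ _ _"])
    also have "\<dots> = (\<Sum>l<dm. dir_deriv m (\<lambda>y. mc m p y v l * E (unitv l) f (p y)) x u)"
      by (rule dir_deriv_sum[OF U _ x]) (intro smooth_mult U smooth_mc[OF p] sf_sm[OF El p])
    also have "\<dots> = (\<Sum>l<dm. d v u l * E (unitv l) f (p x) + mc m p x v l * E (mc m p x u) (E (unitv l) f) (p x))"
      by (rule sum.cong[OF refl])
        (simp add: dir_deriv_mult[OF smooth_mc[OF p] sf_sm[OF El p] x] d_def mc_deriv[OF p x El])
    also have "\<dots> = E (d v u) f (p x) + E (mc m p x u) (\<lambda>g. \<Sum>l<dm. mc m p x v l * E (unitv l) f g) (p x)"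
      by (simp add: sum.distrib E_field_sum El E_sum[of "d v u"])
    also have "(\<lambda>g. \<Sum>l<dm. mc m p x v l * E (unitv l) f g) = E (mc m p x v) f"
      by (intro ext) (simp add: E_sum[of "mc m p x v"])
    finally show ?thesis .
  qed
  have "(\<lambda>i. 1 * d v u i + (-1) * d u v i) = (\<lambda>i. 0 * d v u i + (-1) * br (mc m p x u) (mc m p x v) i)"
  proof (rule E_cancel[OF _ _ sm_carrier[OF p x]])
    show "(\<lambda>i. 1 * d v u i + (-1) * d u v i) \<in> Rn dm"
      "(\<lambda>i. 0 * d v u i + (-1) * br (mc m p x u) (mc m p x v) i) \<in> Rn dm"
      using dR lie_br(1) by (auto simp: Rn_iff)
    fix f assume f: "f \<in> SF"
    have "E (d v u) f (p x) + E (mc m p x u) (E (mc m p x v) f) (p x) =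
        E (d u v) f (p x) + E (mc m p x v) (E (mc m p x u) f) (p x)"
      using dir_deriv_commute[OF U sf_sm[OF f p] x, of v u] second[OF f] by simp
    then show "E (\<lambda>i. 1 * d v u i + (-1) * d u v i) f (p x) =
        E (\<lambda>i. 0 * d v u i + (-1) * br (mc m p x u) (mc m p x v) i) f (p x)"
      unfolding E_lin lie_br(2) by (simp add: lie_algebra_of_def)
  qed
  from fun_cong[OF this, of i] show ?thesis by (simp add: d_def)
qed

end

declare One_nat_def [simp del]

section \<open>Linear algebra\<close>

text \<open>A reduced echelon basis of a subspace: the coefficients of a vector with respect to the basis are
  its entries at the pivots.\<close>

lemma pivot_basis:
  assumes S: "S \<subseteq> Rn n" and zero: "(\<lambda>i. 0) \<in> S"
    and lin: "\<And>z w a b. z \<in> S \<Longrightarrow> w \<in> S \<Longrightarrow> (\<lambda>i. a * z i + b * w i) \<in> S"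
  shows "\<exists>I Z. I \<subseteq> {..<n} \<and> (\<forall>i\<in>I. Z i \<in> S) \<and> (\<forall>i\<in>I. \<forall>j\<in>I. Z i j = (if i = j then 1 else 0)) \<and>
    (\<forall>w\<in>S. w = (\<lambda>j. \<Sum>i\<in>I. w i * Z i j))"
proof -
  have closed: "(\<lambda>j. \<Sum>i\<in>I. c i * Z i j) \<in> S" if "\<And>i. i \<in> I \<Longrightarrow> Z i \<in> S" for I :: "nat set" and c Z
    using that
  proof (induction I rule: infinite_finite_induct)
    case (insert a I)
    have "(\<lambda>i. c a * Z a i + 1 * (\<Sum>k\<in>I. c k * Z k i)) \<in> S" using insert by (intro lin) auto
    then show ?case using insert by simp
  qed (use zero in auto)
  define P where "P I \<longleftrightarrow> I \<subseteq> {..<n} \<and> (\<exists>Z. (\<forall>i\<in>I. Z i \<in> S) \<and>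
      (\<forall>i\<in>I. \<forall>j\<in>I. Z i j = (if i = j then 1 else 0)))" for I :: "nat set"
  have "P {}" by (simp add: P_def)
  moreover have "card I < Suc n" if "P I" for I
    using that card_mono[of "{..<n}" I] by (simp add: P_def)
  ultimately have "\<exists>I. P I \<and> (\<forall>J. P J \<longrightarrow> card J \<le> card I)"
    using ex_has_greatest_nat[of P "{}" card n] by fastforce
  then obtain I where I: "P I" and max: "\<And>J. P J \<Longrightarrow> card J \<le> card I" by blast
  then obtain Z where I': "I \<subseteq> {..<n}" and Z: "\<And>i. i \<in> I \<Longrightarrow> Z i \<in> S"
    "\<And>i j. i \<in> I \<Longrightarrow> j \<in> I \<Longrightarrow> Z i j = (if i = j then 1 else 0)" unfolding P_def by blast
  have fin: "finite I" using I' finite_subset by blast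
  have rep: "w = (\<lambda>j. \<Sum>i\<in>I. w i * Z i j)" if w: "w \<in> S" for w
  proof (rule ccontr)
    assume ne: "w \<noteq> (\<lambda>j. \<Sum>i\<in>I. w i * Z i j)"
    \<comment> \<open>Subtracting the combination makes all pivot entries vanish; a remaining
      nonzero entry \<open>j\<close> would be one more pivot, against maximality.\<close>
    define w' where "w' = (\<lambda>j. 1 * w j + (-1) * (\<Sum>i\<in>I. w i * Z i j))"
    have w'S: "w' \<in> S" unfolding w'_def by (intro lin w closed Z)
    have w'0: "w' k = 0" if "k \<in> I" for k
    proof -
      have "(\<Sum>i\<in>I. w i * Z i k) = (\<Sum>i\<in>I. if i = k then w i else 0)"
        using that by (intro sum.cong) (auto simp: Z(2))
      then show ?thesis using fin that by (simp add: w'_def)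
    qed
    obtain j where j: "w' j \<noteq> 0" using ne by (auto simp: w'_def fun_eq_iff)
    have "w' \<in> Rn n" using w'S S by blast
    then have jn: "j < n" using j by (metis Rn_iff not_less)
    have jI: "j \<notin> I" using j w'0 by blast
    \<comment> \<open>The new basis vector is \<open>w'\<close> scaled to have entry 1 at
      \<open>j\<close>; the old ones are cleared at \<open>j\<close> and keep their pivot entries,
      as \<open>w'\<close> is 0 there.\<close>
    define Y where "Y i = (if i = j then (\<lambda>k. inverse (w' j) * w' k + 0 * w' k)
       else (\<lambda>k. 1 * Z i k + (- Z i j * inverse (w' j)) * w' k))" for i
    have YS: "Y i \<in> S" if "i \<in> insert j I" for i
    proof (cases "i = j")
      case True
      then show ?thesis unfolding Y_def using lin[OF w'S w'S, of "inverse (w' j)" 0] by simp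
    next
      case False
      then have "i \<in> I" using that by simp
      from lin[OF Z(1)[OF this] w'S, of 1 "- Z i j * inverse (w' j)"] False show ?thesis unfolding Y_def by simp
    qed
    have Yd: "Y i k = (if i = k then 1 else 0)" if "i \<in> insert j I" "k \<in> insert j I" for i k
      using that j jI w'0 by (auto simp: Y_def Z(2))
    have "P (insert j I)" unfolding P_def using I' jn YS Yd by (intro conjI exI[of _ Y]) auto
    from max[OF this] show False using jI fin by simp
  qed
  show ?thesis using I' Z rep by (intro exI[of _ I] exI[of _ Z]) blast
qed

text \<open>With a reduced basis, membership says that \<open>w\<close> equals the sum of the
  \<open>w i * Z i\<close> over the pivots, which is one linear equation per coordinate. Equations
  pass to limits and to derivatives, and both uses occur below.\<close>

lemma subspace_equations:
  assumes S: "S \<subseteq> Rn n" and zero: "(\<lambda>i. 0) \<in> S"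
    and lin: "\<And>z w a b. z \<in> S \<Longrightarrow> w \<in> S \<Longrightarrow> (\<lambda>i. a * z i + b * w i) \<in> S"
  shows "\<exists>A. \<forall>w\<in>Rn n. w \<in> S \<longleftrightarrow> (\<forall>j<n. (\<Sum>i<n. A j i * w i) = 0)"
proof -
  obtain I Z where I: "I \<subseteq> {..<n}" and Z: "\<forall>i\<in>I. Z i \<in> S" and rep: "\<forall>w\<in>S. w = (\<lambda>j. \<Sum>i\<in>I. w i * Z i j)"
    using pivot_basis[OF S zero lin] by blast
  have fin: "finite I" using I finite_subset by blast
  define A where "A j i = (if i = j then 1 else 0) - (if i \<in> I then Z i j else 0)" for i j
  have A: "(\<Sum>i<n. A j i * w i) = w j - (\<Sum>i\<in>I. w i * Z i j)" if "j < n" for j w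
  proof -
    have "(\<Sum>i<n. A j i * w i) = (\<Sum>i<n. (if i = j then w i else 0) - (if i \<in> I then w i * Z i j else 0))"
      by (rule sum.cong) (auto simp: A_def algebra_simps)
    also have "\<dots> = w j - (\<Sum>i<n. if i \<in> I then w i * Z i j else 0)"
      using that by (simp add: sum_subtractf)
    also have "(\<Sum>i<n. if i \<in> I then w i * Z i j else 0) = (\<Sum>i\<in>I. w i * Z i j)"
      using I by (subst sum.inter_restrict[symmetric]) (auto simp: Int_absorb1)
    finally show ?thesis .
  qed
  have closed: "(\<lambda>j. \<Sum>i\<in>J. c i * Z i j) \<in> S" if "J \<subseteq> I" for J c
    using finite_subset[OF that fin] that
  proof (induction J rule: finite_induct)
    case (insert a J)
    have "(\<lambda>i. c a * Z a i + 1 * (\<Sum>k\<in>J. c k * Z k i)) \<in> S" using insert Z by (intro lin) auto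
    then show ?case using insert by simp
  qed (use zero in auto)
  have "w \<in> S \<longleftrightarrow> (\<forall>j<n. (\<Sum>i<n. A j i * w i) = 0)" if w: "w \<in> Rn n" for w
  proof
    assume "w \<in> S"
    then have "w j = (\<Sum>i\<in>I. w i * Z i j)" for j using rep by meson
    then show "\<forall>j<n. (\<Sum>i<n. A j i * w i) = 0" using A[of _ w] by (metis diff_self)
  next
    assume h: "\<forall>j<n. (\<Sum>i<n. A j i * w i) = 0"
    have "w = (\<lambda>j. \<Sum>i\<in>I. w i * Z i j)"
    proof
      fix j show "w j = (\<Sum>i\<in>I. w i * Z i j)"
      proof (cases "j < n")
        case True
        then show ?thesis using h A[OF True, of w] by simp
      next
        case False
        have "(\<lambda>j. \<Sum>i\<in>I. w i * Z i j) \<in> Rn n" using closed[of I w] S by blast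
        then show ?thesis using False w by (simp add: Rn_iff)
      qed
    qed
    then show "w \<in> S" using closed[of I w] by simp
  qed
  then show ?thesis by blast
qed

text \<open>Gaussian elimination with function coefficients, pivoting on the last diagonal entry,
  which is nonzero near \<open>x0\<close>.\<close>

lemma solve_linear_smooth:
  fixes k :: nat
  assumes "eopen m U" "x0 \<in> U"
    and "\<And>i j. i < k \<Longrightarrow> j < k \<Longrightarrow> smooth_fun_on m U (A i j)" "\<And>i. i < k \<Longrightarrow> smooth_fun_on m U (b i)"
    and "\<And>i j. i < k \<Longrightarrow> j < k \<Longrightarrow> A i j x0 = (if i = j then 1 else 0)"
  shows "\<exists>V \<xi>. x0 \<in> V \<and> V \<subseteq> U \<and> eopen m V \<and> (\<forall>j<k. smooth_fun_on m V (\<xi> j)) \<and>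
    (\<forall>x\<in>V. \<forall>i<k. (\<Sum>j<k. A i j x * \<xi> j x) = b i x)"
  using assms
proof (induction k arbitrary: A b U)
  case 0
  then show ?case by blast
next
  case (Suc k)
  note sA = Suc.prems(3) and sb = Suc.prems(4)
  define U1 where "U1 = {x \<in> U. A k k x \<in> - {0}}"
  have U1: "eopen m U1" unfolding U1_def
    by (rule eopen_vimage_real[OF Suc.prems(1) smooth_continuous[OF sA]]) auto
  have U1s: "U1 \<subseteq> U" by (auto simp: U1_def)
  have x0: "x0 \<in> U1" using Suc.prems(2,5) by (simp add: U1_def)
  have ne: "A k k x \<noteq> 0" if "x \<in> U1" for x using that by (simp add: U1_def)
  \<comment> \<open>The Schur complement of the last entry. At \<open>x0\<close> the entries
    \<open>A i k\<close> with \<open>i < k\<close> vanish, so the reduced matrix is again the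
    identity there.\<close>
  define A' where "A' i j x = A i j x - A i k x * A k j x / A k k x" for i j x
  define b' where "b' i x = b i x - A i k x * b k x / A k k x" for i x
  have s: "smooth_fun_on m U1 (A i j)" if "i < Suc k" "j < Suc k" for i j
    by (rule smooth_subset[OF sA[OF that] U1s])
  have s': "smooth_fun_on m U1 (b i)" if "i < Suc k" for i
    by (rule smooth_subset[OF sb[OF that] U1s])
  have 1: "smooth_fun_on m U1 (A' i j)" if "i < k" "j < k" for i j
    unfolding A'_def[abs_def] using that ne
    by (intro smooth_diff smooth_divide smooth_mult U1 s) auto
  have 2: "smooth_fun_on m U1 (b' i)" if "i < k" for i
    unfolding b'_def[abs_def] using that ne
    by (intro smooth_diff smooth_divide smooth_mult U1 s s') auto
  have 3: "A' i j x0 = (if i = j then 1 else 0)" if "i < k" "j < k" for i j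
    using that Suc.prems(5) by (simp add: A'_def)
  obtain V \<xi> where V: "x0 \<in> V" "V \<subseteq> U1" "eopen m V" and \<xi>: "\<forall>j<k. smooth_fun_on m V (\<xi> j)"
    and sol: "\<forall>x\<in>V. \<forall>i<k. (\<Sum>j<k. A' i j x * \<xi> j x) = b' i x"
    using Suc.IH[of U1 A' b', OF U1 x0 1 2 3] by blast
  define \<xi>' where "\<xi>' j = (if j < k then \<xi> j else (\<lambda>x. (b k x - (\<Sum>j<k. A k j x * \<xi> j x)) / A k k x))" for j
  have sV: "smooth_fun_on m V (A i j)" if "i < Suc k" "j < Suc k" for i j
    by (rule smooth_subset[OF s[OF that] V(2)])
  have sV': "smooth_fun_on m V (b i)" if "i < Suc k" for i
    by (rule smooth_subset[OF s'[OF that] V(2)])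
  have "smooth_fun_on m V (\<lambda>x. (b k x - (\<Sum>j<k. A k j x * \<xi> j x)) / A k k x)"
  proof (intro smooth_divide smooth_diff smooth_sum smooth_mult V(3) sV sV')
    show "smooth_fun_on m V (\<xi> j)" if "j \<in> {..<k}" for j using \<xi> that by blast
    show "A k k x \<noteq> 0" if "x \<in> V" for x using ne V(2) that by blast
  qed auto
  then have "\<forall>j<Suc k. smooth_fun_on m V (\<xi>' j)" using \<xi> by (auto simp: \<xi>'_def)
  moreover have "(\<Sum>j<Suc k. A i j x * \<xi>' j x) = b i x" if x: "x \<in> V" and i: "i < Suc k" for x i
  proof -
    have a: "A k k x \<noteq> 0" using ne V(2) x by blast
    let ?S = "\<Sum>j<k. A k j x * \<xi> j x"
    have sum: "(\<Sum>j<Suc k. A i j x * \<xi>' j x) = (\<Sum>j<k. A i j x * \<xi> j x) + A i k x * ((b k x - ?S) / A k k x)"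
      by (simp add: \<xi>'_def)
    show ?thesis
    proof (cases "i = k")
      case True
      then show ?thesis unfolding sum using a by simp
    next
      case False
      then have "(\<Sum>j<k. A' i j x * \<xi> j x) = b' i x" using sol x i by simp
      moreover have "(\<Sum>j<k. A' i j x * \<xi> j x) = (\<Sum>j<k. A i j x * \<xi> j x) - A i k x / A k k x * ?S"
        unfolding sum_distrib_left sum_subtractf[symmetric]
        by (rule sum.cong) (auto simp: A'_def algebra_simps)
      ultimately show ?thesis unfolding sum b'_def using a by (simp add: field_simps)
    qed
  qed
  ultimately show ?case using V U1s by (intro exI[of _ V] exI[of _ \<xi>']) auto
qed

section \<open>Velocities of smooth curves in a subgroup\<close>

definition z0 :: vec where "z0 = (\<lambda>i. 0)"

definition sc :: "real \<Rightarrow> vec" where "sc t = (\<lambda>i. if i = 0 then t else 0)"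

lemma z0_nth [simp]: "z0 i = 0" by (simp add: z0_def)

lemma z0_Rn: "z0 \<in> Rn m" by (simp add: z0_def Rn_iff)

lemma sc_Rn: "sc t \<in> Rn 1" by (auto simp: sc_def Rn_iff)

lemma sc_0 [simp]: "sc 0 = z0" by (auto simp: sc_def z0_def)

lemma sc_nth: "sc t 0 = t" by (simp add: sc_def)

lemma sc_cube: "sc t \<in> cube 1 z0 \<epsilon> \<longleftrightarrow> \<bar>t\<bar> < \<epsilon>"
  using sc_Rn by (simp add: cube_def sc_def z0_def)

lemma smooth_sc: "eopen m U \<Longrightarrow> smooth_fun_on m U f \<Longrightarrow> smooth_vec_on m U 1 (\<lambda>x. sc (f x))"
  by (rule smooth_vecI) (use sc_Rn in \<open>auto simp: sc_def\<close>)

lemma jacobian_sc: "jacobian m 1 (\<lambda>x. sc (f x)) x v = (\<lambda>l. dir_deriv m f x v * unitv 0 l)"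
  by (auto simp: jacobian_def sc_def unitv_def)

lemma jacobian_pr:
  assumes "u \<in> Rn m" "v \<in> Rn l"
  shows "jacobian (m + l) m (pr1 m) x (va m u v) = u" "jacobian (m + l) l (pr2 m) x (va m u v) = v"
  using assms
  by (auto simp: jacobian_def fun_eq_iff pr1_def pr2_def dir_deriv_coord vec_append_def Rn_iff)

lemma smooth_on_real:
  assumes f: "smooth_fun_on 1 (cube 1 z0 \<epsilon>) f" and t: "\<bar>t\<bar> < \<epsilon>"
  shows "((\<lambda>s. f (sc s)) has_real_derivative partial 0 f (sc t)) (at t)"
proof -
  have "hasp 0 f (sc t) (partial 0 f (sc t))" by (rule smooth_hasp[OF f]) (use t sc_cube in auto)
  moreover have "(sc t)(0 := s) = sc s" for s by (auto simp: sc_def)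
  ultimately show ?thesis by (simp add: hasp_def sc_nth)
qed

context mfd begin

lemma chart_open:
  assumes c: "(W, \<psi>) \<in> charts M" and V: "eopen dm V" "V \<subseteq> \<psi> ` W"
  shows "openin (mtop M) {q \<in> W. \<psi> q \<in> V}"
proof -
  have h: "homeomorphic_map (subtopology (mtop M) W) (subtopology (Euclidean_space dm) (\<psi> ` W)) \<psi>"
    using mfd c unfolding smooth_manifold_def by fast
  have "openin (subtopology (Euclidean_space dm) (\<psi> ` W)) V"
    using V openin_open_subtopology[OF chart(2)[OF c]] by blast
  from openin_continuous_map_preimage[OF homeomorphic_imp_continuous_map[OF h] this]
  have "openin (subtopology (mtop M) W) {q \<in> topspace (subtopology (mtop M) W). \<psi> q \<in> V}" .
  moreover have "{q \<in> topspace (subtopology (mtop M) W). \<psi> q \<in> V} = {q \<in> W. \<psi> q \<in> V}"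
    using chart(5)[OF c] by auto
  ultimately show ?thesis using openin_open_subtopology[OF chart(1)[OF c]] by simp
qed

end

context lie_grp begin

text \<open>With independent variables the two summands of the product rule separate: directions in
  the first factor are twisted by \<open>Adi (q y)\<close>, those in the second are not. This
  evaluates the form on the product plots used below.\<close>

lemma mc_pr:
  assumes p: "sm m U p" and q: "sm l V q" and x: "x \<in> U" and y: "y \<in> V"
    and u: "u \<in> Rn m" and v: "v \<in> Rn l"
  shows "mc (m + l) (\<lambda>w. p (pr1 m w) \<otimes> q (pr2 m w)) (va m x y) (va m u v)
    = (\<lambda>i. Adi (q y) (mc m p x u) i + mc l q y v i)"
proof -
  let ?B = "prodset m l U V"
  have B: "eopen (m + l) ?B" by (rule eopen_prodset[OF sm_eopen[OF p] sm_eopen[OF q]])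
  have xy: "va m x y \<in> ?B"
    by (rule va_prodset[OF eopen_subset[OF sm_eopen[OF p]] eopen_subset[OF sm_eopen[OF q]] x y])
  have xR: "x \<in> Rn m" using x eopen_subset[OF sm_eopen[OF p]] by blast
  have i1: "pr1 m ` ?B \<subseteq> U" and i2: "pr2 m ` ?B \<subseteq> V" by (auto simp: prodset_def)
  note s1 = sm_compose[OF p B smooth_pr1[OF B] i1] and s2 = sm_compose[OF q B smooth_pr2[OF B] i2]
  show ?thesis
    unfolding mc_mult[OF s1 s2 xy] mc_compose[OF p B smooth_pr1[OF B] i1 xy]
      mc_compose[OF q B smooth_pr2[OF B] i2 xy] jacobian_pr[OF u v]
    by (simp add: pr1_va[OF xR] pr2_va)
qed

lemma mc_zero: "mc m p x z0 = z0"
  using mc_lin[of m p x 0 z0 0 z0] by (simp add: z0_def)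

lemma Adi_zero: "Adi g z0 = z0"
  unfolding Adi_def by (rule mc_zero)

lemma E_zero: "E z0 f g = 0"
  using E_lin[of 0 z0 0 z0 f g] by (simp add: z0_def)

text \<open>\<open>Adi (p x) z\<close> is the Maurer--Cartan form of the product of \<psi>0(b) and
  p(x), at b = \<open>e0\<close> and in the direction \<open>z\<close> of b, so its smoothness is an
  instance of \<open>smooth_mc\<close>.\<close>

lemma smooth_Adi:
  assumes p: "sm m U p" and z: "z \<in> Rn dm"
  shows "smooth_fun_on m U (\<lambda>x. Adi (p x) z i)"
proof -
  note U = sm_eopen[OF p]
  let ?q = "\<lambda>w. \<psi>0 (pr1 dm w) \<otimes> p (pr2 dm w)"
  have q: "sm (dm + m) (prodset dm m V0 U) ?q" by (rule sm_prod[OF \<psi>0(1) p])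
  have "smooth_fun_on m U (\<lambda>x. mc (dm + m) ?q (va dm e0 x) (va dm z z0) i)"
    by (rule smooth_compose[OF U sm_eopen[OF q] smooth_va[OF smooth_vec_const[OF U V0(3)] smooth_vec_id[OF U]] _ smooth_mc[OF q]])
      (use va_prodset[OF eopen_subset[OF V0(1)] eopen_subset[OF U] V0(2)] in auto)
  then show ?thesis
    by (rule smooth_cong[OF U, THEN iffD1, rotated])
      (simp add: mc_pr[OF \<psi>0(1) p V0(2) _ z z0_Rn] mc_\<psi>0[OF z] mc_zero)
qed

text \<open>Velocities at the unit of smooth curves in \<open>K\<close>, with no homomorphism
  property demanded; that these are the vectors whose one-parameter groups lie in \<open>K\<close>
  is shown in \<open>lie_subalgebra_eq\<close>.\<close>

definition h0 :: "'a set \<Rightarrow> vec set" where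
  "h0 K = {z. \<exists>c \<epsilon>. \<epsilon> > 0 \<and> sm 1 (cube 1 z0 \<epsilon>) c \<and> (\<forall>x\<in>cube 1 z0 \<epsilon>. c x \<in> K) \<and>
     c z0 = \<one> \<and> mc 1 c z0 (unitv 0) = z}"

lemma h0_Rn: "h0 K \<subseteq> Rn dm"
  using mc_Rn by (auto simp: h0_def)

text \<open>Follow the plot along the straight line through \<open>x\<close> in direction
  \<open>v\<close> and move the resulting curve to the unit by a left translation with an element of
  \<open>K\<close>, which leaves the form unchanged.\<close>

lemma h0I:
  assumes K: "subgroup K G" and p: "sm m U p" and pK: "\<And>y. y \<in> U \<Longrightarrow> p y \<in> K" and x: "x \<in> U" and v: "v \<in> Rn m"
  shows "mc m p x v \<in> h0 K"
proof -
  note U = sm_eopen[OF p]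
  have xR: "x \<in> Rn m" using x eopen_subset[OF U] by blast
  define L where "L y = (\<lambda>i. x i + y 0 * v i)" for y :: vec
  have L: "smooth_vec_on 1 (Rn 1) m L"
    by (rule smooth_vecI) (use xR v in \<open>auto simp: L_def Rn_iff intro!: smooth_add smooth_mult smooth_coord smooth_const eopen_Rn\<close>)
  have L0: "L z0 = x" by (simp add: L_def z0_def)
  let ?A = "{y \<in> Rn 1. L y \<in> U}"
  have A: "eopen 1 ?A" by (rule eopen_vimage[OF eopen_Rn U L])
  obtain \<epsilon> where \<epsilon>: "\<epsilon> > 0" "cube 1 z0 \<epsilon> \<subseteq> ?A"
    using eopen_contains_cube[OF A, of z0] x L0 z0_Rn by auto
  let ?C = "cube 1 z0 \<epsilon>"
  have L': "smooth_vec_on 1 ?C m L" by (rule smooth_vec_on_subset[OF _ L]) (auto simp: cube_def)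
  have im: "L ` ?C \<subseteq> U" using \<epsilon>(2) by auto
  have c1: "sm 1 ?C (\<lambda>y. p (L y))" by (rule sm_compose[OF p eopen_cube L' im])
  have px: "p x \<in> carrier G" "p x \<in> K" using sm_carrier[OF p x] pK[OF x] by auto
  let ?c = "\<lambda>y. \<iota> (p x) \<otimes> p (L y)"
  have c: "sm 1 ?C ?c" by (rule sm_lmult[OF c1]) (simp add: px)
  have z: "z0 \<in> ?C" by (rule mem_cube_self[OF z0_Rn \<epsilon>(1)])
  have J: "jacobian 1 m L z0 (unitv 0) = v"
  proof
    fix i
    have "partial 0 (\<lambda>y. x i + y 0 * v i) z0 = v i"
      by (rule hasp_partial) (auto simp: hasp_def intro!: derivative_eq_intros)
    then show "jacobian 1 m L z0 (unitv 0) i = v i"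
      using v by (auto simp: jacobian_def dir_deriv_unitv L_def Rn_iff)
  qed
  have "mc 1 ?c z0 (unitv 0) = mc m p x v"
    using mc_lmult[OF c1 z, of "\<iota> (p x)"] mc_compose[OF p eopen_cube L' im z, of "unitv 0"] px
    by (simp add: J L0)
  moreover have "?c y \<in> K" if "y \<in> ?C" for y
    using subgroup.m_closed[OF K subgroup.m_inv_closed[OF K px(2)]] pK im that by blast
  ultimately show ?thesis
    unfolding h0_def using \<epsilon>(1) c px L0 by (intro CollectI exI[of _ ?c] exI[of _ \<epsilon>]) auto
qed

lemma h0_zero: "subgroup K G \<Longrightarrow> (\<lambda>i. 0) \<in> h0 K"
  using h0I[OF _ sm_constG[OF one_closed eopen_Rn] _ z0_Rn z0_Rn] mc_const[OF one_closed]
    subgroup.one_closed by metis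

text \<open>The product of the two curves, run at speeds \<open>a\<close> and \<open>b\<close>,
  stays in \<open>K\<close>. Its velocity is the combination since both curves are at the unit at
  time 0, where \<open>Adi\<close> is the identity.\<close>

lemma h0_lin:
  assumes K: "subgroup K G" and z: "z \<in> h0 K" and w: "w \<in> h0 K"
  shows "(\<lambda>i. a * z i + b * w i) \<in> h0 K"
proof -
  obtain c \<epsilon> where c: "\<epsilon> > 0" "sm 1 (cube 1 z0 \<epsilon>) c" "\<forall>x\<in>cube 1 z0 \<epsilon>. c x \<in> K" "c z0 = \<one>" "mc 1 c z0 (unitv 0) = z"
    using z unfolding h0_def by blast
  obtain d \<delta> where d: "\<delta> > 0" "sm 1 (cube 1 z0 \<delta>) d" "\<forall>x\<in>cube 1 z0 \<delta>. d x \<in> K" "d z0 = \<one>" "mc 1 d z0 (unitv 0) = w"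
    using w unfolding h0_def by blast
  have s: "smooth_vec_on 1 U 1 (\<lambda>y. sc (a * y 0))" if "eopen 1 U" for a U
    by (intro smooth_sc that smooth_cmult smooth_coord)
  let ?U1 = "{y \<in> Rn 1. sc (a * y 0) \<in> cube 1 z0 \<epsilon>}" and ?U2 = "{y \<in> Rn 1. sc (b * y 0) \<in> cube 1 z0 \<delta>}"
  have o: "eopen 1 (?U1 \<inter> ?U2)"
    by (intro eopen_Int eopen_vimage[OF eopen_Rn eopen_cube s] eopen_Rn)
  let ?c = "\<lambda>y. c (sc (a * y 0))" and ?d = "\<lambda>y. d (sc (b * y 0))"
  have i1: "(\<lambda>y. sc (a * y 0)) ` (?U1 \<inter> ?U2) \<subseteq> cube 1 z0 \<epsilon>" and
    i2: "(\<lambda>y. sc (b * y 0)) ` (?U1 \<inter> ?U2) \<subseteq> cube 1 z0 \<delta>" by auto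
  have s1: "sm 1 (?U1 \<inter> ?U2) ?c" by (rule sm_compose[OF c(2) o s[OF o] i1])
  have s2: "sm 1 (?U1 \<inter> ?U2) ?d" by (rule sm_compose[OF d(2) o s[OF o] i2])
  have e: "sc (a * z0 0) = z0" for a by (simp add: z0_def sc_def fun_eq_iff)
  have zz: "z0 \<in> ?U1 \<inter> ?U2" using z0_Rn c(1) d(1) mem_cube_self[OF z0_Rn] by (simp add: e)
  have j: "jacobian 1 1 (\<lambda>y. sc (a * y 0)) z0 (unitv 0) = (\<lambda>l. a * unitv 0 l + 0 * unitv 0 l)" for a
    using dir_deriv_cmult[OF smooth_coord[OF eopen_Rn] z0_Rn[of 1], of a 0 "unitv 0"]
    by (simp add: jacobian_sc dir_deriv_coord) (simp add: unitv_def)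
  have "mc 1 ?c z0 (unitv 0) = (\<lambda>i. a * z i)"
    using mc_compose[OF c(2) o s[OF o] i1 zz, of "unitv 0"] unfolding j mc_lin e by (simp add: c(5))
  moreover have "mc 1 ?d z0 (unitv 0) = (\<lambda>i. b * w i)"
    using mc_compose[OF d(2) o s[OF o] i2 zz, of "unitv 0"] unfolding j mc_lin e by (simp add: d(5))
  moreover have "(\<lambda>i. a * z i) \<in> Rn dm"
  proof -
    have "z \<in> Rn dm" using z h0_Rn by blast
    then show ?thesis by (simp add: Rn_iff)
  qed
  ultimately have "mc 1 (\<lambda>y. ?c y \<otimes> ?d y) z0 (unitv 0) = (\<lambda>i. a * z i + b * w i)"
    using mc_mult[OF s1 s2 zz, of "unitv 0"] by (simp add: e d(4) Adi_one)
  moreover have "mc 1 (\<lambda>y. ?c y \<otimes> ?d y) z0 (unitv 0) \<in> h0 K"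
    by (rule h0I[OF K sm_mult[OF s1 s2] _ zz unitv_Rn]) (use c(3) d(3) subgroup.m_closed[OF K] in auto)
  ultimately show ?thesis by simp
qed

text \<open>This is the velocity of a curve in \<open>K\<close> translated by \<open>h\<close> on
  the right, which is again a plot of \<open>K\<close>.\<close>

lemma h0_Adi:
  assumes K: "subgroup K G" and z: "z \<in> h0 K" and h: "h \<in> K"
  shows "Adi h z \<in> h0 K"
proof -
  obtain c \<epsilon> where c: "\<epsilon> > 0" "sm 1 (cube 1 z0 \<epsilon>) c" "\<forall>x\<in>cube 1 z0 \<epsilon>. c x \<in> K" "c z0 = \<one>" "mc 1 c z0 (unitv 0) = z"
    using z unfolding h0_def by blast
  have hG: "h \<in> carrier G" using subgroup.subset[OF K] h by blast
  have zz: "z0 \<in> cube 1 z0 \<epsilon>" by (rule mem_cube_self[OF z0_Rn c(1)])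
  have "mc 1 (\<lambda>y. c y \<otimes> h) z0 (unitv 0) = Adi h z"
    using mc_rmult[OF c(2) zz hG] c(5) by simp
  moreover have "mc 1 (\<lambda>y. c y \<otimes> h) z0 (unitv 0) \<in> h0 K"
    by (rule h0I[OF K sm_rmult[OF c(2) hG] _ zz unitv_Rn]) (use c(3) h subgroup.m_closed[OF K] in auto)
  ultimately show ?thesis by simp
qed

lemma h0_equations:
  assumes "subgroup K G"
  shows "\<exists>A. \<forall>w\<in>Rn dm. w \<in> h0 K \<longleftrightarrow> (\<forall>j<dm. (\<Sum>i<dm. A j i * w i) = 0)"
  by (rule subspace_equations[OF h0_Rn h0_zero[OF assms] h0_lin[OF assms]])

text \<open>The condition on g is closed, as subspaces are closed, and it holds on the dense subgroup.\<close>

lemma h0_Adi_dense: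
  assumes K: "subgroup K G" and dense: "mtop M closure_of K = topspace (mtop M)"
    and z: "z \<in> h0 K" and g: "g \<in> carrier G"
  shows "Adi g z \<in> h0 K"
proof (rule ccontr)
  assume ne: "Adi g z \<notin> h0 K"
  obtain A where A: "\<forall>w\<in>Rn dm. w \<in> h0 K \<longleftrightarrow> (\<forall>j<dm. (\<Sum>i<dm. A j i * w i) = 0)"
    using h0_equations[OF K] by blast
  obtain j where j: "j < dm" "(\<Sum>i<dm. A j i * Adi g z i) \<noteq> 0" using ne A Adi_Rn by blast
  have zR: "z \<in> Rn dm" using z h0_Rn by blast
  obtain W \<psi> where c: "(W, \<psi>) \<in> charts M" "g \<in> W" by (rule chart_at) (use g top_carrier in auto)
  note p = sm_chart_inv[OF c(1)]
  \<comment> \<open>A linear functional that vanishes on \<open>h0 K\<close> but not on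
    \<open>Adi g z\<close>, evaluated on \<open>Adi\<close> of the points near \<open>g\<close>. It
    is nonzero on an open neighbourhood of \<open>g\<close>, and this contains a point of
    \<open>K\<close>.\<close>
  define F where "F y = (\<Sum>i<dm. A j i * Adi (inv_into W \<psi> y) z i)" for y
  have sF: "smooth_fun_on dm (\<psi> ` W) F"
    unfolding F_def[abs_def] by (intro smooth_sum smooth_cmult sm_eopen[OF p] smooth_Adi[OF p zR])
  define V where "V = {y \<in> \<psi> ` W. F y \<in> - {0}}"
  have V: "eopen dm V" unfolding V_def
    by (rule eopen_vimage_real[OF sm_eopen[OF p] smooth_continuous[OF sF]]) auto
  have O: "openin (mtop M) {q \<in> W. \<psi> q \<in> V}" by (rule chart_open[OF c(1) V]) (auto simp: V_def)
  have "g \<in> {q \<in> W. \<psi> q \<in> V}" using c j by (simp add: V_def F_def chart(6)[OF c(1)])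
  moreover have "g \<in> mtop M closure_of K" using dense g top_carrier by simp
  ultimately have "\<exists>h. h \<in> K \<and> h \<in> {q \<in> W. \<psi> q \<in> V}"
    using O unfolding in_closure_of by (elim conjE allE[of _ "{q \<in> W. \<psi> q \<in> V}"]) auto
  then obtain h where h: "h \<in> K" "h \<in> W" "\<psi> h \<in> V" by blast
  have "F (\<psi> h) \<noteq> 0" using h(3) by (simp add: V_def)
  then have "(\<Sum>i<dm. A j i * Adi h z i) \<noteq> 0" unfolding F_def chart(6)[OF c(1) h(2)] .
  moreover have "Adi h z \<in> h0 K" by (rule h0_Adi[OF K z h(1)])
  ultimately show False using A Adi_Rn j(1) by blast
qed

subsection \<open>Integral curves\<close>

definition intcurve :: "real \<Rightarrow> vec \<Rightarrow> (real \<Rightarrow> 'a) \<Rightarrow> bool" where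
  "intcurve \<epsilon> z c \<longleftrightarrow> (\<forall>t. \<bar>t\<bar> < \<epsilon> \<longrightarrow> c t \<in> carrier G \<and>
     (\<forall>f\<in>SF. ((\<lambda>s. f (c s)) has_real_derivative E z f (c t)) (at t)))"

text \<open>Differentiating a smooth function \<open>f\<close> along the curve gives the smooth
  function \<open>E z f\<close> along the curve, so these compositions form a family closed under
  derivatives.\<close>

lemma intcurve_smooth:
  assumes c: "intcurve \<epsilon> z c" and z: "z \<in> Rn dm"
  shows "sm 1 (cube 1 z0 \<epsilon>) (\<lambda>x. c (x 0))"
    and "x \<in> cube 1 z0 \<epsilon> \<Longrightarrow> mc 1 (\<lambda>x. c (x 0)) x (unitv 0) = z"
proof -
  have x0: "\<bar>x 0\<bar> < \<epsilon>" if "x \<in> cube 1 z0 \<epsilon>" for x using that by (simp add: cube_def z0_def)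
  have hp: "hasp 0 (\<lambda>x. f (c (x 0))) x (E z f (c (x 0)))" if "f \<in> SF" "x \<in> cube 1 z0 \<epsilon>" for f x
    using c that x0[OF that(2)] by (simp add: intcurve_def hasp_def)
  show s: "sm 1 (cube 1 z0 \<epsilon>) (\<lambda>x. c (x 0))"
  proof (rule sm_via_functions[OF eopen_cube])
    show "c (x 0) \<in> topspace (mtop M)" if "x \<in> cube 1 z0 \<epsilon>" for x
      using c x0[OF that] top_carrier by (simp add: intcurve_def)
    fix f assume f: "f \<in> SF"
    show "smooth_fun_on 1 (cube 1 z0 \<epsilon>) (\<lambda>x. f (c (x 0)))"
    proof (rule smooth_funI[OF eopen_cube, of _ "(\<lambda>f x. f (c (x 0))) ` SF"])
      fix h assume "h \<in> (\<lambda>f x. f (c (x (0::nat)))) ` SF"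
      then obtain f where f: "f \<in> SF" and h: "h = (\<lambda>x. f (c (x 0)))" by blast
      have "continuous_on {-\<epsilon><..<\<epsilon>} (\<lambda>s. f (c s))"
      proof (intro continuous_at_imp_continuous_on ballI)
        fix s assume "s \<in> {-\<epsilon><..<\<epsilon>}"
        then have "\<bar>s\<bar> < \<epsilon>" by auto
        then show "isCont (\<lambda>s. f (c s)) s" using c f unfolding intcurve_def by (blast intro: DERIV_isCont)
      qed
      then show "continuous_on (cube 1 z0 \<epsilon>) h" unfolding h
        by (rule continuous_on_compose2[OF _ continuous_on_coord]) (use x0 in force)
      show "\<exists>g\<in>(\<lambda>f x. f (c (x (0::nat)))) ` SF. \<forall>x\<in>cube 1 z0 \<epsilon>. hasp i h x (g x)" if "i < 1" for i
        using that hp[OF f] E_sf[OF f] unfolding h by (intro bexI[of _ "\<lambda>x. E z f (c (x 0))"]) auto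
    qed (use f in blast)
  qed
  show "mc 1 (\<lambda>x. c (x 0)) x (unitv 0) = z" if x: "x \<in> cube 1 z0 \<epsilon>"
    by (rule mcI[OF s x z]) (simp add: dir_deriv_unitv hasp_partial[OF hp[OF _ x]])
qed

lemma intcurve_ltrans:
  assumes c: "intcurve \<epsilon> z c" and g: "g \<in> carrier G"
  shows "intcurve \<epsilon> z (\<lambda>t. g \<otimes> c t)"
  unfolding intcurve_def
proof (intro allI impI conjI ballI)
  fix t assume t: "\<bar>t\<bar> < \<epsilon>"
  then have ct: "c t \<in> carrier G" using c by (simp add: intcurve_def)
  then show "g \<otimes> c t \<in> carrier G" using g by simp
  fix f assume f: "f \<in> SF"
  have "((\<lambda>s. left_translate G g f (c s)) has_real_derivative E z (left_translate G g f) (c t)) (at t)"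
    using c t sf_ltrans[OF f g] by (simp add: intcurve_def)
  moreover have "E z (left_translate G g f) (c t) = E z f (g \<otimes> c t)"
    using E_ltrans[OF f g] ct by (simp add: left_translate_def)
  moreover have "\<forall>\<^sub>F s in nhds t. left_translate G g f (c s) = f (g \<otimes> c s)"
  proof (rule eventually_mono[OF eventually_nhds_in_open[of "{-\<epsilon><..<\<epsilon>}" t]])
    fix s assume "s \<in> {-\<epsilon><..<\<epsilon>}"
    then have "\<bar>s\<bar> < \<epsilon>" by auto
    then have "c s \<in> carrier G" using c by (simp add: intcurve_def)
    then show "left_translate G g f (c s) = f (g \<otimes> c s)" by (simp add: left_translate_def)
  qed (use t in auto)
  ultimately show "((\<lambda>s. f (g \<otimes> c s)) has_real_derivative E z f (g \<otimes> c t)) (at t)"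
    using DERIV_cong_ev[OF refl _ refl, of "\<lambda>s. left_translate G g f (c s)" "\<lambda>s. f (g \<otimes> c s)" t] by simp
qed

lemma intcurve_shift:
  assumes c: "intcurve \<epsilon> z c" and \<delta>: "\<delta> + \<bar>a\<bar> \<le> \<epsilon>"
  shows "intcurve \<delta> z (\<lambda>t. c (t + a))"
  unfolding intcurve_def
proof (intro allI impI conjI ballI)
  fix t assume t: "\<bar>t\<bar> < \<delta>"
  then have "\<bar>t + a\<bar> < \<epsilon>" using \<delta> by linarith
  then have 1: "c (t + a) \<in> carrier G" "\<And>f. f \<in> SF \<Longrightarrow> ((\<lambda>s. f (c s)) has_real_derivative E z f (c (t + a))) (at (t + a))"
    using c by (auto simp: intcurve_def)
  show "c (t + a) \<in> carrier G" by (rule 1)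
  show "((\<lambda>s. f (c (s + a))) has_real_derivative E z f (c (t + a))) (at t)" if "f \<in> SF" for f
    using 1(2)[OF that] DERIV_shift[of "\<lambda>s. f (c s)" _ t a] by simp
qed

text \<open>Compare through the quotient r = c d^{-1}: from c = r d and the product rule, an
  injective map sends the form of r to 0. Hence the form vanishes, and every smooth function is
  constant along r.\<close>

lemma intcurve_unique:
  assumes c: "intcurve \<epsilon> z c" and d: "intcurve \<epsilon> z d" and z: "z \<in> Rn dm" and eq: "c 0 = d 0" and t: "\<bar>t\<bar> < \<epsilon>"
  shows "c t = d t"
proof -
  let ?C = "cube 1 z0 \<epsilon>"
  have e: "\<epsilon> > 0" using t by auto
  note sc1 = intcurve_smooth[OF c z] and sd = intcurve_smooth[OF d z]
  let ?r = "\<lambda>x. c (x 0) \<otimes> \<iota> (d (x (0::nat)))"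
  have r: "sm 1 ?C ?r" by (rule sm_mult[OF sc1(1) sm_inv[OF sd(1)]])
  have dG: "d (x 0) \<in> carrier G" "c (x 0) \<in> carrier G" if "x \<in> ?C" for x
    using sm_carrier[OF sd(1) that] sm_carrier[OF sc1(1) that] by auto
  have rd: "?r x \<otimes> d (x 0) = c (x 0)" if "x \<in> ?C" for x
    using dG[OF that] by (simp add: m_assoc)
  have mr: "mc 1 ?r x (unitv 0) = (\<lambda>i. 0)" if x: "x \<in> ?C" for x
  proof (rule Adi_inj[OF mc_Rn dG(1)[OF x]])
    have "z = mc 1 (\<lambda>x. ?r x \<otimes> d (x 0)) x (unitv 0)"
      using mc_cong[OF sm_mult[OF r sd(1)] x, of "\<lambda>x. c (x 0)"] rd sc1(2)[OF x] by auto
    also have "\<dots> = (\<lambda>i. Adi (d (x 0)) (mc 1 ?r x (unitv 0)) i + z i)"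
      using mc_mult[OF r sd(1) x] sd(2)[OF x] by simp
    finally show "Adi (d (x 0)) (mc 1 ?r x (unitv 0)) = (\<lambda>i. 0)" by (simp add: fun_eq_iff)
  qed
  have fr: "f (?r (sc t)) = f (?r (sc 0))" if f: "f \<in> SF" for f
  proof -
    have "((\<lambda>s. f (?r (sc s))) has_real_derivative 0) (at s)" if s: "\<bar>s\<bar> < \<epsilon>" for s
    proof -
      have sC: "sc s \<in> ?C" using s sc_cube by simp
      have "partial 0 (\<lambda>x. f (?r x)) (sc s) = E (mc 1 ?r (sc s) (unitv 0)) f (?r (sc s))"
        using mc_deriv[OF r sC f, of "unitv 0"] by (simp add: dir_deriv_unitv)
      also have "\<dots> = 0" unfolding mr[OF sC] by (rule E_zero[unfolded z0_def])
      finally show ?thesis using smooth_on_real[OF sf_sm[OF f r] s] by simp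
    qed
    then have "\<exists>\<xi>. \<bar>\<xi> - 0\<bar> \<le> \<bar>t - 0\<bar> \<and> f (?r (sc t)) - f (?r (sc 0)) = 0 * (t - 0)"
      using t by (intro mvt_sym[of 0 t "\<lambda>s. f (?r (sc s))" "\<lambda>_. 0"]) auto
    then show ?thesis by simp
  qed
  have tC: "sc t \<in> ?C" "sc 0 \<in> ?C" using t e sc_cube mem_cube_self[OF z0_Rn e, of 1] by auto
  have "?r (sc t) = ?r (sc 0)" by (rule sf_separates[OF sm_into[OF r tC(1)] sm_into[OF r tC(2)] fr])
  also have "\<dots> = \<one>" using dG[OF tC(2)] eq by (simp add: sc_nth)
  finally show ?thesis using rd[OF tC(1)] dG[OF tC(1)] by (simp add: sc_nth)
qed

text \<open>Coordinates of the second kind, with arbitrary smooth curves in place of one-parameter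
  groups.\<close>

primrec prodc :: "(nat \<Rightarrow> vec \<Rightarrow> 'a) \<Rightarrow> nat \<Rightarrow> vec \<Rightarrow> 'a" where
  "prodc c 0 \<tau> = \<one>"
| "prodc c (Suc k) \<tau> = prodc c k \<tau> \<otimes> c k (sc (\<tau> k))"

lemma mc_expand: "mc m p x v i = (\<Sum>j<m. v j * mc m p x (unitv j) i)"
proof (cases "i < dm")
  case True
  have "jacobian m dm \<Phi> x v i = (\<Sum>j<m. v j * jacobian m dm \<Phi> x (unitv j) i)" for \<Phi>
    using True by (simp add: jacobian_def dir_deriv_unitv) (simp add: dir_deriv_def)
  then show ?thesis by (simp add: mc_def)
next
  case False
  then have "mc m p x w i = 0" for w using mc_Rn by (auto simp: Rn_iff)
  then show ?thesis by simp
qed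

text \<open>A product of curves in K is tangent to the left-invariant distribution spanned by the velocities, so a
  solution in the parameter space of the differential equation for the integral curve stays in K.\<close>

lemma intcurve_in_subgroup_local:
  assumes K: "subgroup K G" and z: "z \<in> h0 K"
  shows "\<exists>\<epsilon>>0. \<exists>c. c 0 = \<one> \<and> (\<forall>t. \<bar>t\<bar> < \<epsilon> \<longrightarrow> c t \<in> K) \<and> intcurve \<epsilon> z c"
proof -
  obtain I Z where I: "I \<subseteq> {..<dm}" and Z: "\<forall>i\<in>I. Z i \<in> h0 K"
    and Zd: "\<forall>i\<in>I. \<forall>j\<in>I. Z i j = (if i = j then 1 else 0)"
    and rep: "\<forall>w\<in>h0 K. w = (\<lambda>j. \<Sum>i\<in>I. w i * Z i j)"
    using pivot_basis[OF h0_Rn h0_zero[OF K] h0_lin[OF K]] by blast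
  \<comment> \<open>Padding with zero vectors at the non-pivot indices gives one parameter for each
    of the \<open>dm\<close> indices, and a square system below.\<close>
  define Y where "Y i = (if i \<in> I then Z i else (\<lambda>i. 0))" for i
  have "Y i \<in> h0 K" for i using Z h0_zero[OF K] by (simp add: Y_def)
  then have "\<exists>c \<epsilon>. \<epsilon> > 0 \<and> sm 1 (cube 1 z0 \<epsilon>) c \<and> (\<forall>x\<in>cube 1 z0 \<epsilon>. c x \<in> K) \<and>
     c z0 = \<one> \<and> mc 1 c z0 (unitv 0) = Y i" for i unfolding h0_def by blast
  then obtain c \<epsilon> where c: "\<And>i. \<epsilon> i > 0" "\<And>i. sm 1 (cube 1 z0 (\<epsilon> i)) (c i)"
    "\<And>i x. x \<in> cube 1 z0 (\<epsilon> i) \<Longrightarrow> c i x \<in> K" "\<And>i. c i z0 = \<one>" "\<And>i. mc 1 (c i) z0 (unitv 0) = Y i"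
    by metis
  define e where "e = Min (insert 1 (\<epsilon> ` {..<dm}))"
  have e: "e > 0" using c(1) by (auto simp: e_def)
  have e_le: "e \<le> \<epsilon> i" if "i < dm" for i using that by (auto simp: e_def)
  define U where "U = cube dm z0 e"
  have U: "eopen dm U" "z0 \<in> U" unfolding U_def by (rule eopen_cube, rule mem_cube_self[OF z0_Rn e])
  have im: "(\<lambda>\<tau>. sc (\<tau> i)) ` U \<subseteq> cube 1 z0 (\<epsilon> i)" if "i < dm" for i
    using that e_le[OF that] sc_Rn by (force simp: U_def cube_def z0_def sc_def)
  have ss: "smooth_vec_on dm U 1 (\<lambda>\<tau>. sc (\<tau> i))" for i by (intro smooth_sc U smooth_coord)
  have sci: "sm dm U (\<lambda>\<tau>. c i (sc (\<tau> i)))" if "i < dm" for i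
    by (rule sm_compose[OF c(2) U(1) ss im[OF that]])
  have smF: "sm dm U (prodc c k)" if "k \<le> dm" for k
    using that
  proof (induction k)
    case 0
    then show ?case using sm_constG[OF one_closed U(1)] by (simp add: prodc.simps(1)[abs_def])
  next
    case (Suc k)
    then show ?case using sm_mult[OF _ sci[of k]] by (simp add: prodc.simps(2)[abs_def])
  qed
  have FK: "prodc c k \<tau> \<in> K" if "k \<le> dm" "\<tau> \<in> U" for k \<tau>
    using that
  proof (induction k)
    case (Suc k)
    have "c k (sc (\<tau> k)) \<in> K" using im[of k] Suc.prems by (intro c(3)) auto
    then show ?case using Suc subgroup.m_closed[OF K] by simp
  qed (simp add: subgroup.one_closed[OF K])
  have F0: "prodc c k z0 = \<one>" for k
    by (induction k) (simp_all add: c(4) sc_0)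
  have mcF: "mc dm (prodc c k) z0 v = (\<lambda>j. \<Sum>i<k. v i * Y i j)" if "k \<le> dm" for k v
    using that
  proof (induction k)
    case 0
    then show ?case using mc_const[OF one_closed] by (simp add: prodc.simps(1)[abs_def])
  next
    case (Suc k)
    then have k: "k < dm" by simp
    have z: "sc (z0 k) = z0" by (simp add: z0_def sc_def fun_eq_iff)
    have "mc dm (\<lambda>\<tau>. c k (sc (\<tau> k))) z0 v = mc 1 (c k) z0 (\<lambda>l. v k * unitv 0 l + 0 * unitv 0 l)"
      using mc_compose[OF c(2) U(1) ss im[OF k] U(2), of v]
      by (simp add: jacobian_sc dir_deriv_coord[OF k] z)
    then have 1: "mc dm (\<lambda>\<tau>. c k (sc (\<tau> k))) z0 v = (\<lambda>j. v k * Y k j)"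
      unfolding mc_lin c(5) by simp
    have 2: "Adi \<one> (mc dm (prodc c k) z0 v) = mc dm (prodc c k) z0 v" by (rule Adi_one[OF mc_Rn])
    have "mc dm (\<lambda>\<tau>. prodc c k \<tau> \<otimes> c k (sc (\<tau> k))) z0 v = (\<lambda>j. mc dm (prodc c k) z0 v j + v k * Y k j)"
      using mc_mult[OF smF sci[OF k] U(2), of k v] k by (simp add: 1 2 z c(4))
    then show ?case
      unfolding prodc.simps(2)[abs_def] Suc.IH[OF less_imp_le[OF k]] sum.lessThan_Suc .
  qed
  define F where "F = prodc c dm"
  have F: "sm dm U F" unfolding F_def by (rule smF) simp
  \<comment> \<open>A pivot row asks that the velocity of \<open>F\<close> in the direction \<xi>
    have the prescribed entry there. The other rows are those of the identity; they make the matrix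
    square and equal to the identity at \<open>z0\<close>.\<close>
  define A where "A i j \<tau> = (if i \<in> I then mc dm F \<tau> (unitv j) i else if i = j then 1 else 0)" for i j \<tau>
  have sA: "smooth_fun_on dm U (A i j)" for i j
    unfolding A_def[abs_def] using smooth_mc[OF F] smooth_const[OF U(1)]
    by (cases "i \<in> I"; cases "i = j") simp_all
  have A0: "A i j z0 = (if i = j then 1 else 0)" if "i < dm" "j < dm" for i j
  proof (cases "i \<in> I")
    case True
    have "mc dm F z0 (unitv j) i = (\<Sum>l<dm. if l = j then Y l i else 0)"
      unfolding F_def mcF[OF order_refl] by (rule sum.cong) (auto simp: unitv_def)
    also have "\<dots> = Y j i" using that by simp
    also have "\<dots> = (if i = j then 1 else 0)" using True Zd by (auto simp: Y_def)
    finally show ?thesis using True by (simp add: A_def)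
  qed (simp add: A_def)
  obtain V \<xi> where V: "z0 \<in> V" "V \<subseteq> U" "eopen dm V" and \<xi>: "\<forall>j<dm. smooth_fun_on dm V (\<xi> j)"
    and sol: "\<forall>x\<in>V. \<forall>i<dm. (\<Sum>j<dm. A i j x * \<xi> j x) = z i"
    using solve_linear_smooth[where k=dm and A=A and b="\<lambda>i x. z i", OF U(1,2) sA smooth_const[OF U(1)] A0, simplified]
    by (elim exE conjE)
  have "Ck_on (Suc 0) dm V (\<xi> j)" if "j < dm" for j using \<xi> that smooth_Ck by blast
  then have "\<exists>\<delta>>0. \<exists>\<tau>. \<tau> 0 = z0 \<and> (\<forall>t. \<tau> t \<in> Rn dm) \<and> (\<forall>t. \<bar>t\<bar> < \<delta> \<longrightarrow> \<tau> t \<in> V \<and>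
     (\<forall>j<dm. ((\<lambda>s. \<tau> s j) has_real_derivative \<xi> j (\<tau> t)) (at t)))"
    by (intro ode_exists[OF V(3) _ V(1)])
  then obtain \<delta> \<tau> where \<delta>: "\<delta> > 0" and \<tau>: "\<tau> 0 = z0" "\<forall>t. \<tau> t \<in> Rn dm"
    "\<forall>t. \<bar>t\<bar> < \<delta> \<longrightarrow> \<tau> t \<in> V \<and> (\<forall>j<dm. ((\<lambda>s. \<tau> s j) has_real_derivative \<xi> j (\<tau> t)) (at t))"
    by (elim exE conjE)
  define \<gamma> where "\<gamma> t = F (\<tau> t)" for t
  \<comment> \<open>Pivot entries suffice: \<open>F\<close> is a plot of \<open>K\<close>, so its
    velocity lies in \<open>h0 K\<close>, where a vector is determined by its pivot entries. This
    works on all of \<open>V\<close>, although the velocities of the factors are known at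
    \<open>z0\<close> only.\<close>
  have tangent: "mc dm F x (\<lambda>j. if j < dm then \<xi> j x else 0) = z" (is "mc dm F x ?v = z") if x: "x \<in> V" for x
  proof -
    have xU: "x \<in> U" using x V(2) by blast
    have w: "mc dm F x ?v \<in> h0 K"
      by (rule h0I[OF K F _ xU]) (auto simp: F_def FK Rn_iff)
    have "mc dm F x ?v i = z i" if i: "i \<in> I" for i
    proof -
      have "mc dm F x ?v i = (\<Sum>j<dm. A i j x * \<xi> j x)"
        unfolding mc_expand[of dm F x ?v] by (rule sum.cong) (auto simp: A_def i)
      then show ?thesis using sol x i I by auto
    qed
    then have "(\<lambda>j. \<Sum>i\<in>I. mc dm F x ?v i * Z i j) = (\<lambda>j. \<Sum>i\<in>I. z i * Z i j)" by simp
    then show ?thesis using rep[rule_format, OF w] rep[rule_format, OF z] by simp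
  qed
  have "intcurve \<delta> z \<gamma>"
    unfolding intcurve_def
  proof (intro allI impI conjI ballI)
    fix t assume t: "\<bar>t\<bar> < \<delta>"
    have tV: "\<tau> t \<in> V" and d\<tau>: "\<And>j. j < dm \<Longrightarrow> ((\<lambda>s. \<tau> s j) has_real_derivative \<xi> j (\<tau> t)) (at t)"
      using \<tau>(3) t by auto
    have tU: "\<tau> t \<in> U" using tV V(2) by blast
    show "\<gamma> t \<in> carrier G" unfolding \<gamma>_def by (rule sm_carrier[OF F tU])
    fix f assume f: "f \<in> SF"
    have "((\<lambda>s. f (F (\<tau> s))) has_real_derivative (\<Sum>j<dm. partial j (\<lambda>x. f (F x)) (\<tau> t) * \<xi> j (\<tau> t))) (at t)"
    proof (rule chain_curve[OF U(1) smooth_Ck[OF sf_sm[OF f F]] tU _ d\<tau>])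
      show "\<forall>\<^sub>F s in nhds t. \<tau> s \<in> U"
        by (rule curve_eventually[where c=\<tau> and t=t, OF U(1) tU]) (use \<tau>(2) DERIV_isCont[OF d\<tau>] in auto)
    qed
    also have "(\<Sum>j<dm. partial j (\<lambda>x. f (F x)) (\<tau> t) * \<xi> j (\<tau> t)) =
        dir_deriv dm (\<lambda>x. f (F x)) (\<tau> t) (\<lambda>j. if j < dm then \<xi> j (\<tau> t) else 0)"
      by (simp add: dir_deriv_def mult.commute)
    also have "\<dots> = E z f (\<gamma> t)"
      using mc_deriv[OF F tU f] tangent[OF tV] by (simp add: \<gamma>_def)
    finally show "((\<lambda>s. f (\<gamma> s)) has_real_derivative E z f (\<gamma> t)) (at t)" by (simp add: \<gamma>_def)
  qed
  moreover have "\<gamma> t \<in> K" if "\<bar>t\<bar> < \<delta>" for t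
    using \<tau>(3) that V(2) FK[OF order_refl] by (auto simp: \<gamma>_def F_def)
  moreover have "\<gamma> 0 = \<one>" by (simp add: \<gamma>_def F_def \<tau>(1) F0)
  ultimately show ?thesis using \<delta> by blast
qed

section \<open>Global integral curves and the exponential map\<close>

lemma integral_curve_iff:
  "integral_curve M (E z) \<gamma> \<longleftrightarrow> (\<forall>\<epsilon>. intcurve \<epsilon> z \<gamma>)"
proof
  assume "integral_curve M (E z) \<gamma>"
  then show "\<forall>\<epsilon>. intcurve \<epsilon> z \<gamma>" using top_carrier by (auto simp: integral_curve_def intcurve_def)
next
  assume h: "\<forall>\<epsilon>. intcurve \<epsilon> z \<gamma>"
  have "\<gamma> t \<in> carrier G \<and> (\<forall>f\<in>SF. ((\<lambda>s. f (\<gamma> s)) has_real_derivative E z f (\<gamma> t)) (at t))" for t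
    using h[rule_format, of "\<bar>t\<bar> + 1"] unfolding intcurve_def by force
  then show "integral_curve M (E z) \<gamma>" using top_carrier by (auto simp: integral_curve_def)
qed

text \<open>The local curve is continued by c(\<delta>)^N c(t - N \<delta>), which remains in
  \<open>K\<close> because \<open>K\<close> is a subgroup.\<close>

lemma intcurve_in_subgroup:
  assumes K: "subgroup K G" and z: "z \<in> h0 K"
  shows "\<exists>\<gamma>. integral_curve M (E z) \<gamma> \<and> \<gamma> 0 = \<one> \<and> range \<gamma> \<subseteq> K"
proof -
  obtain \<epsilon> c where \<epsilon>: "\<epsilon> > 0" and c: "c 0 = \<one>" "\<And>t. \<bar>t\<bar> < \<epsilon> \<Longrightarrow> c t \<in> K" "intcurve \<epsilon> z c"
    using intcurve_in_subgroup_local[OF assms] by blast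
  have zR: "z \<in> Rn dm" using z h0_Rn by blast
  have KG: "K \<subseteq> carrier G" by (rule subgroup.subset[OF K])
  \<comment> \<open>Half of \<epsilon>, so that \<open>s + \<delta>\<close> stays in the domain of
    \<open>c\<close> for all \<open>s\<close> of absolute value below \<delta>.\<close>
  define \<delta> where "\<delta> = \<epsilon> / 2"
  have \<delta>: "\<delta> > 0" "\<delta> < \<epsilon>" using \<epsilon> by (auto simp: \<delta>_def)
  have cG: "c t \<in> carrier G" if "\<bar>t\<bar> < \<epsilon>" for t using c(2)[OF that] KG by blast
  have cd: "c \<delta> \<in> carrier G" "c \<delta> \<in> K" using cG[of \<delta>] c(2)[of \<delta>] \<delta> by auto
  have add: "c (s + \<delta>) = c \<delta> \<otimes> c s" if s: "\<bar>s\<bar> < \<delta>" for s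
  proof (rule intcurve_unique[OF intcurve_shift[OF c(3)] intcurve_ltrans[OF _ cd(1)] zR _ s])
    show "\<delta> + \<bar>\<delta>\<bar> \<le> \<epsilon>" using \<epsilon> by (simp add: \<delta>_def)
    show "intcurve \<delta> z c" using intcurve_shift[OF c(3), of \<delta> 0] \<delta> by simp
    show "c (0 + \<delta>) = c \<delta> \<otimes> c 0" using cd by (simp add: c(1))
  qed
  define \<gamma> where "\<gamma> t = (c \<delta> [^] \<lfloor>t / \<delta>\<rfloor>) \<otimes> c (t - \<delta> * \<lfloor>t / \<delta>\<rfloor>)" for t :: real
  \<comment> \<open>The definition takes N to be the floor of t / \<delta>. The formula also holds
    for the neighbouring N, so near every \<open>t\<close>, multiples of \<delta> included, the
    curve is a shifted left translate of \<open>c\<close>.\<close>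
  have \<gamma>: "\<gamma> t = (c \<delta> [^] N) \<otimes> c (t - \<delta> * of_int N)" if "\<bar>t - \<delta> * of_int N\<bar> < \<delta>" for t N
  proof (cases "t - \<delta> * of_int N \<ge> 0")
    case True
    have "\<lfloor>t / \<delta>\<rfloor> = N"
      by (rule floor_unique) (use True that \<delta> in \<open>auto simp: field_simps\<close>)
    then show ?thesis by (simp add: \<gamma>_def)
  next
    case False
    have fl: "\<lfloor>t / \<delta>\<rfloor> = N - 1"
      by (rule floor_unique) (use False that \<delta> in \<open>auto simp: field_simps\<close>)
    let ?s = "t - \<delta> * of_int N"
    have cs: "c ?s \<in> carrier G" using cG that \<delta> by simp
    have "\<gamma> t = (c \<delta> [^] (N - 1)) \<otimes> c (?s + \<delta>)" by (simp add: \<gamma>_def fl algebra_simps)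
    also have "\<dots> = (c \<delta> [^] (N - 1)) \<otimes> c \<delta> \<otimes> c ?s"
      using add[OF that] cs cd by (simp add: m_assoc)
    also have "(c \<delta> [^] (N - 1)) \<otimes> c \<delta> = c \<delta> [^] N"
      using int_pow_mult[OF cd(1), of "N - 1" 1] cd by simp
    finally show ?thesis .
  qed
  have pw: "c \<delta> [^] (N::int) \<in> K" for N using subgroup_int_pow_closed[OF K cd(2)] .
  have near: "\<bar>t - \<delta> * of_int \<lfloor>t / \<delta>\<rfloor>\<bar> < \<delta>" for t
  proof -
    show ?thesis using floor_divide_lower[OF \<delta>(1), of t] floor_divide_upper[OF \<delta>(1), of t]
      by (simp add: algebra_simps abs_less_iff)
  qed
  have inK: "\<gamma> t \<in> K" for t
    unfolding \<gamma>_def using near[of t] \<delta> by (intro subgroup.m_closed[OF K] pw c(2)) linarith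
  have "((\<lambda>s. f (\<gamma> s)) has_real_derivative E z f (\<gamma> t)) (at t)" if f: "f \<in> SF" for f t
  proof -
    define N where "N = \<lfloor>t / \<delta>\<rfloor>"
    let ?a = "\<delta> * real_of_int N"
    have n: "\<bar>t - ?a\<bar> < \<delta>" using near[of t] by (simp add: N_def)
    have ic: "intcurve \<epsilon> z (\<lambda>s. (c \<delta> [^] N) \<otimes> c s)"
      by (rule intcurve_ltrans[OF c(3)]) (use pw KG in blast)
    have "((\<lambda>s. f ((c \<delta> [^] N) \<otimes> c s)) has_real_derivative E z f ((c \<delta> [^] N) \<otimes> c (t - ?a))) (at (t - ?a))"
      using ic f n \<delta> by (simp add: intcurve_def)
    then have "((\<lambda>s. f ((c \<delta> [^] N) \<otimes> c (s - ?a))) has_real_derivative E z f (\<gamma> t)) (at t)"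
      using DERIV_shift[of "\<lambda>s. f ((c \<delta> [^] N) \<otimes> c s)" "E z f (\<gamma> t)" t "- ?a"] \<gamma>[OF n] by simp
    moreover have "\<forall>\<^sub>F s in nhds t. f ((c \<delta> [^] N) \<otimes> c (s - ?a)) = f (\<gamma> s)"
    proof (rule eventually_mono[OF eventually_nhds_in_open[of "{?a - \<delta><..<?a + \<delta>}" t]])
      fix s assume "s \<in> {?a - \<delta><..<?a + \<delta>}"
      then have "\<bar>s - ?a\<bar> < \<delta>" by auto
      then show "f ((c \<delta> [^] N) \<otimes> c (s - ?a)) = f (\<gamma> s)" using \<gamma> by simp
    qed (use n in auto)
    ultimately show ?thesis
      using DERIV_cong_ev[OF refl _ refl, of "\<lambda>s. f ((c \<delta> [^] N) \<otimes> c (s - ?a))" "\<lambda>s. f (\<gamma> s)" t] by simp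
  qed
  then have "integral_curve M (E z) \<gamma>"
    using inK KG top_carrier by (auto simp: integral_curve_def)
  moreover have "\<gamma> 0 = \<one>" by (simp add: \<gamma>_def c(1))
  ultimately show ?thesis using inK by blast
qed

text \<open>Applied to the subgroup \<open>carrier G\<close> itself,
  \<open>intcurve_in_subgroup\<close> thereby yields completeness of all left-invariant
  fields.\<close>

lemma h0_carrier: "h0 (carrier G) = Rn dm"
proof
  show "h0 (carrier G) \<subseteq> Rn dm" by (rule h0_Rn)
  show "Rn dm \<subseteq> h0 (carrier G)"
  proof
    fix z assume z: "z \<in> Rn dm"
    have "mc dm \<psi>0 e0 z \<in> h0 (carrier G)"
      by (rule h0I[OF subgroup_self \<psi>0(1) _ V0(2) z]) (rule \<psi>0(3))
    then show "z \<in> h0 (carrier G)" using mc_\<psi>0[OF z] by simp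
  qed
qed

lemma integral_curve_unique:
  assumes "z \<in> Rn dm" "integral_curve M (E z) \<gamma>" "integral_curve M (E z) \<eta>" "\<gamma> 0 = \<eta> 0"
  shows "\<gamma> = \<eta>"
proof
  fix t
  show "\<gamma> t = \<eta> t"
    by (rule intcurve_unique[where \<epsilon>="\<bar>t\<bar> + 1" and z=z]) (use assms integral_curve_iff in auto)
qed

text \<open>Running \<gamma> at speed \<open>t\<close> gives the integral curve of \<open>t\<close>
  times the field, and uniqueness lets the definite description in \<open>lie_exp\<close> be
  evaluated.\<close>

lemma lie_exp_eq:
  assumes z: "z \<in> Rn dm" and \<gamma>: "integral_curve M (E z) \<gamma>" "\<gamma> 0 = \<one>"
  shows "lie_exp G M (vscale LA t (E z)) = \<gamma> t"
proof -
  have sz: "vscale LA t (E z) = E (\<lambda>i. t * z i)"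
    using E_lin[of t z 0 z] by (auto simp: lie_algebra_of_def fun_eq_iff)
  have tz: "(\<lambda>i. t * z i) \<in> Rn dm" using z by (simp add: Rn_iff)
  have "integral_curve M (E (\<lambda>i. t * z i)) (\<lambda>s. \<gamma> (t * s))"
    unfolding integral_curve_def
  proof (intro conjI ballI allI)
    show "range (\<lambda>s. \<gamma> (t * s)) \<subseteq> topspace (mtop M)" using \<gamma>(1) by (auto simp: integral_curve_def)
    fix f s assume f: "f \<in> SF"
    have "((\<lambda>s. f (\<gamma> s)) has_real_derivative E z f (\<gamma> (t * s))) (at (t * s))"
      using \<gamma>(1) f by (simp add: integral_curve_def)
    moreover have "((\<lambda>s. t * s) has_real_derivative t) (at s)" by (auto intro!: derivative_eq_intros)
    ultimately have "((\<lambda>s. f (\<gamma> (t * s))) has_real_derivative E z f (\<gamma> (t * s)) * t) (at s)"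
      by (rule DERIV_chain2)
    then show "((\<lambda>s. f (\<gamma> (t * s))) has_real_derivative E (\<lambda>i. t * z i) f (\<gamma> (t * s))) (at s)"
      using E_lin[of t z 0 z] by (simp add: mult.commute)
  qed
  then have "(THE \<gamma>. integral_curve M (E (\<lambda>i. t * z i)) \<gamma> \<and> \<gamma> 0 = \<one>) = (\<lambda>s. \<gamma> (t * s))"
    by (intro the_equality) (use \<gamma>(2) integral_curve_unique[OF tz] in auto)
  then show ?thesis by (simp add: lie_exp_def sz)
qed

text \<open>A one-parameter group inside \<open>K\<close> is in particular a smooth curve in
  \<open>K\<close>, which gives one inclusion; the other is \<open>intcurve_in_subgroup\<close>,
  whose curve is the one-parameter group by uniqueness.\<close>

lemma lie_subalgebra_eq:
  assumes K: "subgroup K G"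
  shows "lie_subalgebra_of G M K = E ` h0 K"
proof (rule Set.set_eqI)
  fix Z
  show "Z \<in> lie_subalgebra_of G M K \<longleftrightarrow> Z \<in> E ` h0 K"
  proof
    assume Z: "Z \<in> lie_subalgebra_of G M K"
    then obtain z where z: "z \<in> Rn dm" "Z = E z" using E_surj by (auto simp: lie_subalgebra_of_def)
    obtain \<gamma> where \<gamma>: "integral_curve M (E z) \<gamma>" "\<gamma> 0 = \<one>"
      using intcurve_in_subgroup[OF subgroup_self] z h0_carrier by blast
    have "\<gamma> t \<in> K" for t
      using Z lie_exp_eq[OF z(1) \<gamma>] z(2) by (auto simp: lie_subalgebra_of_def)
    moreover have ic: "intcurve 1 z \<gamma>" using \<gamma>(1) integral_curve_iff by blast
    moreover have zz: "z0 \<in> cube 1 z0 1" by (rule mem_cube_self[OF z0_Rn]) simp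
    ultimately have "z \<in> h0 K"
      using h0I[OF K intcurve_smooth(1)[OF ic z(1)] _ zz unitv_Rn] intcurve_smooth(2)[OF ic z(1) zz] by auto
    then show "Z \<in> E ` h0 K" using z by blast
  next
    assume "Z \<in> E ` h0 K"
    then obtain z where z: "z \<in> h0 K" "Z = E z" by blast
    obtain \<gamma> where \<gamma>: "integral_curve M (E z) \<gamma>" "\<gamma> 0 = \<one>" "range \<gamma> \<subseteq> K"
      using intcurve_in_subgroup[OF K z(1)] by blast
    have "z \<in> Rn dm" using z h0_Rn by blast
    from lie_exp_eq[OF this \<gamma>(1,2)] show "Z \<in> lie_subalgebra_of G M K"
      using \<gamma>(3) E_in z(2) by (auto simp: lie_subalgebra_of_def)
  qed
qed

subsection \<open>The ideal\<close>

text \<open>The Maurer--Cartan equation for the product of a curve in the subgroup and a chart identifies the bracket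
  with a derivative of the adjoint action.\<close>

lemma h0_br:
  assumes K: "subgroup K G" and dense: "mtop M closure_of K = topspace (mtop M)"
    and z: "z \<in> h0 K" and x: "x \<in> Rn dm"
  shows "br z x \<in> h0 K"
proof -
  obtain c \<epsilon> where c: "\<epsilon> > 0" "sm 1 (cube 1 z0 \<epsilon>) c" "c z0 = \<one>" "mc 1 c z0 (unitv 0) = z"
    using z unfolding h0_def by blast
  let ?C = "cube 1 z0 \<epsilon>" and ?B = "prodset 1 dm (cube 1 z0 \<epsilon>) V0"
  let ?q = "\<lambda>w. c (pr1 1 w) \<otimes> \<psi>0 (pr2 1 w)"
  let ?u = "va 1 (unitv 0) z0" and ?v = "va 1 z0 x" and ?x = "va 1 z0 e0"
  have zR: "z \<in> Rn dm" using z h0_Rn by blast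
  have zC: "z0 \<in> ?C" by (rule mem_cube_self[OF z0_Rn c(1)])
  have q: "sm (1 + dm) ?B ?q" by (rule sm_prod[OF c(2) \<psi>0(1)])
  have xB: "?x \<in> ?B"
    by (rule va_prodset[OF eopen_subset[OF eopen_cube] eopen_subset[OF V0(1)] zC V0(2)])
  have u: "unitv 0 \<in> Rn 1" by (rule unitv_Rn) simp
  have mu: "mc (1 + dm) ?q (va 1 z0 y) ?u = Adi (\<psi>0 y) z" if "y \<in> V0" for y
    using mc_pr[OF c(2) \<psi>0(1) zC that u z0_Rn] by (simp add: c(4) mc_zero)
  have mv: "mc (1 + dm) ?q (va 1 s e0) ?v = x" if "s \<in> ?C" for s
    using mc_pr[OF c(2) \<psi>0(1) that V0(2) z0_Rn x] by (simp add: mc_zero Adi_zero mc_\<psi>0 x)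
  \<comment> \<open>In the curve direction at parameter 0 the form is
    \<open>Adi (\<psi>0 y) z\<close>; in the direction \<open>x\<close> at \<open>e0\<close> it is
    constantly \<open>x\<close>. The latter has derivative 0, so only the derivative of the adjoint
    action is left in the Maurer--Cartan equation.\<close>
  have br: "br z x i = dir_deriv dm (\<lambda>y. Adi (\<psi>0 y) z i) e0 x" for i
  proof -
    have "dir_deriv (1 + dm) (\<lambda>w. mc (1 + dm) ?q w ?u i) ?x ?v = dir_deriv dm (\<lambda>y. mc (1 + dm) ?q (va 1 z0 y) ?u i) e0 x"
      unfolding slice2_dir_deriv[of dm "\<lambda>w. mc (1 + dm) ?q w ?u i" 1 z0 e0 x] by (simp add: z0_def)
    also have "\<dots> = dir_deriv dm (\<lambda>y. Adi (\<psi>0 y) z i) e0 x"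
      by (rule dir_deriv_cong[OF V0(1,2)]) (simp add: mu)
    finally have 1: "dir_deriv (1 + dm) (\<lambda>w. mc (1 + dm) ?q w ?u i) ?x ?v = dir_deriv dm (\<lambda>y. Adi (\<psi>0 y) z i) e0 x" .
    have "dir_deriv (1 + dm) (\<lambda>w. mc (1 + dm) ?q w ?v i) ?x ?u = dir_deriv 1 (\<lambda>s. mc (1 + dm) ?q (va 1 s e0) ?v i) z0 (unitv 0)"
      unfolding slice1_dir_deriv[of 1 "\<lambda>w. mc (1 + dm) ?q w ?v i" e0 z0 "unitv 0" dm] by (simp add: z0_def)
    also have "\<dots> = dir_deriv 1 (\<lambda>s. x i) z0 (unitv 0)"
      by (rule dir_deriv_cong[OF eopen_cube zC]) (use mv in simp)
    finally have 2: "dir_deriv (1 + dm) (\<lambda>w. mc (1 + dm) ?q w ?v i) ?x ?u = 0" by (simp add: dir_deriv_const)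
    have "dir_deriv (1 + dm) (\<lambda>w. mc (1 + dm) ?q w ?v i) ?x ?u - dir_deriv (1 + dm) (\<lambda>w. mc (1 + dm) ?q w ?u i) ?x ?v
        = - br (mc (1 + dm) ?q ?x ?u) (mc (1 + dm) ?q ?x ?v) i"
      by (rule maurer_cartan[OF q xB])
    then show ?thesis unfolding 1 2 mu[OF V0(2)] mv[OF zC] by (simp add: \<psi>0(2) Adi_one[OF zR])
  qed
  obtain A where A: "\<forall>w\<in>Rn dm. w \<in> h0 K \<longleftrightarrow> (\<forall>j<dm. (\<Sum>i<dm. A j i * w i) = 0)"
    using h0_equations[OF K] by blast
  \<comment> \<open>The vectors \<open>Adi (\<psi>0 y) z\<close> all lie in the subspace, by
    density; hence so does their derivative, as it satisfies the same linear equations.\<close>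
  have "(\<Sum>i<dm. A j i * br z x i) = 0" if j: "j < dm" for j
  proof -
    have s: "smooth_fun_on dm V0 (\<lambda>y. Adi (\<psi>0 y) z i)" for i by (rule smooth_Adi[OF \<psi>0(1) zR])
    have "(\<Sum>i<dm. A j i * br z x i) = (\<Sum>i<dm. dir_deriv dm (\<lambda>y. A j i * Adi (\<psi>0 y) z i) e0 x)"
      unfolding br dir_deriv_cmult[OF s V0(2)] ..
    also have "\<dots> = dir_deriv dm (\<lambda>y. \<Sum>i<dm. A j i * Adi (\<psi>0 y) z i) e0 x"
      by (subst dir_deriv_sum[OF V0(1) _ V0(2)]) (auto intro!: smooth_cmult[OF V0(1) s])
    also have "dir_deriv dm (\<lambda>y. \<Sum>i<dm. A j i * Adi (\<psi>0 y) z i) e0 x = dir_deriv dm (\<lambda>y. 0) e0 x"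
      by (rule dir_deriv_cong[OF V0(1,2)]) (use A Adi_Rn h0_Adi_dense[OF K dense z \<psi>0(3)] j in blast)
    finally show ?thesis by (simp add: dir_deriv_const)
  qed
  then show ?thesis using A lie_br(1) by blast
qed

lemma lie_ideal_h0:
  assumes K: "subgroup K G" and dense: "mtop M closure_of K = topspace (mtop M)"
  shows "lie_ideal LA (E ` h0 K)"
  unfolding lie_ideal_def vs_subspace_def
proof (intro conjI ballI allI)
  show "E ` h0 K \<subseteq> vcarrier LA" using E_in by blast
  have "E (\<lambda>i. 0) = vzero LA" using E_lin[of 0 z0 0 z0] by (auto simp: lie_algebra_of_def fun_eq_iff)
  then show "vzero LA \<in> E ` h0 K" using h0_zero[OF K] by (metis imageI)
  show "vadd LA x y \<in> E ` h0 K" if xy: "x \<in> E ` h0 K" "y \<in> E ` h0 K" for x y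
  proof -
    obtain z w where z: "z \<in> h0 K" "x = E z" and w: "w \<in> h0 K" "y = E w" using xy by blast
    have "vadd LA x y = E (\<lambda>i. 1 * z i + 1 * w i)"
      unfolding z w using E_lin[of 1 z 1 w] by (auto simp: lie_algebra_of_def fun_eq_iff)
    then show ?thesis using h0_lin[OF K z(1) w(1)] by blast
  qed
  show "vscale LA a x \<in> E ` h0 K" if x: "x \<in> E ` h0 K" for a x
  proof -
    obtain z where z: "z \<in> h0 K" "x = E z" using x by blast
    have "vscale LA a x = E (\<lambda>i. a * z i + 0 * z i)"
      unfolding z using E_lin[of a z 0 z] by (auto simp: lie_algebra_of_def fun_eq_iff)
    then show ?thesis using h0_lin[OF K z(1) z(1)] by blast
  qed
  show "lie_bracket LA x y \<in> E ` h0 K" if x: "x \<in> vcarrier LA" and y: "y \<in> E ` h0 K" for x y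
  proof -
    obtain z w where z: "z \<in> h0 K" "y = E z" and w: "w \<in> Rn dm" "x = E w" using y E_surj[OF x] by blast
    have "lie_bracket LA (E w) (E z) f p = (-1) * lie_bracket LA (E z) (E w) f p" for f p
      by (simp add: lie_algebra_of_def)
    then have "lie_bracket LA x y = E (\<lambda>i. (-1) * br z w i + 0 * br z w i)"
      unfolding z w E_lin[abs_def] lie_br(2) by (auto simp: fun_eq_iff)
    then show ?thesis using h0_lin[OF K h0_br[OF K dense z(1) w(1)] h0_br[OF K dense z(1) w(1)]] by blast
  qed
qed

end

section \<open>Alternating forms\<close>

abbreviation "alt n \<equiv> alternating_form (euclid_vs n)"

lemma euclid_vs_simps [simp]:
  "vcarrier (euclid_vs n) = Rn n"
  "vadd (euclid_vs n) = (\<lambda>x y i. x i + y i)" "vscale (euclid_vs n) = (\<lambda>c x i. c * x i)"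
  by (simp_all add: euclid_vs_def)

lemma alt_out: "alternating_form V k W \<Longrightarrow> \<not> (length vs = k \<and> set vs \<subseteq> vcarrier V) \<Longrightarrow> W vs = 0"
  unfolding alternating_form_def by blast

lemma alt_dist: "alternating_form V k W \<Longrightarrow> set vs \<subseteq> vcarrier V \<Longrightarrow> \<not> distinct vs \<Longrightarrow> W vs = 0"
  unfolding alternating_form_def by blast

lemma alternating_lin:
  "alternating_form V k W \<Longrightarrow> length us + length ws + 1 = k \<Longrightarrow> set us \<subseteq> vcarrier V \<Longrightarrow> set ws \<subseteq> vcarrier V \<Longrightarrow>
    x \<in> vcarrier V \<Longrightarrow> y \<in> vcarrier V \<Longrightarrow>
    W (us @ vadd V (vscale V a x) (vscale V b y) # ws) = a * W (us @ x # ws) + b * W (us @ y # ws)"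
  unfolding alternating_form_def by (elim conjE allE[of _ us] allE[of _ ws] allE[of _ x] allE[of _ y] allE[of _ a] allE[of _ b]) simp

lemma Rn_lin: "x \<in> Rn n \<Longrightarrow> y \<in> Rn n \<Longrightarrow> (\<lambda>i. a * x i + b * y i) \<in> Rn n"
  by (simp add: Rn_iff)

text \<open>Free of conditions on the other arguments: if these are not admissible, all three values
  are 0.\<close>

lemma alt_lin:
  assumes W: "alt n k W" and xy: "x \<in> Rn n" "y \<in> Rn n"
  shows "W (us @ (\<lambda>i. a * x i + b * y i) # ws) = a * W (us @ x # ws) + b * W (us @ y # ws)"
proof (cases "length us + length ws + 1 = k \<and> set us \<subseteq> Rn n \<and> set ws \<subseteq> Rn n")
  case True
  then show ?thesis using alternating_lin[OF W, of us ws x y a b] xy by simp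
next
  case False
  then have "W (us @ z # ws) = 0" for z by (intro alt_out[OF W]) auto
  then show ?thesis by simp
qed

lemma alt_zero: "alt n k W \<Longrightarrow> W (us @ z0 # ws) = 0"
  using alt_lin[of n k W z0 z0 us 0 0 ws] z0_Rn by (simp add: z0_def)

lemma alt_sum:
  assumes W: "alt n k W" and X: "\<And>l. l < (N::nat) \<Longrightarrow> X l \<in> Rn n"
  shows "W (us @ (\<lambda>i. \<Sum>l<N. c l * X l i) # ws) = (\<Sum>l<N. c l * W (us @ X l # ws))"
  using X
proof (induction N)
  case 0
  then show ?case using alt_zero[OF W, of us ws] by (simp add: z0_def)
next
  case (Suc N)
  have "(\<lambda>i. \<Sum>l<N. c l * X l i) \<in> Rn n" using Suc.prems by (simp add: Rn_iff)
  then have "W (us @ (\<lambda>i. 1 * (\<Sum>l<N. c l * X l i) + c N * X N i) # ws) =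
      1 * W (us @ (\<lambda>i. \<Sum>l<N. c l * X l i) # ws) + c N * W (us @ X N # ws)"
    by (rule alt_lin[OF W]) (use Suc.prems in auto)
  then show ?case using Suc by simp
qed

lemma vec_unitv: "z \<in> Rn n \<Longrightarrow> z = (\<lambda>i. \<Sum>l<n. z l * unitv l i)"
proof
  fix i assume z: "z \<in> Rn n"
  have "(\<Sum>l<n. z l * unitv l i) = (\<Sum>l<n. if l = i then z l else 0)"
    by (rule sum.cong) (auto simp: unitv_def)
  then show "z i = (\<Sum>l<n. z l * unitv l i)" using z by (simp add: Rn_iff)
qed

lemma alt_expand:
  assumes W: "alt n k W" and z: "z \<in> Rn n"
  shows "W (us @ z # ws) = (\<Sum>l<n. z l * W (us @ unitv l # ws))"
  by (subst vec_unitv[OF z]) (rule alt_sum[OF W unitv_Rn])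

lemma alt_swap:
  assumes W: "alt n k W" and xy: "x \<in> Rn n" "y \<in> Rn n"
  shows "W (us @ x # y # ws) = - W (us @ y # x # ws)"
proof (cases "set us \<subseteq> Rn n \<and> set ws \<subseteq> Rn n")
  case True
  let ?s = "\<lambda>i. 1 * x i + 1 * y i"
  have s: "?s \<in> Rn n" by (rule Rn_lin[OF xy])
  have z: "W (us @ a # a # ws) = 0" if "a \<in> Rn n" for a
    by (rule alt_dist[OF W]) (use True that in auto)
  have "0 = W (us @ ?s # ?s # ws)" using z[OF s] by simp
  also have "\<dots> = 1 * W (us @ x # ?s # ws) + 1 * W (us @ y # ?s # ws)"
    by (rule alt_lin[OF W xy])
  also have "W (us @ x # ?s # ws) = 1 * W (us @ x # x # ws) + 1 * W (us @ x # y # ws)"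
    using alt_lin[OF W xy, of "us @ [x]" 1 1 ws] by simp
  also have "W (us @ y # ?s # ws) = 1 * W (us @ y # x # ws) + 1 * W (us @ y # y # ws)"
    using alt_lin[OF W xy, of "us @ [y]" 1 1 ws] by simp
  finally show ?thesis using z[OF xy(1)] z[OF xy(2)] by simp
next
  case False
  then have "W (us @ a # b # ws) = 0" for a b by (intro alt_out[OF W]) auto
  then show ?thesis by simp
qed

lemma alt_move:
  assumes W: "alt n k W" and d: "d \<in> Rn n" and us: "set us \<subseteq> Rn n"
  shows "W (as @ us @ d # ws) = (- 1) ^ length us * W (as @ d # us @ ws)"
  using us
proof (induction us arbitrary: ws rule: rev_induct)
  case (snoc u us)
  have "W (as @ (us @ [u]) @ d # ws) = - W ((as @ us) @ d # u # ws)"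
    using alt_swap[OF W, of u d "as @ us" ws] snoc.prems d by simp
  also have "\<dots> = - ((- 1) ^ length us * W (as @ d # us @ u # ws))"
    using snoc.IH[of "u # ws"] snoc.prems by simp
  finally show ?case by simp
qed simp

section \<open>Lists with deleted entries and signed sums over pairs\<close>

definition rem :: "nat \<Rightarrow> 'x list \<Rightarrow> 'x list" where "rem i xs = take i xs @ drop (Suc i) xs"

lemma nths_all_but: "nths xs (- {i}) = rem i xs"
proof (induction xs arbitrary: i)
  case (Cons x xs)
  show ?case
  proof (cases i)
    case 0
    have "{j. Suc j \<in> - {0::nat}} = UNIV" by auto
    then show ?thesis using 0 by (simp add: nths_Cons rem_def nths_all)
  next
    case (Suc k)
    have "{j. Suc j \<in> - {Suc k}} = - {k}" by auto
    then show ?thesis using Suc Cons[of k] by (simp add: nths_Cons rem_def)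
  qed
qed (simp add: rem_def)

lemma nths_all_but2: "i < j \<Longrightarrow> nths xs (- {i, j}) = rem i (rem j xs)"
proof (induction xs arbitrary: i j)
  case (Cons x xs)
  then obtain j' where j: "j = Suc j'" by (cases j) auto
  show ?case
  proof (cases i)
    case 0
    have "{k. Suc k \<in> - {0, Suc j'}} = - {j'}" by auto
    then show ?thesis using 0 j by (simp add: nths_Cons nths_all_but rem_def)
  next
    case (Suc i')
    have "{k. Suc k \<in> - {Suc i', Suc j'}} = - {i', j'}" by auto
    then show ?thesis using Suc j Cons by (simp add: nths_Cons rem_def)
  qed
qed (simp add: rem_def)

lemma length_rem: "i < length xs \<Longrightarrow> length (rem i xs) = length xs - 1"
  by (simp add: rem_def)

lemma set_rem: "set (rem i xs) \<subseteq> set xs"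
  unfolding rem_def using set_take_subset[of i xs] set_drop_subset[of "Suc i" xs] by simp

lemma rem_map: "rem i (map f xs) = map f (rem i xs)"
  by (simp add: rem_def take_map drop_map)

lemma rem_append:
  "rem i (us @ z # ws) = (if i < length us then rem i us @ z # ws else if i = length us then us @ ws
     else us @ z # rem (i - Suc (length us)) ws)"
proof (cases i "length us" rule: linorder_cases)
  case greater
  then obtain t where "i = Suc (length us + t)" using less_iff_Suc_add by auto
  then show ?thesis by (simp add: rem_def)
qed (auto simp: rem_def Suc_diff_le)

text \<open>The increasing enumeration of the indices other than \<open>i\<close>: what stands at
  \<open>j\<close> after the deletion of entry \<open>i\<close> stood at \<open>skip i j\<close>
  before.\<close>

definition skip :: "nat \<Rightarrow> nat \<Rightarrow> nat" where "skip i j = (if j < i then j else Suc j)"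

lemma nth_rem: "Suc j < length xs \<Longrightarrow> i < length xs \<Longrightarrow> rem i xs ! j = xs ! skip i j"
  by (auto simp: rem_def skip_def nth_append min_def)

lemma rem_commute: "i \<le> j \<Longrightarrow> rem j (rem i xs) = rem i (rem (Suc j) xs)"
proof (induction xs arbitrary: i j)
  case (Cons x xs)
  show ?case
  proof (cases i)
    case 0
    then show ?thesis by (simp add: rem_def drop_take)
  next
    case (Suc i')
    then obtain j' where j: "j = Suc j'" using Cons.prems by (cases j) auto
    then show ?thesis using Cons Suc by (simp add: rem_def)
  qed
qed (simp add: rem_def)

lemma sum_skip:
  fixes h :: "nat \<Rightarrow> real"
  assumes "i < Suc n"
  shows "(\<Sum>j<n. h (skip i j)) = (\<Sum>j\<in>{..<Suc n} - {i}. h j)"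
  by (rule sum.reindex_bij_witness[of _ "\<lambda>j. if j < i then j else j - 1" "skip i"])
    (use assms in \<open>auto simp: skip_def\<close>)

lemma sum_offdiag:
  fixes g :: "nat \<Rightarrow> nat \<Rightarrow> real"
  shows "(\<Sum>i<n. \<Sum>j\<in>{..<n} - {i}. g i j) = (\<Sum>(i, j)\<in>{(i, j). i < j \<and> j < n}. g i j + g j i)"
proof -
  let ?P = "{(i, j). i < j \<and> j < n}" and ?P' = "{(i, j). j < i \<and> i < n}"
  have fin: "finite ?P" "finite ?P'"
    by (rule finite_subset[of _ "{..<n} \<times> {..<n}"]; auto)+
  have "(\<Sum>i<n. \<Sum>j\<in>{..<n} - {i}. g i j) = (\<Sum>(i, j)\<in>(SIGMA i:{..<n}. {..<n} - {i}). g i j)"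
    by (rule sum.Sigma) auto
  also have "(SIGMA i:{..<n}. {..<n} - {i}) = ?P \<union> ?P'" by auto
  also have "(\<Sum>(i, j)\<in>?P \<union> ?P'. g i j) = (\<Sum>(i, j)\<in>?P. g i j) + (\<Sum>(i, j)\<in>?P'. g i j)"
    by (rule sum.union_disjoint[OF fin]) auto
  also have "(\<Sum>(i, j)\<in>?P'. g i j) = (\<Sum>(i, j)\<in>?P. g j i)"
    by (rule sum.reindex_bij_witness[of _ "\<lambda>(i, j). (j, i)" "\<lambda>(i, j). (j, i)"]) auto
  also have "(\<Sum>(i, j)\<in>?P. g i j) + (\<Sum>(i, j)\<in>?P. g j i) = (\<Sum>(i, j)\<in>?P. g i j + g j i)"
    by (simp add: sum.distrib[symmetric] case_prod_unfold)
  finally show ?thesis .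
qed

text \<open>For j' = \<open>skip i j\<close> the sign is (-1)^(i + j') if j' < i and the opposite if
  j' > i, so each unordered pair contributes a difference. It serves both d d = 0, where
  \<open>h\<close> is symmetric, and the derivative of a form in Maurer--Cartan forms, where the
  difference is a bracket.\<close>

lemma sum_signed_pairs:
  fixes h :: "nat \<Rightarrow> nat \<Rightarrow> real"
  shows "(\<Sum>i<n. (- 1) ^ i * (\<Sum>j<n - 1. (- 1) ^ j * h i (skip i j))) =
    (\<Sum>(i, j)\<in>{(i, j). i < j \<and> j < n}. (- 1) ^ (i + j) * (h j i - h i j))"
proof -
  define g where "g i j = (- 1) ^ i * ((if j < i then (- 1) ^ j else - ((- 1) ^ j)) * h i j)" for i j
  have "(\<Sum>i<n. (- 1) ^ i * (\<Sum>j<n - 1. (- 1) ^ j * h i (skip i j))) = (\<Sum>i<n. \<Sum>j\<in>{..<n} - {i}. g i j)"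
  proof (rule sum.cong[OF refl])
    fix i assume i: "i \<in> {..<n}"
    then have n: "n = Suc (n - 1)" by auto
    have "(\<Sum>j<n - 1. (- 1) ^ j * h i (skip i j)) = (\<Sum>j<n - 1. (\<lambda>j. (if j < i then (- 1) ^ j else - ((- 1) ^ j)) * h i j) (skip i j))"
      by (rule sum.cong) (auto simp: skip_def)
    also have "\<dots> = (\<Sum>j\<in>{..<n} - {i}. (if j < i then (- 1) ^ j else - ((- 1) ^ j)) * h i j)"
      using sum_skip[of i "n - 1"] i n by simp
    finally show "(- 1) ^ i * (\<Sum>j<n - 1. (- 1) ^ j * h i (skip i j)) = (\<Sum>j\<in>{..<n} - {i}. g i j)"
      by (simp add: g_def sum_distrib_left)
  qed
  also have "\<dots> = (\<Sum>(i, j)\<in>{(i, j). i < j \<and> j < n}. g i j + g j i)" by (rule sum_offdiag)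
  also have "\<dots> = (\<Sum>(i, j)\<in>{(i, j). i < j \<and> j < n}. (- 1) ^ (i + j) * (h j i - h i j))"
    by (rule sum.cong) (auto simp: g_def power_add algebra_simps)
  finally show ?thesis .
qed

subsection \<open>Differentiating alternating forms with variable arguments\<close>

text \<open>The variable arguments are expanded in unit vectors one after the other; the prefix
  \<open>us\<close> collects the unit vectors already chosen and makes the induction go through,
  here and in the product rule that follows.\<close>

lemma alt_smooth:
  assumes W: "alt n k W" and V: "eopen m V"
  shows "(\<And>\<zeta>. \<zeta> \<in> set \<zeta>s \<Longrightarrow> (\<forall>x. \<zeta> x \<in> Rn n) \<and> (\<forall>i. smooth_fun_on m V (\<lambda>x. \<zeta> x i))) \<Longrightarrow>
    smooth_fun_on m V (\<lambda>x. W (us @ map (\<lambda>\<zeta>. \<zeta> x) \<zeta>s))"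
proof (induction \<zeta>s arbitrary: us)
  case Nil
  then show ?case by (simp add: smooth_const[OF V])
next
  case (Cons \<zeta> \<zeta>s)
  then have z: "\<And>x. \<zeta> x \<in> Rn n" "\<And>i. smooth_fun_on m V (\<lambda>x. \<zeta> x i)" by auto
  have eq: "W (us @ map (\<lambda>\<zeta>. \<zeta> x) (\<zeta> # \<zeta>s)) = (\<Sum>l<n. \<zeta> x l * W ((us @ [unitv l]) @ map (\<lambda>\<zeta>. \<zeta> x) \<zeta>s))" for x
    using alt_expand[OF W z(1)[of x], of us "map (\<lambda>\<zeta>. \<zeta> x) \<zeta>s"] by simp
  have "smooth_fun_on m V (\<lambda>x. W ((us @ [unitv l]) @ map (\<lambda>\<zeta>. \<zeta> x) \<zeta>s))" for l
    by (rule Cons.IH) (use Cons.prems in auto)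
  then show ?case unfolding eq by (intro smooth_sum smooth_mult V z(2))
qed

lemma alt_dir_deriv:
  assumes W: "alt n k W" and V: "eopen m V" and x: "x \<in> V"
  shows "(\<And>\<zeta>. \<zeta> \<in> set \<zeta>s \<Longrightarrow> (\<forall>x. \<zeta> x \<in> Rn n) \<and> (\<forall>i. smooth_fun_on m V (\<lambda>x. \<zeta> x i))) \<Longrightarrow>
    dir_deriv m (\<lambda>x. W (us @ map (\<lambda>\<zeta>. \<zeta> x) \<zeta>s)) x v =
    (\<Sum>j<length \<zeta>s. W (us @ (map (\<lambda>\<zeta>. \<zeta> x) \<zeta>s)[j := (\<lambda>i. dir_deriv m (\<lambda>x. (\<zeta>s ! j) x i) x v)]))"
proof (induction \<zeta>s arbitrary: us)
  case Nil
  then show ?case by (simp add: dir_deriv_const)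
next
  case (Cons \<zeta> \<zeta>s)
  then have z: "\<And>x. \<zeta> x \<in> Rn n" "\<And>i. smooth_fun_on m V (\<lambda>x. \<zeta> x i)" by auto
  define R where "R x = map (\<lambda>\<zeta>. \<zeta> x) \<zeta>s" for x
  define D where "D j = (\<lambda>i. dir_deriv m (\<lambda>x. (\<zeta>s ! j) x i) x v)" for j
  define D0 where "D0 = (\<lambda>i. dir_deriv m (\<lambda>x. \<zeta> x i) x v)"
  have D0: "D0 \<in> Rn n"
  proof -
    have "(\<lambda>x. \<zeta> x i) = (\<lambda>x. 0)" if "i \<ge> n" for i using z(1) that by (auto simp: Rn_iff)
    then show ?thesis by (simp add: D0_def Rn_iff dir_deriv_const)
  qed
  have sW: "smooth_fun_on m V (\<lambda>x. W ((us @ [unitv l]) @ R x))" for l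
    unfolding R_def by (rule alt_smooth[OF W V]) (use Cons.prems in auto)
  have IH: "dir_deriv m (\<lambda>x. W ((us @ [unitv l]) @ R x)) x v = (\<Sum>j<length \<zeta>s. W ((us @ [unitv l]) @ (R x)[j := D j]))" for l
    unfolding R_def D_def by (rule Cons.IH) (use Cons.prems in auto)
  have eq: "W (us @ map (\<lambda>\<zeta>. \<zeta> x) (\<zeta> # \<zeta>s)) = (\<Sum>l<n. \<zeta> x l * W ((us @ [unitv l]) @ R x))" for x
    using alt_expand[OF W z(1)[of x], of us "R x"] by (simp add: R_def)
  have "dir_deriv m (\<lambda>x. W (us @ map (\<lambda>\<zeta>. \<zeta> x) (\<zeta> # \<zeta>s))) x v =
     dir_deriv m (\<lambda>x. \<Sum>l<n. \<zeta> x l * W ((us @ [unitv l]) @ R x)) x v"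
    unfolding eq ..
  also have "\<dots> = (\<Sum>l<n. dir_deriv m (\<lambda>x. \<zeta> x l * W ((us @ [unitv l]) @ R x)) x v)"
    by (rule dir_deriv_sum[OF V _ x]) (intro smooth_mult V z(2) sW)
  also have "\<dots> = (\<Sum>l<n. D0 l * W (us @ unitv l # R x) + \<zeta> x l * (\<Sum>j<length \<zeta>s. W (us @ unitv l # (R x)[j := D j])))"
    unfolding dir_deriv_mult[OF z(2) sW x] IH by (simp add: D0_def)
  also have "\<dots> = (\<Sum>l<n. D0 l * W (us @ unitv l # R x)) + (\<Sum>j<length \<zeta>s. \<Sum>l<n. \<zeta> x l * W (us @ unitv l # (R x)[j := D j]))"
    unfolding sum.distrib sum_distrib_left by (subst sum.swap) simp
  also have "\<dots> = W (us @ D0 # R x) + (\<Sum>j<length \<zeta>s. W (us @ \<zeta> x # (R x)[j := D j]))"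
    using alt_expand[OF W D0, of us "R x"] alt_expand[OF W z(1)[of x], of us] by simp
  also have "\<dots> = (\<Sum>j<length (\<zeta> # \<zeta>s). W (us @ (map (\<lambda>\<zeta>. \<zeta> x) (\<zeta> # \<zeta>s))[j := (\<lambda>i. dir_deriv m (\<lambda>x. ((\<zeta> # \<zeta>s) ! j) x i) x v)]))"
    by (simp add: sum.lessThan_Suc_shift R_def D_def D0_def del: sum.lessThan_Suc)
  finally show ?case .
qed

lemma alt_update:
  assumes W: "alt n k W" and d: "d \<in> Rn n" and L: "set L \<subseteq> Rn n" and j: "j < length L"
  shows "W (L[j := d]) = (- 1) ^ j * W (d # rem j L)"
proof -
  have "L[j := d] = [] @ take j L @ d # drop (Suc j) L" using j by (simp add: upd_conv_take_nth_drop)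
  then show ?thesis
    using alt_move[OF W d, of "take j L" "[]" "drop (Suc j) L"] L set_take_subset[of j L] j
    by (auto simp: rem_def min_def)
qed

section \<open>The exterior derivative on Euclidean open sets\<close>

lemma smooth_formD:
  assumes "smooth_form m V k \<alpha>"
  shows "\<And>x. x \<in> V \<Longrightarrow> alt m k (\<alpha> x)" "\<And>x. x \<notin> V \<Longrightarrow> \<alpha> x = (\<lambda>vs. 0)"
    "\<And>vs. eopen m V \<Longrightarrow> smooth_fun_on m V (\<lambda>x. \<alpha> x vs)"
proof -
  show a: "alt m k (\<alpha> x)" if "x \<in> V" for x using assms that by (simp add: smooth_form_def)
  show "\<alpha> x = (\<lambda>vs. 0)" if "x \<notin> V" for x using assms that by (simp add: smooth_form_def)
  show "smooth_fun_on m V (\<lambda>x. \<alpha> x vs)" if V: "eopen m V" for vs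
  proof (cases "length vs = k \<and> set vs \<subseteq> Rn m")
    case True
    then show ?thesis using assms by (simp add: smooth_form_def)
  next
    case False
    show ?thesis
      by (rule smooth_cong[OF V, THEN iffD1, OF _ smooth_const[OF V, of 0]])
        (use alt_out[OF a] False in auto)
  qed
qed

lemma ext_deriv_rem:
  "x \<in> V \<Longrightarrow> set vs \<subseteq> Rn m \<Longrightarrow> ext_deriv m V \<alpha> x vs =
    (\<Sum>i<length vs. (- 1) ^ i * dir_deriv m (\<lambda>y. \<alpha> y (rem i vs)) x (vs ! i))"
  by (simp add: ext_deriv_def nths_all_but)

lemma ext_deriv_alt:
  assumes V: "eopen m V" and \<alpha>: "smooth_form m V k \<alpha>" and x: "x \<in> V"
  shows "alt m (Suc k) (ext_deriv m V \<alpha> x)"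
proof -
  note a = smooth_formD[OF \<alpha>]
  note s = a(3)[OF V]
  have c0: "dir_deriv m (\<lambda>y. \<alpha> y vs) x v = 0" if "\<And>y. y \<in> V \<Longrightarrow> \<alpha> y vs = 0" for vs v
    using dir_deriv_cong[OF V x, of "\<lambda>y. \<alpha> y vs" "\<lambda>y. 0" v] that by (simp add: dir_deriv_const)
  have 1: "ext_deriv m V \<alpha> x vs = 0" if "\<not> (length vs = Suc k \<and> set vs \<subseteq> Rn m)" for vs
  proof (cases "set vs \<subseteq> Rn m")
    case True
    then have l: "length vs \<noteq> Suc k" using that by simp
    have "dir_deriv m (\<lambda>y. \<alpha> y (rem i vs)) x (vs ! i) = 0" if "i < length vs" for i
      by (rule c0, rule alt_out[OF a(1)]) (use length_rem[OF that] l that in auto)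
    then show ?thesis unfolding ext_deriv_rem[OF x True] by simp
  qed (auto simp: ext_deriv_def)
  have 2: "ext_deriv m V \<alpha> x (us @ (\<lambda>i. a * z i + b * w i) # ws) =
      a * ext_deriv m V \<alpha> x (us @ z # ws) + b * ext_deriv m V \<alpha> x (us @ w # ws)"
    if R: "set us \<subseteq> Rn m" "set ws \<subseteq> Rn m" "z \<in> Rn m" "w \<in> Rn m" for us ws z w a b
  proof -
    let ?t = "\<lambda>u i. (- 1) ^ i * dir_deriv m (\<lambda>y. \<alpha> y (rem i (us @ u # ws))) x ((us @ u # ws) ! i)"
    let ?c = "\<lambda>i. a * z i + b * w i"
    have t: "?t ?c i = a * ?t z i + b * ?t w i" if "i < length us + Suc (length ws)" for i
    proof (cases "i = length us")
      case True
      then show ?thesis by (simp add: rem_append dir_deriv_lin algebra_simps)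
    next
      case False
      have dl: "dir_deriv m (\<lambda>y. \<alpha> y (as @ ?c # bs)) x v =
         a * dir_deriv m (\<lambda>y. \<alpha> y (as @ z # bs)) x v + b * dir_deriv m (\<lambda>y. \<alpha> y (as @ w # bs)) x v" for as bs v
      proof -
        have "dir_deriv m (\<lambda>y. \<alpha> y (as @ ?c # bs)) x v =
            dir_deriv m (\<lambda>y. a * \<alpha> y (as @ z # bs) + b * \<alpha> y (as @ w # bs)) x v"
          by (rule dir_deriv_cong[OF V x]) (rule alt_lin[OF a(1) R(3,4)])
        then show ?thesis
          unfolding dir_deriv_add[OF smooth_cmult[OF V s] smooth_cmult[OF V s] x] dir_deriv_cmult[OF s x] .
      qed
      have nth: "(us @ u # ws) ! i = (us @ u' # ws) ! i" for u u'
        using False by (cases "i < length us") (auto simp: nth_append nth_Cons split: nat.split)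
      show ?thesis
        using False dl nth[of ?c z] nth[of w z] by (simp add: rem_append algebra_simps)
    qed
    have sub: "set (us @ u # ws) \<subseteq> Rn m" if "u \<in> Rn m" for u using R that by simp
    show ?thesis
      unfolding ext_deriv_rem[OF x sub[OF R(3)]] ext_deriv_rem[OF x sub[OF R(4)]]
        ext_deriv_rem[OF x sub[OF Rn_lin[OF R(3,4)]]] length_append list.size(4) sum_distrib_left sum.distrib[symmetric]
      by (rule sum.cong) (use t in auto)
  qed
  have 3: "ext_deriv m V \<alpha> x vs = 0" if vs: "set vs \<subseteq> Rn m" "\<not> distinct vs" for vs
  proof -
    obtain as bs cs v where dec: "vs = as @ [v] @ bs @ [v] @ cs" using not_distinct_decomp[OF vs(2)] by blast
    have R: "set as \<subseteq> Rn m" "set bs \<subseteq> Rn m" "set cs \<subseteq> Rn m" "v \<in> Rn m" using vs(1) dec by auto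
    define p where "p = length as"
    define q where "q = length as + Suc (length bs)"
    let ?t = "\<lambda>i. (- 1) ^ i * dir_deriv m (\<lambda>y. \<alpha> y (rem i vs)) x (vs ! i)"
    have pq: "p < length vs" "q < length vs" "p \<noteq> q" by (auto simp: p_def q_def dec)
    have other: "?t i = 0" if "i < length vs" "i \<noteq> p" "i \<noteq> q" for i
    proof -
      have "\<not> distinct (rem i vs)"
        using that by (auto simp: dec rem_append p_def q_def)
      then have "dir_deriv m (\<lambda>y. \<alpha> y (rem i vs)) x (vs ! i) = 0"
        using vs(1) set_rem[of i vs] by (intro c0 alt_dist[OF a(1)]) auto
      then show ?thesis by simp
    qed
    have rp: "rem p vs = as @ bs @ v # cs" "rem q vs = as @ v # bs @ cs"
      by (auto simp: dec rem_append p_def q_def)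
    have np: "vs ! p = v" "vs ! q = v" by (auto simp: dec p_def q_def nth_append)
    \<comment> \<open>Only the terms that delete one of the two equal entries survive. The two
      shortened lists differ by moving \<open>v\<close> across \<open>bs\<close>, and q = p + length
      bs + 1 supplies the opposite sign.\<close>
    have "dir_deriv m (\<lambda>y. \<alpha> y (rem p vs)) x v = dir_deriv m (\<lambda>y. (- 1) ^ length bs * \<alpha> y (rem q vs)) x v"
      by (rule dir_deriv_cong[OF V x]) (simp add: rp alt_move[OF a(1) R(4) R(2)])
    then have "?t p = (- 1) ^ (p + length bs) * dir_deriv m (\<lambda>y. \<alpha> y (rem q vs)) x v"
      by (simp add: dir_deriv_cmult[OF s x] np power_add)
    moreover have "?t q = - ((- 1) ^ (p + length bs) * dir_deriv m (\<lambda>y. \<alpha> y (rem q vs)) x v)"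
      unfolding np by (simp add: q_def p_def)
    ultimately have "?t p + ?t q = 0" by simp
    moreover have "(\<Sum>i<length vs. ?t i) = (\<Sum>i\<in>{p, q}. ?t i)"
      by (rule sum.mono_neutral_right) (use pq other in auto)
    ultimately show ?thesis unfolding ext_deriv_rem[OF x vs(1)] using pq(3) by simp
  qed
  show ?thesis
    unfolding alternating_form_def
  proof (intro conjI allI impI)
    show "ext_deriv m V \<alpha> x vs = 0" if "\<not> (length vs = Suc k \<and> set vs \<subseteq> vcarrier (euclid_vs m))" for vs
      using 1 that by simp
    show "ext_deriv m V \<alpha> x (us @ vadd (euclid_vs m) (vscale (euclid_vs m) a z) (vscale (euclid_vs m) b w) # ws) =
        a * ext_deriv m V \<alpha> x (us @ z # ws) + b * ext_deriv m V \<alpha> x (us @ w # ws)"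
      if "length us + length ws + 1 = Suc k \<and> set us \<union> set ws \<union> {z, w} \<subseteq> vcarrier (euclid_vs m)" for us ws z w a b
      using 2[of us ws z w a b] that by simp
    show "ext_deriv m V \<alpha> x vs = 0" if "set vs \<subseteq> vcarrier (euclid_vs m) \<and> \<not> distinct vs" for vs
      using 3 that by simp
  qed
qed

lemma ext_deriv_squared:
  assumes V: "eopen m V" and \<alpha>: "smooth_form m V k \<alpha>"
  shows "ext_deriv m V (ext_deriv m V \<alpha>) x vs = 0"
proof (cases "x \<in> V \<and> set vs \<subseteq> Rn m")
  case True
  then have x: "x \<in> V" and vs: "set vs \<subseteq> Rn m" by auto
  note s = smooth_formD(3)[OF \<alpha> V]
  define n where "n = length vs"
  \<comment> \<open>Both second derivatives for a pair of indices refer to the list with these two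
    entries deleted. The case distinction only fixes the order of deletion, so \<open>h\<close> is
    symmetric by the symmetry of second derivatives.\<close>
  define h where "h i j = dir_deriv m (\<lambda>z. dir_deriv m (\<lambda>y. \<alpha> y (if j < i then rem j (rem i vs) else rem i (rem j vs))) z (vs ! j)) x (vs ! i)" for i j
  have inner: "dir_deriv m (\<lambda>y. ext_deriv m V \<alpha> y (rem i vs)) x (vs ! i) =
      (\<Sum>j<n - 1. (- 1) ^ j * h i (skip i j))" if i: "i < n" for i
  proof -
    have sub: "set (rem i vs) \<subseteq> Rn m" using set_rem[of i vs] vs by blast
    have "dir_deriv m (\<lambda>y. ext_deriv m V \<alpha> y (rem i vs)) x (vs ! i) =
       dir_deriv m (\<lambda>y. \<Sum>j<n - 1. (- 1) ^ j * dir_deriv m (\<lambda>y. \<alpha> y (rem j (rem i vs))) y (rem i vs ! j)) x (vs ! i)"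
      by (rule dir_deriv_cong[OF V x]) (use ext_deriv_rem[OF _ sub] length_rem[of i vs] i in \<open>auto simp: n_def\<close>)
    also have "\<dots> = (\<Sum>j<n - 1. dir_deriv m (\<lambda>y. (- 1) ^ j * dir_deriv m (\<lambda>y. \<alpha> y (rem j (rem i vs))) y (rem i vs ! j)) x (vs ! i))"
      by (rule dir_deriv_sum[OF V _ x]) (intro smooth_cmult[OF V] smooth_dir_deriv[OF V] s)
    also have "\<dots> = (\<Sum>j<n - 1. (- 1) ^ j * h i (skip i j))"
    proof (rule sum.cong[OF refl])
      fix j assume j: "j \<in> {..<n - 1}"
      have e1: "rem i vs ! j = vs ! skip i j" by (rule nth_rem) (use i j in \<open>auto simp: n_def\<close>)
      have e2: "rem j (rem i vs) = (if skip i j < i then rem (skip i j) (rem i vs) else rem i (rem (skip i j) vs))"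
        using rem_commute[of i j vs] by (auto simp: skip_def)
      show "dir_deriv m (\<lambda>y. (- 1) ^ j * dir_deriv m (\<lambda>y. \<alpha> y (rem j (rem i vs))) y (rem i vs ! j)) x (vs ! i)
          = (- 1) ^ j * h i (skip i j)"
        unfolding dir_deriv_cmult[OF smooth_dir_deriv[OF V s] x] e1 h_def e2 by simp
    qed
    finally show ?thesis .
  qed
  have "ext_deriv m V (ext_deriv m V \<alpha>) x vs = (\<Sum>i<n. (- 1) ^ i * (\<Sum>j<n - 1. (- 1) ^ j * h i (skip i j)))"
    unfolding ext_deriv_rem[OF x vs] n_def[symmetric] using inner by simp
  also have "\<dots> = (\<Sum>(i, j)\<in>{(i, j). i < j \<and> j < n}. (- 1) ^ (i + j) * (h j i - h i j))" by (rule sum_signed_pairs)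
  also have "\<dots> = 0"
  proof (rule sum.neutral, clarify)
    fix i j :: nat assume ij: "i < j"
    have "h i j = h j i"
      using ij dir_deriv_commute[OF V s x, of "rem i (rem j vs)" "vs ! j" "vs ! i"] by (simp add: h_def)
    then show "(- 1) ^ (i + j) * (h j i - h i j) = 0" by simp
  qed
  finally show ?thesis .
qed (auto simp: ext_deriv_def)

section \<open>Isomorphic complexes have isomorphic cohomology\<close>

lemma vs_coset_image:
  assumes f: "\<And>x y. x \<in> A \<Longrightarrow> y \<in> A \<Longrightarrow> f (vadd V x y) = vadd V' (f x) (f y)" and W: "W \<subseteq> A" and x: "x \<in> A"
  shows "f ` vs_coset V x W = vs_coset V' (f x) (f ` W)"
proof -
  have "f (vadd V x w) = vadd V' (f x) (f w)" if "w \<in> W" for w using f x W that by blast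
  then show ?thesis by (auto simp: vs_coset_def image_image intro!: image_cong)
qed

text \<open>The induced map sends a coset to its image under \<Phi>, so it is well defined without a
  choice of representatives. The records carry no vector space axioms; the few that matter are
  assumed.\<close>

lemma cochain_isomorphic_cohomology:
  assumes iso: "cochain_isomorphic C d C' d'"
    and add: "\<And>k x y. x \<in> vcarrier (C k) \<Longrightarrow> y \<in> vcarrier (C k) \<Longrightarrow> vadd (C k) x y \<in> vcarrier (C k)"
    and scale: "\<And>k a x. x \<in> vcarrier (C k) \<Longrightarrow> vscale (C k) a x \<in> vcarrier (C k)"
    and zero: "\<And>k. vzero (C k) \<in> vcarrier (C k)"
    and scale0: "\<And>k x. x \<in> vcarrier (C k) \<Longrightarrow> vscale (C k) 0 x = vzero (C k)"
    and scale0': "\<And>k x. x \<in> vcarrier (C' k) \<Longrightarrow> vscale (C' k) 0 x = vzero (C' k)"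
  shows "vs_isomorphic (cohomology C d k) (cohomology C' d' k)"
proof -
  obtain \<Phi> where cc: "cochain_complex C d" "cochain_complex C' d'" and \<Phi>: "\<And>k. vs_isomorphism (C k) (C' k) (\<Phi> k)"
    and com: "\<And>k x. x \<in> vcarrier (C k) \<Longrightarrow> \<Phi> (Suc k) (d k x) = d' k (\<Phi> k x)"
    using iso unfolding cochain_isomorphic_def by blast
  have lin: "\<And>k x y. x \<in> vcarrier (C k) \<Longrightarrow> y \<in> vcarrier (C k) \<Longrightarrow> \<Phi> k (vadd (C k) x y) = vadd (C' k) (\<Phi> k x) (\<Phi> k y)"
    "\<And>k a x. x \<in> vcarrier (C k) \<Longrightarrow> \<Phi> k (vscale (C k) a x) = vscale (C' k) a (\<Phi> k x)"
    and bij: "\<And>k. bij_betw (\<Phi> k) (vcarrier (C k)) (vcarrier (C' k))"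
    using \<Phi> unfolding vs_isomorphism_def vs_linear_def by blast+
  have into: "\<Phi> k x \<in> vcarrier (C' k)" if "x \<in> vcarrier (C k)" for k x using bij that bij_betwE by blast
  have dC: "d k x \<in> vcarrier (C (Suc k))" if "x \<in> vcarrier (C k)" for k x
    using cc(1) that unfolding cochain_complex_def vs_linear_def by blast
  have \<Phi>0: "\<Phi> k (vzero (C k)) = vzero (C' k)" for k
    using lin(2)[OF zero[of k], of 0] scale0[OF zero[of k]] scale0'[OF into[OF zero[of k]]] by simp
  have cyc: "\<Phi> k ` cocycles C d k = cocycles C' d' k" for k
  proof
    show "\<Phi> k ` cocycles C d k \<subseteq> cocycles C' d' k"
      using com[symmetric] into \<Phi>0 by (auto simp: cocycles_def)
    show "cocycles C' d' k \<subseteq> \<Phi> k ` cocycles C d k"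
    proof
      fix y assume y: "y \<in> cocycles C' d' k"
      then obtain x where x: "x \<in> vcarrier (C k)" "y = \<Phi> k x"
        using bij[of k] by (auto simp: cocycles_def bij_betw_def)
      have "\<Phi> (Suc k) (d k x) = \<Phi> (Suc k) (vzero (C (Suc k)))"
        using y x com \<Phi>0 by (simp add: cocycles_def)
      then have "d k x = vzero (C (Suc k))"
        using bij[of "Suc k"] dC[OF x(1)] zero by (auto simp: bij_betw_def inj_on_def)
      then show "y \<in> \<Phi> k ` cocycles C d k" using x by (auto simp: cocycles_def)
    qed
  qed
  have cob: "\<Phi> k ` coboundaries C d k = coboundaries C' d' k" for k
  proof (cases k)
    case (Suc j)
    have "\<Phi> (Suc j) ` d j ` vcarrier (C j) = d' j ` \<Phi> j ` vcarrier (C j)"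
      using com by (auto simp: image_image)
    then show ?thesis using Suc bij[of j] by (simp add: bij_betw_def)
  qed (simp add: \<Phi>0)
  have cobC: "coboundaries C d k \<subseteq> vcarrier (C k)" for k
    by (cases k) (auto simp: zero dC)
  let ?C = "vcarrier (C k)" and ?W = "coboundaries C d k" and ?W' = "coboundaries C' d' k"
  have cocC: "cocycles C d k \<subseteq> ?C" by (auto simp: cocycles_def)
  have co: "vs_coset ((C k)\<lparr>vcarrier := X\<rparr>) = vs_coset (C k)" "vs_coset ((C' k)\<lparr>vcarrier := Y\<rparr>) = vs_coset (C' k)" for X Y
    by (auto simp: vs_coset_def fun_eq_iff)
  have im: "\<Phi> k ` vs_coset (C k) x ?W = vs_coset (C' k) (\<Phi> k x) ?W'" if "x \<in> ?C" for x
    using vs_coset_image[of ?C "\<Phi> k" "C k" "C' k", OF lin(1) cobC that] cob by simp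
  have cosub: "vs_coset (C k) x ?W \<subseteq> ?C" if "x \<in> ?C" for x
    unfolding vs_coset_def using add[OF that] cobC by blast
  let ?H = "cohomology C d k" and ?H' = "cohomology C' d' k"
  have car: "vcarrier ?H = (\<lambda>x. vs_coset (C k) x ?W) ` cocycles C d k"
    "vcarrier ?H' = (\<lambda>x. vs_coset (C' k) x ?W') ` cocycles C' d' k"
    by (simp_all add: cohomology_def quot_vs_def co)
  have ops: "vadd ?H A B = (\<Union>x\<in>A. \<Union>y\<in>B. vs_coset (C k) (vadd (C k) x y) ?W)"
    "vadd ?H' A' B' = (\<Union>x\<in>A'. \<Union>y\<in>B'. vs_coset (C' k) (vadd (C' k) x y) ?W')"
    "vscale ?H a A = (\<Union>x\<in>A. vs_coset (C k) (vscale (C k) a x) ?W)"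
    "vscale ?H' a A' = (\<Union>x\<in>A'. vs_coset (C' k) (vscale (C' k) a x) ?W')" for A B A' B' a
    by (simp_all add: cohomology_def quot_vs_def co)
  have sub: "A \<subseteq> ?C" if "A \<in> vcarrier ?H" for A using that cosub cocC unfolding car by blast
  have "vs_isomorphism ?H ?H' (\<lambda>A. \<Phi> k ` A)"
    unfolding vs_isomorphism_def vs_linear_def
  proof (intro conjI ballI allI)
    have image: "(\<lambda>A. \<Phi> k ` A) ` vcarrier ?H = vcarrier ?H'"
      unfolding car cyc[symmetric] image_image by (rule image_cong[OF refl]) (use im cocC in blast)
    then show "(\<lambda>A. \<Phi> k ` A) ` vcarrier ?H \<subseteq> vcarrier ?H'" by simp
    show "bij_betw (\<lambda>A. \<Phi> k ` A) (vcarrier ?H) (vcarrier ?H')"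
      unfolding bij_betw_def
    proof (intro conjI image inj_onI)
      fix A B assume "A \<in> vcarrier ?H" "B \<in> vcarrier ?H" "\<Phi> k ` A = \<Phi> k ` B"
      then show "A = B" using sub bij[of k] by (meson bij_betw_def inj_on_image_eq_iff)
    qed
    fix A assume A: "A \<in> vcarrier ?H"
    show "\<Phi> k ` vadd ?H A B = vadd ?H' (\<Phi> k ` A) (\<Phi> k ` B)" if B: "B \<in> vcarrier ?H" for B
    proof -
      have "\<Phi> k ` vs_coset (C k) (vadd (C k) x y) ?W = vs_coset (C' k) (vadd (C' k) (\<Phi> k x) (\<Phi> k y)) ?W'"
        if "x \<in> A" "y \<in> B" for x y
        using im[OF add] lin(1) sub[OF A] sub[OF B] that by (metis subsetD)
      then show ?thesis unfolding ops image_UN by simp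
    qed
    show "\<Phi> k ` vscale ?H a A = vscale ?H' a (\<Phi> k ` A)" for a
    proof -
      have "\<Phi> k ` vs_coset (C k) (vscale (C k) a x) ?W = vs_coset (C' k) (vscale (C' k) a (\<Phi> k x)) ?W'"
        if "x \<in> A" for x
        using im[OF scale] lin(2) sub[OF A] that by (metis subsetD)
      then show ?thesis unfolding ops image_UN by simp
    qed
  qed
  then show ?thesis unfolding vs_isomorphic_def by blast
qed

section \<open>Differential forms on the quotient by a dense subgroup\<close>

context lie_grp begin

text \<open>Differentiate each slot in turn, move the derivative to the front by alternation and
  group the terms by pairs of indices: what appears is the difference of derivatives in the
  Maurer--Cartan equation, hence a bracket.\<close>

lemma ext_deriv_mc:
  assumes p: "sm m V p" and W: "alt dm k W" and x: "x \<in> V" and vs: "set vs \<subseteq> Rn m" and len: "length vs = Suc k"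
  shows "(\<Sum>i<length vs. (- 1) ^ i * dir_deriv m (\<lambda>y. W (map (mc m p y) (rem i vs))) x (vs ! i)) =
    (\<Sum>(i, j)\<in>{(i, j). i < j \<and> j < length vs}. (- 1) ^ (i + j) *
      W (br (mc m p x (vs ! i)) (mc m p x (vs ! j)) # map (mc m p x) (rem i (rem j vs))))"
proof -
  note V = sm_eopen[OF p]
  define dd where "dd v u = (\<lambda>l. dir_deriv m (\<lambda>y. mc m p y v l) x u)" for v u
  have dd: "dd v u \<in> Rn dm" for v u
  proof -
    have "(\<lambda>y. mc m p y v l) = (\<lambda>y. 0)" if "l \<ge> dm" for l using that mc_Rn by (auto simp: Rn_iff)
    then show ?thesis by (auto simp: Rn_iff dd_def dir_deriv_const)
  qed
  define h where "h i j = W (dd (vs ! j) (vs ! i) # map (mc m p x) (if j < i then rem j (rem i vs) else rem i (rem j vs)))" for i j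
  have inner: "dir_deriv m (\<lambda>y. W (map (mc m p y) (rem i vs))) x (vs ! i) = (\<Sum>j<length vs - 1. (- 1) ^ j * h i (skip i j))"
    if i: "i < length vs" for i
  proof -
    let ?zs = "map (\<lambda>v y. mc m p y v) (rem i vs)"
    have lr: "length (rem i vs) = length vs - 1" by (rule length_rem[OF i])
    have "dir_deriv m (\<lambda>y. W ([] @ map (\<lambda>\<zeta>. \<zeta> y) ?zs)) x (vs ! i) =
       (\<Sum>j<length ?zs. W ([] @ (map (\<lambda>\<zeta>. \<zeta> x) ?zs)[j := (\<lambda>l. dir_deriv m (\<lambda>x. (?zs ! j) x l) x (vs ! i))]))"
      by (rule alt_dir_deriv[OF W V x]) (use mc_Rn smooth_mc[OF p] in auto)
    then have "dir_deriv m (\<lambda>y. W (map (mc m p y) (rem i vs))) x (vs ! i) =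
       (\<Sum>j<length vs - 1. W ((map (mc m p x) (rem i vs))[j := (\<lambda>l. dir_deriv m (\<lambda>x. (?zs ! j) x l) x (vs ! i))]))"
      by (simp add: comp_def lr)
    also have "\<dots> = (\<Sum>j<length vs - 1. (- 1) ^ j * h i (skip i j))"
    proof (rule sum.cong[OF refl])
      fix j assume j: "j \<in> {..<length vs - 1}"
      then have jl: "j < length (rem i vs)" using lr by simp
      have e1: "rem i vs ! j = vs ! skip i j" by (rule nth_rem) (use i j in auto)
      have e2: "rem j (rem i vs) = (if skip i j < i then rem (skip i j) (rem i vs) else rem i (rem (skip i j) vs))"
        using rem_commute[of i j vs] by (auto simp: skip_def)
      have e3: "(\<lambda>l. dir_deriv m (\<lambda>x. (?zs ! j) x l) x (vs ! i)) = dd (vs ! skip i j) (vs ! i)"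
        using jl e1 by (simp add: dd_def)
      have "W ((map (mc m p x) (rem i vs))[j := dd (vs ! skip i j) (vs ! i)]) =
          (- 1) ^ j * W (dd (vs ! skip i j) (vs ! i) # rem j (map (mc m p x) (rem i vs)))"
        by (rule alt_update[OF W dd]) (use mc_Rn jl in auto)
      then show "W ((map (mc m p x) (rem i vs))[j := (\<lambda>l. dir_deriv m (\<lambda>x. (?zs ! j) x l) x (vs ! i))]) = (- 1) ^ j * h i (skip i j)"
        unfolding e3 h_def rem_map e2 .
    qed
    finally show ?thesis .
  qed
  have "(\<Sum>i<length vs. (- 1) ^ i * dir_deriv m (\<lambda>y. W (map (mc m p y) (rem i vs))) x (vs ! i)) =
      (\<Sum>i<length vs. (- 1) ^ i * (\<Sum>j<length vs - 1. (- 1) ^ j * h i (skip i j)))"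
    by (rule sum.cong) (auto simp: inner)
  also have "\<dots> = (\<Sum>(i, j)\<in>{(i, j). i < j \<and> j < length vs}. (- 1) ^ (i + j) * (h j i - h i j))"
    by (rule sum_signed_pairs)
  also have "\<dots> = (\<Sum>(i, j)\<in>{(i, j). i < j \<and> j < length vs}. (- 1) ^ (i + j) *
      W (br (mc m p x (vs ! i)) (mc m p x (vs ! j)) # map (mc m p x) (rem i (rem j vs))))"
  proof (rule sum.cong[OF refl], clarify)
    fix i j :: nat assume ij: "i < j"
    let ?b = "br (mc m p x (vs ! i)) (mc m p x (vs ! j))" and ?R = "map (mc m p x) (rem i (rem j vs))"
    have eq: "(\<lambda>l. 1 * dd (vs ! j) (vs ! i) l + (-1) * dd (vs ! i) (vs ! j) l) = (\<lambda>l. (-1) * ?b l + 0 * ?b l)"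
      using maurer_cartan[OF p x, of "vs ! j" _ "vs ! i"] by (simp add: dd_def fun_eq_iff)
    have "1 * W (dd (vs ! j) (vs ! i) # ?R) + (-1) * W (dd (vs ! i) (vs ! j) # ?R) = (-1) * W (?b # ?R) + 0 * W (?b # ?R)"
      using alt_lin[OF W dd dd, of "[]" 1 "vs ! j" "vs ! i" "-1" "vs ! i" "vs ! j" ?R]
        alt_lin[OF W lie_br(1) lie_br(1), of "[]" "-1" "mc m p x (vs ! i)" "mc m p x (vs ! j)" 0 "mc m p x (vs ! i)" "mc m p x (vs ! j)" ?R]
      unfolding eq by simp
    then have "h j i - h i j = W (?b # ?R)" using ij by (simp add: h_def)
    then show "(- 1) ^ (i + j) * (h j i - h i j) = (- 1) ^ (i + j) * W (?b # ?R)" by simp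
  qed
  finally show ?thesis .
qed

lemma br_lin: "br (\<lambda>i. a * z i + b * w i) x = (\<lambda>i. a * br z x i + b * br w x i)"
proof (rule E_cancel[OF lie_br(1) Rn_lin[OF lie_br(1) lie_br(1)] one_closed])
  fix f assume f: "f \<in> SF"
  have "E (\<lambda>i. a * z i + b * w i) f = (\<lambda>p. a * E z f p + b * E w f p)" by (intro ext) (rule E_lin)
  then show "E (br (\<lambda>i. a * z i + b * w i) x) f \<one> = E (\<lambda>i. a * br z x i + b * br w x i) f \<one>"
    unfolding E_lin lie_br(2)
    by (simp add: lie_algebra_of_def E_lin E_field_lin[OF E_sf[OF f] E_sf[OF f]] algebra_simps)
qed

lemma br_anti: "br x z = (\<lambda>i. (-1) * br z x i + 0 * br z x i)"
  by (rule E_cancel[OF lie_br(1) Rn_lin[OF lie_br(1) lie_br(1)] one_closed])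
    (unfold E_lin lie_br(2), simp add: lie_algebra_of_def)

end

text \<open>Operations on a quotient are unions over all representatives; once the resulting coset
  does not depend on them, the union is that coset.\<close>

lemma UN_const2:
  assumes "A \<noteq> {}" "B \<noteq> {}" "\<And>x y. x \<in> A \<Longrightarrow> y \<in> B \<Longrightarrow> F x y = C"
  shows "(\<Union>x\<in>A. \<Union>y\<in>B. F x y) = C"
  using assms by auto

locale dense_grp = lie_grp M G W0 \<phi>0
  for M :: "'a manifold" and G :: "('a, 'z) monoid_scheme" (structure) and W0 \<phi>0 +
  fixes H :: "'a set"
  assumes HS: "subgroup H G" and HD: "mtop M closure_of H = topspace (mtop M)"
begin

section \<open>The quotient Lie algebra in coordinates\<close>

abbreviation "hh \<equiv> lie_subalgebra_of G M H"
abbreviation "QL \<equiv> quot_lie_algebra LA hh"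
abbreviation "D \<equiv> coset_diffeology G M H"

text \<open>Vectors of \<open>Rn dm\<close> serve as names for the elements of the quotient Lie
  algebra, with \<open>h0 H\<close> as the ambiguity.\<close>

definition cs :: "vec \<Rightarrow> 'a vfield set" where "cs z = vs_coset LA (E z) hh"

lemma hh: "hh = E ` h0 H" by (rule lie_subalgebra_eq[OF HS])

lemma LA_carrier: "vcarrier LA = E ` Rn dm"
  using E_in E_surj by blast

lemma LA_ops:
  "vadd LA (E z) (E w) = E (\<lambda>i. z i + w i)" "vscale LA a (E z) = E (\<lambda>i. a * z i)"
  using E_lin[of 1 z 1 w] E_lin[of a z 0 z] by (auto simp: lie_algebra_of_def fun_eq_iff)

lemma h0_add: "z \<in> h0 H \<Longrightarrow> w \<in> h0 H \<Longrightarrow> (\<lambda>i. z i + w i) \<in> h0 H"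
  using h0_lin[OF HS, of z w 1 1] by simp

lemma h0_cmult: "z \<in> h0 H \<Longrightarrow> (\<lambda>i. a * z i) \<in> h0 H"
  using h0_lin[OF HS, of z z a 0] by simp

lemma cs_alt: "cs z = (\<lambda>h. E (\<lambda>i. z i + h i)) ` h0 H"
  unfolding cs_def vs_coset_def hh image_image LA_ops ..

lemma cs_self: "E z \<in> cs z"
  unfolding cs_alt using h0_zero[OF HS] by (force simp: image_iff)

lemma cs_eq:
  assumes z: "z \<in> Rn dm" and w: "w \<in> Rn dm"
  shows "cs z = cs w \<longleftrightarrow> (\<lambda>i. z i - w i) \<in> h0 H"
proof
  assume "cs z = cs w"
  then have "E z \<in> cs w" using cs_self[of z] by simp
  then obtain h where h: "h \<in> h0 H" "E z = E (\<lambda>i. w i + h i)" unfolding cs_alt by blast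
  have "(\<lambda>i. w i + h i) \<in> Rn dm" using w h(1) h0_Rn Rn_lin[OF w, of h 1 1] by auto
  from E_inj[OF z this h(2)] have "(\<lambda>i. z i - w i) = h" by (simp add: fun_eq_iff)
  then show "(\<lambda>i. z i - w i) \<in> h0 H" using h(1) by simp
next
  have sub: "cs z \<subseteq> cs w" if d: "(\<lambda>i. z i - w i) \<in> h0 H" for z w
  proof
    fix X assume "X \<in> cs z"
    then obtain h where h: "h \<in> h0 H" "X = E (\<lambda>i. z i + h i)" unfolding cs_alt by blast
    have "X = E (\<lambda>i. w i + ((z i - w i) + h i))" using h(2) by simp
    then show "X \<in> cs w" unfolding cs_alt using h0_add[OF d h(1)] by (rule image_eqI[where x="\<lambda>i. (z i - w i) + h i"])
  qed
  assume d: "(\<lambda>i. z i - w i) \<in> h0 H"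
  have "(\<lambda>i. w i - z i) \<in> h0 H" using h0_cmult[OF d, of "-1"] by simp
  then show "cs z = cs w" using sub[OF d] sub by blast
qed

lemma QL_carrier: "vcarrier QL = cs ` Rn dm"
  by (simp add: quot_lie_algebra_def quot_vs_def LA_carrier image_image cs_def)

lemma QL_add:
  assumes "z \<in> Rn dm" "w \<in> Rn dm"
  shows "vadd QL (cs z) (cs w) = cs (\<lambda>i. z i + w i)"
proof -
  have "vadd QL (cs z) (cs w) = (\<Union>x\<in>cs z. \<Union>y\<in>cs w. vs_coset LA (vadd LA x y) hh)"
    by (simp add: quot_lie_algebra_def quot_vs_def)
  also have "\<dots> = cs (\<lambda>i. z i + w i)"
  proof (rule UN_const2)
    fix X Y assume "X \<in> cs z" "Y \<in> cs w"
    then obtain h k where hk: "h \<in> h0 H" "X = E (\<lambda>i. z i + h i)" "k \<in> h0 H" "Y = E (\<lambda>i. w i + k i)"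
      unfolding cs_alt by blast
    have R: "h \<in> Rn dm" "k \<in> Rn dm" using hk h0_Rn by auto
    have "vs_coset LA (vadd LA X Y) hh = cs (\<lambda>i. (z i + h i) + (w i + k i))"
      unfolding hk LA_ops cs_def ..
    also have "\<dots> = cs (\<lambda>i. z i + w i)"
      by (subst cs_eq) (use assms R h0_add[OF hk(1,3)] in \<open>auto simp: Rn_iff\<close>)
    finally show "vs_coset LA (vadd LA X Y) hh = cs (\<lambda>i. z i + w i)" .
  qed (use cs_self in blast)+
  finally show ?thesis .
qed

lemma QL_scale:
  assumes "z \<in> Rn dm"
  shows "vscale QL a (cs z) = cs (\<lambda>i. a * z i)"
proof -
  have "vscale QL a (cs z) = (\<Union>x\<in>cs z. \<Union>y\<in>{()}. vs_coset LA (vscale LA a x) hh)"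
    by (simp add: quot_lie_algebra_def quot_vs_def)
  also have "\<dots> = cs (\<lambda>i. a * z i)"
  proof (rule UN_const2)
    fix X assume "X \<in> cs z"
    then obtain h where h: "h \<in> h0 H" "X = E (\<lambda>i. z i + h i)" unfolding cs_alt by blast
    have R: "h \<in> Rn dm" using h h0_Rn by auto
    have "vs_coset LA (vscale LA a X) hh = cs (\<lambda>i. a * (z i + h i))" unfolding h LA_ops cs_def ..
    also have "\<dots> = cs (\<lambda>i. a * z i)"
      by (subst cs_eq) (use assms R h0_cmult[OF h(1), of a] in \<open>auto simp: Rn_iff algebra_simps\<close>)
    finally show "vs_coset LA (vscale LA a X) hh = cs (\<lambda>i. a * z i)" .
  qed (use cs_self in blast)+
  finally show ?thesis .
qed

lemma QL_lin:
  assumes "z \<in> Rn dm" "w \<in> Rn dm"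
  shows "vadd QL (vscale QL a (cs z)) (vscale QL b (cs w)) = cs (\<lambda>i. a * z i + b * w i)"
  unfolding QL_scale[OF assms(1)] QL_scale[OF assms(2)]
  by (rule QL_add) (use assms in \<open>auto simp: Rn_iff\<close>)

lemma QL_bracket:
  assumes z: "z \<in> Rn dm" and w: "w \<in> Rn dm"
  shows "lie_bracket QL (cs z) (cs w) = cs (br z w)"
proof -
  have "lie_bracket QL (cs z) (cs w) = (\<Union>x\<in>cs z. \<Union>y\<in>cs w. vs_coset LA (lie_bracket LA x y) hh)"
    by (simp add: quot_lie_algebra_def)
  also have "\<dots> = cs (br z w)"
  proof (rule UN_const2)
    fix X Y assume "X \<in> cs z" "Y \<in> cs w"
    then obtain h k where hk: "h \<in> h0 H" "X = E (\<lambda>i. z i + h i)" "k \<in> h0 H" "Y = E (\<lambda>i. w i + k i)"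
      unfolding cs_alt by blast
    let ?z = "\<lambda>i. z i + h i" and ?w = "\<lambda>i. w i + k i"
    have R: "h \<in> Rn dm" "k \<in> Rn dm" using hk h0_Rn by auto
    have wR: "?w \<in> Rn dm" using w R by (simp add: Rn_iff)
    have 1: "br ?z x = (\<lambda>i. br z x i + br h x i)" for x using br_lin[of 1 z 1 h x] by simp
    have 2: "br ?w x = (\<lambda>i. br w x i + br k x i)" for x using br_lin[of 1 w 1 k x] by simp
    \<comment> \<open>[z + h, w + k] - [z, w] = -[k, z] + [h, w + k], and both terms lie in the
      ideal.\<close>
    have "(\<lambda>i. br ?z ?w i - br z w i) = (\<lambda>i. (-1) * br k z i + 1 * br h ?w i)"
      using br_anti[of z ?w] br_anti[of z w] unfolding 1 2 by (simp add: fun_eq_iff)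
    also have "\<dots> \<in> h0 H"
      by (rule h0_lin[OF HS h0_br[OF HS HD hk(3) z] h0_br[OF HS HD hk(1) wR]])
    finally have "cs (br ?z ?w) = cs (br z w)" using cs_eq[OF lie_br(1) lie_br(1)] by simp
    then show "vs_coset LA (lie_bracket LA X Y) hh = cs (br z w)"
      unfolding hk lie_br(2)[symmetric] cs_def .
  qed (use cs_self in blast)+
  finally show ?thesis .
qed

text \<open>The pullback of \<omega> along the projection from \<open>Rn dm\<close> onto the
  quotient Lie algebra.\<close>

definition Wf :: "'a vfield set form \<Rightarrow> vec form" where
  "Wf \<omega> zs = (if set zs \<subseteq> Rn dm then \<omega> (map cs zs) else 0)"

lemma map_cs_carrier: "set zs \<subseteq> Rn dm \<Longrightarrow> set (map cs zs) \<subseteq> vcarrier QL"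
  unfolding QL_carrier by auto

lemma Wf_alt:
  assumes \<omega>: "alternating_form QL k \<omega>"
  shows "alt dm k (Wf \<omega>)"
  unfolding alternating_form_def
proof (intro conjI allI impI)
  fix vs assume "\<not> (length vs = k \<and> set vs \<subseteq> vcarrier (euclid_vs dm))"
  then show "Wf \<omega> vs = 0" using alt_out[OF \<omega>, of "map cs vs"] by (auto simp: Wf_def)
next
  fix us ws x y a b
  assume h: "length us + length ws + 1 = k \<and> set us \<union> set ws \<union> {x, y} \<subseteq> vcarrier (euclid_vs dm)"
  then have R: "set us \<subseteq> Rn dm" "set ws \<subseteq> Rn dm" "x \<in> Rn dm" "y \<in> Rn dm" by auto
  have "\<omega> (map cs us @ vadd QL (vscale QL a (cs x)) (vscale QL b (cs y)) # map cs ws) =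
      a * \<omega> (map cs us @ cs x # map cs ws) + b * \<omega> (map cs us @ cs y # map cs ws)"
    by (rule alternating_lin[OF \<omega>]) (use h R map_cs_carrier QL_carrier in auto)
  then show "Wf \<omega> (us @ vadd (euclid_vs dm) (vscale (euclid_vs dm) a x) (vscale (euclid_vs dm) b y) # ws) =
      a * Wf \<omega> (us @ x # ws) + b * Wf \<omega> (us @ y # ws)"
    using R Rn_lin[OF R(3,4)] by (simp add: Wf_def QL_lin)
next
  fix vs assume h: "set vs \<subseteq> vcarrier (euclid_vs dm) \<and> \<not> distinct vs"
  then have "\<not> distinct (map cs vs)" by (auto simp: distinct_map)
  then show "Wf \<omega> vs = 0" using alt_dist[OF \<omega> map_cs_carrier] h by (simp add: Wf_def)
qed

subsection \<open>Plots of the quotient\<close>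

text \<open>Plots P of G are replaced by their pointwise inverses p, so that the ambiguity in the lift of a plot of G/H
  is a left translation by a plot of H, and the left Maurer--Cartan form can be used.\<close>

definition lift :: "nat \<Rightarrow> vec set \<Rightarrow> (vec \<Rightarrow> 'a set) \<Rightarrow> vec \<Rightarrow> vec set \<Rightarrow> (vec \<Rightarrow> 'a) \<Rightarrow> bool" where
  "lift m V Q x U p \<longleftrightarrow> sm m U p \<and> x \<in> U \<and> U \<subseteq> V \<and> (\<forall>u\<in>U. Q u = \<iota> (p u) <# H)"

lemma manifold_plot: "(m, U, P) \<in> manifold_diffeology M \<longleftrightarrow> sm m U P \<and> P \<in> extensional U"
  by (auto simp: manifold_diffeology_def sm_def)

lemma D_iff:
  "(m, V, Q) \<in> D \<longleftrightarrow> eopen m V \<and> Q \<in> V \<rightarrow>\<^sub>E lcosets H \<and> (\<forall>x\<in>V. \<exists>U p. lift m V Q x U p)"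
proof -
  have "(\<exists>U P. x \<in> U \<and> U \<subseteq> V \<and> (m, U, P) \<in> manifold_diffeology M \<and> (\<forall>u\<in>U. P u <# H = Q u)) \<longleftrightarrow>
      (\<exists>U p. lift m V Q x U p)" for x
  proof
    assume "\<exists>U P. x \<in> U \<and> U \<subseteq> V \<and> (m, U, P) \<in> manifold_diffeology M \<and> (\<forall>u\<in>U. P u <# H = Q u)"
    then obtain U P where h: "x \<in> U" "U \<subseteq> V" "sm m U P" "\<forall>u\<in>U. P u <# H = Q u"
      unfolding manifold_plot by blast
    have "lift m V Q x U (\<lambda>u. \<iota> (P u))"
      unfolding lift_def using h sm_inv[OF h(3)] sm_carrier[OF h(3)] by simp
    then show "\<exists>U p. lift m V Q x U p" by blast
  next
    assume "\<exists>U p. lift m V Q x U p"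
    then obtain U p where h: "x \<in> U" "U \<subseteq> V" "sm m U p" "\<forall>u\<in>U. Q u = \<iota> (p u) <# H"
      unfolding lift_def by blast
    have "sm m U (restrict (\<lambda>u. \<iota> (p u)) U)" by (rule sm_cong[OF sm_inv[OF h(3)]]) simp
    then show "\<exists>U P. x \<in> U \<and> U \<subseteq> V \<and> (m, U, P) \<in> manifold_diffeology M \<and> (\<forall>u\<in>U. P u <# H = Q u)"
      using h by (intro exI[of _ U] exI[of _ "restrict (\<lambda>u. \<iota> (p u)) U"]) (simp add: manifold_plot)
  qed
  then show ?thesis by (simp add: coset_diffeology_def quotient_diffeology_def)
qed

text \<open>The effect of passing to inverses: the ambiguity sits on the left, as g = h k with h in
  \<open>H\<close>. A constant h is then invisible to \<open>mc\<close> by \<open>mc_lmult\<close>,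
  and a varying one is controlled by \<open>mc_mult\<close>.\<close>

lemma lcos_eq:
  assumes g: "g \<in> carrier G" and k: "k \<in> carrier G"
  shows "\<iota> g <# H = \<iota> k <# H \<longleftrightarrow> g \<otimes> \<iota> k \<in> H"
proof
  assume eq: "\<iota> g <# H = \<iota> k <# H"
  have "\<iota> k \<in> \<iota> k <# H" using subgroup.one_closed[OF HS] k by (force simp: l_coset_def)
  then obtain h where h: "h \<in> H" "\<iota> k = \<iota> g \<otimes> h" using eq by (auto simp: l_coset_def)
  have "h \<in> carrier G" using subgroup.subset[OF HS] h(1) by blast
  then have "g \<otimes> \<iota> k = h" using g by (simp add: h(2) m_assoc[symmetric])
  then show "g \<otimes> \<iota> k \<in> H" using h(1) by simp
next
  assume h: "g \<otimes> \<iota> k \<in> H"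
  have "\<iota> k = \<iota> g \<otimes> (g \<otimes> \<iota> k)" using g k by (simp add: m_assoc[symmetric])
  then have "\<iota> k <# H = \<iota> g <# ((g \<otimes> \<iota> k) <# H)"
    using lcos_m_assoc[OF subgroup.subset[OF HS], of "\<iota> g" "g \<otimes> \<iota> k"] g k by simp
  also have "(g \<otimes> \<iota> k) <# H = H" by (rule coset_join3) (use g k HS h in auto)
  finally show "\<iota> g <# H = \<iota> k <# H" by simp
qed

text \<open>Two lifts differ by a plot of H, whose Maurer--Cartan form takes values in the ideal.\<close>

lemma lift_unique:
  assumes "lift m V Q x U p" "lift m V' Q x U' p'"
  shows "cs (mc m p x v) = cs (mc m p' x v)"
proof -
  have p: "sm m U p" "x \<in> U" "\<forall>u\<in>U. Q u = \<iota> (p u) <# H"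
    and p': "sm m U' p'" "x \<in> U'" "\<forall>u\<in>U'. Q u = \<iota> (p' u) <# H" using assms by (auto simp: lift_def)
  let ?A = "U \<inter> U'"
  have A: "eopen m ?A" by (intro eopen_Int sm_eopen[OF p(1)] sm_eopen[OF p'(1)])
  have sp: "sm m ?A p" "sm m ?A p'" using sm_subset[OF p(1) A] sm_subset[OF p'(1) A] by auto
  have xA: "x \<in> ?A" using p p' by blast
  let ?h = "\<lambda>u. p u \<otimes> \<iota> (p' u)"
  have sh: "sm m ?A ?h" by (rule sm_mult[OF sp(1) sm_inv[OF sp(2)]])
  have hH: "?h u \<in> H" if u: "u \<in> ?A" for u
    using lcos_eq[OF sm_carrier[OF sp(1) u] sm_carrier[OF sp(2) u]] p(3) p'(3) u by auto
  \<comment> \<open>The vector \<open>v\<close> may have entries at indices from \<open>m\<close>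
    on, on which the form does not depend; \<open>h0I\<close> wants a vector of
    \<open>Rn m\<close>.\<close>
  obtain w where w: "w \<in> Rn m" "\<And>q. mc m q x v = mc m q x w"
  proof
    show "pr1 m v \<in> Rn m" by (simp add: pr1_def Rn_iff)
    show "mc m q x v = mc m q x (pr1 m v)" for q
      by (auto simp: mc_def jacobian_def dir_deriv_def pr1_def fun_eq_iff intro!: sum.cong)
  qed
  have "mc m p x w = mc m (\<lambda>u. ?h u \<otimes> p' u) x w"
    by (rule mc_cong[OF sp(1) xA])
      (use sm_carrier[OF sp(1)] sm_carrier[OF sp(2)] in \<open>simp add: m_assoc\<close>)
  also have "\<dots> = (\<lambda>i. Adi (p' x) (mc m ?h x w) i + mc m p' x w i)"
    by (rule mc_mult[OF sh sp(2) xA])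
  finally have "(\<lambda>i. mc m p x w i - mc m p' x w i) = Adi (p' x) (mc m ?h x w)" by (simp add: fun_eq_iff)
  also have "\<dots> \<in> h0 H"
    by (rule h0_Adi_dense[OF HS HD h0I[OF HS sh hH xA w(1)] sm_carrier[OF sp(2) xA]])
  finally show ?thesis unfolding w(2) using cs_eq[OF mc_Rn mc_Rn] by blast
qed

text \<open>The plot of the coset space that has \<open>p\<close> as a lift on all of
  \<open>U\<close>, with the pointwise inverse as in \<open>lift\<close>.\<close>

definition cq :: "nat \<Rightarrow> vec set \<Rightarrow> (vec \<Rightarrow> 'a) \<Rightarrow> 'a set plot" where
  "cq m U p = (m, U, restrict (\<lambda>x. \<iota> (p x) <# H) U)"

lemma cq_lift: "sm m U p \<Longrightarrow> x \<in> U \<Longrightarrow> lift m U (restrict (\<lambda>x. \<iota> (p x) <# H) U) x U p"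
  by (simp add: lift_def)

lemma cq_D:
  assumes p: "sm m U p"
  shows "cq m U p \<in> D"
  unfolding cq_def D_iff
proof (intro conjI ballI sm_eopen[OF p])
  have "\<iota> (p x) <# H \<in> lcosets H" if "x \<in> U" for x
    using inv_closed[OF sm_carrier[OF p that]] unfolding LCOSETS_def by blast
  then show "restrict (\<lambda>x. \<iota> (p x) <# H) U \<in> U \<rightarrow>\<^sub>E lcosets H" by simp
  fix x assume "x \<in> U"
  from cq_lift[OF p this] show "\<exists>B q. lift m U (restrict (\<lambda>x. \<iota> (p x) <# H) U) x B q"
    by (intro exI)
qed

lemma cq_cong: "(\<And>x. x \<in> U \<Longrightarrow> p x = q x) \<Longrightarrow> cq m U p = cq m U q"
  unfolding cq_def by (metis (mono_tags, lifting) restrict_ext)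

text \<open>(h p)^{-1} H = p^{-1} h^{-1} H = p^{-1} H.\<close>

lemma cq_subgroup:
  assumes h: "\<And>x. x \<in> U \<Longrightarrow> h x \<in> H" and p: "sm m U p"
  shows "cq m U (\<lambda>x. h x \<otimes> p x) = cq m U p"
proof -
  have "\<iota> (h x \<otimes> p x) <# H = \<iota> (p x) <# H" if x: "x \<in> U" for x
  proof -
    have c: "h x \<in> carrier G" "p x \<in> carrier G" using h[OF x] subgroup.subset[OF HS] sm_carrier[OF p x] by auto
    then show ?thesis using lcos_eq[of "h x \<otimes> p x" "p x"] h[OF x] by (simp add: m_assoc)
  qed
  then show ?thesis unfolding cq_def by (metis (mono_tags, lifting) restrict_ext)
qed

lemma cq_compose: "\<Phi> ` U \<subseteq> V \<Longrightarrow> (m, U, restrict (restrict (\<lambda>x. \<iota> (p x) <# H) V \<circ> \<Phi>) U) = cq m U (\<lambda>x. p (\<Phi> x))"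
  by (auto simp: cq_def restrict_def fun_eq_iff)

lemma lift_restrict: "lift m V Q x U p \<Longrightarrow> (m, U, restrict (Q \<circ> (\<lambda>y. y)) U) = cq m U p"
  by (auto simp: lift_def cq_def restrict_def fun_eq_iff)

subsection \<open>Forms on the Lie algebra quotient define forms on the coset space\<close>

definition lf :: "'a set plot \<Rightarrow> vec \<Rightarrow> vec \<Rightarrow> 'a" where
  "lf = (\<lambda>(m, V, Q) x. SOME p. \<exists>U. lift m V Q x U p)"

text \<open>At each point a lift near this point is chosen; by \<open>lift_unique\<close> the class
  of its Maurer--Cartan form modulo the ideal does not depend on the choice.\<close>

definition Psi :: "'a vfield set form \<Rightarrow> 'a set plot \<Rightarrow> dform" where
  "Psi \<omega> = (\<lambda>(m, V, Q) x vs. if (m, V, Q) \<in> D \<and> x \<in> V \<and> set vs \<subseteq> Rn m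
     then \<omega> (map (\<lambda>v. cs (mc m (lf (m, V, Q) x) x v)) vs) else 0)"

text \<open>One lift computes the form at all points of its domain, which is what allows
  differentiation although \<open>lf\<close> chooses point by point.\<close>

lemma Psi_lift:
  assumes q: "(m, V, Q) \<in> D" and l: "lift m V Q x U p" and y: "y \<in> U" and vs: "set vs \<subseteq> Rn m"
  shows "Psi \<omega> (m, V, Q) y vs = Wf \<omega> (map (mc m p y) vs)"
proof -
  have l': "lift m V Q y U p" using l y by (auto simp: lift_def)
  have yV: "y \<in> V" using l y by (auto simp: lift_def)
  have "\<exists>p U. lift m V Q y U p" using l' by (intro exI)
  from someI_ex[OF this] have "\<exists>U. lift m V Q y U (lf (m, V, Q) y)" by (simp add: lf_def)
  then obtain U' where "lift m V Q y U' (lf (m, V, Q) y)" by blast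
  then have "cs (mc m (lf (m, V, Q) y) y v) = cs (mc m p y v)" for v by (rule lift_unique[OF _ l'])
  then have e: "map (\<lambda>v. cs (mc m (lf (m, V, Q) y) y v)) vs = map cs (map (mc m p y) vs)" by simp
  have "set (map (mc m p y) vs) \<subseteq> Rn dm" using mc_Rn by auto
  then show ?thesis using q yV vs unfolding Psi_def Wf_def prod.case e by simp
qed

lemma Psi_cq: "sm m U p \<Longrightarrow> x \<in> U \<Longrightarrow> set vs \<subseteq> Rn m \<Longrightarrow> Psi \<omega> (cq m U p) x vs = Wf \<omega> (map (mc m p x) vs)"
  using Psi_lift[OF _ cq_lift] cq_D unfolding cq_def by blast

lemma Psi_out: "\<not> ((m, V, Q) \<in> D \<and> x \<in> V \<and> set vs \<subseteq> Rn m) \<Longrightarrow> Psi \<omega> (m, V, Q) x vs = 0"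
  by (auto simp: Psi_def)

lemma Psi_form:
  assumes \<omega>: "alternating_form QL k \<omega>"
  shows "diffeological_form D k (Psi \<omega>)"
  unfolding diffeological_form_def
proof (intro conjI allI impI ballI)
  show "Psi \<omega> p = (\<lambda>x vs. 0)" if "p \<notin> D" for p
    using that by (cases p) (auto simp: Psi_def)
next
  note W = Wf_alt[OF \<omega>]
  fix q assume q: "q \<in> D"
  obtain n V Q where nvq: "q = (n, V, Q)" by (cases q)
  then have qD: "(n, V, Q) \<in> D" using q by simp
  then have V: "eopen n V" and L: "\<And>x. x \<in> V \<Longrightarrow> \<exists>U p. lift n V Q x U p" unfolding D_iff by auto
  have "smooth_form n V k (Psi \<omega> (n, V, Q))"
    unfolding smooth_form_def
  proof (intro conjI ballI allI impI)
    fix x assume x: "x \<in> V"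
    obtain U p where l: "lift n V Q x U p" using L[OF x] by blast
    then have xU: "x \<in> U" by (simp add: lift_def)
    show "alt n k (Psi \<omega> (n, V, Q) x)"
      unfolding alternating_form_def
    proof (intro conjI allI impI)
      fix vs assume "\<not> (length vs = k \<and> set vs \<subseteq> vcarrier (euclid_vs n))"
      then have "length vs \<noteq> k" if "set vs \<subseteq> Rn n" using that by simp
      then show "Psi \<omega> (n, V, Q) x vs = 0"
        using Psi_lift[OF qD l xU, of vs \<omega>] alt_out[OF W, of "map (mc n p x) vs"] Psi_out[of n V Q x vs \<omega>]
        by (cases "set vs \<subseteq> Rn n") simp_all
    next
      fix us ws z w a b
      assume "length us + length ws + 1 = k \<and> set us \<union> set ws \<union> {z, w} \<subseteq> vcarrier (euclid_vs n)"
      then have R: "set us \<subseteq> Rn n" "set ws \<subseteq> Rn n" "z \<in> Rn n" "w \<in> Rn n" by auto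
      have e: "Psi \<omega> (n, V, Q) x (us @ u # ws) = Wf \<omega> (map (mc n p x) us @ mc n p x u # map (mc n p x) ws)"
        if "u \<in> Rn n" for u using Psi_lift[OF qD l xU, of "us @ u # ws" \<omega>] R that by simp
      show "Psi \<omega> (n, V, Q) x (us @ vadd (euclid_vs n) (vscale (euclid_vs n) a z) (vscale (euclid_vs n) b w) # ws) =
        a * Psi \<omega> (n, V, Q) x (us @ z # ws) + b * Psi \<omega> (n, V, Q) x (us @ w # ws)"
        using alt_lin[OF W mc_Rn mc_Rn] by (simp add: e[OF R(3)] e[OF R(4)] e[OF Rn_lin[OF R(3,4)]] mc_lin)
    next
      fix vs assume h: "set vs \<subseteq> vcarrier (euclid_vs n) \<and> \<not> distinct vs"
      then have "\<not> distinct (map (mc n p x) vs)" by (auto simp: distinct_map)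
      moreover have "set (map (mc n p x) vs) \<subseteq> vcarrier (euclid_vs dm)" using mc_Rn by auto
      ultimately have "Wf \<omega> (map (mc n p x) vs) = 0" using alt_dist[OF W] by blast
      then show "Psi \<omega> (n, V, Q) x vs = 0" using Psi_lift[OF qD l xU] h by simp
    qed
  next
    show "Psi \<omega> (n, V, Q) x = (\<lambda>vs. 0)" if "x \<notin> V" for x using that by (auto simp: Psi_def)
  next
    fix vs assume vs: "length vs = k \<and> set vs \<subseteq> Rn n"
    show "smooth_fun_on n V (\<lambda>x. Psi \<omega> (n, V, Q) x vs)"
    proof (rule smooth_local[OF V])
      fix x assume x: "x \<in> V"
      obtain U p where l: "lift n V Q x U p" using L[OF x] by blast
      then have p: "sm n U p" "x \<in> U" by (simp_all add: lift_def)
      note U = sm_eopen[OF p(1)]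
      have "smooth_fun_on n U (\<lambda>y. Wf \<omega> ([] @ map (\<lambda>\<zeta>. \<zeta> y) (map (\<lambda>v y. mc n p y v) vs)))"
        by (rule alt_smooth[OF W U]) (use mc_Rn smooth_mc[OF p(1)] in auto)
      then have "smooth_fun_on n U (\<lambda>x. Psi \<omega> (n, V, Q) x vs)"
        by (rule smooth_cong[OF U, THEN iffD1, rotated]) (use Psi_lift[OF qD l] vs in \<open>simp add: comp_def\<close>)
      then show "\<exists>A. x \<in> A \<and> eopen n A \<and> smooth_fun_on n A (\<lambda>x. Psi \<omega> (n, V, Q) x vs)" using p U by blast
    qed
  qed
  then show "case q of (n, V, Q) \<Rightarrow> smooth_form n V k (Psi \<omega> (n, V, Q))" using nvq by simp
  have "Psi \<omega> (m, U, restrict (Q \<circ> \<Phi>) U) = pullback_form m U n \<Phi> (Psi \<omega> (n, V, Q))"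
    if U: "eopen m U" and \<Phi>: "smooth_vec_on m U n \<Phi>" "\<Phi> ` U \<subseteq> V" for m U \<Phi>
  proof -
    \<comment> \<open>Lifts of the composed plot arise by composing lifts with \<Phi>;
      \<open>mc_compose\<close> then gives the compatibility with pullback.\<close>
    have lf: "\<exists>A. lift m U (restrict (Q \<circ> \<Phi>) U) x A (\<lambda>y. p (\<Phi> y)) \<and> sm m A (\<lambda>y. p (\<Phi> y)) \<and> A \<subseteq> U \<and> x \<in> A \<and> \<Phi> ` A \<subseteq> B"
      if l: "lift n V Q (\<Phi> x) B p" and x: "x \<in> U" for x B p
    proof -
      have p: "sm n B p" "\<Phi> x \<in> B" "\<forall>u\<in>B. Q u = \<iota> (p u) <# H" using l by (auto simp: lift_def)
      let ?A = "{y \<in> U. \<Phi> y \<in> B}"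
      have A: "eopen m ?A" by (rule eopen_vimage[OF U sm_eopen[OF p(1)] \<Phi>(1)])
      have "sm m ?A (\<lambda>y. p (\<Phi> y))"
        by (rule sm_compose[OF p(1) A smooth_vec_on_subset[OF _ \<Phi>(1)]]) auto
      then show ?thesis using p x by (intro exI[of _ ?A]) (auto simp: lift_def)
    qed
    have qD': "(m, U, restrict (Q \<circ> \<Phi>) U) \<in> D"
      unfolding D_iff
    proof (intro conjI U ballI)
      show "restrict (Q \<circ> \<Phi>) U \<in> U \<rightarrow>\<^sub>E lcosets H" using qD \<Phi>(2) unfolding D_iff by (auto simp: PiE_iff)
      show "\<exists>A p. lift m U (restrict (Q \<circ> \<Phi>) U) x A p" if x: "x \<in> U" for x
        using L[of "\<Phi> x"] lf[OF _ x] \<Phi>(2) x by blast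
    qed
    show ?thesis
    proof (intro ext)
      fix x vs
      show "Psi \<omega> (m, U, restrict (Q \<circ> \<Phi>) U) x vs = pullback_form m U n \<Phi> (Psi \<omega> (n, V, Q)) x vs"
      proof (cases "x \<in> U \<and> set vs \<subseteq> Rn m")
        case True
        then have x: "x \<in> U" and vs: "set vs \<subseteq> Rn m" by auto
        obtain B p where l: "lift n V Q (\<Phi> x) B p" using L \<Phi>(2) x by blast
        obtain A where A: "lift m U (restrict (Q \<circ> \<Phi>) U) x A (\<lambda>y. p (\<Phi> y))" "sm m A (\<lambda>y. p (\<Phi> y))" "A \<subseteq> U" "x \<in> A" "\<Phi> ` A \<subseteq> B"
          using lf[OF l x] by blast
        have p: "sm n B p" "\<Phi> x \<in> B" using l by (auto simp: lift_def)
        have js: "set (map (jacobian m n \<Phi> x) vs) \<subseteq> Rn n" using jacobian_Rn by auto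
        have e: "map (mc m (\<lambda>y. p (\<Phi> y)) x) vs = map (mc n p (\<Phi> x)) (map (jacobian m n \<Phi> x) vs)"
          using mc_compose[OF p(1) sm_eopen[OF A(2)] smooth_vec_on_subset[OF A(3) \<Phi>(1)] A(5) A(4)] by simp
        show ?thesis
          unfolding Psi_lift[OF qD' A(1) A(4) vs] pullback_form_def Psi_lift[OF qD l p(2) js] e using True by simp
      next
        case False
        then show ?thesis by (auto simp: pullback_form_def Psi_def)
      qed
    qed
  qed
  then show "case q of (n, V, Q) \<Rightarrow> \<forall>m U \<Phi>. eopen m U \<and> smooth_vec_on m U n \<Phi> \<and> \<Phi> ` U \<subseteq> V \<longrightarrow>
      Psi \<omega> (m, U, restrict (Q \<circ> \<Phi>) U) = pullback_form m U n \<Phi> (Psi \<omega> (n, V, Q))"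
    using nvq by simp
qed

text \<open>At the unit, the Maurer--Cartan form of the chart parametrisation \<psi>0 is the
  identity, so \<omega> can be read off from this single plot and point. Injectivity of
  \<open>Psi\<close> follows.\<close>

lemma Psi_base: "set vs \<subseteq> Rn dm \<Longrightarrow> Psi \<omega> (cq dm V0 \<psi>0) e0 vs = \<omega> (map cs vs)"
proof -
  assume vs: "set vs \<subseteq> Rn dm"
  then have "map (mc dm \<psi>0 e0) vs = vs" using mc_\<psi>0 by (intro map_idI) auto
  then show ?thesis using Psi_cq[OF \<psi>0(1) V0(2) vs] vs by (simp add: Wf_def)
qed

lemma ex_reps: "set As \<subseteq> vcarrier QL \<Longrightarrow> \<exists>vs. set vs \<subseteq> Rn dm \<and> As = map cs vs"
proof (induction As)
  case (Cons A As)
  then obtain vs z where "set vs \<subseteq> Rn dm" "As = map cs vs" "z \<in> Rn dm" "A = cs z" by (auto simp: QL_carrier)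
  then show ?case by (intro exI[of _ "z # vs"]) simp
qed simp

lemma Psi_inj:
  assumes \<omega>: "alternating_form QL k \<omega>" and \<eta>: "alternating_form QL k \<eta>" and eq: "Psi \<omega> = Psi \<eta>"
  shows "\<omega> = \<eta>"
proof
  fix As
  show "\<omega> As = \<eta> As"
  proof (cases "set As \<subseteq> vcarrier QL")
    case True
    then obtain vs where "set vs \<subseteq> Rn dm" "As = map cs vs" using ex_reps by blast
    then show ?thesis using Psi_base[of vs \<omega>] Psi_base[of vs \<eta>] eq by simp
  next
    case False
    then show ?thesis using alt_out[OF \<omega>] alt_out[OF \<eta>] by simp
  qed
qed

subsection \<open>Every form on the coset space arises\<close>

context
  fixes k \<beta> assumes \<beta>: "diffeological_form D k \<beta>"
begin

lemma form_smooth: "(m, V, Q) \<in> D \<Longrightarrow> smooth_form m V k (\<beta> (m, V, Q))"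
  using \<beta> unfolding diffeological_form_def by fast

lemma form_pullback:
  assumes "(n, V, Q) \<in> D" "eopen m U" "smooth_vec_on m U n \<Phi>" "\<Phi> ` U \<subseteq> V"
  shows "\<beta> (m, U, restrict (Q \<circ> \<Phi>) U) = pullback_form m U n \<Phi> (\<beta> (n, V, Q))"
  using \<beta> assms unfolding diffeological_form_def by fast

lemma form_pullback_cq:
  assumes p: "sm n V p" and "eopen m U" "smooth_vec_on m U n \<Phi>" "\<Phi> ` U \<subseteq> V"
  shows "\<beta> (cq m U (\<lambda>x. p (\<Phi> x))) = pullback_form m U n \<Phi> (\<beta> (cq n V p))"
  using form_pullback[OF _ assms(2-4), of "restrict (\<lambda>x. \<iota> (p x) <# H) V"] cq_D[OF p]
    cq_compose[OF assms(4), of m p] by (simp add: cq_def)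

lemma form_restrict:
  assumes q: "(m, V, Q) \<in> D" and l: "lift m V Q x U p" and vs: "set vs \<subseteq> Rn m"
  shows "\<beta> (m, V, Q) x vs = \<beta> (cq m U p) x vs"
proof -
  have U: "eopen m U" "x \<in> U" "U \<subseteq> V" using l sm_eopen by (auto simp: lift_def)
  have "\<beta> (cq m U p) = pullback_form m U m (\<lambda>y. y) (\<beta> (m, V, Q))"
    using form_pullback[OF q U(1) smooth_vec_id[OF U(1)]] U(3) lift_restrict[OF l] by simp
  moreover have "map (jacobian m m (\<lambda>y. y) x) vs = vs" using vs jacobian_id by (intro map_idI) auto
  ultimately show ?thesis using U vs by (simp add: pullback_form_def)
qed

text \<open>The values on the translated plots are compared through one plot that contains the
  translating element as a parameter: its coefficients are continuous in that parameter, and for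
  elements of \<open>H\<close> the translated plot of the coset space is literally the original
  one.\<close>

lemma form_translate:
  assumes p: "sm m U p" and x: "x \<in> U" and vs: "set vs \<subseteq> Rn m" and g: "g \<in> carrier G"
  shows "\<beta> (cq m U (\<lambda>y. g \<otimes> p y)) x vs = \<beta> (cq m U p) x vs"
proof (rule ccontr)
  assume ne: "\<not> ?thesis"
  define c where "c = \<beta> (cq m U p) x vs"
  obtain W \<psi> where ch: "(W, \<psi>) \<in> charts M" "g \<in> W" by (rule chart_at) (use g top_carrier in auto)
  note s = sm_chart_inv[OF ch(1)] and U = sm_eopen[OF p]
  have A: "eopen dm (\<psi> ` W)" by (rule chart(2)[OF ch(1)])
  let ?r = "\<lambda>w. inv_into W \<psi> (pr1 dm w) \<otimes> p (pr2 dm w)" and ?B = "prodset dm m (\<psi> ` W) U"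
  have r: "sm (dm + m) ?B ?r" by (rule sm_prod[OF s p])
  \<comment> \<open>The arguments \<open>va dm z0 v\<close> are tangent to the slice on which the
    group parameter is fixed, so \<open>F a\<close> is the value on the plot translated by the point
    with coordinates \<open>a\<close>.\<close>
  define F where "F a = \<beta> (cq (dm + m) ?B ?r) (va dm a x) (map (va dm z0) vs)" for a
  have B: "eopen (dm + m) ?B" by (rule sm_eopen[OF r])
  have inB: "va dm a y \<in> ?B" if "a \<in> \<psi> ` W" "y \<in> U" for a y
    by (rule va_prodset[OF eopen_subset[OF A] eopen_subset[OF U] that])
  have sb: "smooth_form (dm + m) ?B k (\<beta> (cq (dm + m) ?B ?r))"
    using form_smooth cq_D[OF r] unfolding cq_def by blast
  have xR: "x \<in> Rn m" using x eopen_subset[OF U] by blast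
  have sF: "smooth_fun_on dm (\<psi> ` W) F"
    unfolding F_def
    by (rule smooth_compose[OF A B smooth_va[OF smooth_vec_id[OF A] smooth_vec_const[OF A xR]] _ smooth_formD(3)[OF sb B]])
      (use inB x in blast)
  have F: "F a = \<beta> (cq m U (\<lambda>y. inv_into W \<psi> a \<otimes> p y)) x vs" if a: "a \<in> \<psi> ` W" for a
  proof -
    have aR: "a \<in> Rn dm" using a eopen_subset[OF A] by blast
    have sv: "smooth_vec_on m U (dm + m) (\<lambda>y. va dm a y)"
      by (rule smooth_va[OF smooth_vec_const[OF U aR] smooth_vec_id[OF U]])
    have "\<beta> (cq m U (\<lambda>y. ?r (va dm a y))) = pullback_form m U (dm + m) (\<lambda>y. va dm a y) (\<beta> (cq (dm + m) ?B ?r))"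
      by (rule form_pullback_cq[OF r U sv]) (use inB a in blast)
    then have pb: "\<beta> (cq m U (\<lambda>y. inv_into W \<psi> a \<otimes> p y)) =
        pullback_form m U (dm + m) (\<lambda>y. va dm a y) (\<beta> (cq (dm + m) ?B ?r))"
      unfolding pr1_va[OF aR] pr2_va .
    have "jacobian m (dm + m) (\<lambda>y. va dm a y) x v = va dm z0 v" if "v \<in> Rn m" for v
      unfolding jacobian_va jacobian_const jacobian_id[OF that] z0_def ..
    then have e: "map (jacobian m (dm + m) (\<lambda>y. va dm a y) x) vs = map (va dm z0) vs"
      using vs by (intro map_cong) auto
    show ?thesis unfolding F_def pb pullback_form_def e using x vs by simp
  qed
  define V where "V = {a \<in> \<psi> ` W. F a \<in> - {c}}"
  have V: "eopen dm V" unfolding V_def by (rule eopen_vimage_real[OF A smooth_continuous[OF sF]]) auto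
  have O: "openin (mtop M) {q \<in> W. \<psi> q \<in> V}" by (rule chart_open[OF ch(1) V]) (auto simp: V_def)
  have "F (\<psi> g) \<noteq> c" using ne F[of "\<psi> g"] ch by (simp add: c_def chart(6)[OF ch(1)])
  then have "g \<in> {q \<in> W. \<psi> q \<in> V}" using ch by (simp add: V_def)
  moreover have "g \<in> mtop M closure_of H" using HD g top_carrier by simp
  ultimately have "\<exists>h. h \<in> H \<and> h \<in> {q \<in> W. \<psi> q \<in> V}"
    using O unfolding in_closure_of by (elim conjE allE[of _ "{q \<in> W. \<psi> q \<in> V}"]) auto
  then obtain h where h: "h \<in> H" "h \<in> W" "\<psi> h \<in> V" by blast
  have "F (\<psi> h) = \<beta> (cq m U (\<lambda>y. h \<otimes> p y)) x vs" using F[of "\<psi> h"] h(2) by (simp add: chart(6)[OF ch(1)])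
  also have "\<dots> = c" using cq_subgroup[OF _ p, of "\<lambda>y. h"] h(1) by (simp add: c_def)
  finally show False using h(3) by (simp add: V_def)
qed

definition base where "base = \<beta> (cq dm V0 \<psi>0) e0"

lemma base_alt: "alt dm k base"
  unfolding base_def
  using smooth_formD(1)[OF form_smooth V0(2)] cq_D[OF \<psi>0(1)] unfolding cq_def by blast

text \<open>A left translation takes \<open>p x\<close> to the unit; near \<open>x\<close> the
  translated plot factors through \<psi>0, and the Jacobian of the factor is \<open>mc m p x\<close>
  by definition.\<close>

lemma form_base:
  assumes p: "sm m U p" and x: "x \<in> U" and vs: "set vs \<subseteq> Rn m"
  shows "\<beta> (cq m U p) x vs = base (map (mc m p x) vs)"
proof -
  have px: "p x \<in> carrier G" by (rule sm_carrier[OF p x])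
  let ?q = "\<lambda>y. \<iota> (p x) \<otimes> p y"
  have q: "sm m U ?q" by (rule sm_lmult[OF p]) (simp add: px)
  let ?A = "{y \<in> U. ?q y \<in> W0}" and ?\<Phi> = "\<lambda>y. \<phi>0 (?q y)"
  have A: "eopen m ?A" by (rule sm_open[OF q chart(1)[OF c0]])
  have xA: "x \<in> ?A" using x px one_W0 by simp
  have "\<beta> (cq m U p) x vs = \<beta> (cq m U ?q) x vs"
    using form_translate[OF p x vs inv_closed[OF px]] by simp
  also have "\<dots> = \<beta> (cq m ?A ?q) x vs"
  proof -
    have "lift m U (restrict (\<lambda>x. \<iota> (?q x) <# H) U) x ?A ?q"
      using xA sm_subset[OF q A] by (auto simp: lift_def)
    then show ?thesis using form_restrict[OF _ _ vs] cq_D[OF q] unfolding cq_def by blast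
  qed
  also have "cq m ?A ?q = cq m ?A (\<lambda>y. \<psi>0 (?\<Phi> y))"
    by (rule cq_cong) (simp add: chart(6)[OF c0])
  also have "\<beta> \<dots> = pullback_form m ?A dm ?\<Phi> (\<beta> (cq dm V0 \<psi>0))"
    by (rule form_pullback_cq[OF \<psi>0(1) A sm_chart[OF q c0]]) auto
  finally have *: "\<beta> (cq m U p) x vs = pullback_form m ?A dm ?\<Phi> (\<beta> (cq dm V0 \<psi>0)) x vs" .
  have e: "?\<Phi> x = e0" using px by simp
  show ?thesis unfolding * pullback_form_def base_def mc_def[abs_def] e using xA vs by simp
qed

text \<open>For a curve c in H through the unit, the plots c(s) b and b, with b in a chart, have the same image in G/H.\<close>

lemma base_h0:
  assumes z: "z \<in> h0 H" and us: "set us \<subseteq> Rn dm" and ws: "set ws \<subseteq> Rn dm"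
  shows "base (us @ z # ws) = 0"
proof -
  obtain c \<epsilon> where c: "\<epsilon> > 0" "sm 1 (cube 1 z0 \<epsilon>) c" "\<forall>x\<in>cube 1 z0 \<epsilon>. c x \<in> H" "c z0 = \<one>" "mc 1 c z0 (unitv 0) = z"
    using z unfolding h0_def by blast
  let ?C = "cube 1 z0 \<epsilon>" and ?B = "prodset 1 dm (cube 1 z0 \<epsilon>) V0" and ?x = "va 1 z0 e0"
  let ?p = "\<lambda>w. \<psi>0 (pr2 1 w)" and ?r = "\<lambda>w. c (pr1 1 w) \<otimes> \<psi>0 (pr2 1 w)"
  have zR: "z \<in> Rn dm" using z h0_Rn by blast
  have zC: "z0 \<in> ?C" by (rule mem_cube_self[OF z0_Rn c(1)])
  have r: "sm (1 + dm) ?B ?r" by (rule sm_prod[OF c(2) \<psi>0(1)])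
  have B: "eopen (1 + dm) ?B" by (rule sm_eopen[OF r])
  have i2: "pr2 1 ` ?B \<subseteq> V0" by (auto simp: prodset_def)
  have p: "sm (1 + dm) ?B ?p" by (rule sm_compose[OF \<psi>0(1) B smooth_pr2[OF B] i2])
  have xB: "?x \<in> ?B" by (rule va_prodset[OF eopen_subset[OF eopen_cube] eopen_subset[OF V0(1)] zC V0(2)])
  have u: "unitv 0 \<in> Rn 1" by (rule unitv_Rn) simp
  \<comment> \<open>The slot of \<open>z\<close> holds the direction of the curve parameter: the
    form of \<open>?r\<close> maps it to \<open>z\<close>, that of \<open>?p\<close>, where the
    curve is absent, to 0.\<close>
  let ?L = "map (va 1 z0) us @ va 1 (unitv 0) z0 # map (va 1 z0) ws"
  have L: "set ?L \<subseteq> Rn (1 + dm)" using us ws va_Rn[of _ dm 1] z0_Rn by auto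
  have mr: "mc (1 + dm) ?r ?x (va 1 z0 v) = v" if "v \<in> Rn dm" for v
    using mc_pr[OF c(2) \<psi>0(1) zC V0(2) z0_Rn that] by (simp add: mc_zero Adi_zero mc_\<psi>0[OF that])
  have mru: "mc (1 + dm) ?r ?x (va 1 (unitv 0) z0) = z"
    using mc_pr[OF c(2) \<psi>0(1) zC V0(2) u z0_Rn] by (simp add: mc_zero c(5) \<psi>0(2) Adi_one[OF zR])
  have mp: "mc (1 + dm) ?p ?x (va 1 u' v) = mc dm \<psi>0 e0 v" if "u' \<in> Rn 1" "v \<in> Rn dm" for u' v
    unfolding mc_compose[OF \<psi>0(1) B smooth_pr2[OF B] i2 xB] jacobian_pr[OF that] pr2_va ..
  have "map (mc (1 + dm) ?r ?x) ?L = us @ z # ws"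
    using us ws mr mru by (auto intro!: map_idI)
  then have "base (us @ z # ws) = \<beta> (cq (1 + dm) ?B ?r) ?x ?L" using form_base[OF r xB L] by simp
  also have "cq (1 + dm) ?B ?r = cq (1 + dm) ?B ?p"
    by (rule cq_subgroup[OF _ p]) (use c(3) in \<open>auto simp: prodset_def\<close>)
  also have "\<beta> \<dots> ?x ?L = base (map (mc (1 + dm) ?p ?x) ?L)" by (rule form_base[OF p xB L])
  also have "map (mc (1 + dm) ?p ?x) ?L = map (mc (1 + dm) ?p ?x) (map (va 1 z0) us) @ z0 # map (mc (1 + dm) ?p ?x) (map (va 1 z0) ws)"
    using mp[OF u z0_Rn] by (simp add: mc_zero)
  also have "base \<dots> = 0" by (rule alt_zero[OF base_alt])
  finally show ?thesis .
qed

text \<open>The arguments are exchanged one at a time. Each exchange costs a term with an argument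
  in \<open>h0 H\<close>, which vanishes by \<open>base_h0\<close>; \<open>us\<close> collects the
  arguments already exchanged.\<close>

lemma base_cong:
  assumes "length vs = length ws" "set vs \<subseteq> Rn dm" "set ws \<subseteq> Rn dm" "map cs vs = map cs ws"
  shows "base vs = base ws"
proof -
  have "base (us @ vs) = base (us @ ws)" if "set us \<subseteq> Rn dm" for us
    using assms that
  proof (induction vs ws arbitrary: us rule: list_induct2)
    case (Cons v vs w ws)
    then have R: "v \<in> Rn dm" "w \<in> Rn dm" by auto
    have d: "(\<lambda>i. v i - w i) \<in> h0 H" using Cons.prems cs_eq[OF R] by simp
    have "base (us @ v # vs) = base (us @ (\<lambda>i. 1 * w i + 1 * (v i - w i)) # vs)" by simp
    also have "\<dots> = 1 * base (us @ w # vs) + 1 * base (us @ (\<lambda>i. v i - w i) # vs)"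
      by (rule alt_lin[OF base_alt R(2)]) (use d h0_Rn in blast)
    also have "base (us @ (\<lambda>i. v i - w i) # vs) = 0"
      by (rule base_h0[OF d]) (use Cons.prems in auto)
    finally have "base (us @ v # vs) = base (us @ w # vs)" by simp
    also have "\<dots> = base ((us @ [w]) @ ws)" using Cons.IH[of "us @ [w]"] Cons.prems by simp
    finally show ?case by simp
  qed simp
  from this[of "[]"] show ?thesis by simp
qed

lemma Psi_surj: "\<exists>\<omega>. alternating_form QL k \<omega> \<and> Psi \<omega> = \<beta>"
proof -
  define rep where "rep A = (SOME z. z \<in> Rn dm \<and> cs z = A)" for A
  have rep: "rep A \<in> Rn dm" "cs (rep A) = A" if "A \<in> vcarrier QL" for A
  proof -
    have "\<exists>z. z \<in> Rn dm \<and> cs z = A" using that by (auto simp: QL_carrier)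
    from someI_ex[OF this] show "rep A \<in> Rn dm" "cs (rep A) = A" by (auto simp: rep_def)
  qed
  have reps: "set (map rep As) \<subseteq> Rn dm" "map cs (map rep As) = As" if "set As \<subseteq> vcarrier QL" for As
    using that rep by (auto intro!: map_idI)
  \<comment> \<open>The form descends to the quotient through chosen representatives; by
    \<open>base_cong\<close> any other choice gives the same value.\<close>
  define \<omega> where "\<omega> As = (if set As \<subseteq> vcarrier QL then base (map rep As) else 0)" for As
  have \<omega>: "\<omega> (map cs vs) = base vs" if "set vs \<subseteq> Rn dm" for vs
  proof -
    have c: "set (map cs vs) \<subseteq> vcarrier QL" by (rule map_cs_carrier[OF that])
    have "base (map rep (map cs vs)) = base vs"
      by (rule base_cong) (use that reps[OF c] in auto)
    then show ?thesis using c by (simp add: \<omega>_def)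
  qed
  have a: "alternating_form QL k \<omega>"
    unfolding alternating_form_def
  proof (intro conjI allI impI)
    fix As assume "\<not> (length As = k \<and> set As \<subseteq> vcarrier QL)"
    then show "\<omega> As = 0" using alt_out[OF base_alt, of "map rep As"] by (auto simp: \<omega>_def)
  next
    fix As Bs A B a b
    assume h: "length As + length Bs + 1 = k \<and> set As \<union> set Bs \<union> {A, B} \<subseteq> vcarrier QL"
    then have R: "A \<in> vcarrier QL" "B \<in> vcarrier QL" and S: "set As \<subseteq> vcarrier QL" "set Bs \<subseteq> vcarrier QL" by auto
    let ?z = "rep A" and ?w = "rep B" and ?us = "map rep As" and ?ws = "map rep Bs"
    have e: "\<omega> (As @ cs v # Bs) = base (?us @ v # ?ws)" if "v \<in> Rn dm" for v
      using \<omega>[of "?us @ v # ?ws"] reps[OF S(1)] reps[OF S(2)] that by simp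
    have "vadd QL (vscale QL a A) (vscale QL b B) = cs (\<lambda>i. a * ?z i + b * ?w i)"
      using QL_lin[OF rep(1)[OF R(1)] rep(1)[OF R(2)]] rep(2)[OF R(1)] rep(2)[OF R(2)] by simp
    then have "\<omega> (As @ vadd QL (vscale QL a A) (vscale QL b B) # Bs) = base (?us @ (\<lambda>i. a * ?z i + b * ?w i) # ?ws)"
      using e[OF Rn_lin[OF rep(1)[OF R(1)] rep(1)[OF R(2)]]] by simp
    also have "\<dots> = a * base (?us @ ?z # ?ws) + b * base (?us @ ?w # ?ws)"
      by (rule alt_lin[OF base_alt rep(1)[OF R(1)] rep(1)[OF R(2)]])
    finally show "\<omega> (As @ vadd QL (vscale QL a A) (vscale QL b B) # Bs) = a * \<omega> (As @ A # Bs) + b * \<omega> (As @ B # Bs)"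
      using e[OF rep(1)[OF R(1)]] e[OF rep(1)[OF R(2)]] rep(2)[OF R(1)] rep(2)[OF R(2)] by simp
  next
    fix As assume h: "set As \<subseteq> vcarrier QL \<and> \<not> distinct As"
    then have "\<not> distinct (map rep As)" by (auto simp: distinct_map)
    then show "\<omega> As = 0" using alt_dist[OF base_alt, of "map rep As"] reps(1)[of As] h by (simp add: \<omega>_def)
  qed
  have "Psi \<omega> q x vs = \<beta> q x vs" for q x vs
  proof -
    obtain m V Q where q: "q = (m, V, Q)" by (cases q)
    show ?thesis
    proof (cases "(m, V, Q) \<in> D \<and> x \<in> V \<and> set vs \<subseteq> Rn m")
      case True
      then have D: "(m, V, Q) \<in> D" and x: "x \<in> V" and vs: "set vs \<subseteq> Rn m" by auto
      obtain U p where l: "lift m V Q x U p" using D x unfolding D_iff by blast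
      then have p: "sm m U p" "x \<in> U" by (auto simp: lift_def)
      have s: "set (map (mc m p x) vs) \<subseteq> Rn dm" using mc_Rn by auto
      have "Psi \<omega> q x vs = base (map (mc m p x) vs)"
        using Psi_lift[OF D l p(2) vs] \<omega>[OF s] s by (simp add: q Wf_def)
      also have "\<dots> = \<beta> q x vs" using form_base[OF p vs] form_restrict[OF D l vs] q by simp
      finally show ?thesis .
    next
      case False
      have "\<beta> q x vs = 0"
      proof (cases "q \<in> D")
        case True
        note s = smooth_formD[OF form_smooth[OF True[unfolded q]]]
        show ?thesis using False True s(2)[of x] alt_out[OF s(1)[of x], of vs] by (cases "x \<in> V") (auto simp: q)
      next
        case nD: False
        then show ?thesis using \<beta> unfolding diffeological_form_def by metis
      qed
      then show ?thesis using Psi_out[OF False] q by simp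
    qed
  qed
  then show ?thesis using a by (intro exI[of _ \<omega>] conjI ext)
qed

end

subsection \<open>The differentials correspond\<close>

lemma CE_d_cs:
  assumes "set vs \<subseteq> Rn dm"
  shows "CE_d QL \<omega> (map cs vs) = (\<Sum>(i, j)\<in>{(i, j). i < j \<and> j < length vs}.
    (- 1) ^ (i + j) * Wf \<omega> (br (vs ! i) (vs ! j) # rem i (rem j vs)))"
proof -
  have c: "set (map cs vs) \<subseteq> vcarrier QL" by (rule map_cs_carrier[OF assms])
  have "CE_d QL \<omega> (map cs vs) = (\<Sum>(i, j)\<in>{(i, j). i < j \<and> j < length vs}.
     (- 1) ^ (i + j) * \<omega> (lie_bracket QL (map cs vs ! i) (map cs vs ! j) # nths (map cs vs) (- {i, j})))"
    using c by (simp add: CE_d_def)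
  also have "\<dots> = (\<Sum>(i, j)\<in>{(i, j). i < j \<and> j < length vs}.
    (- 1) ^ (i + j) * Wf \<omega> (br (vs ! i) (vs ! j) # rem i (rem j vs)))"
  proof (rule sum.cong[OF refl], clarify)
    fix i j assume ij: "i < j" "j < length vs"
    have R: "vs ! i \<in> Rn dm" "vs ! j \<in> Rn dm" using ij assms by (auto simp: subset_iff)
    have s: "set (rem i (rem j vs)) \<subseteq> Rn dm" using set_rem[of i "rem j vs"] set_rem[of j vs] assms by blast
    have n: "nths (map cs vs) (- {i, j}) = map cs (rem i (rem j vs))"
      by (simp only: nths_all_but2[OF ij(1)] rem_map)
    have l: "lie_bracket QL (map cs vs ! i) (map cs vs ! j) = cs (br (vs ! i) (vs ! j))"
      using ij QL_bracket[OF R] by simp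
    show "(- 1) ^ (i + j) * \<omega> (lie_bracket QL (map cs vs ! i) (map cs vs ! j) # nths (map cs vs) (- {i, j})) =
        (- 1) ^ (i + j) * Wf \<omega> (br (vs ! i) (vs ! j) # rem i (rem j vs))"
      unfolding n l using s lie_br(1) by (simp add: Wf_def)
  qed
  finally show ?thesis .
qed

lemma CE_d_length:
  assumes \<omega>: "alternating_form QL k \<omega>" and l: "length As \<noteq> Suc k"
  shows "CE_d QL \<omega> As = 0"
proof (cases "set As \<subseteq> vcarrier QL")
  case True
  then obtain vs where vs: "set vs \<subseteq> Rn dm" "As = map cs vs" using ex_reps by blast
  have "Wf \<omega> (br (vs ! i) (vs ! j) # rem i (rem j vs)) = 0" if "i < j" "j < length vs" for i j
  proof (rule alt_out[OF Wf_alt[OF \<omega>]])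
    have "length (rem j vs) = length vs - 1" "length (rem i (rem j vs)) = length (rem j vs) - 1"
      using that by (simp_all add: length_rem)
    then show "\<not> (length (br (vs ! i) (vs ! j) # rem i (rem j vs)) = k \<and>
        set (br (vs ! i) (vs ! j) # rem i (rem j vs)) \<subseteq> vcarrier (euclid_vs dm))"
      using that l vs(2) by auto
  qed
  then show ?thesis unfolding vs(2) CE_d_cs[OF vs(1)] by (intro sum.neutral) auto
qed (auto simp: CE_d_def)

text \<open>Near \<open>x\<close> a lift turns \<open>Psi \<omega>\<close> into a constant
  alternating form applied to Maurer--Cartan forms, which \<open>ext_deriv_mc\<close>
  differentiates.\<close>

lemma ext_deriv_Psi:
  assumes \<omega>: "alternating_form QL k \<omega>" and q: "(m, V, Q) \<in> D"
  shows "ext_deriv m V (Psi \<omega> (m, V, Q)) x vs = Psi (CE_d QL \<omega>) (m, V, Q) x vs"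
proof (cases "x \<in> V \<and> set vs \<subseteq> Rn m")
  case True
  then have x: "x \<in> V" and vs: "set vs \<subseteq> Rn m" by auto
  have V: "eopen m V" using q by (simp add: D_iff)
  obtain U p where l: "lift m V Q x U p" using q x unfolding D_iff by blast
  then have p: "sm m U p" "x \<in> U" by (auto simp: lift_def)
  note W = Wf_alt[OF \<omega>]
  have s: "set (map (mc m p x) vs) \<subseteq> Rn dm" using mc_Rn by auto
  show ?thesis
  proof (cases "length vs = Suc k")
    case len: True
    have "ext_deriv m V (Psi \<omega> (m, V, Q)) x vs =
        (\<Sum>i<length vs. (- 1) ^ i * dir_deriv m (\<lambda>y. Wf \<omega> (map (mc m p y) (rem i vs))) x (vs ! i))"
      unfolding ext_deriv_rem[OF x vs]
    proof (rule sum.cong[OF refl])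
      fix i
      have "set (rem i vs) \<subseteq> Rn m" using set_rem[of i vs] vs by blast
      then have "dir_deriv m (\<lambda>y. Psi \<omega> (m, V, Q) y (rem i vs)) x (vs ! i) =
          dir_deriv m (\<lambda>y. Wf \<omega> (map (mc m p y) (rem i vs))) x (vs ! i)"
        by (intro dir_deriv_cong[OF sm_eopen[OF p(1)] p(2)]) (rule Psi_lift[OF q l])
      then show "(- 1) ^ i * dir_deriv m (\<lambda>y. Psi \<omega> (m, V, Q) y (rem i vs)) x (vs ! i) =
          (- 1) ^ i * dir_deriv m (\<lambda>y. Wf \<omega> (map (mc m p y) (rem i vs))) x (vs ! i)" by simp
    qed
    also have "\<dots> = (\<Sum>(i, j)\<in>{(i, j). i < j \<and> j < length vs}. (- 1) ^ (i + j) *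
        Wf \<omega> (br (mc m p x (vs ! i)) (mc m p x (vs ! j)) # map (mc m p x) (rem i (rem j vs))))"
      by (rule ext_deriv_mc[OF p(1) W p(2) vs len])
    also have "\<dots> = CE_d QL \<omega> (map cs (map (mc m p x) vs))"
      unfolding CE_d_cs[OF s] by (rule sum.cong) (auto simp: rem_map)
    also have "\<dots> = Psi (CE_d QL \<omega>) (m, V, Q) x vs"
      using Psi_lift[OF q l p(2) vs, of "CE_d QL \<omega>"] s by (simp add: Wf_def)
    finally show ?thesis .
  next
    case False
    \<comment> \<open>For lists of the wrong length both sides are 0, the left one because the
      exterior derivative is alternating of degree \<open>Suc k\<close>.\<close>
    have "Psi (CE_d QL \<omega>) (m, V, Q) x vs = 0"
      using Psi_lift[OF q l p(2) vs, of "CE_d QL \<omega>"] CE_d_length[OF \<omega>, of "map cs (map (mc m p x) vs)"] False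
      by (simp add: Wf_def)
    moreover have "smooth_form m V k (Psi \<omega> (m, V, Q))" by (rule form_smooth[OF Psi_form[OF \<omega>] q])
    then have "ext_deriv m V (Psi \<omega> (m, V, Q)) x vs = 0"
      using alt_out[OF ext_deriv_alt[OF V _ x]] False by blast
    ultimately show ?thesis by simp
  qed
qed (auto simp: ext_deriv_def Psi_def)

text \<open>The coboundary is the exterior derivative of \<open>Psi \<omega>\<close> on the plot
  given by \<psi>0, evaluated at the unit, and that is alternating.\<close>

lemma CE_d_alt:
  assumes \<omega>: "alternating_form QL k \<omega>"
  shows "alternating_form QL (Suc k) (CE_d QL \<omega>)"
proof -
  have q: "(dm, V0, restrict (\<lambda>x. \<iota> (\<psi>0 x) <# H) V0) \<in> D" using cq_D[OF \<psi>0(1)] by (simp add: cq_def)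
  define X where "X = ext_deriv dm V0 (Psi \<omega> (dm, V0, restrict (\<lambda>x. \<iota> (\<psi>0 x) <# H) V0)) e0"
  have X: "alt dm (Suc k) X"
    unfolding X_def by (rule ext_deriv_alt[OF V0(1) form_smooth[OF Psi_form[OF \<omega>] q] V0(2)])
  have eq: "CE_d QL \<omega> (map cs vs) = X vs" if "set vs \<subseteq> Rn dm" for vs
    using Psi_base[OF that, of "CE_d QL \<omega>"] ext_deriv_Psi[OF \<omega> q] by (simp add: X_def cq_def)
  show ?thesis
    unfolding alternating_form_def
  proof (intro conjI allI impI)
    fix As assume "\<not> (length As = Suc k \<and> set As \<subseteq> vcarrier QL)"
    then show "CE_d QL \<omega> As = 0" using CE_d_length[OF \<omega>, of As] by (auto simp: CE_d_def)
  next
    fix As Bs A B a b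
    assume "length As + length Bs + 1 = Suc k \<and> set As \<union> set Bs \<union> {A, B} \<subseteq> vcarrier QL"
    then have S: "set As \<subseteq> vcarrier QL" "set Bs \<subseteq> vcarrier QL" and R: "A \<in> vcarrier QL" "B \<in> vcarrier QL" by auto
    obtain us where us: "set us \<subseteq> Rn dm" "As = map cs us" using ex_reps[OF S(1)] by blast
    obtain ws where ws: "set ws \<subseteq> Rn dm" "Bs = map cs ws" using ex_reps[OF S(2)] by blast
    obtain z w where zw: "z \<in> Rn dm" "A = cs z" "w \<in> Rn dm" "B = cs w" using R by (auto simp: QL_carrier)
    have e: "CE_d QL \<omega> (As @ cs v # Bs) = X (us @ v # ws)" if "v \<in> Rn dm" for v
      using eq[of "us @ v # ws"] us ws that by simp
    show "CE_d QL \<omega> (As @ vadd QL (vscale QL a A) (vscale QL b B) # Bs) =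
        a * CE_d QL \<omega> (As @ A # Bs) + b * CE_d QL \<omega> (As @ B # Bs)"
      unfolding zw(2,4) QL_lin[OF zw(1,3)] e[OF zw(1)] e[OF zw(3)] e[OF Rn_lin[OF zw(1,3)]]
      by (rule alt_lin[OF X zw(1,3)])
  next
    fix As assume h: "set As \<subseteq> vcarrier QL \<and> \<not> distinct As"
    define rep where "rep A = (SOME z. z \<in> Rn dm \<and> cs z = A)" for A
    have rep: "rep A \<in> Rn dm \<and> cs (rep A) = A" if "A \<in> set As" for A
    proof -
      have "\<exists>z. z \<in> Rn dm \<and> cs z = A" using that h by (auto simp: QL_carrier)
      from someI_ex[OF this] show ?thesis by (auto simp: rep_def)
    qed
    have m: "As = map cs (map rep As)" "set (map rep As) \<subseteq> Rn dm" using rep by (auto intro!: map_idI[symmetric])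
    have "\<not> distinct (map rep As)" using h by (auto simp: distinct_map)
    then have "X (map rep As) = 0" using alt_dist[OF X] m(2) by simp
    then show "CE_d QL \<omega> As = 0" using eq[OF m(2)] m(1) by simp
  qed
qed

lemma diffeo_d_Psi:
  assumes "alternating_form QL k \<omega>"
  shows "diffeo_d D (Psi \<omega>) = Psi (CE_d QL \<omega>)"
proof (intro ext)
  fix q :: "'a set plot" and x vs
  obtain m V Q where q: "q = (m, V, Q)" by (cases q)
  show "diffeo_d D (Psi \<omega>) q x vs = Psi (CE_d QL \<omega>) q x vs"
    using ext_deriv_Psi[OF assms, of m V Q x vs] by (cases "q \<in> D") (auto simp: diffeo_d_def q Psi_def)
qed

lemma diffeo_d_squared:
  assumes "diffeological_form D k \<beta>"
  shows "diffeo_d D (diffeo_d D \<beta>) = (\<lambda>q x vs. 0)"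
proof (intro ext)
  fix q :: "'a set plot" and x vs
  obtain m V Q where q: "q = (m, V, Q)" by (cases q)
  show "diffeo_d D (diffeo_d D \<beta>) q x vs = 0"
    using ext_deriv_squared[OF _ form_smooth[OF assms], of m V Q x vs] by (auto simp: diffeo_d_def q D_iff)
qed

section \<open>The isomorphism of complexes and of cohomology\<close>

lemma CE_d_lin:
  "CE_d L (\<lambda>vs. a * \<omega> vs + b * \<eta> vs) = (\<lambda>vs. a * CE_d L \<omega> vs + b * CE_d L \<eta> vs)"
proof
  fix Zs
  show "CE_d L (\<lambda>vs. a * \<omega> vs + b * \<eta> vs) Zs = a * CE_d L \<omega> Zs + b * CE_d L \<eta> Zs"
    by (auto simp: CE_d_def sum_distrib_left sum.distrib[symmetric] case_prod_unfold algebra_simps intro!: sum.cong)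
qed

lemma Psi_lin: "Psi (\<lambda>vs. a * \<omega> vs + b * \<eta> vs) = (\<lambda>q x vs. a * Psi \<omega> q x vs + b * Psi \<eta> q x vs)"
  by (auto simp: Psi_def fun_eq_iff)

lemma alternating_comb:
  assumes "alternating_form V k \<omega>" "alternating_form V k \<eta>"
  shows "alternating_form V k (\<lambda>vs. a * \<omega> vs + b * \<eta> vs)"
  unfolding alternating_form_def
proof (intro conjI allI impI)
  fix vs assume "\<not> (length vs = k \<and> set vs \<subseteq> vcarrier V)"
  then show "a * \<omega> vs + b * \<eta> vs = 0" using alt_out[OF assms(1)] alt_out[OF assms(2)] by simp
next
  fix us ws x y c d
  assume h: "length us + length ws + 1 = k \<and> set us \<union> set ws \<union> {x, y} \<subseteq> vcarrier V"
  have "\<omega> (us @ vadd V (vscale V c x) (vscale V d y) # ws) = c * \<omega> (us @ x # ws) + d * \<omega> (us @ y # ws)"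
    "\<eta> (us @ vadd V (vscale V c x) (vscale V d y) # ws) = c * \<eta> (us @ x # ws) + d * \<eta> (us @ y # ws)"
    using h by (auto intro!: alternating_lin[OF assms(1)] alternating_lin[OF assms(2)])
  then show "a * \<omega> (us @ vadd V (vscale V c x) (vscale V d y) # ws) + b * \<eta> (us @ vadd V (vscale V c x) (vscale V d y) # ws) =
      c * (a * \<omega> (us @ x # ws) + b * \<eta> (us @ x # ws)) + d * (a * \<omega> (us @ y # ws) + b * \<eta> (us @ y # ws))"
    by (simp add: algebra_simps)
next
  fix vs assume "set vs \<subseteq> vcarrier V \<and> \<not> distinct vs"
  then show "a * \<omega> vs + b * \<eta> vs = 0" using alt_dist[OF assms(1)] alt_dist[OF assms(2)] by simp
qed

abbreviation "Om \<equiv> diffeo_forms D"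
abbreviation "Lam \<equiv> exterior_dual QL"

lemma carriers: "vcarrier (Om k) = {\<beta>. diffeological_form D k \<beta>}" "vcarrier (Lam k) = {\<omega>. alternating_form QL k \<omega>}"
  by (simp_all add: diffeo_forms_def exterior_dual_def)

lemma Psi_image: "Psi ` vcarrier (Lam k) = vcarrier (Om k)"
  unfolding carriers using Psi_form Psi_surj by blast

lemma Psi_bij: "bij_betw Psi (vcarrier (Lam k)) (vcarrier (Om k))"
  using Psi_image Psi_inj by (auto simp: bij_betw_def inj_on_def carriers)

text \<open>Sums and multiples are written as instances of one linear combination, so that
  \<open>alternating_comb\<close>, \<open>CE_d_lin\<close> and \<open>Psi_lin\<close> cover
  both.\<close>

lemma Lam_ops:
  "vadd (Lam k) = (\<lambda>\<omega> \<eta> vs. 1 * \<omega> vs + 1 * \<eta> vs)" "vscale (Lam k) = (\<lambda>c \<omega> vs. c * \<omega> vs + 0 * \<omega> vs)"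
  "vzero (Lam k) = (\<lambda>vs. 0)"
  by (simp_all add: exterior_dual_def)

lemma Om_ops:
  "vadd (Om k) = (\<lambda>\<alpha> \<beta> q x vs. 1 * \<alpha> q x vs + 1 * \<beta> q x vs)"
  "vscale (Om k) = (\<lambda>c \<beta> q x vs. c * \<beta> q x vs + 0 * \<beta> q x vs)" "vzero (Om k) = (\<lambda>q x vs. 0)"
  by (simp_all add: diffeo_forms_def)

lemma Lam_closed:
  "x \<in> vcarrier (Lam k) \<Longrightarrow> y \<in> vcarrier (Lam k) \<Longrightarrow> vadd (Lam k) x y \<in> vcarrier (Lam k)"
  "x \<in> vcarrier (Lam k) \<Longrightarrow> vscale (Lam k) c x \<in> vcarrier (Lam k)" "vzero (Lam k) \<in> vcarrier (Lam k)"
proof -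
  show "x \<in> vcarrier (Lam k) \<Longrightarrow> y \<in> vcarrier (Lam k) \<Longrightarrow> vadd (Lam k) x y \<in> vcarrier (Lam k)"
    "x \<in> vcarrier (Lam k) \<Longrightarrow> vscale (Lam k) c x \<in> vcarrier (Lam k)"
    unfolding carriers Lam_ops mem_Collect_eq by (rule alternating_comb; assumption)+
  show "vzero (Lam k) \<in> vcarrier (Lam k)" by (simp add: carriers Lam_ops alternating_form_def)
qed

lemma Psi_ops:
  "Psi (vadd (Lam k) \<omega> \<eta>) = vadd (Om k) (Psi \<omega>) (Psi \<eta>)" "Psi (vscale (Lam k) c \<omega>) = vscale (Om k) c (Psi \<omega>)"
  "Psi (vzero (Lam k)) = vzero (Om k)"
  unfolding Lam_ops Om_ops Psi_lin by (auto simp: Psi_def fun_eq_iff)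

lemma CE_d_ops:
  "CE_d QL (vadd (Lam k) \<omega> \<eta>) = vadd (Lam l) (CE_d QL \<omega>) (CE_d QL \<eta>)" "CE_d QL (vscale (Lam k) c \<omega>) = vscale (Lam l) c (CE_d QL \<omega>)"
  unfolding Lam_ops CE_d_lin by simp_all

lemma complexes: "cochain_complex Om (\<lambda>k. diffeo_d D)" "cochain_complex Lam (\<lambda>k. CE_d QL)"
proof -
  have dL: "CE_d QL \<omega> \<in> vcarrier (Lam (Suc k))" "diffeo_d D (Psi \<omega>) = Psi (CE_d QL \<omega>)"
    if "\<omega> \<in> vcarrier (Lam k)" for \<omega> k
    using CE_d_alt diffeo_d_Psi that by (auto simp: carriers)
  have ex: "\<exists>\<omega>\<in>vcarrier (Lam k). \<beta> = Psi \<omega>" if "\<beta> \<in> vcarrier (Om k)" for \<beta> k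
    using Psi_image[of k] that by blast
  have sq: "diffeo_d D (diffeo_d D \<beta>) = vzero (Om l)" if "\<beta> \<in> vcarrier (Om k)" for \<beta> k l
    using diffeo_d_squared that by (auto simp: carriers Om_ops)
  show "cochain_complex Om (\<lambda>k. diffeo_d D)"
    unfolding cochain_complex_def vs_linear_def
  proof (intro allI conjI ballI)
    show "diffeo_d D ` vcarrier (Om k) \<subseteq> vcarrier (Om (Suc k))" for k
    proof (rule image_subsetI)
      fix \<alpha> assume "\<alpha> \<in> vcarrier (Om k)"
      then obtain \<omega> where \<omega>: "\<omega> \<in> vcarrier (Lam k)" "\<alpha> = Psi \<omega>" using ex by blast
      show "diffeo_d D \<alpha> \<in> vcarrier (Om (Suc k))"
        unfolding \<omega>(2) dL(2)[OF \<omega>(1)] Psi_image[symmetric] by (rule imageI[OF dL(1)[OF \<omega>(1)]])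
    qed
    fix k \<alpha> assume "\<alpha> \<in> vcarrier (Om k)"
    then obtain \<omega> where \<omega>: "\<omega> \<in> vcarrier (Lam k)" "\<alpha> = Psi \<omega>" using ex by blast
    show "diffeo_d D (vadd (Om k) \<alpha> \<beta>) = vadd (Om (Suc k)) (diffeo_d D \<alpha>) (diffeo_d D \<beta>)"
      if "\<beta> \<in> vcarrier (Om k)" for \<beta>
    proof -
      obtain \<eta> where \<eta>: "\<eta> \<in> vcarrier (Lam k)" "\<beta> = Psi \<eta>" using ex \<open>\<beta> \<in> vcarrier (Om k)\<close> by blast
      show ?thesis
        unfolding \<omega>(2) \<eta>(2) dL(2)[OF \<omega>(1)] dL(2)[OF \<eta>(1)] Psi_ops(1)[symmetric] dL(2)[OF Lam_closed(1)[OF \<omega>(1) \<eta>(1)]]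
        by (simp only: CE_d_ops(1)[where l="Suc k"])
    qed
    show "diffeo_d D (vscale (Om k) c \<alpha>) = vscale (Om (Suc k)) c (diffeo_d D \<alpha>)" for c
      unfolding \<omega>(2) dL(2)[OF \<omega>(1)] Psi_ops(2)[symmetric] dL(2)[OF Lam_closed(2)[OF \<omega>(1)]]
      by (simp only: CE_d_ops(2)[where l="Suc k"])
    show "diffeo_d D (diffeo_d D \<alpha>) = vzero (Om (Suc (Suc k)))"
      using sq \<open>\<alpha> \<in> vcarrier (Om k)\<close> by blast
  qed
  show "cochain_complex Lam (\<lambda>k. CE_d QL)"
    unfolding cochain_complex_def vs_linear_def
  proof (intro allI conjI ballI)
    show "CE_d QL ` vcarrier (Lam k) \<subseteq> vcarrier (Lam (Suc k))" for k using dL by blast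
    show "CE_d QL (vadd (Lam k) x y) = vadd (Lam (Suc k)) (CE_d QL x) (CE_d QL y)" for k x y by (rule CE_d_ops)
    show "CE_d QL (vscale (Lam k) c x) = vscale (Lam (Suc k)) c (CE_d QL x)" for k c x by (rule CE_d_ops)
    fix k \<omega> assume \<omega>: "\<omega> \<in> vcarrier (Lam k)"
    \<comment> \<open>The square of the coboundary vanishes because that of the exterior derivative
      does and \<open>Psi\<close> is injective.\<close>
    have "Psi (CE_d QL (CE_d QL \<omega>)) = Psi (vzero (Lam (Suc (Suc k))))"
      using sq[of "Psi \<omega>" k] Psi_image[of k] \<omega> dL[OF \<omega>] dL(2)[OF dL(1)[OF \<omega>]] by (auto simp: Psi_ops(3))
    then show "CE_d QL (CE_d QL \<omega>) = vzero (Lam (Suc (Suc k)))"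
      using Psi_inj[of "Suc (Suc k)"] dL(1)[OF dL(1)[OF \<omega>]] Lam_closed(3)[of "Suc (Suc k)"] by (auto simp: carriers)
  qed
qed

text \<open>The isomorphism is the inverse of \<open>Psi\<close> in each degree, since
  \<open>Psi\<close> itself runs from forms on the Lie algebra to forms on the coset space.\<close>

lemma isomorphic_complexes: "cochain_isomorphic Om (\<lambda>k. diffeo_d D) Lam (\<lambda>k. CE_d QL)"
proof -
  define \<Phi> where "\<Phi> k = inv_into (vcarrier (Lam k)) Psi" for k
  have bij: "bij_betw (\<Phi> k) (vcarrier (Om k)) (vcarrier (Lam k))" for k
    unfolding \<Phi>_def by (rule bij_betw_inv_into[OF Psi_bij])
  have \<Phi>: "\<Phi> k (Psi \<omega>) = \<omega>" if "\<omega> \<in> vcarrier (Lam k)" for k \<omega>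
    unfolding \<Phi>_def using Psi_bij[of k] that by (simp add: bij_betw_def)
  have ex: "\<exists>\<omega>\<in>vcarrier (Lam k). \<beta> = Psi \<omega>" if "\<beta> \<in> vcarrier (Om k)" for \<beta> k
    using Psi_image[of k] that by blast
  have "vs_isomorphism (Om k) (Lam k) (\<Phi> k)" for k
    unfolding vs_isomorphism_def vs_linear_def
  proof (intro conjI ballI allI bij)
    show "\<Phi> k ` vcarrier (Om k) \<subseteq> vcarrier (Lam k)" using bij[of k] by (simp add: bij_betw_def)
    fix \<alpha> assume "\<alpha> \<in> vcarrier (Om k)"
    then obtain \<omega> where \<omega>: "\<omega> \<in> vcarrier (Lam k)" "\<alpha> = Psi \<omega>" using ex by blast
    show "\<Phi> k (vadd (Om k) \<alpha> \<beta>) = vadd (Lam k) (\<Phi> k \<alpha>) (\<Phi> k \<beta>)" if b: "\<beta> \<in> vcarrier (Om k)" for \<beta>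
    proof -
      obtain \<eta> where \<eta>: "\<eta> \<in> vcarrier (Lam k)" "\<beta> = Psi \<eta>" using ex b by blast
      show ?thesis
        unfolding \<omega>(2) \<eta>(2) Psi_ops(1)[symmetric] \<Phi>[OF \<omega>(1)] \<Phi>[OF \<eta>(1)] by (rule \<Phi>[OF Lam_closed(1)[OF \<omega>(1) \<eta>(1)]])
    qed
    show "\<Phi> k (vscale (Om k) c \<alpha>) = vscale (Lam k) c (\<Phi> k \<alpha>)" for c
      unfolding \<omega>(2) Psi_ops(2)[symmetric] \<Phi>[OF \<omega>(1)] by (rule \<Phi>[OF Lam_closed(2)[OF \<omega>(1)]])
  qed
  moreover have "\<Phi> (Suc k) (diffeo_d D \<alpha>) = CE_d QL (\<Phi> k \<alpha>)" if "\<alpha> \<in> vcarrier (Om k)" for k \<alpha>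
  proof -
    obtain \<omega> where \<omega>: "\<omega> \<in> vcarrier (Lam k)" "\<alpha> = Psi \<omega>" using ex \<open>\<alpha> \<in> vcarrier (Om k)\<close> by blast
    then have a: "alternating_form QL k \<omega>" by (simp add: carriers)
    show ?thesis
      unfolding \<omega>(2) diffeo_d_Psi[OF a] \<Phi>[OF \<omega>(1)]
      by (rule \<Phi>) (use CE_d_alt[OF a] in \<open>simp add: carriers\<close>)
  qed
  ultimately show ?thesis
    unfolding cochain_isomorphic_def using complexes by (intro conjI exI[of _ \<Phi>] allI ballI) auto
qed

lemma isomorphic_cohomology:
  "vs_isomorphic (cohomology Om (\<lambda>k. diffeo_d D) k) (cohomology Lam (\<lambda>k. CE_d QL) k)"
proof (rule cochain_isomorphic_cohomology[OF isomorphic_complexes])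
  fix l c x y assume x: "x \<in> vcarrier (Om l)"
  then obtain \<omega> where \<omega>: "\<omega> \<in> vcarrier (Lam l)" "x = Psi \<omega>" using Psi_image[of l] by blast
  show "vscale (Om l) c x \<in> vcarrier (Om l)"
    unfolding \<omega>(2) Psi_ops(2)[symmetric] using Lam_closed(2)[OF \<omega>(1)] Psi_image by blast
  show "vscale (Om l) 0 x = vzero (Om l)" by (simp add: Om_ops)
  assume "y \<in> vcarrier (Om l)"
  then obtain \<eta> where \<eta>: "\<eta> \<in> vcarrier (Lam l)" "y = Psi \<eta>" using Psi_image[of l] by blast
  show "vadd (Om l) x y \<in> vcarrier (Om l)"
    unfolding \<omega>(2) \<eta>(2) Psi_ops(1)[symmetric] using Lam_closed(1)[OF \<omega>(1) \<eta>(1)] Psi_image by blast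
next
  fix l
  show "vzero (Om l) \<in> vcarrier (Om l)"
    unfolding Psi_ops(3)[symmetric] using Lam_closed(3) Psi_image by blast
qed (simp_all add: Lam_ops)

end

theorem mainTheorem1:
  fixes G :: "('a, 'z) monoid_scheme" and M :: "'a manifold" and H :: "'a set"
  defines "\<gg> \<equiv> lie_algebra_of G M"
    and "\<hh> \<equiv> lie_subalgebra_of G M H"
    and "D \<equiv> coset_diffeology G M H"
  assumes "lie_group G M"
    and "subgroup H G"
    and "mtop M closure_of H = topspace (mtop M)"
  shows "lie_ideal \<gg> \<hh> \<and>
    cochain_isomorphic (diffeo_forms D) (\<lambda>k. diffeo_d D)
      (exterior_dual (quot_lie_algebra \<gg> \<hh>)) (\<lambda>k. CE_d (quot_lie_algebra \<gg> \<hh>)) \<and>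
    (\<forall>k. vs_isomorphic
      (cohomology (diffeo_forms D) (\<lambda>k. diffeo_d D) k)
      (cohomology (exterior_dual (quot_lie_algebra \<gg> \<hh>)) (\<lambda>k. CE_d (quot_lie_algebra \<gg> \<hh>)) k))"
proof -
  interpret mfd M by unfold_locales (use assms(4) in \<open>simp add: lie_group_def\<close>)
  interpret group G using assms(4) by (simp add: lie_group_def)
  have "\<one>\<^bsub>G\<^esub> \<in> topspace (mtop M)" using assms(4) by (simp add: lie_group_def)
  \<comment> \<open>Any chart at the unit can play the part of the fixed chart of the locale; the
    conclusion does not mention it.\<close>
  then obtain W \<phi> where "(W, \<phi>) \<in> charts M" "\<one>\<^bsub>G\<^esub> \<in> W" by (rule chart_at)
  then interpret dense_grp M G W \<phi> H
    by (intro dense_grp.intro lie_grp.intro lie_grp_axioms.intro dense_grp_axioms.intro mfd_axioms assms(4-6))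
  show ?thesis
    unfolding \<gg>_def \<hh>_def D_def
    using lie_ideal_h0[OF HS HD] isomorphic_complexes isomorphic_cohomology by (simp add: hh)
qed

end
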